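(* Let $p<q$ be positive integers, let $\alpha\in\{0,1,\dots,p-1\}$ or $\alpha>p-1$, let $0\le r\le p$ and $k\ge 0$ be integers with $\alpha+2k<(q-p+2r)/2$, and let $\partial^\nu$ be a partial derivative of order $k$ in the matrix entries $z_{ij}$. Let $H^\circ_\alpha$ be the Hilbert space of functions on $\mathrm{B}_{p,q}$ with reproducing kernel $\det(1-zu^t)^{-\alpha}$, and $\mathcal{H}^\circ_\alpha\subset H^\circ_\alpha$ the subspace of functions analytic in a neighborhood of $\overline{\mathrm{B}}_{p,q}$. Then the operator $f\mapsto (\partial^\nu f)|_{\mathrm{M}_r}$, defined on $\mathcal{H}^\circ_\alpha$, extends to a continuous operator from $H^\circ_\alpha$ to $L^1_{\mathrm{loc}}(\mathrm{M}_r)$.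
   Context: $\mathrm{B}_{p,q}$ is the set of real $p\times q$ matrices of operator norm $<1$ and $\overline{\mathrm{B}}_{p,q}\subset\mathbb{R}^{pq}$ the set of those of norm $\le 1$. For the stated $\alpha$ the kernel $\det(1-zu^t)^{-\alpha}$ is positive definite on $\mathrm{B}_{p,q}\times\mathrm{B}_{p,q}$, and $H^\circ_\alpha$ is its reproducing kernel Hilbert space. $\mathrm{M}_r$ is the set of $z\in\overline{\mathrm{B}}_{p,q}$ with $\operatorname{rank}(1-zz^t)=r$, a smooth submanifold of $\mathbb{R}^{pq}$ (an orbit of $\mathrm{O}(p,q)$ acting by $z\mapsto(a+zc)^{-1}(b+zd)$). $L^1_{\mathrm{loc}}(\mathrm{M}_r)$ is the space of functions on $\mathrm{M}_r$ locally integrable with respect to surface Lebesgue measure, with the seminorms $f\mapsto\int_K|f|$, $K\subset\mathrm{M}_r$ compact. *)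

theory Defs
  imports "HOL-Analysis.Analysis"
begin

definition mat_ball :: "(real^'q::finite^'p::finite) set" where
  "mat_ball = {z. onorm (\<lambda>x. z *v x) < 1}"

definition mat_cball :: "(real^'q::finite^'p::finite) set" where
  "mat_cball = {z. onorm (\<lambda>x. z *v x) \<le> 1}"

definition stratum :: "nat \<Rightarrow> (real^'q::finite^'p::finite) set" where
  "stratum r = {z \<in> mat_cball. rank (mat 1 - z ** transpose z) = r}"

definition kern :: "real \<Rightarrow> real^'q::finite^'p::finite \<Rightarrow> real^'q^'p \<Rightarrow> real" where
  "kern \<alpha> z u = det (mat 1 - z ** transpose u) powr (- \<alpha>)"

text \<open>RKHS of a positive definite kernel K on X (functions on X; values outside X are
  irrelevant).  A function f belongs to H(K) iff the functional
  sum c_i K(x_i,.) |-> sum c_i f(x_i) is bounded on the span of the kernel functions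
  (w.r.t. the norm ||sum c_i K(x_i,.)||^2 = sum c_i c_j K(x_i,x_j)), and the
  norm of f in H(K) is the norm of that functional (Aronszajn).\<close>

definition rkhs_vals :: "('a \<Rightarrow> 'a \<Rightarrow> real) \<Rightarrow> 'a set \<Rightarrow> ('a \<Rightarrow> real) \<Rightarrow> real set" where
  "rkhs_vals K X f = {\<bar>\<Sum>i<n. c i * f (x i)\<bar> | (n::nat) c x.
      (\<forall>i<n. x i \<in> X) \<and> (\<Sum>i<n. \<Sum>j<n. c i * c j * K (x i) (x j)) \<le> 1}"

definition in_rkhs :: "('a \<Rightarrow> 'a \<Rightarrow> real) \<Rightarrow> 'a set \<Rightarrow> ('a \<Rightarrow> real) \<Rightarrow> bool" where
  "in_rkhs K X f \<longleftrightarrow> bdd_above (rkhs_vals K X f)"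

definition rkhs_norm :: "('a \<Rightarrow> 'a \<Rightarrow> real) \<Rightarrow> 'a set \<Rightarrow> ('a \<Rightarrow> real) \<Rightarrow> real" where
  "rkhs_norm K X f = Sup (rkhs_vals K X f)"

definition H_space :: "real \<Rightarrow> (real^'q::finite^'p::finite \<Rightarrow> real) set" where
  "H_space \<alpha> = {f. in_rkhs (kern \<alpha>) mat_ball f}"

definition H_norm :: "real \<Rightarrow> (real^'q::finite^'p::finite \<Rightarrow> real) \<Rightarrow> real" where
  "H_norm \<alpha> f = rkhs_norm (kern \<alpha>) mat_ball f"

definition monomial :: "real^'q::finite^'p::finite \<Rightarrow> ('p \<Rightarrow> 'q \<Rightarrow> nat) \<Rightarrow> real" where
  "monomial x \<nu> = (\<Prod>i\<in>UNIV. \<Prod>j\<in>UNIV. (x $ i $ j) ^ (\<nu> i j))"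

definition real_analytic_on :: "(real^'q::finite^'p::finite \<Rightarrow> real) \<Rightarrow> (real^'q^'p) set \<Rightarrow> bool" where
  "real_analytic_on f U \<longleftrightarrow> (\<forall>a\<in>U. \<exists>e>0. \<exists>c. \<forall>x\<in>ball a e.
      ((\<lambda>\<nu>. c \<nu> * monomial (x - a) \<nu>) has_sum f x) UNIV)"

definition H_hol :: "real \<Rightarrow> (real^'q::finite^'p::finite \<Rightarrow> real) set" where
  "H_hol \<alpha> = {f \<in> H_space \<alpha>. \<exists>U. open U \<and> mat_cball \<subseteq> U \<and> real_analytic_on f U}"

definition unit_mat :: "'p::finite \<Rightarrow> 'q::finite \<Rightarrow> real^'q^'p" where
  "unit_mat i j = (\<chi> a b. if a = i \<and> b = j then 1 else 0)"

definition partial :: "'p::finite \<Rightarrow> 'q::finite \<Rightarrow> (real^'q^'p \<Rightarrow> real) \<Rightarrow> real^'q^'p \<Rightarrow> real" where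
  "partial i j f x = deriv (\<lambda>t. f (x + t *\<^sub>R unit_mat i j)) 0"

fun pderivs :: "('p::finite \<times> 'q::finite) list \<Rightarrow> (real^'q^'p \<Rightarrow> real) \<Rightarrow> real^'q^'p \<Rightarrow> real" where
  "pderivs [] f = f"
| "pderivs ((i, j) # ds) f = partial i j (pderivs ds f)"

definition surface_chart ::
  "('a::euclidean_space) set \<Rightarrow> (real^'n::finite) set \<Rightarrow> (real^'n \<Rightarrow> 'a)
     \<Rightarrow> (real^'n \<Rightarrow> ((real^'n) \<Rightarrow>\<^sub>L 'a)) \<Rightarrow> bool" where
  "surface_chart M V \<phi> \<phi>' \<longleftrightarrow> open V \<and> inj_on \<phi> V \<and> \<phi> ` V \<subseteq> M
     \<and> openin (top_of_set M) (\<phi> ` V) \<and> continuous_on (\<phi> ` V) (inv_into V \<phi>)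
     \<and> (\<forall>t\<in>V. (\<phi> has_derivative blinfun_apply (\<phi>' t)) (at t) \<and> inj (blinfun_apply (\<phi>' t)))
     \<and> continuous_on V \<phi>'"

text \<open>Surface-area density (Gram determinant) of a parametrisation: surface measure
  on phi(V) is the push-forward of chart_jac * Lebesgue measure.\<close>
definition chart_jac :: "(real^'n::finite \<Rightarrow> ((real^'n) \<Rightarrow>\<^sub>L 'a::euclidean_space)) \<Rightarrow> real^'n \<Rightarrow> real" where
  "chart_jac \<phi>' t = sqrt (det (\<chi> a b. (\<phi>' t) (axis a 1) \<bullet> (\<phi>' t) (axis b 1)))"

end

(*
  For f in the Hilbert space, let D_m f (x) be a finite-difference quotient of f of order k and step
  comparable to 2^-m, based at (1 - 2^-m) x; it uses points of the open ball only. The operator is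
  T f (x) = L (m |-> D_m f (x)), where L is a linear functional on all real sequences that extends the
  limit; for analytic f this is the partial derivative.

  By the mean value theorem the pairing of D_m and D_m' under the kernel is a polynomial times
  det(1 - z u^t)^-(alpha + 2k) at points approaching (x, y) nontangentially, so for small g > 0 the
  pairing of D_(m+1) - D_m with itself is at most C 2^(-m g) det(1 - x y^t)^-b, b = alpha + 2k + g.
  The norm of H bounds finite combinations of the D_m f (x) by the square root of such pairings, and
  Riemann sums turn this into a bound for the integral of |D_(m+1) f - D_m f| over a compact piece of
  the stratum. It is summable in m as soon as det(1 - x y^t)^-b is integrable in x, uniformly in y.

  This integrability (2 b < q - p + 2 r) is shown by writing the determinant in an orthonormal basis
  adapted to ker(1 - y y^t) and splitting it into p pivots. r of them are bounded below. The others are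
  treated one at a time: the stratum has enough self-maps changing a single row of 1 - x y^t, along
  which the set where the pivot is below s^2 has measure O(s^N) by a packing argument.
*)
theory Submission
  imports Defs
begin

section \<open>Contractions and their fixed vectors\<close>

text \<open>Origin of the exponent: the self-maps are indexed by R^q x R^p. For a minor of size i,
  the i conditions that deform one row orthogonally to all rows of the minor, and the p - r
  directions where 1 - z z^t degenerates, leave N = q + r - i transversal dimensions. There the
  pivot vanishes at most quadratically, being half the squared distance of two unit vectors of a
  semi-inner product; the power -b of such a zero is integrable when 2 b < N. The largest minor
  needed has i = p - r, so N = q - p + 2 r.

  The obstacle is uniformity in y: the basis adapted to ker(1 - y y^t) moves with y. Minors are
  therefore estimated for all orthonormal frames at once, with radii and constants fixed before the
  frames. The self-maps enter charts only through Lipschitz bounds and closeness to the identity, so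
  no Jacobian has to be controlled.

  Elements of H need not have boundary values, while the operator must be linear and given at every
  point. Extending the limit to all sequences fills the exceptional null set; the choice of the
  extension does not affect the class in L^1.\<close>

lemma vmult_scale: "(a *\<^sub>R x) v* A = a *\<^sub>R (x v* (A :: real^'q::finite^'p::finite))"
  by (simp add: vec_eq_iff vector_matrix_mult_def sum_distrib_left mult_ac)

lemma vmult_scale_mat: "x v* (a *\<^sub>R A) = a *\<^sub>R (x v* (A :: real^'q::finite^'p::finite))"
  by (simp add: vec_eq_iff vector_matrix_mult_def sum_distrib_left mult_ac)

text \<open>A matrix and its transpose have the same operator norm; both halves are Cauchy-Schwarz
  applied to the square of the norm of the image. The row action \<open>v*\<close> is the convenient
  one because single rows are going to be moved.\<close>

lemma mat_cball_iff:
  fixes z :: "real^'q::finite^'p::finite"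
  shows "z \<in> mat_cball \<longleftrightarrow> (\<forall>v. norm (v v* z) \<le> norm v)"
proof -
  have bl: "bounded_linear (\<lambda>x. z *v x)" by (simp add: matrix_vector_mul_bounded_linear)
  have "z \<in> mat_cball \<longleftrightarrow> (\<forall>x. norm (z *v x) \<le> norm x)"
  proof
    assume "z \<in> mat_cball"
    then have "onorm (\<lambda>x. z *v x) \<le> 1" by (simp add: mat_cball_def)
    then have "onorm (\<lambda>x. z *v x) * norm x \<le> 1 * norm x" for x by (intro mult_right_mono) auto
    then show "\<forall>x. norm (z *v x) \<le> norm x" using onorm[OF bl] order_trans by fastforce
  qed (auto simp: mat_cball_def intro!: onorm_le)
  also have "\<dots> \<longleftrightarrow> (\<forall>v. norm (v v* z) \<le> norm v)"
  proof
    assume h: "\<forall>x. norm (z *v x) \<le> norm x"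
    show "\<forall>v. norm (v v* z) \<le> norm v"
    proof
      fix v
      have "norm (v v* z) * norm (v v* z) = v \<bullet> (z *v (v v* z))"
        by (simp add: dot_lmul_matrix[symmetric] norm_eq_sqrt_inner)
      also have "\<dots> \<le> norm v * norm (z *v (v v* z))" by (rule norm_cauchy_schwarz)
      also have "\<dots> \<le> norm v * norm (v v* z)" using h by (intro mult_left_mono) auto
      finally show "norm (v v* z) \<le> norm v"
        by (cases "norm (v v* z) = 0") (auto simp: mult_le_cancel_right)
    qed
  next
    assume h: "\<forall>v. norm (v v* z) \<le> norm v"
    show "\<forall>x. norm (z *v x) \<le> norm x"
    proof
      fix x
      have "norm (z *v x) * norm (z *v x) = ((z *v x) v* z) \<bullet> x"
        by (simp add: dot_lmul_matrix norm_eq_sqrt_inner)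
      also have "\<dots> \<le> norm ((z *v x) v* z) * norm x" by (rule norm_cauchy_schwarz)
      also have "\<dots> \<le> norm (z *v x) * norm x" using h by (intro mult_right_mono) auto
      finally show "norm (z *v x) \<le> norm x"
        by (cases "norm (z *v x) = 0") (auto simp: mult_le_cancel_left)
    qed
  qed
  finally show ?thesis .
qed

text \<open>This is the kernel of 1 - z z^t, written with the row action so that no transpose
  occurs.\<close>

definition fixspace :: "real^'q::finite^'p::finite \<Rightarrow> (real^'p) set" where
  "fixspace z = {v. z *v (v v* z) = v}"

lemma subspace_fixspace: "subspace (fixspace z)"
  by (auto simp: subspace_def fixspace_def vector_matrix_mult_add_rdistrib matrix_vector_right_distrib
      vmult_scale_mat matrix_vector_mult_scaleR vector_matrix_left_distrib vmult_scale)

text \<open>The equality case of contractivity: if the norm is kept, then expanding the square of z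
  z^t v - v gives a number at most 0. Membership in the kernel becomes a statement on norms, which
  can be followed through a congruence.\<close>

lemma fixspace_iff_norm:
  assumes z: "z \<in> mat_cball"
  shows "v \<in> fixspace z \<longleftrightarrow> norm (v v* z) = norm v"
proof
  assume "v \<in> fixspace z"
  then have "(v v* z) \<bullet> (v v* z) = v \<bullet> v" by (simp add: fixspace_def dot_lmul_matrix)
  then show "norm (v v* z) = norm v" by (simp add: norm_eq_sqrt_inner)
next
  assume n: "norm (v v* z) = norm v"
  let ?w = "z *v (v v* z)"
  have vw: "v \<bullet> ?w = v \<bullet> v"
    using n by (simp add: dot_lmul_matrix[symmetric] power2_norm_eq_inner[symmetric])
  have "norm ?w * norm ?w = (?w v* z) \<bullet> (v v* z)" by (simp add: dot_lmul_matrix norm_eq_sqrt_inner)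
  also have "\<dots> \<le> norm (?w v* z) * norm (v v* z)" by (rule norm_cauchy_schwarz)
  also have "\<dots> \<le> norm ?w * norm v" using z n by (intro mult_mono) (auto simp: mat_cball_iff)
  finally have "norm ?w \<le> norm v" by (cases "norm ?w = 0") (auto simp: mult_le_cancel_left)
  then have "?w \<bullet> ?w \<le> v \<bullet> v" by (simp add: norm_le)
  then have "(?w - v) \<bullet> (?w - v) \<le> 0"
    using vw by (simp add: inner_diff_left inner_diff_right inner_commute)
  then have "?w - v = 0" by (meson inner_eq_zero_iff inner_ge_zero order_antisym)
  then show "v \<in> fixspace z" by (simp add: fixspace_def)
qed

text \<open>The kernel of the symmetric matrix 1 - z z^t is the orthogonal complement of its range,
  so the rank can be traded for the dimension of \<open>fixspace\<close>, which is easy to follow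
  under a linear bijection.\<close>

lemma stratum_iff:
  fixes z :: "real^'q::finite^'p::finite"
  shows "z \<in> stratum r \<longleftrightarrow> z \<in> mat_cball \<and> r + dim (fixspace z) = CARD('p)"
proof -
  let ?A = "mat 1 - z ** transpose z"
  have A: "?A *v x = x - z *v (x v* z)" for x
    by (simp add: matrix_vector_mult_diff_rdistrib matrix_vector_mul_assoc[symmetric])
  have sym: "transpose ?A = ?A"
    by (simp add: transpose_def vec_eq_iff mat_def matrix_matrix_mult_def mult.commute)
  have ker: "fixspace z = {x. \<forall>y\<in>range ((*v) ?A). orthogonal x y}"
  proof (intro set_eqI)
    fix x
    have "x \<in> fixspace z \<longleftrightarrow> ?A *v x = 0" unfolding A fixspace_def by (auto simp: algebra_simps)
    also have "\<dots> \<longleftrightarrow> (\<forall>y. (?A *v x) \<bullet> y = 0)" by (metis inner_eq_zero_iff inner_zero_left)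
    also have "\<dots> \<longleftrightarrow> (\<forall>y. x \<bullet> (?A *v y) = 0)"
      by (metis dot_lmul_matrix sym transpose_matrix_vector)
    finally show "x \<in> fixspace z \<longleftrightarrow> x \<in> {x. \<forall>y\<in>range ((*v) ?A). orthogonal x y}"
      by (simp add: orthogonal_def)
  qed
  have "dim {y. \<forall>x\<in>range ((*v) ?A). orthogonal x y} + dim (range ((*v) ?A)) = dim (UNIV :: (real^'p) set)"
  proof -
    have s: "subspace (range ((*v) ?A))" using matrix_vector_mul_linear[of ?A] by (rule linear_subspace_image) simp
    show ?thesis using dim_subspace_orthogonal_to_vectors[OF s subspace_UNIV] by simp
  qed
  moreover have "{y. \<forall>x\<in>range ((*v) ?A). orthogonal x y} = fixspace z"
    unfolding ker by (auto simp: orthogonal_commute)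
  ultimately have "rank ?A + dim (fixspace z) = CARD('p)"
    by (simp add: rank_dim_range add.commute)
  then show ?thesis by (auto simp: stratum_def)
qed

section \<open>A semi-inner product attached to a contraction\<close>

type_synonym ('p, 'q) param = "(real^'q) \<times> (real^'p)"

text \<open>The Gram matrix is block diagonal with blocks 1 and 1 - z z^t. The form degenerates on
  the vectors (0, k) with k in \<open>fixspace z\<close>.\<close>

definition sip :: "real^'q::finite^'p::finite \<Rightarrow> ('p, 'q) param \<Rightarrow> ('p, 'q) param \<Rightarrow> real" where
  "sip z x y = fst x \<bullet> fst y + snd x \<bullet> snd y - (snd x v* z) \<bullet> (snd y v* z)"

text \<open>An isometric embedding of R^p for \<open>sip z\<close>: the first component restores
  what the factor 1 - z z^t takes away.\<close>

definition rowv :: "real^'q::finite^'p::finite \<Rightarrow> real^'p \<Rightarrow> ('p, 'q) param" where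
  "rowv z w = (w v* z, w)"

text \<open>The adjoint of \<open>rowv z\<close> between \<open>sip z\<close> and the Euclidean
  product, see \<open>sip_row_left\<close>. With \<open>cov_row\<close>, the composition of
  \<open>cov z\<close> followed by \<open>rowv z\<close> is the orthogonal projection onto the
  embedded R^p.\<close>

definition cov :: "real^'q::finite^'p::finite \<Rightarrow> ('p, 'q) param \<Rightarrow> real^'p" where
  "cov z x = z *v fst x + snd x - z *v (snd x v* z)"

lemma sip_add_left: "sip z (x + x') y = sip z x y + sip z x' y"
  by (simp add: sip_def inner_add_left vector_matrix_left_distrib)

lemma sip_scale_left: "sip z (a *\<^sub>R x) y = a * sip z x y"
  by (simp add: sip_def vmult_scale algebra_simps)

lemma sip_commute: "sip z x y = sip z y x"
  by (simp add: sip_def inner_commute)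

lemma sip_add_right: "sip z y (x + x') = sip z y x + sip z y x'"
  using sip_add_left sip_commute by metis

lemma sip_scale_right: "sip z y (a *\<^sub>R x) = a * sip z y x"
  using sip_scale_left sip_commute by metis

lemma sip_minus_left: "sip z (- x) y = - sip z x y"
  using sip_scale_left[of z "-1" x y] by simp

lemma sip_minus_right: "sip z y (- x) = - sip z y x"
  using sip_scale_right[of z y "-1" x] by simp

lemma sip_diff_left: "sip z (x - x') y = sip z x y - sip z x' y"
  using sip_add_left[of z x "-x'" y] by (simp add: sip_minus_left)

lemma sip_diff_right: "sip z y (x - x') = sip z y x - sip z y x'"
  using sip_add_right[of z y x "-x'"] by (simp add: sip_minus_right)

lemmas sip_simps = sip_add_left sip_add_right sip_scale_left sip_scale_right
  sip_minus_left sip_minus_right sip_diff_left sip_diff_right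

lemma sip_nonneg:
  assumes "z \<in> mat_cball" shows "0 \<le> sip z x x"
proof -
  have "norm (snd x v* z) \<le> norm (snd x)" using assms by (simp add: mat_cball_iff)
  then have "(snd x v* z) \<bullet> (snd x v* z) \<le> snd x \<bullet> snd x" by (simp add: norm_le)
  then show ?thesis by (simp add: sip_def add_nonneg_nonneg add_increasing)
qed

lemma sip_row_left: "sip z (rowv z w) x = w \<bullet> cov z x"
  by (simp add: sip_def rowv_def cov_def dot_lmul_matrix inner_add_right inner_diff_right)

lemma sip_row_right: "sip z x (rowv z w) = w \<bullet> cov z x"
  using sip_row_left sip_commute by metis

lemma cov_row: "cov z (rowv z w) = w"
  by (simp add: cov_def rowv_def)

lemma cov_add: "cov z (x + y) = cov z x + cov z y"
  by (simp add: cov_def vector_matrix_left_distrib matrix_vector_right_distrib)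

lemma cov_scale: "cov z (a *\<^sub>R x) = a *\<^sub>R cov z x"
  by (simp add: cov_def vmult_scale matrix_vector_mult_scaleR algebra_simps)

lemma cov_diff: "cov z (x - y) = cov z x - cov z y"
  using cov_add[of z "x - y" y] by simp

lemma row_add: "rowv z (x + y) = rowv z x + rowv z y"
  by (simp add: rowv_def vector_matrix_left_distrib)

lemma row_diff: "rowv z (x - y) = rowv z x - rowv z y"
  using row_add[of z "x - y" y] by simp

section \<open>Rotating one row\<close>

definition outer :: "real^'p::finite \<Rightarrow> real^'q::finite \<Rightarrow> real^'q^'p" where
  "outer a b = (\<chi> i j. a $ i * b $ j)"

lemma vmult_outer: "v v* outer a b = (v \<bullet> a) *\<^sub>R b"
  by (simp add: vec_eq_iff outer_def vector_matrix_mult_def inner_vec_def sum_distrib_left sum_distrib_right mult_ac)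

text \<open>An orthogonal projection Q with a marked unit vector f in its range. The range stands
  for the rows of a minor, f for the row that is to move.\<close>

definition proj_frame :: "real^'p::finite \<Rightarrow> real^'p^'p \<Rightarrow> bool" where
  "proj_frame f Q \<longleftrightarrow> f \<bullet> f = 1 \<and> Q *v f = f \<and> (\<forall>x. Q *v (Q *v x) = Q *v x)
     \<and> (\<forall>x y. (Q *v x) \<bullet> y = x \<bullet> (Q *v y))"

text \<open>For an orthogonal projection Q this is the component of y orthogonal, with respect to
  \<open>sip z\<close>, to the embedded range of Q.\<close>

definition eta :: "real^'p^'p \<Rightarrow> real^'q::finite^'p::finite \<Rightarrow> ('p, 'q) param \<Rightarrow> ('p, 'q) param" where
  "eta Q z y = y - rowv z (Q *v cov z y)"

text \<open>Each \<open>theta f Q _ y\<close> maps every stratum into itself. It changes the row \<open>f v* z\<close> but keeps \<open>a v* z\<close> for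
  \<open>a\<close> in the range of \<open>Q\<close> orthogonal to \<open>f\<close>; averaging over \<open>y\<close> therefore affects one pivot at a time.\<close>

definition theta :: "real^'p \<Rightarrow> real^'p^'p \<Rightarrow> real^'q::finite^'p::finite \<Rightarrow> ('p, 'q) param \<Rightarrow> real^'q^'p" where
  "theta f Q z y = z - 2 *\<^sub>R outer f (f v* z)
     + (2 / (1 + sip z (eta Q z y) (eta Q z y))) *\<^sub>R outer (f - cov z (eta Q z y)) (f v* z + fst (eta Q z y))"

lemma eta_diff: "eta Q z (x - y) = eta Q z x - eta Q z y"
  by (simp add: eta_def cov_diff matrix_vector_mult_diff_distrib row_diff)

lemma eta_zero [simp]: "eta Q z 0 = 0"
  using eta_diff[of Q z 0 0] by simp

lemma sip_zero [simp]: "sip z 0 y = 0" "sip z y 0 = 0"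
  by (simp_all add: sip_def)

lemma cov_zero [simp]: "cov z 0 = 0"
  using cov_diff[of z 0 0] by simp

lemma theta_zero: "theta f Q z 0 = z"
  by (simp add: theta_def)

context
  fixes f :: "real^'p::finite" and Q :: "real^'p^'p" and z :: "real^'q::finite^'p"
  assumes fr: "proj_frame f Q" and z: "z \<in> mat_cball"
begin

lemma proj_cov_eta: "Q *v cov z (eta Q z y) = 0"
  using fr by (simp add: eta_def cov_diff cov_row matrix_vector_mult_diff_distrib proj_frame_def)

lemma inner_cov_eta: "Q *v a = a \<Longrightarrow> a \<bullet> cov z (eta Q z y) = 0"
  using proj_cov_eta[of y] fr unfolding proj_frame_def by (metis inner_zero_right)

lemma tau_nonneg: "0 \<le> sip z (eta Q z y) (eta Q z y)"
  by (rule sip_nonneg[OF z])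

definition refl_f :: "real^'p \<Rightarrow> real^'p" where
  "refl_f v = v - (2 * (v \<bullet> f)) *\<^sub>R f"

definition mu :: "('p, 'q) param \<Rightarrow> real^'p \<Rightarrow> real" where
  "mu y v = 2 * (v \<bullet> (f - cov z (eta Q z y))) / (1 + sip z (eta Q z y) (eta Q z y))"

definition Mt :: "('p, 'q) param \<Rightarrow> real^'p \<Rightarrow> real^'p" where
  "Mt y v = refl_f v + mu y v *\<^sub>R (f + snd (eta Q z y))"

lemma vmult_theta: "v v* theta f Q z y = refl_f v v* z + mu y v *\<^sub>R (f v* z + fst (eta Q z y))"
  by (simp add: theta_def refl_f_def mu_def vector_matrix_mult_add_rdistrib vector_matrix_mult_diff_distrib
     vector_matrix_left_distrib vmult_scale_mat vmult_scale vmult_outer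
     vector_matrix_mult_diff_rdistrib)

text \<open>This shows where \<open>theta\<close> comes from. Put e = \<open>rowv z f\<close>. The
  reflection taking e to -e is followed by the reflection in the hyperplane orthogonal to e + eta,
  whose squared length is 1 + sip eta eta. The embedded R^p is thus moved by an isometry of
  \<open>sip z\<close>; first components give the new matrix, second components give
  \<open>Mt\<close>.\<close>

lemma theta_pair: "(v v* theta f Q z y, Mt y v) = rowv z (refl_f v) + mu y v *\<^sub>R (rowv z f + eta Q z y)"
  by (simp add: vmult_theta Mt_def rowv_def prod_eq_iff)

text \<open>Both reflections preserve \<open>sip z\<close>, so the pair has the length of v. For z'
  = theta and M = \<open>Mt\<close> this is the congruence 1 - z' z'^t = M^t (1 - z z^t) M, from
  which contractivity and the rank are read off.\<close>

lemma theta_norm: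
  "norm (v v* theta f Q z y) ^ 2 = norm v ^ 2 - (norm (Mt y v) ^ 2 - norm (Mt y v v* z) ^ 2)"
proof -
  let ?\<eta> = "eta Q z y" and ?p = "(v v* theta f Q z y, Mt y v)"
  let ?b = "cov z ?\<eta>" and ?\<tau> = "sip z ?\<eta> ?\<eta>" and ?\<mu> = "mu y v"
  have f: "f \<bullet> f = 1" "Q *v f = f" using fr by (auto simp: proj_frame_def)
  have fb: "f \<bullet> ?b = 0" using inner_cov_eta[OF f(2)] .
  have rr: "refl_f v \<bullet> refl_f v = v \<bullet> v"
    using f by (simp add: refl_f_def inner_diff_left inner_diff_right inner_commute algebra_simps)
  have rf: "refl_f v \<bullet> f = - (v \<bullet> f)" using f by (simp add: refl_f_def inner_diff_left)
  have rb: "refl_f v \<bullet> ?b = v \<bullet> ?b" using fb by (simp add: refl_f_def inner_diff_left)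
  have "sip z ?p ?p = v \<bullet> v + 2 * ?\<mu> * (v \<bullet> ?b - v \<bullet> f) + ?\<mu>\<^sup>2 * (1 + ?\<tau>)"
    unfolding theta_pair sip_simps sip_row_left sip_row_right cov_row cov_add cov_scale
    using f fb rr rf rb by (simp add: inner_add_right inner_commute algebra_simps power2_eq_square)
  \<comment> \<open>The denominator \<open>1 + \<tau>\<close> in \<open>mu\<close> is chosen so that
    the quadratic term cancels the cross term.\<close>
  also have "?\<mu>\<^sup>2 * (1 + ?\<tau>) = - 2 * ?\<mu> * (v \<bullet> ?b - v \<bullet> f)"
  proof -
    have "?\<mu> * (1 + ?\<tau>) = - 2 * (v \<bullet> ?b - v \<bullet> f)"
      using tau_nonneg[of y] by (simp add: mu_def inner_diff_right)
    then have "?\<mu> * (?\<mu> * (1 + ?\<tau>)) = ?\<mu> * (- 2 * (v \<bullet> ?b - v \<bullet> f))" by (rule arg_cong)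
    then show ?thesis by (simp add: power2_eq_square algebra_simps)
  qed
  finally have "sip z ?p ?p = v \<bullet> v" by simp
  then show ?thesis by (simp add: sip_def power2_norm_eq_inner)
qed

text \<open>Such an a is fixed by the first reflection, and \<open>mu\<close> vanishes on it because
  a is orthogonal both to f and to the covector of eta.\<close>

lemma theta_fixes_row:
  assumes a: "Q *v a = a" "a \<bullet> f = 0"
  shows "a v* theta f Q z y = a v* z"
  using inner_cov_eta[OF a(1), of y] a(2) by (simp add: vmult_theta refl_f_def mu_def inner_diff_right)

lemma theta_mat_cball: "theta f Q z y \<in> mat_cball"
  unfolding mat_cball_iff
proof
  fix v
  have "norm (Mt y v v* z) \<le> norm (Mt y v)" using z by (simp add: mat_cball_iff)
  then have "norm (Mt y v v* z) ^ 2 \<le> norm (Mt y v) ^ 2" by (simp add: power_mono)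
  then have "norm (v v* theta f Q z y) ^ 2 \<le> norm v ^ 2" using theta_norm[of v y] by linarith
  then show "norm (v v* theta f Q z y) \<le> norm v" by (simp add: power2_le_iff_abs_le)
qed

lemma mu_add: "mu y (v + w) = mu y v + mu y w"
  by (simp add: mu_def inner_add_left add_divide_distrib ring_distribs)

lemma mu_scale: "mu y (a *\<^sub>R v) = a * mu y v"
  by (simp add: mu_def)

lemma linear_Mt: "linear (Mt y)"
  by (rule linearI) (simp_all add: Mt_def mu_add mu_scale refl_f_def inner_add_left algebra_simps)

text \<open>For v in the kernel, the product of v with f - b has two values: mu (1 + tau) / 2 by
  definition of \<open>mu\<close>, and mu (1 + (f + b) . snd eta) after reflecting back. Smallness
  separates the two factors, so mu = 0 and then v = 0.\<close>

lemma inj_Mt: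
  assumes small: "sip z (eta Q z y) (eta Q z y) + 2 * \<bar>(f + cov z (eta Q z y)) \<bullet> snd (eta Q z y)\<bar> < 1"
  shows "inj (Mt y)"
proof -
  let ?\<eta> = "eta Q z y"
  let ?b = "cov z ?\<eta>" and ?\<tau> = "sip z ?\<eta> ?\<eta>"
  have f: "f \<bullet> f = 1" "Q *v f = f" using fr by (auto simp: proj_frame_def)
  have fb: "f \<bullet> ?b = 0" using inner_cov_eta[OF f(2)] .
  have "v = 0" if v: "Mt y v = 0" for v
  proof -
    let ?\<mu> = "mu y v"
    have R: "refl_f v = - ?\<mu> *\<^sub>R (f + snd ?\<eta>)" using v by (simp add: Mt_def eq_neg_iff_add_eq_0)
    have "v = refl_f (refl_f v)"
      using f by (simp add: refl_f_def inner_diff_left algebra_simps)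
    then have "v \<bullet> (f - ?b) = refl_f (refl_f v) \<bullet> (f - ?b)" by simp
    also have "\<dots> = refl_f v \<bullet> (- f - ?b)"
      using f fb by (simp add: refl_f_def[of "refl_f v"] inner_diff_left inner_diff_right algebra_simps)
    also have "\<dots> = ?\<mu> * ((f + snd ?\<eta>) \<bullet> (f + ?b))"
      unfolding R by (simp add: inner_diff_right inner_add_right algebra_simps)
    also have "(f + snd ?\<eta>) \<bullet> (f + ?b) = 1 + (f + ?b) \<bullet> snd ?\<eta>"
      using f fb by (simp add: inner_add_left inner_add_right inner_commute)
    finally have "v \<bullet> (f - ?b) = ?\<mu> * (1 + (f + ?b) \<bullet> snd ?\<eta>)" .
    moreover have "?\<mu> * (1 + ?\<tau>) = 2 * (v \<bullet> (f - ?b))"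
      using tau_nonneg[of y] by (simp add: mu_def)
    ultimately have "?\<mu> * ((1 + ?\<tau>) - 2 * (1 + (f + ?b) \<bullet> snd ?\<eta>)) = 0" by (simp add: algebra_simps)
    moreover have "(1 + ?\<tau>) - 2 * (1 + (f + ?b) \<bullet> snd ?\<eta>) < 0"
    proof -
      have "(1 + t) - 2 * (1 + s) < 0" if "t + 2 * \<bar>s\<bar> < 1" for s t :: real using that by argo
      from this[OF small] show ?thesis .
    qed
    ultimately have "?\<mu> = 0" by auto
    then have "refl_f v = 0" using R by simp
    then show "v = 0" using \<open>v = refl_f (refl_f v)\<close> by (simp add: refl_f_def)
  qed
  then show ?thesis using linear_injective_0[OF linear_Mt] by blast
qed

text \<open>By \<open>theta_norm\<close> the kernel attached to the new matrix is the preimage of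
  the old one under \<open>Mt\<close>, and \<open>inj_Mt\<close> makes \<open>Mt\<close> bijective,
  so the two dimensions agree.\<close>

lemma theta_stratum:
  assumes small: "sip z (eta Q z y) (eta Q z y) + 2 * \<bar>(f + cov z (eta Q z y)) \<bullet> snd (eta Q z y)\<bar> < 1"
    and zr: "z \<in> stratum r"
  shows "theta f Q z y \<in> stratum r"
proof -
  have "v \<in> fixspace (theta f Q z y) \<longleftrightarrow> Mt y v \<in> fixspace z" for v
  proof -
    have "v \<in> fixspace (theta f Q z y) \<longleftrightarrow> norm (v v* theta f Q z y) ^ 2 = norm v ^ 2"
      by (simp add: fixspace_iff_norm[OF theta_mat_cball] power2_eq_iff_nonneg)
    also have "\<dots> \<longleftrightarrow> norm (Mt y v) ^ 2 = norm (Mt y v v* z) ^ 2" using theta_norm[of v y] by auto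
    also have "\<dots> \<longleftrightarrow> Mt y v \<in> fixspace z" by (auto simp: fixspace_iff_norm[OF z] power2_eq_iff_nonneg)
    finally show ?thesis .
  qed
  then have "fixspace (theta f Q z y) = Mt y -` fixspace z" by auto
  moreover have "surj (Mt y)" using linear_injective_imp_surjective[OF linear_Mt inj_Mt[OF small]] by simp
  ultimately have "fixspace z = Mt y ` fixspace (theta f Q z y)" by (simp add: surj_image_vimage_eq)
  then have "dim (fixspace z) = dim (fixspace (theta f Q z y))"
    using dim_image_eq[OF linear_Mt] inj_Mt[OF small] by (metis inj_on_subset subset_UNIV)
  then show ?thesis using zr theta_mat_cball by (simp add: stratum_iff)
qed

text \<open>The moved vector h y and the vector c are unit vectors for \<open>sip z\<close>, and the
  pivot is 1 - <h y, c>, half of their squared distance. Two small pivots force h y and h y' to be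
  close; since h is an inverse stereographic projection of eta, the parameters are then close as
  well.\<close>

lemma theta_pivot_ineq:
  fixes Y :: "real^'q"
  defines "piv \<equiv> \<lambda>y. 1 - f \<bullet> (theta f Q z y *v Y)"
  defines "u \<equiv> Q *v (z *v Y) - (f \<bullet> (z *v Y)) *\<^sub>R f"
  assumes Y: "Y \<bullet> Y = 1 + u \<bullet> u"
    and t: "sip z (eta Q z y) (eta Q z y) \<le> 1" "sip z (eta Q z y') (eta Q z y') \<le> 1"
  shows "sip z (eta Q z (y - y')) (eta Q z (y - y')) \<le> 4 * (piv y + piv y')"
    and "0 \<le> piv y"
proof -
  have f: "f \<bullet> f = 1" "Q *v f = f" "\<And>x. Q *v (Q *v x) = Q *v x" "\<And>x y. (Q *v x) \<bullet> y = x \<bullet> (Q *v y)"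
    using fr by (auto simp: proj_frame_def)
  define \<kappa> where "\<kappa> = f \<bullet> (z *v Y)"
  have u: "Q *v u = u" "f \<bullet> u = 0"
    using f by (simp_all add: u_def matrix_vector_mult_diff_distrib matrix_vector_mult_scaleR inner_diff_right)
      (metis f(2,4))
  have uzY: "u \<bullet> (z *v Y) = u \<bullet> u"
  proof -
    have "u \<bullet> u = (Q *v (z *v Y)) \<bullet> u - \<kappa> * (f \<bullet> u)" by (subst (1) u_def) (simp add: inner_diff_left \<kappa>_def)
    also have "\<dots> = (z *v Y) \<bullet> (Q *v u)" using f(4) u(2) by simp
    also have "\<dots> = u \<bullet> (z *v Y)" using u(1) by (simp add: inner_commute)
    finally show ?thesis by simp
  qed
  \<comment> \<open>Subtracting the embedded u removes the part of Y seen by the rows that are kept;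
    the hypothesis on \<open>Y \<bullet> Y\<close> says precisely that the rest has length
    1.\<close>
  define c where "c = (Y, 0) - rowv z u"
  have cc: "sip z c c = 1"
  proof -
    have "cov z (Y, 0) = z *v Y" by (simp add: cov_def)
    moreover have "sip z (Y, 0) (Y, 0) = Y \<bullet> Y" by (simp add: sip_def)
    ultimately show ?thesis
      unfolding c_def sip_simps sip_row_left sip_row_right cov_row cov_diff using Y uzY by (simp add: inner_diff_right)
  qed
  \<comment> \<open>Inverse stereographic projection of eta from the point opposite to
    \<open>rowv z f\<close>; this is where the two reflections send \<open>rowv z f\<close>.\<close>
  define h where "h y = ((1 - sip z (eta Q z y) (eta Q z y)) / (1 + sip z (eta Q z y) (eta Q z y))) *\<^sub>R rowv z f
      + (2 / (1 + sip z (eta Q z y) (eta Q z y))) *\<^sub>R eta Q z y" for y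
  have rf: "sip z (rowv z f) (rowv z f) = 1" using f by (simp add: sip_row_left cov_row)
  have re: "sip z (rowv z f) (eta Q z y) = 0" "sip z (eta Q z y) (rowv z f) = 0" for y
    using inner_cov_eta[OF f(2), of y] by (simp_all add: sip_row_left sip_row_right)
  have ec: "sip z (eta Q z y) c = fst (eta Q z y) \<bullet> Y" for y
    unfolding c_def sip_diff_right sip_row_right using inner_cov_eta[OF u(1)] by (simp add: sip_def)
  have fc: "sip z (rowv z f) c = \<kappa>"
    unfolding c_def sip_diff_right sip_row_left cov_row using u(2) by (simp add: cov_def \<kappa>_def)
  have hc: "piv y = 1 - sip z (h y) c" for y
  proof -
    let ?\<tau> = "sip z (eta Q z y) (eta Q z y)"
    have D: "1 + ?\<tau> > 0" using tau_nonneg[of y] by linarith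
    have "f \<bullet> (theta f Q z y *v Y) = (f v* theta f Q z y) \<bullet> Y" by (simp add: dot_lmul_matrix)
    also have "f v* theta f Q z y = - (f v* z) + (2 / (1 + ?\<tau>)) *\<^sub>R (f v* z + fst (eta Q z y))"
    proof -
      have "refl_f f = - f" using f by (simp add: refl_f_def scaleR_2)
      moreover have "mu y f = 2 / (1 + ?\<tau>)" using f inner_cov_eta[OF f(2), of y] by (simp add: mu_def inner_diff_right)
      ultimately show ?thesis using vmult_scale[of "-1" f z] by (simp add: vmult_theta)
    qed
    also have "\<dots> \<bullet> Y = - \<kappa> + (2 / (1 + ?\<tau>)) * (\<kappa> + fst (eta Q z y) \<bullet> Y)"
      unfolding \<kappa>_def dot_lmul_matrix[symmetric] by (simp only: inner_add_left inner_minus_left inner_scaleR_left)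
    also have "\<dots> = ((1 - ?\<tau>) / (1 + ?\<tau>)) * \<kappa> + (2 / (1 + ?\<tau>)) * (fst (eta Q z y) \<bullet> Y)"
    proof -
      have "- k + (2 / (1 + t)) * (k + x) = ((1 - t) / (1 + t)) * k + (2 / (1 + t)) * x" if "1 + t > 0" for k t x :: real
        using that by (simp add: divide_simps) (simp add: algebra_simps)
      from this[OF D] show ?thesis .
    qed
    also have "\<dots> = sip z (h y) c" unfolding h_def sip_simps ec fc ..
    finally show ?thesis by (simp add: piv_def)
  qed
  have hh: "sip z (h y) (h y') = ((1 - sip z (eta Q z y) (eta Q z y)) * (1 - sip z (eta Q z y') (eta Q z y'))
       + 4 * sip z (eta Q z y) (eta Q z y')) / ((1 + sip z (eta Q z y) (eta Q z y)) * (1 + sip z (eta Q z y') (eta Q z y')))" for y y'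
    unfolding h_def sip_simps re rf by (simp add: add_divide_distrib mult.commute)
  have h1: "sip z (h y) (h y) = 1" for y
  proof -
    have "1 + sip z (eta Q z y) (eta Q z y) > 0" using tau_nonneg[of y] by linarith
    moreover have "((1 - t) * (1 - t) + 4 * t) / ((1 + t) * (1 + t)) = 1" if "1 + t > 0" for t :: real
    proof -
      have "(1 + t) * (1 + t) \<noteq> 0" using that by simp
      moreover have "(1 - t) * (1 - t) + 4 * t = (1 + t) * (1 + t)" by (simp add: algebra_simps)
      ultimately show ?thesis by simp
    qed
    ultimately show ?thesis unfolding hh by blast
  qed
  have "0 \<le> sip z (h y - c) (h y - c)" by (rule sip_nonneg[OF z])
  then show "0 \<le> piv y" unfolding hc sip_simps h1 cc using sip_commute[of z c "h y"] by simp
  \<comment> \<open>Parallelogram law: the squared distance of h y and h y' is at most twice the sum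
    of their squared distances to c.\<close>
  have "0 \<le> sip z ((h y - c) + (h y' - c)) ((h y - c) + (h y' - c))" by (rule sip_nonneg[OF z])
  then have 1: "sip z (h y - h y') (h y - h y') \<le> 4 * (piv y + piv y')"
    unfolding hc sip_simps h1 cc using sip_commute[of z c "h y"] sip_commute[of z c "h y'"] sip_commute[of z "h y" "h y'"]
    by (simp add: algebra_simps)
  define \<tau> \<tau>' where "\<tau> = sip z (eta Q z y) (eta Q z y)" and "\<tau>' = sip z (eta Q z y') (eta Q z y')"
  have T: "0 \<le> \<tau>" "0 \<le> \<tau>'" "\<tau> \<le> 1" "\<tau>' \<le> 1" using t tau_nonneg by (simp_all add: \<tau>_def \<tau>'_def)
  define q where "q = sip z (eta Q z (y - y')) (eta Q z (y - y'))"
  have q0: "0 \<le> q" unfolding q_def by (rule tau_nonneg)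
  have q: "q = \<tau> + \<tau>' - 2 * sip z (eta Q z y) (eta Q z y')"
    unfolding q_def eta_diff sip_simps \<tau>_def \<tau>'_def using sip_commute[of z "eta Q z y" "eta Q z y'"] by simp
  have "sip z (h y - h y') (h y - h y') = 2 - 2 * sip z (h y) (h y')"
    unfolding sip_simps h1 using sip_commute[of z "h y" "h y'"] by simp
  also have "\<dots> = 4 * q / ((1 + \<tau>) * (1 + \<tau>'))"
    unfolding hh \<tau>_def[symmetric] \<tau>'_def[symmetric] q using T
    by (simp add: divide_simps) (simp add: algebra_simps)
  finally have 2: "4 * q / ((1 + \<tau>) * (1 + \<tau>')) \<le> 4 * (piv y + piv y')" using 1 by simp
  \<comment> \<open>On the unit ball the inverse stereographic projection does not shrink distances;
    this is what the bounds \<open>\<tau> \<le> 1\<close> and \<open>\<tau>' \<le> 1\<close> are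
    for.\<close>
  have "(1 + \<tau>) * (1 + \<tau>') \<le> 2 * 2" using T by (intro mult_mono) auto
  then have "4 * q / 4 \<le> 4 * q / ((1 + \<tau>) * (1 + \<tau>'))"
    using q0 T by (intro divide_left_mono) (auto intro!: mult_pos_pos add_pos_nonneg)
  with 2 show "sip z (eta Q z (y - y')) (eta Q z (y - y')) \<le> 4 * (piv y + piv y')"
    unfolding q_def[symmetric] by simp
qed

end

section \<open>Uniform Lipschitz bounds\<close>

text \<open>One number bounds the values and the Lipschitz quotients, uniformly in the parameter.
  Including the values is what makes the class stable under bilinear operations.\<close>

definition unif_lip :: "'x set \<Rightarrow> 'w::real_normed_vector set \<Rightarrow> ('x \<Rightarrow> 'w \<Rightarrow> 'v::real_normed_vector) \<Rightarrow> bool" where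
  "unif_lip X D G \<longleftrightarrow> (\<exists>B. \<forall>x\<in>X. (\<forall>w\<in>D. norm (G x w) \<le> B) \<and>
      (\<forall>w\<in>D. \<forall>w'\<in>D. norm (G x w - G x w') \<le> B * norm (w - w')))"

lemma unif_lipE:
  assumes "unif_lip X D G"
  obtains B where "0 \<le> B" "\<And>x w. x \<in> X \<Longrightarrow> w \<in> D \<Longrightarrow> norm (G x w) \<le> B"
    "\<And>x w w'. x \<in> X \<Longrightarrow> w \<in> D \<Longrightarrow> w' \<in> D \<Longrightarrow> norm (G x w - G x w') \<le> B * norm (w - w')"
proof -
  from assms obtain B where B: "\<And>x w. x \<in> X \<Longrightarrow> w \<in> D \<Longrightarrow> norm (G x w) \<le> B"
    "\<And>x w w'. x \<in> X \<Longrightarrow> w \<in> D \<Longrightarrow> w' \<in> D \<Longrightarrow> norm (G x w - G x w') \<le> B * norm (w - w')"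
    unfolding unif_lip_def by blast
  have "B * norm (w - w') \<le> max B 0 * norm (w - w')" for w w' :: 'b by (intro mult_right_mono) auto
  note le = this
  show thesis
  proof (rule that[of "max B 0"])
    show "norm (G x w) \<le> max B 0" if "x \<in> X" "w \<in> D" for x w using B(1)[OF that] by simp
    show "norm (G x w - G x w') \<le> max B 0 * norm (w - w')" if "x \<in> X" "w \<in> D" "w' \<in> D" for x w w'
      using B(2)[OF that] le by (rule order_trans)
  qed simp
qed

lemma unif_lipI:
  assumes "\<And>x w. x \<in> X \<Longrightarrow> w \<in> D \<Longrightarrow> norm (G x w) \<le> B1"
    "\<And>x w w'. x \<in> X \<Longrightarrow> w \<in> D \<Longrightarrow> w' \<in> D \<Longrightarrow> norm (G x w - G x w') \<le> B2 * norm (w - w')"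
  shows "unif_lip X D G"
  unfolding unif_lip_def
proof (intro exI[of _ "max B1 B2"] ballI conjI)
  fix x w w' assume xw: "x \<in> X" "w \<in> D" "w' \<in> D"
  have "B2 * norm (w - w') \<le> max B1 B2 * norm (w - w')" by (intro mult_right_mono) auto
  then show "norm (G x w - G x w') \<le> max B1 B2 * norm (w - w')" using assms(2)[OF xw] by linarith
qed (use assms(1) in \<open>auto simp: le_max_iff_disj\<close>)

lemma unif_lip_param:
  assumes "\<And>x. x \<in> X \<Longrightarrow> norm (h x) \<le> C" shows "unif_lip X D (\<lambda>x w. h x)"
  by (rule unif_lipI[of _ _ _ C 0]) (use assms in auto)

lemma unif_lip_linear:
  assumes g: "bounded_linear g" and D: "bounded D" shows "unif_lip X D (\<lambda>x w. g w)"
proof -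
  obtain K where K: "0 \<le> K" "\<And>w. norm (g w) \<le> norm w * K"
    using bounded_linear.nonneg_bounded[OF g] by blast
  obtain C where C: "\<And>w. w \<in> D \<Longrightarrow> norm w \<le> C" using D unfolding bounded_iff by blast
  show ?thesis
  proof (rule unif_lipI[of _ _ _ "C * K" K])
    show "norm (g w) \<le> C * K" if "w \<in> D" for w
      using K(2)[of w] mult_right_mono[OF C[OF that] K(1)] by linarith
    show "norm (g w - g w') \<le> K * norm (w - w')" for w w'
      using K(2)[of "w - w'"] by (simp add: bounded_linear.linear[OF g, THEN linear_diff] mult.commute)
  qed
qed

lemma unif_lip_add:
  assumes "unif_lip X D F" "unif_lip X D G" shows "unif_lip X D (\<lambda>x w. F x w + G x w)"
proof -
  obtain A where A: "\<And>x w. x \<in> X \<Longrightarrow> w \<in> D \<Longrightarrow> norm (F x w) \<le> A"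
    "\<And>x w w'. x \<in> X \<Longrightarrow> w \<in> D \<Longrightarrow> w' \<in> D \<Longrightarrow> norm (F x w - F x w') \<le> A * norm (w - w')"
    by (rule unif_lipE[OF assms(1)]) (rule that; assumption)
  obtain B where B: "\<And>x w. x \<in> X \<Longrightarrow> w \<in> D \<Longrightarrow> norm (G x w) \<le> B"
    "\<And>x w w'. x \<in> X \<Longrightarrow> w \<in> D \<Longrightarrow> w' \<in> D \<Longrightarrow> norm (G x w - G x w') \<le> B * norm (w - w')"
    by (rule unif_lipE[OF assms(2)]) (rule that; assumption)
  show ?thesis
  proof (rule unif_lipI[of _ _ _ "A + B" "A + B"])
    fix x w w' assume xw: "x \<in> X" "w \<in> D" "w' \<in> D"
    have "norm (F x w + G x w - (F x w' + G x w')) \<le> norm (F x w - F x w') + norm (G x w - G x w')"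
      by (rule norm_diff_triangle_ineq)
    then show "norm (F x w + G x w - (F x w' + G x w')) \<le> (A + B) * norm (w - w')"
      using A(2)[OF xw] B(2)[OF xw] by (simp add: distrib_right)
  qed (use A(1) B(1) norm_triangle_mono in blast)
qed

lemma unif_lip_bilinear:
  assumes b: "bounded_bilinear b" and "unif_lip X D F" "unif_lip X D G"
  shows "unif_lip X D (\<lambda>x w. b (F x w) (G x w))"
proof -
  interpret bounded_bilinear b by fact
  obtain K where K: "0 \<le> K" "\<And>u v. norm (b u v) \<le> norm u * norm v * K" using nonneg_bounded by blast
  obtain A where A: "0 \<le> A" "\<And>x w. x \<in> X \<Longrightarrow> w \<in> D \<Longrightarrow> norm (F x w) \<le> A"
    "\<And>x w w'. x \<in> X \<Longrightarrow> w \<in> D \<Longrightarrow> w' \<in> D \<Longrightarrow> norm (F x w - F x w') \<le> A * norm (w - w')"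
    by (rule unif_lipE[OF assms(2)]) (rule that; assumption)
  obtain B where B: "0 \<le> B" "\<And>x w. x \<in> X \<Longrightarrow> w \<in> D \<Longrightarrow> norm (G x w) \<le> B"
    "\<And>x w w'. x \<in> X \<Longrightarrow> w \<in> D \<Longrightarrow> w' \<in> D \<Longrightarrow> norm (G x w - G x w') \<le> B * norm (w - w')"
    by (rule unif_lipE[OF assms(3)]) (rule that; assumption)
  have le: "norm (b u v) \<le> U * V * K" if "norm u \<le> U" "norm v \<le> V" for u v U V
  proof -
    have "norm u * norm v \<le> U * V" using that by (intro mult_mono) (auto intro: order_trans[OF norm_ge_zero])
    then show ?thesis using K(2)[of u v] mult_right_mono[OF _ K(1)] by (meson order_trans)
  qed
  show ?thesis
  proof (rule unif_lipI[of _ _ _ "A * B * K" "2 * A * B * K"])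
    fix x w w' assume xw: "x \<in> X" "w \<in> D" "w' \<in> D"
    have "b (F x w) (G x w) - b (F x w') (G x w') = b (F x w - F x w') (G x w) + b (F x w') (G x w - G x w')"
      by (simp add: diff_left diff_right)
    also have "norm \<dots> \<le> (A * norm (w - w')) * B * K + A * (B * norm (w - w')) * K"
      using le[OF A(3)[OF xw] B(2)[OF xw(1,2)]] le[OF A(2)[OF xw(1,3)] B(3)[OF xw]] norm_triangle_mono by blast
    finally show "norm (b (F x w) (G x w) - b (F x w') (G x w')) \<le> 2 * A * B * K * norm (w - w')"
      by (simp add: algebra_simps)
  qed (use le A(2) B(2) in blast)
qed

lemma unif_lip_scale: "unif_lip X D G \<Longrightarrow> unif_lip X D (\<lambda>x w. c *\<^sub>R G x w)"
  using unif_lip_bilinear[OF bounded_bilinear_scaleR unif_lip_param[of X "\<lambda>_. c" "\<bar>c\<bar>"]] by simp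

lemma unif_lip_diff:
  assumes "unif_lip X D F" "unif_lip X D G" shows "unif_lip X D (\<lambda>x w. F x w - G x w)"
  using unif_lip_add[OF assms(1) unif_lip_scale[OF assms(2), of "-1"]] by simp

text \<open>A difference of reciprocals is the difference divided by the product, and the product is
  at least 1. The threshold fits the denominator 1 + sip eta eta.\<close>

lemma unif_lip_inverse:
  fixes G :: "'x \<Rightarrow> 'w::real_normed_vector \<Rightarrow> real"
  assumes G: "unif_lip X D G" and ge: "\<And>x w. x \<in> X \<Longrightarrow> w \<in> D \<Longrightarrow> 1 \<le> G x w"
  shows "unif_lip X D (\<lambda>x w. inverse (G x w))"
proof -
  obtain B where B: "0 \<le> B"
    "\<And>x w w'. x \<in> X \<Longrightarrow> w \<in> D \<Longrightarrow> w' \<in> D \<Longrightarrow> norm (G x w - G x w') \<le> B * norm (w - w')"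
    by (rule unif_lipE[OF G]) (rule that; assumption)
  show ?thesis
  proof (rule unif_lipI[of _ _ _ 1 B])
    fix x w w' assume xw: "x \<in> X" "w \<in> D" "w' \<in> D"
    have g: "1 \<le> G x w" "1 \<le> G x w'" using ge xw by auto
    have "inverse (G x w) - inverse (G x w') = - (inverse (G x w) * (G x w - G x w') * inverse (G x w'))"
      using g by (intro inverse_diff_inverse) auto
    then have "norm (inverse (G x w) - inverse (G x w')) = norm (G x w - G x w') / (G x w * G x w')"
      using g by (simp add: abs_mult divide_simps)
    also have "\<dots> \<le> norm (G x w - G x w') / 1"
      using g mult_mono[of 1 "G x w" 1 "G x w'"] by (intro divide_left_mono) auto
    finally show "norm (inverse (G x w) - inverse (G x w')) \<le> B * norm (w - w')" using B(2)[OF xw] by simp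
  next
    fix x w assume "x \<in> X" "w \<in> D"
    then have "1 \<le> G x w" by (rule ge)
    then show "norm (inverse (G x w)) \<le> 1" by (simp add: inverse_le_1_iff)
  qed
qed

section \<open>Boundedness of the matrix operations and uniformity of \<open>theta\<close>\<close>

lemma bounded_bilinear_matrix_vector: "bounded_bilinear (\<lambda>(A :: real^'q::finite^'p::finite) x. A *v x)"
  unfolding bilinear_conv_bounded_bilinear[symmetric] bilinear_def
  by (auto intro!: linearI simp: matrix_vector_right_distrib matrix_vector_mult_add_rdistrib matrix_vector_mult_scaleR
      scaleR_matrix_vector_assoc)

lemma bounded_bilinear_vector_matrix: "bounded_bilinear (\<lambda>x (A :: real^'q::finite^'p::finite). x v* A)"
  unfolding bilinear_conv_bounded_bilinear[symmetric] bilinear_def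
  by (auto intro!: linearI simp: vector_matrix_left_distrib vector_matrix_mult_add_rdistrib vmult_scale vmult_scale_mat)

lemma bounded_bilinear_outer: "bounded_bilinear (outer :: real^'p::finite \<Rightarrow> real^'q::finite \<Rightarrow> _)"
  unfolding bilinear_conv_bounded_bilinear[symmetric] bilinear_def
  by (auto intro!: linearI simp: outer_def vec_eq_iff algebra_simps)

lemma norm_le_sum_rows: "norm (A :: real^'q::finite^'p::finite) \<le> (\<Sum>i\<in>UNIV. norm (A $ i))"
  unfolding norm_vec_def by (rule L2_set_le_sum) auto

lemma axis_vmult: "axis i 1 v* (A :: real^'q::finite^'p::finite) = A $ i"
  by (simp add: vec_eq_iff vector_matrix_mult_def axis_def if_distrib[of "\<lambda>x. x * _"] cong: if_cong)

lemma mat_cball_norm: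
  assumes "z \<in> mat_cball" shows "norm (z :: real^'q::finite^'p::finite) \<le> CARD('p)"
proof -
  have "norm (z $ i) \<le> 1" for i
    using assms unfolding mat_cball_iff by (metis axis_vmult norm_axis_1)
  then have "(\<Sum>i\<in>UNIV. norm (z $ i)) \<le> (\<Sum>i\<in>(UNIV::'p set). 1)" by (intro sum_mono) auto
  then show ?thesis using norm_le_sum_rows[of z] by simp
qed

lemma bounded_mat_cball: "bounded (mat_cball :: (real^'q::finite^'p::finite) set)"
  unfolding bounded_iff using mat_cball_norm by blast

lemma proj_frame_norm:
  fixes f :: "real^'p::finite"
  assumes "proj_frame f Q"
  shows "norm f = 1" "norm Q \<le> CARD('p)" "norm (Q *v x) \<le> norm x"
proof -
  have f: "f \<bullet> f = 1" "\<And>x. Q *v (Q *v x) = Q *v x" "\<And>x y. (Q *v x) \<bullet> y = x \<bullet> (Q *v y)"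
    using assms by (auto simp: proj_frame_def)
  show "norm f = 1" using f(1) by (simp add: norm_eq_1)
  have *: "norm (Q *v x) \<le> norm x" for x
  proof -
    have "norm (Q *v x) * norm (Q *v x) = (Q *v x) \<bullet> x" using f(2) f(3)[of "Q *v x" x] f(3)[of x "Q *v x"]
      by (simp add: power2_norm_eq_inner[symmetric] power2_eq_square[symmetric] inner_commute)
    also have "\<dots> \<le> norm (Q *v x) * norm x" by (rule norm_cauchy_schwarz)
    finally show ?thesis by (cases "norm (Q *v x) = 0") (auto simp: mult_le_cancel_left)
  qed
  then show "norm (Q *v x) \<le> norm x" .
  have "Q \<in> mat_cball" unfolding mat_cball_def using * by (auto intro!: onorm_le)
  then show "norm Q \<le> CARD('p)" by (rule mat_cball_norm)
qed

text \<open>All ingredients of \<open>theta\<close> are obtained from f, Q, z, y by bilinear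
  operations and one division by a number at least 1, and f, Q, z, y range over bounded sets.
  Lipschitz dependence on z controls the distortion of volume, dependence on y the distance from the
  identity; averaging over moving frames requires both independently of the frame.\<close>

lemma theta_uniform:
  fixes dummy :: "real^'q::finite^'p::finite"
  obtains L \<delta> where "0 \<le> L" "0 < \<delta>" "\<delta> \<le> 1"
    "\<And>(f :: real^'p) Q (z :: real^'q^'p) y z' y'. \<lbrakk>proj_frame f Q; z \<in> mat_cball; z' \<in> mat_cball; norm y \<le> 1; norm y' \<le> 1\<rbrakk>
       \<Longrightarrow> norm (theta f Q z y - theta f Q z' y') \<le> L * norm ((z, y) - (z', y'))"
    "\<And>(f :: real^'p) Q (z :: real^'q^'p) y. \<lbrakk>proj_frame f Q; z \<in> mat_cball; norm y \<le> \<delta>\<rbrakk>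
       \<Longrightarrow> sip z (eta Q z y) (eta Q z y) + 2 * \<bar>(f + cov z (eta Q z y)) \<bullet> snd (eta Q z y)\<bar> < 1"
proof -
  define X where "X = {(f :: real^'p, Q). proj_frame f Q}"
  define D where "D = (mat_cball :: (real^'q^'p) set) \<times> cball (0 :: ('p, 'q) param) 1"
  have D: "bounded D" unfolding D_def by (intro bounded_Times bounded_mat_cball bounded_cball)
  have mvl: "unif_lip X D (\<lambda>x w. F x w *v G x w)" if "unif_lip X D F" "unif_lip X D G"
    for F :: "_ \<Rightarrow> _ \<Rightarrow> real^'c::finite^'d::finite" and G using that by (rule unif_lip_bilinear[OF bounded_bilinear_matrix_vector])
  have vml: "unif_lip X D (\<lambda>x w. F x w v* G x w)" if "unif_lip X D F" "unif_lip X D G"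
    for F and G :: "_ \<Rightarrow> _ \<Rightarrow> real^'q^'p" using that by (rule unif_lip_bilinear[OF bounded_bilinear_vector_matrix])
  have inn: "unif_lip X D (\<lambda>x w. F x w \<bullet> G x w)" if "unif_lip X D F" "unif_lip X D G"
    for F G :: "_ \<Rightarrow> _ \<Rightarrow> 'v::real_inner" using that by (rule unif_lip_bilinear[OF bounded_bilinear_inner])
  have lf: "unif_lip X D (\<lambda>x w. fst x)"
    by (rule unif_lip_param[of _ _ 1]) (auto simp: X_def proj_frame_norm)
  have lQ: "unif_lip X D (\<lambda>x w. snd x)"
    by (rule unif_lip_param[of _ _ "CARD('p)"]) (auto simp: X_def proj_frame_norm)
  have lz: "unif_lip X D (\<lambda>x w. fst w)" and ly: "unif_lip X D (\<lambda>x w. snd w)"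
    by (rule unif_lip_linear[OF _ D], rule bounded_linear_fst bounded_linear_snd)+
  have ly1: "unif_lip X D (\<lambda>x w. fst (snd w))" and ly2: "unif_lip X D (\<lambda>x w. snd (snd w))"
    by (rule unif_lip_linear[OF _ D], intro bounded_linear_compose[OF bounded_linear_fst bounded_linear_snd]
        bounded_linear_compose[OF bounded_linear_snd bounded_linear_snd])+
  have lcov: "unif_lip X D (\<lambda>x w. cov (fst w) (F x w))"
    if "unif_lip X D (\<lambda>x w. fst (F x w))" "unif_lip X D (\<lambda>x w. snd (F x w))" for F
    unfolding cov_def using that by (intro unif_lip_add unif_lip_diff mvl vml lz)
  define s where "s x w = snd x *v cov (fst w) (snd w)" for x :: "(real^'p) \<times> (real^'p^'p)" and w :: "(real^'q^'p) \<times> ('p, 'q) param"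
  have ls: "unif_lip X D s" unfolding s_def by (intro mvl lQ lcov ly1 ly2)
  define et where "et x w = eta (snd x) (fst w) (snd w)" for x :: "(real^'p) \<times> (real^'p^'p)" and w :: "(real^'q^'p) \<times> ('p, 'q) param"
  have et1: "fst (et x w) = fst (snd w) - s x w v* fst w" and et2: "snd (et x w) = snd (snd w) - s x w" for x w
    by (simp_all add: et_def eta_def rowv_def s_def)
  have le1: "unif_lip X D (\<lambda>x w. fst (et x w))" unfolding et1 by (intro unif_lip_diff ly1 vml ls lz)
  have le2: "unif_lip X D (\<lambda>x w. snd (et x w))" unfolding et2 by (intro unif_lip_diff ly2 ls)
  have lc: "unif_lip X D (\<lambda>x w. cov (fst w) (et x w))" by (rule lcov[OF le1 le2])
  have lt: "unif_lip X D (\<lambda>x w. sip (fst w) (et x w) (et x w))"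
    unfolding sip_def by (intro unif_lip_add unif_lip_diff inn vml le1 le2 lz)
  have li: "unif_lip X D (\<lambda>x w. inverse (1 + sip (fst w) (et x w) (et x w)))"
  proof (rule unif_lip_inverse)
    show "unif_lip X D (\<lambda>x w. 1 + sip (fst w) (et x w) (et x w))"
      by (intro unif_lip_add lt unif_lip_param[of _ _ 1]) auto
    show "1 \<le> 1 + sip (fst w) (et x w) (et x w)" if "w \<in> D" for x w
      using that sip_nonneg[of "fst w" "et x w"] by (auto simp: D_def)
  qed
  have th: "unif_lip X D (\<lambda>x w. theta (fst x) (snd x) (fst w) (snd w))"
  proof -
    have "unif_lip X D (\<lambda>x w. fst w - 2 *\<^sub>R outer (fst x) (fst x v* fst w)
       + (2 *\<^sub>R inverse (1 + sip (fst w) (et x w) (et x w))) *\<^sub>R outer (fst x - cov (fst w) (et x w)) (fst x v* fst w + fst (et x w)))"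
      by (intro unif_lip_add unif_lip_diff unif_lip_scale lz vml lf lc le1 li unif_lip_bilinear[OF bounded_bilinear_outer]
          unif_lip_bilinear[OF bounded_bilinear_scaleR])
    then show ?thesis by (simp add: theta_def et_def divide_inverse)
  qed
  have lsm: "unif_lip X D (\<lambda>x w. (fst x + cov (fst w) (et x w)) \<bullet> snd (et x w))"
    by (intro inn unif_lip_add lf lc le2)
  obtain L where L: "0 \<le> L" "\<And>x w w'. x \<in> X \<Longrightarrow> w \<in> D \<Longrightarrow> w' \<in> D \<Longrightarrow>
      norm (theta (fst x) (snd x) (fst w) (snd w) - theta (fst x) (snd x) (fst w') (snd w')) \<le> L * norm (w - w')"
    by (rule unif_lipE[OF th]) (rule that; assumption)
  obtain A where A: "0 \<le> A" "\<And>x w w'. x \<in> X \<Longrightarrow> w \<in> D \<Longrightarrow> w' \<in> D \<Longrightarrow>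
      norm (sip (fst w) (et x w) (et x w) - sip (fst w') (et x w') (et x w')) \<le> A * norm (w - w')"
    by (rule unif_lipE[OF lt]) (rule that; assumption)
  obtain B where B: "0 \<le> B" "\<And>x w w'. x \<in> X \<Longrightarrow> w \<in> D \<Longrightarrow> w' \<in> D \<Longrightarrow>
      norm ((fst x + cov (fst w) (et x w)) \<bullet> snd (et x w) - (fst x + cov (fst w') (et x w')) \<bullet> snd (et x w')) \<le> B * norm (w - w')"
    by (rule unif_lipE[OF lsm]) (rule that; assumption)
  \<comment> \<open>Both quantities vanish at y = 0, so the sum in question is at most (A + 2 B)
    |y|; this radius keeps it below 1/2.\<close>
  define \<delta> where "\<delta> = 1 / (2 * (1 + A + 2 * B))"
  have \<delta>: "0 < \<delta>" "\<delta> \<le> 1" using A(1) B(1) by (auto simp: \<delta>_def divide_simps)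
  show thesis
  proof (rule that[of L \<delta>])
    fix f :: "real^'p" and Q and z z' :: "real^'q^'p" and y y' :: "('p, 'q) param"
    assume "proj_frame f Q" "z \<in> mat_cball" "z' \<in> mat_cball" "norm y \<le> 1" "norm y' \<le> 1"
    then show "norm (theta f Q z y - theta f Q z' y') \<le> L * norm ((z, y) - (z', y'))"
      using L(2)[of "(f, Q)" "(z, y)" "(z', y')"] by (simp add: X_def D_def)
  next
    fix f :: "real^'p" and Q and z :: "real^'q^'p" and y :: "('p, 'q) param"
    assume h: "proj_frame f Q" "z \<in> mat_cball" "norm y \<le> \<delta>"
    have in': "(f, Q) \<in> X" "(z, y) \<in> D" "(z, 0) \<in> D" using h \<delta> by (auto simp: X_def D_def)
    have n: "norm ((z, y) - (z, 0)) = norm y" by (simp add: norm_Pair)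
    have 1: "sip z (eta Q z y) (eta Q z y) \<le> A * norm y"
      using A(2)[OF in'] unfolding n by (simp add: et_def)
    have 2: "\<bar>(f + cov z (eta Q z y)) \<bullet> snd (eta Q z y)\<bar> \<le> B * norm y"
      using B(2)[OF in'] unfolding n by (simp add: et_def)
    have "(A + 2 * B) * norm y \<le> (A + 2 * B) * \<delta>" using h(3) A(1) B(1) by (intro mult_left_mono) auto
    also have "\<dots> < 1" using A(1) B(1) by (simp add: \<delta>_def divide_simps)
    finally have "A * norm y + 2 * (B * norm y) < 1" by (simp add: algebra_simps)
    then show "sip z (eta Q z y) (eta Q z y) + 2 * \<bar>(f + cov z (eta Q z y)) \<bullet> snd (eta Q z y)\<bar> < 1"
      using 1 2 by argo
  qed (use L(1) \<delta> in auto)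
qed

section \<open>Packing and negative powers\<close>

text \<open>Extended-valued, and infinite where the argument is not positive. A finite integral then
  includes the statement that the determinant is positive almost everywhere, so its sign never has
  to be discussed beforehand.\<close>

definition negpow :: "real \<Rightarrow> real \<Rightarrow> ennreal" where
  "negpow \<beta> x = (if x \<le> 0 then \<infinity> else ennreal (x powr (- \<beta>)))"

lemma negpow_measurable [measurable]: "negpow \<beta> \<in> borel_measurable borel"
  unfolding negpow_def by measurable

text \<open>For x not positive both sides are infinite, because the power of a positive y is
  positive; for positive x this is multiplicativity of powers.\<close>

lemma negpow_mult:
  assumes "0 < y" shows "negpow \<beta> (x * y) = negpow \<beta> x * negpow \<beta> y"
  using assms by (auto simp: negpow_def mult_le_0_iff powr_mult ennreal_mult ennreal_top_mult zero_less_mult_iff)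

lemma negpow_antimono:
  assumes "0 \<le> \<beta>" "x \<le> y" shows "negpow \<beta> y \<le> negpow \<beta> x"
  using assms powr_mono2'[of "- \<beta>" x y] by (auto simp: negpow_def intro!: ennreal_leI)

text \<open>Translates of E by a grid of mesh s in the span of Bs are disjoint, since a common point
  would give two points of E differing by a grid vector of length at least s. About (1/s)^d of them
  fit into the ball of radius 2, so E has measure O(s^d).\<close>

lemma packing_bound:
  fixes E :: "'a::euclidean_space set"
  assumes E: "E \<in> lmeasurable" "E \<subseteq> cball 0 1"
    and Bs: "pairwise orthogonal Bs" "\<And>b. b \<in> Bs \<Longrightarrow> norm b = 1" and s: "0 < s"
    and sep: "\<And>x y. x \<in> E \<Longrightarrow> y \<in> E \<Longrightarrow> x - y \<in> span Bs \<Longrightarrow> norm (x - y) < s"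
  shows "measure lebesgue E \<le> measure lebesgue (cball (0::'a) 2) * (s * (card Bs + 1)) ^ card Bs"
proof -
  have fin: "finite Bs" using pairwise_orthogonal_imp_finite[OF Bs(1)] .
  define d where "d = card Bs"
  \<comment> \<open>Grid coordinates are s k with k at most K, the largest number for which the
    crude bound s (d + 1) K <= 1 keeps the grid in the unit ball. For large s it is 0 and only one
    translate is used.\<close>
  define K where "K = nat \<lfloor>1 / (s * (real d + 1))\<rfloor>"
  define u where "u = s * (real d + 1)"
  have u: "0 < u" using s by (simp add: u_def)
  have "real K \<le> 1 / u" "1 / u \<le> real K + 1" using u unfolding K_def u_def[symmetric] by auto
  then have "u * K \<le> 1" "1 \<le> u * (real K + 1)"
    unfolding pos_le_divide_eq[OF u] pos_divide_le_eq[OF u] by (simp_all only: mult.commute[of u])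
  then have K1: "s * (d + 1) * K \<le> 1" and K2: "1 \<le> s * (d + 1) * (real K + 1)"
    by (simp_all add: u_def add.commute)
  define G where "G = (PiE Bs (\<lambda>_. {0..K}))"
  have cG: "card G = (K + 1) ^ d" and fG: "finite G"
    using fin by (simp_all add: G_def card_PiE d_def finite_PiE)
  define w where "w k = (\<Sum>b\<in>Bs. (s * real (k b)) *\<^sub>R b)" for k :: "'a \<Rightarrow> nat"
  have w_span: "w k \<in> span Bs" for k
    unfolding w_def by (intro span_sum span_scale span_base)
  have w_norm: "norm (w k) \<le> 1" if "k \<in> G" for k
  proof -
    have "norm (w k) \<le> (\<Sum>b\<in>Bs. norm ((s * real (k b)) *\<^sub>R b))" unfolding w_def by (rule norm_sum)
    also have "\<dots> \<le> (\<Sum>b\<in>Bs. s * real K)"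
      using that s Bs(2) by (intro sum_mono) (auto simp: G_def PiE_def Pi_def)
    also have "\<dots> = s * d * K" by (simp add: d_def)
    also have "\<dots> \<le> s * (d + 1) * K" using s by (simp add: algebra_simps)
    finally show ?thesis using K1 by linarith
  qed
  have w_inner: "w k \<bullet> b = s * real (k b)" if b: "b \<in> Bs" for k b
  proof -
    have "w k \<bullet> b = (\<Sum>c\<in>Bs. s * real (k c) * (c \<bullet> b))"
      unfolding w_def by (simp add: inner_sum_left)
    also have "\<dots> = (\<Sum>c\<in>Bs. if c = b then s * real (k c) else 0)"
      using Bs b by (intro sum.cong) (auto simp: pairwise_def orthogonal_def norm_eq_1)
    finally show ?thesis using fin b by simp
  qed
  have w_sep: "s \<le> norm (w k - w l)" if kl: "k \<in> G" "l \<in> G" "k \<noteq> l" for k l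
  proof -
    obtain b where b: "b \<in> Bs" "k b \<noteq> l b"
      using kl unfolding G_def by (metis PiE_ext)
    have "s * 1 \<le> s * \<bar>real (k b) - real (l b)\<bar>" using s b by (intro mult_left_mono) auto
    also have "\<dots> = \<bar>(w k - w l) \<bullet> b\<bar>"
      using s b by (simp add: inner_diff_left w_inner right_diff_distrib[symmetric] abs_mult)
    also have "\<dots> \<le> norm (w k - w l)" using Cauchy_Schwarz_ineq2[of "w k - w l" b] b Bs by simp
    finally show ?thesis by simp
  qed
  have disj: "disjoint_family_on (\<lambda>k. (+) (w k) ` E) G"
    unfolding disjoint_family_on_def
  proof (intro ballI impI, rule ccontr)
    fix k l assume kl: "k \<in> G" "l \<in> G" "k \<noteq> l" and "(+) (w k) ` E \<inter> (+) (w l) ` E \<noteq> {}"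
    then obtain x y where xy: "x \<in> E" "y \<in> E" "w k + x = w l + y" by auto
    then have e: "y - x = w k - w l" by (simp add: algebra_simps)
    have "w k - w l \<in> span Bs" by (intro span_diff w_span)
    then have "norm (y - x) < s" by (intro sep) (use xy e in auto)
    then show False using w_sep[OF kl] unfolding e by linarith
  qed
  have "real (card G) * measure lebesgue E = (\<Sum>k\<in>G. measure lebesgue ((+) (w k) ` E))"
    unfolding measure_translation by simp
  also have "\<dots> = measure lebesgue (\<Union>k\<in>G. (+) (w k) ` E)"
    using E disj fG by (intro measure_UNION'[symmetric]) (auto simp: measurable_translation disjoint_family_on_def pairwise_def disjnt_def)
  also have "\<dots> \<le> measure lebesgue (cball (0::'a) 2)"
  proof (rule measure_mono_fmeasurable)
    show "(\<Union>k\<in>G. (+) (w k) ` E) \<subseteq> cball 0 2"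
      using w_norm E(2) by (auto intro!: order_trans[OF norm_triangle_ineq] simp: subset_iff) fastforce
    show "(\<Union>k\<in>G. (+) (w k) ` E) \<in> sets lebesgue"
      using E fG by (intro fmeasurableD fmeasurable.finite_UN) (auto simp: measurable_translation)
  qed auto
  finally have 1: "(real K + 1) ^ d * measure lebesgue E \<le> measure lebesgue (cball (0::'a) 2)"
    by (simp add: cG add.commute)
  have "measure lebesgue E \<le> (s * (d + 1) * (real K + 1)) ^ d * measure lebesgue E"
    using K2 by (simp add: mult_le_cancel_right1 measure_nonneg one_le_power leD)
  also have "\<dots> = (s * (d + 1)) ^ d * ((real K + 1) ^ d * measure lebesgue E)"
    by (simp add: power_mult_distrib)
  also have "\<dots> \<le> (s * (d + 1)) ^ d * measure lebesgue (cball (0::'a) 2)"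
    using 1 s by (intro mult_left_mono) auto
  finally show ?thesis by (simp add: d_def mult.commute add.commute)
qed

text \<open>Where x lies between 4^-(k+1) and 4^-k, the weight 4^((k+1) \<beta>) of layer k
  dominates the power. The summand 1 covers x >= 1, and for x <= 0 every layer contributes at least
  1, so the series is infinite.\<close>

lemma negpow_le_dyadic:
  assumes \<beta>: "0 < \<beta>"
  shows "negpow \<beta> x \<le> 1 + (\<Sum>k. ennreal (4 powr (real (Suc k) * \<beta>)) * indicator {..<(1/2)^(2*k)} x)"
    (is "_ \<le> 1 + ?S")
proof (cases "x \<ge> 1")
  case True
  then have "x powr (-\<beta>) \<le> 1" using \<beta> powr_mono2'[of "-\<beta>" 1 x] by simp
  then have "negpow \<beta> x \<le> 1" using True by (simp add: negpow_def)
  then show ?thesis by (simp add: add_increasing2)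
next
  case x1: False
  show ?thesis
  proof (cases "x \<le> 0")
    case True
    have "ennreal (real n) \<le> ?S" for n
    proof -
      have "ennreal (real n) = (\<Sum>k<n. 1)" by (simp add: ennreal_of_nat_eq_real_of_nat)
      also have "\<dots> \<le> (\<Sum>k<n. ennreal (4 powr (real (Suc k) * \<beta>)) * indicator {..<(1/2)^(2*k)} x)"
      proof (rule sum_mono)
        fix k
        have "x < (1/2::real)^(2*k)" using True by (rule order.strict_trans1) simp
        moreover have "1 \<le> 4 powr (real (Suc k) * \<beta>)" using \<beta> by (intro ge_one_powr_ge_zero) auto
        ultimately show "1 \<le> ennreal (4 powr (real (Suc k) * \<beta>)) * indicator {..<(1/2)^(2*k)} x" by simp
      qed
      also have "\<dots> \<le> ?S" by (rule sum_le_suminf) auto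
      finally show ?thesis .
    qed
    note large = this
    have "?S = \<infinity>"
    proof (rule ccontr)
      assume "?S \<noteq> \<infinity>"
      then have "?S < top" by (simp add: less_top)
      then obtain n where "?S < of_nat n" by (rule ennreal_Ex_less_of_nat[elim_format]) blast
      with large[of n] show False unfolding ennreal_of_nat_eq_real_of_nat by (meson leD)
    qed
    then show ?thesis by simp
  next
    case False
    then have x0: "0 < x" by simp
    define k where "k = nat \<lfloor>log 4 (1/x)\<rfloor>"
    have l0: "0 \<le> log 4 (1/x)" using x0 x1 by (simp add: zero_le_log_cancel_iff)
    have k: "real k \<le> log 4 (1/x)" "log 4 (1/x) < real k + 1"
      using l0 unfolding k_def by linarith+
    have a: "4 powr (real k) \<le> 1/x" using k(1) x0 by (simp add: le_log_iff)
    have b: "1/x < 4 powr (real k + 1)" using k(2) x0 by (simp add: log_less_iff)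
    have p4: "(1/2::real)^(2*k) = 1 / 4^k" by (simp add: power_mult power_divide)
    define T where "T k = ennreal (4 powr (real (Suc k) * \<beta>)) * indicator {..<(1/2)^(2*k)} x" for k :: nat
    have T: "T k \<le> (\<Sum>k. T k)" for k using sum_le_suminf[of T "{k}"] by simp
    show ?thesis
    proof (cases "x < (1/2::real)^(2*k)")
      case True
      have "x powr (-\<beta>) = (1/x) powr \<beta>" using x0 by (simp add: powr_divide powr_minus divide_simps)
      also have "\<dots> \<le> (4 powr (real k + 1)) powr \<beta>" using b \<beta> x0 by (intro powr_mono2) auto
      also have "\<dots> = 4 powr (real (Suc k) * \<beta>)" by (simp add: powr_powr add.commute)
      finally have "negpow \<beta> x \<le> ennreal (4 powr (real (Suc k) * \<beta>)) * indicator {..<(1/2)^(2*k)} x"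
        using x0 True by (simp add: negpow_def ennreal_leI)
      also have "\<dots> \<le> ?S" using T[of "k"] unfolding T_def .
      finally show ?thesis by (simp add: add_increasing)
    next
      case False
      \<comment> \<open>The boundary value x = 4^-k lies outside layer k, which is half open, and is
        served by layer k - 1.\<close>
      have "4 ^ k \<le> 1/x" using a by (simp add: powr_realpow)
      then have "x \<le> 1/4^k" using x0 by (simp add: field_simps)
      then have xe: "x = 1/4^k" using False p4 by simp
      have kpos: "k > 0" using xe x1 by (cases k) auto
      have "x powr (-\<beta>) = (4^k) powr \<beta>" unfolding xe by (simp add: powr_divide powr_minus divide_simps)
      also have "\<dots> = 4 powr (real (Suc (k - 1)) * \<beta>)"
        using kpos by (simp add: powr_realpow[symmetric] powr_powr)
      finally have e: "x powr (-\<beta>) = 4 powr (real (Suc (k - 1)) * \<beta>)" .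
      have "x < (1/2::real)^(2*(k-1))" unfolding xe using kpos
        by (simp add: power_mult power_divide divide_simps power_strict_increasing)
      then have "negpow \<beta> x \<le> ennreal (4 powr (real (Suc (k-1)) * \<beta>)) * indicator {..<(1/2)^(2*(k-1))} x"
        using x0 e by (simp add: negpow_def)
      also have "\<dots> \<le> ?S" using T[of "k-1"] unfolding T_def .
      finally show ?thesis by (simp add: add_increasing)
    qed
  qed
qed

text \<open>Layer k has weight 4^((k+1) \<beta>) and measure O(2^(-k d)), a geometric series whose
  ratio is below 1 because \<open>2 * \<beta> < d\<close>. The constant is chosen before g and
  serves every g with the same sublevel bound.\<close>

lemma negpow_integral_bound:
  fixes \<beta> C :: real and d :: nat
  assumes \<beta>: "0 < \<beta>" "2 * \<beta> < real d" and C: "0 \<le> C" and B: "B \<in> lmeasurable"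
  obtains D where "0 < D"
    "\<And>g :: 'a::euclidean_space \<Rightarrow> real. \<lbrakk>g \<in> borel_measurable borel;
       \<And>\<rho>. 0 < \<rho> \<Longrightarrow> emeasure lebesgue {y \<in> B. g y < \<rho>\<^sup>2} \<le> ennreal (C * \<rho> ^ d)\<rbrakk>
      \<Longrightarrow> (\<integral>\<^sup>+y\<in>B. negpow \<beta> (g y) \<partial>lebesgue) \<le> ennreal D"
proof -
  define q where "q = 4 powr \<beta> * (1/2)^d"
  have q: "0 < q" "q < 1"
  proof -
    have "4 powr \<beta> = 2 powr (2 * \<beta>)" using powr_powr[of 2 2 \<beta>] by simp
    also have "\<dots> < 2 powr d" using \<beta> by (intro powr_less_mono) auto
    finally show "q < 1" by (simp add: q_def powr_realpow power_divide divide_simps)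
  qed (simp add: q_def)
  \<comment> \<open>The summand 1 makes D positive, so that D times infinity is infinity when D
    multiplies a \<open>negpow\<close> later on.\<close>
  define D where "D = measure lebesgue B + 4 powr \<beta> * C * (1 / (1 - q)) + 1"
  have D: "0 < D" using q C unfolding D_def
    by (smt (verit) divide_nonneg_nonneg measure_nonneg mult_nonneg_nonneg powr_ge_zero)
  have bound: "(\<integral>\<^sup>+y\<in>B. negpow \<beta> (g y) \<partial>lebesgue) \<le> ennreal D"
    if g [measurable]: "g \<in> borel_measurable borel"
      and gm: "\<And>\<rho>. 0 < \<rho> \<Longrightarrow> emeasure lebesgue {y \<in> B. g y < \<rho>\<^sup>2} \<le> ennreal (C * \<rho> ^ d)" for g :: "'a \<Rightarrow> real"
  proof -
    have gl [measurable]: "g \<in> borel_measurable lebesgue" by (rule measurable_completion) simp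
    have Bs [measurable]: "B \<in> sets lebesgue" using B by auto
    define c where "c k = ennreal (4 powr (real (Suc k) * \<beta>))" for k :: nat
    have "(\<integral>\<^sup>+y\<in>B. negpow \<beta> (g y) \<partial>lebesgue)
        \<le> (\<integral>\<^sup>+y. indicator B y + (\<Sum>k. c k * indicator {y \<in> B. g y < ((1/2)^k)\<^sup>2} y) \<partial>lebesgue)"
    proof (rule nn_integral_mono)
      fix y :: 'a
      have p: "((1/2::real)^k)\<^sup>2 = (1/2)^(2*k)" for k by (simp add: power_mult[symmetric] mult.commute)
      show "negpow \<beta> (g y) * indicator B y \<le> indicator B y + (\<Sum>k. c k * indicator {y \<in> B. g y < ((1/2)^k)\<^sup>2} y)"
        using negpow_le_dyadic[OF \<beta>(1), of "g y"]
        by (cases "y \<in> B") (simp_all add: c_def p indicator_def)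
    qed
    also have "\<dots> = emeasure lebesgue B + (\<Sum>k. c k * emeasure lebesgue {y \<in> B. g y < ((1/2)^k)\<^sup>2})"
    proof -
      have m [measurable]: "{y \<in> B. g y < r} \<in> sets lebesgue" for r by measurable
      show ?thesis
        by (subst nn_integral_add) (auto simp: nn_integral_suminf nn_integral_cmult_indicator)
    qed
    also have "\<dots> \<le> ennreal (measure lebesgue B) + (\<Sum>k. ennreal (4 powr \<beta> * C * q^k))"
    proof (intro add_mono suminf_le)
      show "emeasure lebesgue B \<le> ennreal (measure lebesgue B)" using B by (simp add: emeasure_eq_measure2)
      fix k
      have "c k * emeasure lebesgue {y \<in> B. g y < ((1/2)^k)\<^sup>2} \<le> c k * ennreal (C * ((1/2)^k) ^ d)"
        by (intro mult_left_mono gm) auto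
      also have "\<dots> = ennreal (4 powr (real (Suc k) * \<beta>) * (C * ((1/2)^k) ^ d))"
        unfolding c_def using C by (simp add: ennreal_mult)
      also have "4 powr (real (Suc k) * \<beta>) * (C * ((1/2)^k) ^ d) = 4 powr \<beta> * C * q^k"
      proof -
        have "4 powr (real (Suc k) * \<beta>) = 4 powr \<beta> * (4 powr \<beta>)^k"
          by (simp add: powr_add[symmetric] powr_realpow[symmetric] powr_powr algebra_simps)
        moreover have "((1/2::real)^k) ^ d = ((1/2)^d)^k" by (simp add: power_mult[symmetric] mult.commute)
        ultimately show ?thesis unfolding q_def by (simp add: power_mult_distrib)
      qed
      finally show "c k * emeasure lebesgue {y \<in> B. g y < ((1/2)^k)\<^sup>2} \<le> ennreal (4 powr \<beta> * C * q^k)" .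
    qed auto
    also have "(\<Sum>k. ennreal (4 powr \<beta> * C * q^k)) = ennreal (4 powr \<beta> * C * (1 / (1 - q)))"
      using q C by (subst suminf_ennreal2) (auto intro!: summable_mult simp: suminf_mult suminf_geometric)
    also have "ennreal (measure lebesgue B) + \<dots> \<le> ennreal D"
      using q C by (simp add: D_def ennreal_plus[symmetric] del: ennreal_plus)
    finally show ?thesis .
  qed
  show ?thesis using that[OF D] bound by blast
qed

section \<open>Principal minors and pivots\<close>

text \<open>The principal submatrix is padded by the identity, so that minors of all sizes are
  determinants over one matrix type.\<close>

definition submat :: "'p::finite set \<Rightarrow> real^'p^'p \<Rightarrow> real^'p^'p" where
  "submat I A = (\<chi> a b. if a \<in> I \<and> b \<in> I then A $ a $ b else if a = b then 1 else 0)"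

lemma submat_empty [simp]: "submat {} A = mat 1"
  by (simp add: submat_def mat_def vec_eq_iff)

lemma submat_UNIV [simp]: "submat UNIV A = A"
  by (simp add: submat_def vec_eq_iff)

text \<open>In the Leibniz sum only permutations fixing j survive, and these see row j in column j
  alone.\<close>

lemma det_column_axis_cong:
  fixes A B :: "real^'p::finite^'p"
  assumes A: "\<And>a. A $ a $ j = (if a = j then 1 else 0)"
    and B: "\<And>a. B $ a $ j = (if a = j then 1 else 0)"
    and AB: "\<And>a b. a \<noteq> j \<Longrightarrow> A $ a $ b = B $ a $ b"
  shows "det A = det B"
  unfolding det_def
proof (rule sum.cong[OF refl])
  fix \<sigma> assume "\<sigma> \<in> {\<sigma>. \<sigma> permutes (UNIV::'p set)}"
  then have \<sigma>: "\<sigma> permutes (UNIV::'p set)" by simp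
  have "(\<Prod>i\<in>UNIV. A $ i $ \<sigma> i) = (\<Prod>i\<in>UNIV. B $ i $ \<sigma> i)"
  proof (cases "\<sigma> j = j")
    case True
    have "A $ i $ \<sigma> i = B $ i $ \<sigma> i" for i
      by (cases "i = j") (simp_all add: True A B AB)
    then show ?thesis by simp
  next
    case False
    obtain i where i: "\<sigma> i = j" using permutes_surj[OF \<sigma>] by (metis surjD)
    then have "i \<noteq> j" using False by auto
    then have "A $ i $ \<sigma> i = 0" "B $ i $ \<sigma> i = 0" by (simp_all add: i A B)
    then have "(\<Prod>i\<in>UNIV. A $ i $ \<sigma> i) = 0" "(\<Prod>i\<in>UNIV. B $ i $ \<sigma> i) = 0"
      by (auto intro!: prod_zero)
    then show ?thesis by (simp only:)
  qed
  then show "of_int (sign \<sigma>) * (\<Prod>i\<in>UNIV. A $ i $ \<sigma> i) = of_int (sign \<sigma>) * (\<Prod>i\<in>UNIV. B $ i $ \<sigma> i)"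
    by simp
qed

text \<open>The vector v eliminates column j by means of the columns in I, so the quotient of the
  two minors is the Schur complement, the j-th entry of A v. In the proof this is Cramer's rule for
  column j.\<close>

lemma det_submat_insert:
  fixes A :: "real^'p::finite^'p"
  assumes j: "j \<notin> I" and vj: "v $ j = 1" and v0: "\<And>a. a \<notin> insert j I \<Longrightarrow> v $ a = 0"
    and Av: "\<And>a. a \<in> I \<Longrightarrow> (A *v v) $ a = 0"
  shows "det (submat (insert j I) A) = (A *v v) $ j * det (submat I A)"
proof -
  define M where "M = submat (insert j I) A"
  let ?p = "(A *v v) $ j"
  have Mv: "(M *v v) $ a = (if a = j then ?p else 0)" for a
  proof (cases "a \<in> insert j I")
    case True
    then have "(M *v v) $ a = (A *v v) $ a"
      unfolding matrix_vector_mult_def M_def submat_def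
      by (auto intro!: sum.cong simp: v0)
    then show ?thesis using True Av j by auto
  next
    case False
    then have "(M *v v) $ a = (\<Sum>b\<in>UNIV. (if a = b then 1 else 0) * v $ b)"
      unfolding matrix_vector_mult_def M_def submat_def by simp
    also have "\<dots> = v $ a" by (simp add: if_distrib[of "\<lambda>x. x * _"] cong: if_cong)
    finally show ?thesis using False v0 by auto
  qed
  define N where "N = (\<chi> a b. if b = j then (if a = j then 1 else 0) else M $ a $ b)"
  have "det M = v $ j * det M" using vj by simp
  also have "\<dots> = det (\<chi> a b. if b = j then (M *v v) $ a else M $ a $ b)"
    by (rule cramer_lemma[symmetric])
  also have "\<dots> = det (\<chi> a b. if b = j then ?p * (if a = j then 1 else 0) else M $ a $ b)"
    by (rule arg_cong[where f=det]) (simp add: vec_eq_iff Mv)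
  also have "\<dots> = det (transpose (\<chi> b. if b = j then ?p *s (\<chi> a. if a = j then 1 else 0) else (\<chi> a. M $ a $ b)))"
    by (rule arg_cong[where f=det]) (simp add: vec_eq_iff transpose_def)
  also have "\<dots> = ?p * det (transpose (\<chi> b. if b = j then (\<chi> a. if a = j then 1 else 0) else (\<chi> a. M $ a $ b)))"
    unfolding det_transpose by (rule det_row_mul)
  also have "transpose (\<chi> b. if b = j then (\<chi> a. if a = j then 1 else 0) else (\<chi> a. M $ a $ b)) = N"
    by (simp add: vec_eq_iff transpose_def N_def)
  also have "det N = det (submat I A)"
    by (rule det_column_axis_cong[of _ j]) (use j in \<open>auto simp: N_def M_def submat_def\<close>)
  finally show ?thesis unfolding M_def .
qed

text \<open>Solving the padded system for the negated column j gives the elimination vector; the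
  padding rows force the solution to vanish outside I, so that it works for A itself.\<close>

lemma submat_pivot_exists:
  fixes A :: "real^'p::finite^'p"
  assumes j: "j \<notin> I" and nz: "det (submat I A) \<noteq> 0"
  obtains v where "v $ j = 1" "\<And>a. a \<notin> insert j I \<Longrightarrow> v $ a = 0" "\<And>a. a \<in> I \<Longrightarrow> (A *v v) $ a = 0"
proof -
  obtain w where w: "submat I A *v w = (\<chi> a. if a \<in> I then - A $ a $ j else 0)"
    using nz cramer by blast
  have out: "(submat I A *v w) $ a = w $ a" if "a \<notin> I" for a
  proof -
    have "(submat I A *v w) $ a = (\<Sum>b\<in>UNIV. (if a = b then 1 else 0) * w $ b)"
      unfolding matrix_vector_mult_def submat_def using that by simp
    then show ?thesis by (simp add: if_distrib[of "\<lambda>x. x * _"] cong: if_cong)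
  qed
  have w0: "w $ a = 0" if "a \<notin> I" for a
    using out[OF that] that by (simp add: w)
  define v where "v = w + axis j 1"
  have "v $ j = 1" using w0 j by (simp add: v_def)
  moreover have "v $ a = 0" if "a \<notin> insert j I" for a
    using that w0 by (auto simp: v_def axis_def)
  moreover have "(A *v v) $ a = 0" if a: "a \<in> I" for a
  proof -
    have "(A *v w) $ a = (submat I A *v w) $ a"
      unfolding matrix_vector_mult_def submat_def using a w0 by (auto intro!: sum.cong)
    then have "(A *v w) $ a = - A $ a $ j" using a by (simp add: w)
    moreover have "(A *v axis j 1) $ a = A $ a $ j"
      by (simp add: matrix_vector_mult_basis column_def)
    ultimately show ?thesis by (simp add: v_def matrix_vector_right_distrib)
  qed
  ultimately show ?thesis using that by blast
qed

section \<open>Lipschitz images and surface charts\<close>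

lemma lmeasurable_cbox_borel: "cbox a b \<in> sets lborel"
  by simp

text \<open>Cover S by nonoverlapping cubes of almost the same total measure. A cube of side l in
  dimension n has diameter at most n l, so its image lies in a cube of side 2 L n l; T is a
  measurable piece of the image.\<close>

lemma lipschitz_image_emeasure:
  fixes g :: "'a::euclidean_space \<Rightarrow> 'a"
  assumes S: "S \<in> lmeasurable" "bounded S" and L: "0 \<le> L"
    and lip: "\<And>x y. x \<in> S \<Longrightarrow> y \<in> S \<Longrightarrow> norm (g x - g y) \<le> L * norm (x - y)"
    and T: "T \<in> sets lebesgue" "T \<subseteq> g ` S"
  shows "emeasure lebesgue T \<le> ennreal ((2 * L * DIM('a)) ^ DIM('a) * measure lebesgue S)"
proof -
  define n where "n = DIM('a)"
  define c where "c = (2 * L * n) ^ n"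
  have c0: "0 \<le> c" using L by (simp add: c_def)
  obtain a where a: "S \<subseteq> cbox (- a) a" using bounded_subset_cbox_symmetric[OF S(2)] by metis
  obtain r where r: "0 < r" "\<And>i. i \<in> Basis \<Longrightarrow> \<bar>a \<bullet> i\<bar> \<le> r"
  proof
    show "0 < norm a + 1" by (simp add: add_nonneg_pos)
    show "\<bar>a \<bullet> i\<bar> \<le> norm a + 1" if "i \<in> Basis" for i using Basis_le_norm[OF that, of a] by simp
  qed
  \<comment> \<open>The surrounding box is a cube, so that the boxes of its dyadic subdivision are
    cubes as well.\<close>
  define b where "b = (\<Sum>i\<in>Basis. r *\<^sub>R (i::'a))"
  have bi: "b \<bullet> i = r" if "i \<in> Basis" for i using that by (simp add: b_def)
  have Sb: "S \<subseteq> cbox (- b) b"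
    using a r(2) by (fastforce simp: mem_box bi abs_le_iff)
  have key: "emeasure lebesgue T \<le> ennreal (c * (measure lebesgue S + e))" if e: "e > 0" for e
  proof -
    obtain D where D: "countable D" "\<And>K. K \<in> D \<Longrightarrow> K \<subseteq> cbox (- b) b \<and> K \<noteq> {} \<and> (\<exists>c d. K = cbox c d)"
       "pairwise (\<lambda>A B. interior A \<inter> interior B = {}) D"
       "\<And>u v. cbox u v \<in> D \<Longrightarrow> \<exists>n. \<forall>i \<in> Basis. v \<bullet> i - u \<bullet> i = (b \<bullet> i - (- b) \<bullet> i) / 2 ^ n"
       "S \<subseteq> \<Union>D" "\<Union>D \<in> lmeasurable" "measure lebesgue (\<Union>D) \<le> measure lebesgue S + e"
      by (rule measurable_outer_intervals_bounded[OF S(1) Sb e]) blast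
    have cube: "\<exists>Q\<in>lmeasurable. g ` (K \<inter> S) \<subseteq> Q \<and> measure lebesgue Q \<le> c * measure lebesgue K" if K: "K \<in> D" for K
    proof (cases "K \<inter> S = {}")
      case True
      then show ?thesis using c0 by (intro bexI[of _ "{}"]) auto
    next
      case False
      then obtain x where x: "x \<in> K" "x \<in> S" by auto
      obtain u v where uv: "K = cbox u v" using D(2)[OF K] by auto
      obtain l where l: "\<And>i. i \<in> Basis \<Longrightarrow> v \<bullet> i - u \<bullet> i = l"
        using D(4)[of u v] K uv bi by (metis (no_types, lifting) inner_minus_left)
      have l0: "0 \<le> l" using l x(1) SOME_Basis by (fastforce simp: uv mem_box)
      define \<rho> where "\<rho> = L * (n * l)"
      define w where "w = (\<Sum>i\<in>Basis. \<rho> *\<^sub>R (i::'a))"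
      have wi: "w \<bullet> i = \<rho>" if "i \<in> Basis" for i using that by (simp add: w_def)
      have \<rho>0: "0 \<le> \<rho>" using L l0 by (simp add: \<rho>_def)
      have "g ` (K \<inter> S) \<subseteq> cbox (g x - w) (g x + w)"
      proof (clarify, simp add: mem_box, intro ballI)
        fix y and i :: 'a assume y: "y \<in> K" "y \<in> S" and i: "i \<in> Basis"
        have "norm (y - x) \<le> (\<Sum>i\<in>Basis. \<bar>(y - x) \<bullet> i\<bar>)" by (rule norm_le_l1)
        also have "\<dots> \<le> (\<Sum>i\<in>(Basis::'a set). l)"
        proof (rule sum_mono)
          fix i :: 'a assume i: "i \<in> Basis"
          then show "\<bar>(y - x) \<bullet> i\<bar> \<le> l" using x(1) y(1) l[OF i]
            by (auto simp: uv mem_box inner_diff_left abs_le_iff) (smt (verit))+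
        qed
        finally have "norm (y - x) \<le> n * l" by (simp add: n_def)
        then have "norm (g y - g x) \<le> \<rho>"
          using lip[OF y(2) x(2)] L unfolding \<rho>_def by (meson mult_left_mono order_trans)
        then have "\<bar>(g y - g x) \<bullet> i\<bar> \<le> \<rho>" using Basis_le_norm[OF i] order_trans by blast
        then show "(g x - w) \<bullet> i \<le> g y \<bullet> i \<and> g y \<bullet> i \<le> (g x + w) \<bullet> i"
          by (auto simp: inner_diff_left inner_add_left wi[OF i])
      qed
      moreover have "measure lebesgue (cbox (g x - w) (g x + w)) \<le> c * measure lebesgue K"
      proof -
        have "measure lebesgue (cbox (g x - w) (g x + w)) = (\<Prod>i\<in>(Basis::'a set). 2 * \<rho>)"
          using \<rho>0 unfolding measure_completion[OF lmeasurable_cbox_borel] by (subst content_cbox) (auto simp: wi inner_diff_left inner_add_left intro!: prod.cong)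
        moreover have "measure lebesgue K = (\<Prod>i\<in>(Basis::'a set). l)"
        proof -
          have "measure lborel (cbox u v) = (\<Prod>i\<in>Basis. v \<bullet> i - u \<bullet> i)"
          proof (rule content_cbox, rule ballI)
            fix i :: 'a assume "i \<in> Basis"
            then show "u \<bullet> i \<le> v \<bullet> i" using l[of i] l0 by linarith
          qed
          then show ?thesis unfolding uv measure_completion[OF lmeasurable_cbox_borel]
            by (simp add: l cong: prod.cong)
        qed
        ultimately show ?thesis by (simp add: c_def \<rho>_def n_def power_mult_distrib mult.assoc)
      qed
      ultimately show ?thesis by blast
    qed
    then obtain Q where Q: "\<And>K. K \<in> D \<Longrightarrow> Q K \<in> lmeasurable" "\<And>K. K \<in> D \<Longrightarrow> g ` (K \<inter> S) \<subseteq> Q K"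
       "\<And>K. K \<in> D \<Longrightarrow> measure lebesgue (Q K) \<le> c * measure lebesgue K" by metis
    have Dm: "K \<in> lmeasurable" if "K \<in> D" for K using D(2)[OF that] by auto
    have neg: "pairwise (\<lambda>A B. negligible (A \<inter> B)) D"
      unfolding pairwise_def
    proof (intro ballI impI)
      fix A B assume AB: "A \<in> D" "B \<in> D" "A \<noteq> B"
      have "interior (A \<inter> B) = {}" using D(3) AB by (simp add: pairwise_def)
      moreover have "convex (A \<inter> B)" using D(2) AB by (metis convex_Int convex_box(1))
      ultimately show "negligible (A \<inter> B)" by (simp add: negligible_convex_interior)
    qed
    have fin: "measure lebesgue (\<Union>K\<in>D'. Q K) \<le> c * (measure lebesgue S + e)"
      if D': "D' \<subseteq> D" "finite D'" for D'
    proof -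
      have "measure lebesgue (\<Union>K\<in>D'. Q K) \<le> (\<Sum>K\<in>D'. measure lebesgue (Q K))"
        using D' Q(1) by (intro measure_UNION_le) (auto dest: fmeasurableD)
      also have "\<dots> \<le> (\<Sum>K\<in>D'. c * measure lebesgue K)" using D' Q(3) by (intro sum_mono) auto
      also have "\<dots> = c * measure lebesgue (\<Union>D')"
        using D' Dm neg by (subst measure_negligible_finite_Union) (auto intro: pairwise_subset simp: sum_distrib_left)
      also have "\<dots> \<le> c * measure lebesgue (\<Union>D)"
        using D' D(6) c0 Dm by (intro mult_left_mono measure_mono_fmeasurable) (auto dest: fmeasurableD intro!: sets.finite_Union)
      also have "\<dots> \<le> c * (measure lebesgue S + e)" using c0 D(7) by (intro mult_left_mono) auto
      finally show ?thesis .
    qed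
    have U: "(\<Union>K\<in>D. Q K) \<in> lmeasurable" "measure lebesgue (\<Union>K\<in>D. Q K) \<le> c * (measure lebesgue S + e)"
      using fmeasurable_UN_bound[OF D(1) Q(1) fin] measure_UN_bound[OF D(1) Q(1) fin] by auto
    have "T \<subseteq> (\<Union>K\<in>D. Q K)"
    proof
      fix y assume "y \<in> T"
      then obtain x where x: "x \<in> S" "y = g x" using T(2) by auto
      then obtain K where "K \<in> D" "x \<in> K" using D(5) by auto
      then show "y \<in> (\<Union>K\<in>D. Q K)" using Q(2)[of K] x by auto
    qed
    then have "emeasure lebesgue T \<le> emeasure lebesgue (\<Union>K\<in>D. Q K)"
      using U(1) by (intro emeasure_mono) (auto dest: fmeasurableD)
    also have "\<dots> \<le> ennreal (c * (measure lebesgue S + e))"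
      using U by (simp add: emeasure_eq_measure2 ennreal_leI)
    finally show ?thesis .
  qed
  have "((\<lambda>e. ennreal (c * (measure lebesgue S + e))) \<longlongrightarrow> ennreal (c * (measure lebesgue S + 0))) (at_right 0)"
    by (intro tendsto_intros)
  then have "emeasure lebesgue T \<le> ennreal (c * (measure lebesgue S + 0))"
  proof (rule tendsto_lowerbound)
    show "\<forall>\<^sub>F e in at_right 0. emeasure lebesgue T \<le> ennreal (c * (measure lebesgue S + e))"
      using eventually_at_right_less[of "0::real"] by eventually_elim (rule key)
  qed simp
  then show ?thesis by (simp add: c_def n_def)
qed

text \<open>The estimate for sets says that Lebesgue measure on B is dominated by a multiple of the
  push-forward under g of Lebesgue measure on S; both measures are then integrated against f. This
  takes the place of the change of variables formula.\<close>

lemma nn_integral_lipschitz_image_le: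
  fixes g :: "'a::euclidean_space \<Rightarrow> 'a" and f :: "'a \<Rightarrow> ennreal"
  assumes S: "S \<in> sets borel" "bounded S" and L: "0 \<le> L"
    and lip: "\<And>x y. x \<in> S \<Longrightarrow> y \<in> S \<Longrightarrow> norm (g x - g y) \<le> L * norm (x - y)"
    and B: "B \<in> sets borel" "B \<subseteq> g ` S"
    and f: "f \<in> borel_measurable borel"
  shows "(\<integral>\<^sup>+x\<in>B. f x \<partial>lborel) \<le> ennreal ((2 * L * DIM('a)) ^ DIM('a)) * (\<integral>\<^sup>+x\<in>S. f (g x) \<partial>lborel)"
proof -
  define c where "c = (2 * L * DIM('a)) ^ DIM('a)"
  have c0: "0 \<le> c" using L by (simp add: c_def)
  have Sm: "S \<in> lmeasurable" using S by (intro bounded_set_imp_lmeasurable) auto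
  have "L-lipschitz_on S g" using lip L by (intro lipschitz_onI) (auto simp: dist_norm)
  then have cg: "continuous_on S g" by (rule lipschitz_on_continuous_on)
  \<comment> \<open>Extension by 0, to have a Borel map on the whole space for the
    push-forward.\<close>
  define G where "G x = (if x \<in> S then g x else 0)" for x
  have G [measurable]: "G \<in> borel_measurable borel"
    unfolding G_def using S(1) cg
    by (intro borel_measurable_continuous_on_if) (auto intro: continuous_on_const)
  have [measurable]: "S \<in> sets borel" "B \<in> sets borel" "f \<in> borel_measurable borel" using S B f by auto
  define \<mu> where "\<mu> = density lborel (indicator B)"
  define \<nu> where "\<nu> = scale_measure (ennreal c) (distr (density lborel (indicator S)) borel G)"
  have "emeasure \<mu> A \<le> emeasure \<nu> A" if A: "A \<in> sets borel" for A
  proof -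
    have [measurable]: "A \<in> sets borel" by fact
    have "emeasure \<mu> A = emeasure lborel (B \<inter> A)"
      unfolding \<mu>_def using A B(1) by (intro emeasure_restricted) auto
    also have "\<dots> = emeasure lebesgue (B \<inter> A)" by simp
    also have "\<dots> \<le> ennreal (c * measure lebesgue (S \<inter> G -` A))"
      unfolding c_def
    proof (rule lipschitz_image_emeasure[where g=g])
      have "S \<inter> G -` A \<in> sets borel" using measurable_sets_borel[OF G, of A] A by auto
      then show "S \<inter> G -` A \<in> lmeasurable" using S(2)
        by (intro bounded_set_imp_lmeasurable) (auto intro: bounded_subset)
      show "B \<inter> A \<subseteq> g ` (S \<inter> G -` A)" using B(2) by (auto simp: G_def)
    qed (use S(2) lip L in \<open>auto intro: bounded_subset\<close>)
    also have "\<dots> = ennreal c * emeasure lborel (S \<inter> G -` A)"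
    proof -
      have b: "S \<inter> G -` A \<in> sets borel" using measurable_sets_borel[OF G, of A] A by auto
      then have "S \<inter> G -` A \<in> lmeasurable" using S(2)
        by (intro bounded_set_imp_lmeasurable) (auto intro: bounded_subset)
      then have "emeasure lebesgue (S \<inter> G -` A) = ennreal (measure lebesgue (S \<inter> G -` A))"
        by (rule emeasure_eq_measure2)
      then show ?thesis using c0 b by (simp add: ennreal_mult)
    qed
    also have "\<dots> = emeasure \<nu> A"
    proof -
      have b: "G -` A \<in> sets borel" using measurable_sets_borel[OF G, of A] A by auto
      have "emeasure (distr (density lborel (indicator S)) borel G) A = emeasure lborel (S \<inter> G -` A)"
        using b S(1) A by (subst emeasure_distr) (auto simp: emeasure_restricted)
      then show ?thesis by (simp add: \<nu>_def)
    qed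
    finally show ?thesis .
  qed
  then have "\<mu> \<le> \<nu>"
    by (auto simp: le_measure_iff le_fun_def \<mu>_def \<nu>_def space_scale_measure)
       (metis emeasure_notin_sets le_zero_eq linorder_linear sets_density sets_lborel)
  then have "nn_integral \<mu> f \<le> nn_integral \<nu> f"
    by (intro nn_integral_mono_measure) (auto simp: \<mu>_def \<nu>_def)
  also have "nn_integral \<nu> f = ennreal c * (\<integral>\<^sup>+x\<in>S. f (G x) \<partial>lborel)"
    by (simp add: \<nu>_def nn_integral_scale_measure nn_integral_distr nn_integral_density mult.commute)
  also have "(\<integral>\<^sup>+x\<in>S. f (G x) \<partial>lborel) = (\<integral>\<^sup>+x\<in>S. f (g x) \<partial>lborel)"
    by (intro nn_integral_cong) (auto simp: G_def indicator_def)
  also have "nn_integral \<mu> f = (\<integral>\<^sup>+x\<in>B. f x \<partial>lborel)"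
    by (simp add: \<mu>_def nn_integral_density mult.commute)
  finally show ?thesis unfolding c_def .
qed

text \<open>With a left inverse A of the derivative at t0, the map A \<phi> - id has derivative at
  most 1/4 near t0, by continuity of the derivative. Hence t - s differs from A (\<phi> t - \<phi>
  s) by at most a quarter of its own length.\<close>

lemma surface_chart_lower_lipschitz:
  fixes \<phi> :: "real^'n::finite \<Rightarrow> 'a::euclidean_space"
  assumes ch: "surface_chart M V \<phi> \<phi>'" and t0: "t0 \<in> V"
  obtains R0 K where "0 < R0" "0 < K" "cball t0 R0 \<subseteq> V"
    "\<And>s t. s \<in> cball t0 R0 \<Longrightarrow> t \<in> cball t0 R0 \<Longrightarrow> norm (t - s) \<le> K * norm (\<phi> t - \<phi> s)"
    "\<And>s t. s \<in> cball t0 R0 \<Longrightarrow> t \<in> cball t0 R0 \<Longrightarrow> norm (\<phi> t - \<phi> s) \<le> K * norm (t - s)"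
proof -
  from ch have V: "open V" and der: "\<And>t. t \<in> V \<Longrightarrow> (\<phi> has_derivative blinfun_apply (\<phi>' t)) (at t)"
    and inj: "\<And>t. t \<in> V \<Longrightarrow> inj (blinfun_apply (\<phi>' t))" and c': "continuous_on V \<phi>'"
    unfolding surface_chart_def by auto
  obtain A where A: "linear A" "A \<circ> blinfun_apply (\<phi>' t0) = id"
    using linear_injective_left_inverse[OF bounded_linear.linear[OF blinfun.bounded_linear_right] inj[OF t0]] by blast
  then have bA: "bounded_linear A" by (simp add: linear_conv_bounded_linear)
  obtain KA where KA: "0 < KA" "\<And>x. norm (A x) \<le> norm x * KA"
    using bounded_linear.pos_bounded[OF bA] by auto
  have "0 < 1 / (4 * KA)" using KA by simp
  then obtain d where d: "d > 0" "\<And>t. t \<in> V \<Longrightarrow> dist t t0 < d \<Longrightarrow> dist (\<phi>' t) (\<phi>' t0) < 1 / (4 * KA)"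
    using c' t0 unfolding continuous_on_iff by metis
  obtain d2 where d2: "d2 > 0" "cball t0 d2 \<subseteq> V" using V t0 unfolding open_contains_cball by auto
  define R0 where "R0 = min d2 (d / 2)"
  have R0: "0 < R0" "R0 \<le> d2" "R0 < d" using d(1) d2(1) by (auto simp: R0_def)
  have R0V: "cball t0 R0 \<subseteq> V" by (rule order_trans[OF subset_cball[OF R0(2)] d2(2)])
  have inV: "t \<in> V" if "t \<in> cball t0 R0" for t using subsetD[OF R0V that] .
  have close: "norm (\<phi>' t - \<phi>' t0) \<le> 1 / (4 * KA)" if "t \<in> cball t0 R0" for t
  proof -
    have "dist t t0 < d" using that R0(3) by (simp add: dist_commute)
    moreover have "t \<in> V" using that R0V by (rule subsetD[rotated])
    ultimately show ?thesis using d(2)[of t] by (simp add: dist_norm)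
  qed
  define KP where "KP = norm (\<phi>' t0) + 1 / (4 * KA)"
  have upper: "norm (\<phi> t - \<phi> s) \<le> KP * norm (t - s)" if st: "s \<in> cball t0 R0" "t \<in> cball t0 R0" for s t
  proof (rule differentiable_bound[of "cball t0 R0" \<phi> "\<lambda>t. blinfun_apply (\<phi>' t)" KP t s])
    fix x assume x: "x \<in> cball t0 R0"
    then show "(\<phi> has_derivative blinfun_apply (\<phi>' x)) (at x within cball t0 R0)"
      by (rule has_derivative_at_withinI[OF der[OF inV]])
    have "onorm (blinfun_apply (\<phi>' x)) = norm (\<phi>' x)" by (rule norm_blinfun.rep_eq[symmetric])
    also have "\<dots> \<le> norm (\<phi>' t0) + norm (\<phi>' x - \<phi>' t0)" by (rule norm_triangle_sub)
    also have "\<dots> \<le> KP" using close[OF x] by (simp add: KP_def)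
    finally show "onorm (blinfun_apply (\<phi>' x)) \<le> KP" .
  qed (use st in auto)
  have near: "norm ((A (\<phi> t) - t) - (A (\<phi> s) - s)) \<le> (1/4) * norm (t - s)"
    if st: "s \<in> cball t0 R0" "t \<in> cball t0 R0" for s t
  proof (rule differentiable_bound[of "cball t0 R0" "\<lambda>t. A (\<phi> t) - t" "\<lambda>t h. A (blinfun_apply (\<phi>' t) h) - h" "1/4" t s])
    fix x assume x: "x \<in> cball t0 R0"
    then have "(\<phi> has_derivative blinfun_apply (\<phi>' x)) (at x within cball t0 R0)"
      by (rule has_derivative_at_withinI[OF der[OF inV]])
    then show "((\<lambda>t. A (\<phi> t) - t) has_derivative (\<lambda>h. A (blinfun_apply (\<phi>' x) h) - h)) (at x within cball t0 R0)"
      by (intro has_derivative_diff bounded_linear.has_derivative[OF bA] has_derivative_ident)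
    show "onorm (\<lambda>h. A (blinfun_apply (\<phi>' x) h) - h) \<le> 1/4"
    proof (rule onorm_le)
      fix h
      have "A (blinfun_apply (\<phi>' x) h) - h = A (blinfun_apply (\<phi>' x) h) - A (blinfun_apply (\<phi>' t0) h)"
        using A(2) by (metis comp_apply id_apply)
      also have "\<dots> = A (blinfun_apply (\<phi>' x - \<phi>' t0) h)"
        by (simp add: linear_diff[OF A(1)] blinfun.diff_left)
      finally have "norm (A (blinfun_apply (\<phi>' x) h) - h) \<le> norm (blinfun_apply (\<phi>' x - \<phi>' t0) h) * KA"
        using KA(2) by simp
      also have "\<dots> \<le> (norm (\<phi>' x - \<phi>' t0) * norm h) * KA"
        using KA(1) by (intro mult_right_mono norm_blinfun) auto
      also have "\<dots> \<le> (1 / (4 * KA) * norm h) * KA"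
        using KA(1) close[OF x] by (intro mult_right_mono) auto
      also have "\<dots> = 1/4 * norm h" using KA(1) by simp
      finally show "norm (A (blinfun_apply (\<phi>' x) h) - h) \<le> 1/4 * norm h" .
    qed
  qed (use st in auto)
  have lower: "norm (t - s) \<le> (4/3 * KA) * norm (\<phi> t - \<phi> s)" if st: "s \<in> cball t0 R0" "t \<in> cball t0 R0" for s t
  proof -
    have "t - s = A (\<phi> t - \<phi> s) - ((A (\<phi> t) - t) - (A (\<phi> s) - s))"
      by (simp add: linear_diff[OF A(1)])
    then have "norm (t - s) \<le> norm (A (\<phi> t - \<phi> s)) + norm ((A (\<phi> t) - t) - (A (\<phi> s) - s))"
      using norm_triangle_ineq4 by metis
    also have "\<dots> \<le> norm (\<phi> t - \<phi> s) * KA + 1/4 * norm (t - s)"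
      using KA(2) near[OF st] by (intro add_mono) auto
    finally show ?thesis by (simp add: field_simps)
  qed
  define K where "K = max (4/3 * KA) KP"
  have "0 < K" using KA by (simp add: K_def less_max_iff_disj)
  show thesis
  proof (rule that[of R0 K])
    fix s t assume st: "s \<in> cball t0 R0" "t \<in> cball t0 R0"
    show "norm (t - s) \<le> K * norm (\<phi> t - \<phi> s)"
      using lower[OF st] by (rule order_trans) (intro mult_right_mono, auto simp: K_def)
    show "norm (\<phi> t - \<phi> s) \<le> K * norm (t - s)"
      using upper[OF st] by (rule order_trans) (intro mult_right_mono, auto simp: K_def)
  qed (simp_all only: R0(1) R0V \<open>0 < K\<close>)
qed

text \<open>The image of a chart is relatively open and its inverse is continuous, so smaller
  parameter sets also have relatively open images. Points of M near \<open>\<phi> t\<close> can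
  therefore be pulled back.\<close>

lemma surface_chart_open_image:
  assumes ch: "surface_chart M V \<phi> \<phi>'" and U: "open U" "U \<subseteq> V" "t \<in> U"
  obtains \<epsilon> where "0 < \<epsilon>" "M \<inter> ball (\<phi> t) \<epsilon> \<subseteq> \<phi> ` U"
proof -
  from ch have V: "inj_on \<phi> V" "openin (top_of_set M) (\<phi> ` V)"
    "continuous_on (\<phi> ` V) (inv_into V \<phi>)" unfolding surface_chart_def by auto
  have "\<phi> ` U = \<phi> ` V \<inter> inv_into V \<phi> -` U"
    using U(2) V(1) by (auto simp: inv_into_f_f subset_iff image_iff)
  then have "openin (top_of_set (\<phi> ` V)) (\<phi> ` U)"
    using continuous_openin_preimage_gen[OF V(3) U(1)] by simp
  then have "openin (top_of_set M) (\<phi> ` U)" using V(2) openin_trans by blast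
  then obtain \<epsilon> where "0 < \<epsilon>" "ball (\<phi> t) \<epsilon> \<inter> M \<subseteq> \<phi> ` U"
    using U(3) unfolding openin_contains_ball by blast
  then show thesis using that by (simp add: Int_commute)
qed

text \<open>Surjectivity of the transported map onto the smaller ball is Brouwer's theorem.\<close>

lemma surface_chart_pullback:
  fixes \<phi> :: "real^'n::finite \<Rightarrow> 'a::euclidean_space"
  assumes ch: "surface_chart M V \<phi> \<phi>'" and t0: "t0 \<in> V"
  obtains R K where "0 < R" "0 < K" "cball t0 (2 * R) \<subseteq> V"
    "\<And>\<rho>. \<lbrakk>0 < \<rho>; \<rho> \<le> R\<rbrakk> \<Longrightarrow> \<exists>\<delta>>0. \<forall>\<theta> L F. 0 \<le> L \<longrightarrow>
        (\<forall>s\<in>cball t0 (2 * \<rho>). \<theta> (\<phi> s) \<in> M \<and> norm (\<theta> (\<phi> s) - \<phi> s) \<le> \<delta>) \<longrightarrow>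
        (\<forall>s\<in>cball t0 (2 * \<rho>). \<forall>t\<in>cball t0 (2 * \<rho>). norm (\<theta> (\<phi> s) - \<theta> (\<phi> t)) \<le> L * norm (\<phi> s - \<phi> t)) \<longrightarrow>
        F \<in> borel_measurable borel \<longrightarrow>
        (\<integral>\<^sup>+t\<in>ball t0 \<rho>. F (\<phi> t) \<partial>lborel)
          \<le> ennreal ((K * L) ^ CARD('n)) * (\<integral>\<^sup>+s\<in>ball t0 (2 * \<rho>). F (\<theta> (\<phi> s)) \<partial>lborel)"
proof -
  from ch have V: "open V" "inj_on \<phi> V" and der: "\<And>t. t \<in> V \<Longrightarrow> (\<phi> has_derivative blinfun_apply (\<phi>' t)) (at t)"
    unfolding surface_chart_def by auto
  have c\<phi>: "continuous_on V \<phi>"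
    using der by (meson continuous_at_imp_continuous_on has_derivative_continuous)
  obtain R0 K where R0: "0 < R0" "0 < K" "cball t0 R0 \<subseteq> V"
    and lo: "\<And>s t. s \<in> cball t0 R0 \<Longrightarrow> t \<in> cball t0 R0 \<Longrightarrow> norm (t - s) \<le> K * norm (\<phi> t - \<phi> s)"
    and up: "\<And>s t. s \<in> cball t0 R0 \<Longrightarrow> t \<in> cball t0 R0 \<Longrightarrow> norm (\<phi> t - \<phi> s) \<le> K * norm (t - s)"
    using surface_chart_lower_lipschitz[OF ch t0] by metis
  have BV: "ball t0 R0 \<subseteq> V" by (rule order_trans[OF ball_subset_cball R0(3)])
  obtain \<epsilon> where \<epsilon>: "0 < \<epsilon>" "M \<inter> ball (\<phi> t0) \<epsilon> \<subseteq> \<phi> ` ball t0 R0"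
    using surface_chart_open_image[OF ch open_ball BV, of t0] R0(1) by auto
  \<comment> \<open>The first bound keeps doubled balls where the chart is bi-Lipschitz. The second
    keeps their images within \<epsilon>/4 of \<open>\<phi> t0\<close>, so that a further
    displacement of at most \<epsilon>/4 stays in the image of the chart.\<close>
  define R where "R = min (R0 / 2) (\<epsilon> / (8 * K))"
  have R: "0 < R" using R0 \<epsilon> by (simp add: R_def)
  have R2: "2 * R \<le> R0" "K * (2 * R) \<le> \<epsilon> / 4"
    using R0 by (auto simp: R_def min_def field_simps)
  define K' where "K' = 2 * (K * K) * real CARD('n)"
  show thesis
  proof (rule that[of R K'])
    show "0 < R" by fact
    show "0 < K'" using R0 by (simp add: K'_def)
    show "cball t0 (2 * R) \<subseteq> V" by (rule order_trans[OF subset_cball[OF R2(1)] R0(3)])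
    fix \<rho> assume \<rho>: "0 < \<rho>" "\<rho> \<le> R"
    define \<delta> where "\<delta> = min (\<epsilon> / 4) (\<rho> / (2 * K))"
    have \<delta>: "0 < \<delta>" "\<delta> \<le> \<epsilon> / 4" "K * \<delta> \<le> \<rho> / 2"
      using \<epsilon> \<rho> R0 by (auto simp: \<delta>_def min_def field_simps)
    have sub: "cball t0 (2 * \<rho>) \<subseteq> cball t0 R0" using \<rho> R2 by (intro subset_cball) auto
    show "\<exists>\<delta>>0. \<forall>\<theta> L F. 0 \<le> L \<longrightarrow>
        (\<forall>s\<in>cball t0 (2 * \<rho>). \<theta> (\<phi> s) \<in> M \<and> norm (\<theta> (\<phi> s) - \<phi> s) \<le> \<delta>) \<longrightarrow>
        (\<forall>s\<in>cball t0 (2 * \<rho>). \<forall>t\<in>cball t0 (2 * \<rho>). norm (\<theta> (\<phi> s) - \<theta> (\<phi> t)) \<le> L * norm (\<phi> s - \<phi> t)) \<longrightarrow>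
        F \<in> borel_measurable borel \<longrightarrow>
        (\<integral>\<^sup>+t\<in>ball t0 \<rho>. F (\<phi> t) \<partial>lborel)
          \<le> ennreal ((K' * L) ^ CARD('n)) * (\<integral>\<^sup>+s\<in>ball t0 (2 * \<rho>). F (\<theta> (\<phi> s)) \<partial>lborel)"
    proof (intro exI[of _ \<delta>] conjI \<delta>(1) allI impI)
      fix \<theta> :: "'a \<Rightarrow> 'a" and L :: real and F :: "'a \<Rightarrow> ennreal"
      assume L: "0 \<le> L"
        and \<theta>: "\<forall>s\<in>cball t0 (2 * \<rho>). \<theta> (\<phi> s) \<in> M \<and> norm (\<theta> (\<phi> s) - \<phi> s) \<le> \<delta>"
        and lip: "\<forall>s\<in>cball t0 (2 * \<rho>). \<forall>t\<in>cball t0 (2 * \<rho>). norm (\<theta> (\<phi> s) - \<theta> (\<phi> t)) \<le> L * norm (\<phi> s - \<phi> t)"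
        and F: "F \<in> borel_measurable borel"
      \<comment> \<open>The self-map read in the chart. It will be Lipschitz with constant K L K and
        within \<rho>/2 of the identity.\<close>
      define g where "g s = inv_into V \<phi> (\<theta> (\<phi> s))" for s
      have g: "g s \<in> ball t0 R0 \<and> \<phi> (g s) = \<theta> (\<phi> s)" if s: "s \<in> cball t0 (2 * \<rho>)" for s
      proof -
        have "norm (\<phi> s - \<phi> t0) \<le> K * norm (s - t0)" using up[of t0 s] s sub R0(1) by auto
        also have "\<dots> \<le> K * (2 * R)" using s \<rho> R0(2) by (intro mult_left_mono) (auto simp: dist_norm norm_minus_commute)
        also have "\<dots> \<le> \<epsilon> / 4" by (rule R2)
        finally have "norm (\<phi> s - \<phi> t0) \<le> \<epsilon> / 4" .
        moreover have "norm (\<theta> (\<phi> s) - \<phi> s) \<le> \<epsilon> / 4" using \<theta> s \<delta>(2) by fastforce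
        ultimately have "norm (\<theta> (\<phi> s) - \<phi> t0) \<le> \<epsilon> / 4 + \<epsilon> / 4"
          using norm_triangle_ineq[of "\<theta> (\<phi> s) - \<phi> s" "\<phi> s - \<phi> t0"] by simp
        then have "\<theta> (\<phi> s) \<in> M \<inter> ball (\<phi> t0) \<epsilon>" using \<theta> s \<epsilon>(1)
          by (auto simp: dist_norm norm_minus_commute)
        then obtain x where x: "x \<in> ball t0 R0" "\<theta> (\<phi> s) = \<phi> x" using \<epsilon>(2) by auto
        then have "g s = x" using V(2) BV by (auto simp: g_def inv_into_f_f)
        then show ?thesis using x by simp
      qed
      have glip: "norm (g s - g t) \<le> (K * L * K) * norm (s - t)"
        if st: "s \<in> cball t0 (2 * \<rho>)" "t \<in> cball t0 (2 * \<rho>)" for s t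
      proof -
        have "norm (g s - g t) \<le> K * norm (\<phi> (g s) - \<phi> (g t))"
          using g[OF st(1)] g[OF st(2)] by (intro lo) auto
        also have "\<dots> = K * norm (\<theta> (\<phi> s) - \<theta> (\<phi> t))" using g st by simp
        also have "\<dots> \<le> K * (L * norm (\<phi> s - \<phi> t))" using lip st R0(2) by (intro mult_left_mono) auto
        also have "\<dots> \<le> K * (L * (K * norm (s - t)))"
          using up[OF subsetD[OF sub st(2)] subsetD[OF sub st(1)]] R0(2) L by (intro mult_left_mono) auto
        finally show ?thesis by (simp add: mult.assoc)
      qed
      have gclose: "norm (g s - s) \<le> \<rho> / 2" if s: "s \<in> cball t0 (2 * \<rho>)" for s
      proof -
        have "norm (g s - s) \<le> K * norm (\<phi> (g s) - \<phi> s)"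
          using g[OF s] s sub by (intro lo) auto
        also have "\<dots> \<le> K * \<delta>" using g[OF s] \<theta> s R0(2) by (intro mult_left_mono) auto
        finally show ?thesis using \<delta>(3) by linarith
      qed
      have cg: "continuous_on (cball t0 (2 * \<rho>)) g"
        by (rule lipschitz_on_continuous_on[of "K * L * K"], rule lipschitz_onI)
           (use glip R0 L in \<open>auto simp: dist_norm\<close>)
      have surj: "ball t0 \<rho> \<subseteq> g ` ball t0 (2 * \<rho>)"
      proof
        fix x assume x: "x \<in> ball t0 \<rho>"
        \<comment> \<open>The map z -> x + (z - g z) sends the ball of radius 3/2 \<rho> into
          itself, since |x - t0| < \<rho> and |g z - z| <= \<rho>/2; a fixed point of it solves g z
          = x.\<close>
        have "\<exists>y\<in>cball t0 (3/2 * \<rho>). g y = x"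
        proof (rule brouwer_surjective_cball[of _ _ _ x "{x}"])
          show "continuous_on (cball t0 (3/2 * \<rho>)) g" using cg \<rho> by (auto elim: continuous_on_subset)
          fix y z assume "y \<in> {x}" and z: "z \<in> cball t0 (3/2 * \<rho>)"
          then have y: "y = x" by simp
          have "norm (g z - z) \<le> \<rho> / 2" using z \<rho> by (intro gclose) auto
          moreover have "norm (t0 - x) < \<rho>" using x by (simp add: dist_norm)
          ultimately have "norm ((t0 - x) + (g z - z)) \<le> 3/2 * \<rho>"
            using norm_triangle_ineq[of "t0 - x" "g z - z"] by linarith
          then show "y + (z - g z) \<in> cball t0 (3/2 * \<rho>)" by (simp add: y dist_norm algebra_simps)
        qed (use \<rho> in auto)
        then obtain y where y: "y \<in> cball t0 (3/2 * \<rho>)" "g y = x" by auto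
        then have "y \<in> ball t0 (2 * \<rho>)" using \<rho> by auto
        then show "x \<in> g ` ball t0 (2 * \<rho>)" using y by auto
      qed
      define f where "f t = (if t \<in> ball t0 R0 then F (\<phi> t) else 0)" for t
      have f: "f \<in> borel_measurable borel"
      proof -
        define p where "p t = (if t \<in> ball t0 R0 then \<phi> t else 0)" for t
        have p: "p \<in> borel_measurable borel"
          unfolding p_def using BV c\<phi>
          by (intro borel_measurable_continuous_on_if) (auto intro: continuous_on_subset)
        have "f = (\<lambda>t. if t \<in> ball t0 R0 then F (p t) else 0)" by (auto simp: f_def p_def)
        moreover have "(\<lambda>t. if t \<in> ball t0 R0 then F (p t) else 0) \<in> borel_measurable borel"
          using measurable_compose[OF p F] by (intro measurable_If_set) auto
        ultimately show ?thesis by simp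
      qed
      have "(\<integral>\<^sup>+t\<in>ball t0 \<rho>. F (\<phi> t) \<partial>lborel) = (\<integral>\<^sup>+t\<in>ball t0 \<rho>. f t \<partial>lborel)"
        using \<rho> R2 by (intro nn_integral_cong) (auto simp: f_def indicator_def)
      also have "\<dots> \<le> ennreal ((2 * (K * L * K) * DIM(real^'n)) ^ DIM(real^'n)) * (\<integral>\<^sup>+s\<in>ball t0 (2 * \<rho>). f (g s) \<partial>lborel)"
        by (rule nn_integral_lipschitz_image_le) (use glip surj f R0 L in auto)
      also have "(\<integral>\<^sup>+s\<in>ball t0 (2 * \<rho>). f (g s) \<partial>lborel) = (\<integral>\<^sup>+s\<in>ball t0 (2 * \<rho>). F (\<theta> (\<phi> s)) \<partial>lborel)"
        using g by (intro nn_integral_cong) (auto simp: f_def indicator_def)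
      also have "(2 * (K * L * K) * DIM(real^'n)) ^ DIM(real^'n) = (K' * L) ^ CARD('n)"
        by (simp add: K'_def mult_ac)
      finally show "(\<integral>\<^sup>+t\<in>ball t0 \<rho>. F (\<phi> t) \<partial>lborel)
          \<le> ennreal ((K' * L) ^ CARD('n)) * (\<integral>\<^sup>+s\<in>ball t0 (2 * \<rho>). F (\<theta> (\<phi> s)) \<partial>lborel)" .
    qed
  qed
qed

section \<open>Point evaluations and finite differences\<close>

text \<open>A list of weighted points is a finite combination of point evaluations. Lists allow
  repetitions and are easily concatenated and scaled.\<close>

definition ev :: "(real \<times> 'a) list \<Rightarrow> ('a \<Rightarrow> real) \<Rightarrow> real" where
  "ev L f = (\<Sum>(c, x)\<leftarrow>L. c * f x)"

text \<open>The inner product of two combinations of kernel functions, once K is a reproducing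
  kernel.\<close>

definition ev2 :: "(real \<times> 'a) list \<Rightarrow> (real \<times> 'a) list \<Rightarrow> ('a \<Rightarrow> 'a \<Rightarrow> real) \<Rightarrow> real" where
  "ev2 L L' K = ev L (\<lambda>x. ev L' (K x))"

lemma ev_simps [simp]:
  "ev [] f = 0" "ev ((c, x) # L) f = c * f x + ev L f" "ev (L @ L') f = ev L f + ev L' f"
  by (simp_all add: ev_def)

definition scale_list :: "real \<Rightarrow> (real \<times> 'a) list \<Rightarrow> (real \<times> 'a) list" where
  "scale_list a L = map (\<lambda>(c, x). (a * c, x)) L"

lemma ev_scale [simp]: "ev (scale_list a L) f = a * ev L f"
  by (induction L) (auto simp: scale_list_def algebra_simps)

lemma snd_scale [simp]: "snd ` set (scale_list a L) = snd ` set L"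
  by (force simp: scale_list_def)

lemma ev_concat: "ev (concat (map g is)) f = (\<Sum>i\<leftarrow>is. ev (g i) f)"
  by (induction "is") auto

lemma ev_linear: "ev L (\<lambda>z. a * f z + b * g z) = a * ev L f + b * ev L g"
  by (induction L) (auto simp: algebra_simps)

lemma ev_add: "ev L (\<lambda>z. f z + g z) = ev L f + ev L g"
  by (induction L) (auto simp: algebra_simps)

lemma ev_cmult: "ev L (\<lambda>z. a * f z) = a * ev L f"
  by (induction L) (auto simp: algebra_simps)

lemma ev_sum_list: "ev L (\<lambda>z. \<Sum>i\<leftarrow>is. f i z) = (\<Sum>i\<leftarrow>is. ev L (f i))"
proof (induction "is")
  case Nil
  show ?case by (induction L) auto
qed (simp add: ev_add)

lemma ev_nth: "ev L f = (\<Sum>i<length L. fst (L ! i) * f (snd (L ! i)))"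
  unfolding ev_def by (simp add: sum_list_sum_nth case_prod_beta atLeast0LessThan)

lemma ev2_scale_concat:
  "ev2 (concat (map (\<lambda>i. scale_list (a i) (L i)) is)) (concat (map (\<lambda>i. scale_list (a i) (L i)) is)) K
    = (\<Sum>i\<leftarrow>is. \<Sum>j\<leftarrow>is. a i * a j * ev2 (L j) (L i) K)"
  unfolding ev2_def ev_concat ev_scale ev_sum_list ev_cmult
  by (simp add: sum_list_const_mult[symmetric] mult.assoc)

section \<open>Point evaluations against the norm of a reproducing kernel space\<close>

lemma rkhs_norm_nonneg:
  assumes "in_rkhs K X f" shows "0 \<le> rkhs_norm K X f"
proof -
  \<comment> \<open>The empty combination, n = 0, has value 0.\<close>
  have "0 \<in> rkhs_vals K X f"
    unfolding rkhs_vals_def by (rule CollectI, rule exI[of _ 0]) auto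
  then show ?thesis
    using assms unfolding in_rkhs_def rkhs_norm_def by (intro cSup_upper) auto
qed

text \<open>Division by \<open>sqrt M\<close> brings the combination into the unit ball over which
  the norm is a supremum. Allowing any positive upper bound M avoids a separate case for a vanishing
  quadratic form.\<close>

lemma rkhs_ev_le:
  assumes f: "in_rkhs K X f" and L: "snd ` set L \<subseteq> X" and M: "ev2 L L K \<le> M" "0 < M"
  shows "\<bar>ev L f\<bar> \<le> rkhs_norm K X f * sqrt M"
proof -
  define L' where "L' = scale_list (1 / sqrt M) L"
  have q: "ev2 L' L' K = ev2 L L K / M"
    using M(2) unfolding ev2_def L'_def ev_scale ev_cmult by simp
  have "\<bar>ev L' f\<bar> \<in> rkhs_vals K X f"
    unfolding rkhs_vals_def
  proof (rule CollectI, intro exI conjI)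
    show "\<bar>ev L' f\<bar> = \<bar>\<Sum>i<length L'. (\<lambda>i. fst (L' ! i)) i * f ((\<lambda>i. snd (L' ! i)) i)\<bar>"
      by (simp add: ev_nth)
    have "snd ` set L' \<subseteq> X" using L by (simp add: L'_def)
    then show "\<forall>i<length L'. (\<lambda>i. snd (L' ! i)) i \<in> X"
      by (metis image_subset_iff nth_mem)
    have "(\<Sum>i<length L'. \<Sum>j<length L'. fst (L' ! i) * fst (L' ! j) * K (snd (L' ! i)) (snd (L' ! j))) = ev2 L' L' K"
      by (simp add: ev2_def ev_nth sum_distrib_left mult.assoc)
    also have "\<dots> \<le> 1" using q M by simp
    finally show "(\<Sum>i<length L'. \<Sum>j<length L'. (\<lambda>i. fst (L' ! i)) i * (\<lambda>i. fst (L' ! i)) j *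
        K ((\<lambda>i. snd (L' ! i)) i) ((\<lambda>i. snd (L' ! i)) j)) \<le> 1" by simp
  qed
  then have "\<bar>ev L' f\<bar> \<le> rkhs_norm K X f"
    using f unfolding in_rkhs_def rkhs_norm_def by (intro cSup_upper) auto
  moreover have "\<bar>ev L' f\<bar> = \<bar>ev L f\<bar> / sqrt M" using M(2) by (simp add: L'_def abs_mult)
  ultimately show ?thesis using M(2) by (simp add: divide_simps)
qed

text \<open>The difference f x - f y is at most the norm of f times the kernel distance of x and y,
  whose square K x x - K x y - K y x + K y y is continuous in y and vanishes at y = x.\<close>

lemma rkhs_continuous_on:
  fixes X :: "'a::metric_space set"
  assumes f: "in_rkhs K X f" and K: "continuous_on (X \<times> X) (\<lambda>(x, y). K x y)"
  shows "continuous_on X f"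
  unfolding continuous_on_iff
proof (intro ballI allI impI)
  fix x and e :: real assume x: "x \<in> X" and e: "0 < e"
  define N where "N = rkhs_norm K X f + 1"
  have N: "N > 0" using rkhs_norm_nonneg[OF f] by (simp add: N_def)
  define q where "q y = ev2 [(1, x), (-1, y)] [(1, x), (-1, y)] K" for y
  have q: "q y = K x x - K x y - K y x + K y y" for y
    by (simp add: q_def ev2_def)
  have c: "continuous_on X (\<lambda>y. K (g y) (h y))"
    if "continuous_on X g" "continuous_on X h" "g ` X \<subseteq> X" "h ` X \<subseteq> X" for g h
    using continuous_on_compose2[OF K continuous_on_Pair[OF that(1,2)]] that(3,4) by auto
  have "continuous_on X q"
    unfolding q by (intro continuous_intros c) (use x in auto)
  moreover have "q x = 0" by (simp add: q)
  ultimately obtain d where d: "d > 0" "\<And>y. y \<in> X \<Longrightarrow> dist y x < d \<Longrightarrow> \<bar>q y\<bar> < (e / (2 * N))\<^sup>2"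
    using x e N unfolding continuous_on_iff dist_real_def
    by (metis diff_zero divide_pos_pos mult_pos_pos zero_less_numeral zero_less_power)
  show "\<exists>d>0. \<forall>x'\<in>X. dist x' x < d \<longrightarrow> dist (f x') (f x) < e"
  proof (intro exI[of _ d] conjI ballI impI d(1))
    fix y assume y: "y \<in> X" "dist y x < d"
    have "\<bar>ev [(1, x), (-1, y)] f\<bar> \<le> rkhs_norm K X f * sqrt ((e / (2 * N))\<^sup>2)"
      by (rule rkhs_ev_le[OF f]) (use x y d(2)[OF y] e N in \<open>auto simp: q_def\<close>)
    then have "\<bar>f x - f y\<bar> \<le> rkhs_norm K X f * (e / (2 * N))"
      using e N by (simp add: real_sqrt_abs)
    also have "\<dots> \<le> N * (e / (2 * N))"
      using e N by (intro mult_right_mono) (auto simp: N_def)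
    also have "\<dots> < e" using e N by (simp add: field_simps)
    finally show "dist (f y) (f x) < e" by (simp add: dist_real_def abs_minus_commute)
  qed
qed

section \<open>Iterated differences, iterated directional derivatives and the mean value
  theorem\<close>

fun fdlist :: "'a::ab_group_add list \<Rightarrow> 'a \<Rightarrow> (real \<times> 'a) list" where
  "fdlist [] x = [(1, x)]"
| "fdlist (w # ws) x = fdlist ws (x + w) @ scale_list (-1) (fdlist ws x)"

fun fdiff :: "'a::ab_group_add list \<Rightarrow> ('a \<Rightarrow> real) \<Rightarrow> 'a \<Rightarrow> real" where
  "fdiff [] F x = F x"
| "fdiff (w # ws) F x = fdiff ws F (x + w) - fdiff ws F x"

lemma ev_fdlist: "ev (fdlist ws x) f = fdiff ws f x"
  by (induction ws arbitrary: x) auto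

text \<open>The pairing of two difference functionals is a single iterated difference of the kernel
  on the product space, so that one mean value theorem treats both variables together.\<close>

lemma ev2_fdlist:
  "ev2 (fdlist ws x) (fdlist ws' y) K
    = fdiff (map (\<lambda>w. (w, 0)) ws @ map (\<lambda>w. (0, w)) ws') (\<lambda>(x, y). K x y) (x, y)"
proof (induction ws arbitrary: x)
  case Nil
  show ?case
    by (induction ws' arbitrary: y) (simp_all add: ev2_def)
next
  case (Cons w ws)
  then show ?case by (simp add: ev2_def)
qed

text \<open>The parallelepiped spanned by the steps. Shifted to the base point it contains all
  points visited by the iterated difference and all intermediate points of the mean value
  theorem.\<close>

fun sbox :: "'a::real_vector list \<Rightarrow> 'a set" where
  "sbox [] = {0}"
| "sbox (w # ws) = (\<lambda>(t, v). t *\<^sub>R w + v) ` ({0..1} \<times> sbox ws)"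

lemma sbox_ConsI: "t \<in> {0..1} \<Longrightarrow> v \<in> sbox ws \<Longrightarrow> t *\<^sub>R w + v \<in> sbox (w # ws)"
  by force

lemma set_fdlist: "p \<in> set (fdlist ws x) \<Longrightarrow> \<exists>v\<in>sbox ws. snd p = x + v"
proof (induction ws arbitrary: x p)
  case (Cons w ws)
  have "p \<in> set (fdlist ws (x + w)) \<or> (\<exists>p'\<in>set (fdlist ws x). snd p' = snd p)"
    using Cons.prems by (force simp: scale_list_def)
  then have "(\<exists>v\<in>sbox ws. snd p = x + w + v) \<or> (\<exists>v\<in>sbox ws. snd p = x + v)"
    using Cons.IH by metis
  then show ?case
  proof
    assume "\<exists>v\<in>sbox ws. snd p = x + w + v"
    then obtain v where "v \<in> sbox ws" "snd p = x + (1 *\<^sub>R w + v)" by (auto simp: add.assoc)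
    then show ?thesis using sbox_ConsI[of 1 v ws w] by auto
  next
    assume "\<exists>v\<in>sbox ws. snd p = x + v"
    then obtain v where "v \<in> sbox ws" "snd p = x + (0 *\<^sub>R w + v)" by auto
    then show ?thesis using sbox_ConsI[of 0 v ws w] by auto
  qed
qed simp

text \<open>A relation rather than a function, because the intermediate derivatives are prescribed
  only on S. The head of the list is the direction differentiated first.\<close>

fun iter_deriv :: "'a::real_normed_vector set \<Rightarrow> 'a list \<Rightarrow> ('a \<Rightarrow> real) \<Rightarrow> ('a \<Rightarrow> real) \<Rightarrow> bool" where
  "iter_deriv S [] F G \<longleftrightarrow> G = F"
| "iter_deriv S (w # ws) F G \<longleftrightarrow>
    (\<exists>F'. (\<forall>x\<in>S. ((\<lambda>t. F (x + t *\<^sub>R w)) has_real_derivative F' x) (at 0)) \<and> iter_deriv S ws F' G)"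

lemma iter_deriv_append:
  "iter_deriv S ws F G \<Longrightarrow> iter_deriv S ws' G H \<Longrightarrow> iter_deriv S (ws @ ws') F H"
  by (induction ws arbitrary: F) auto

lemma iter_deriv_cmult: "iter_deriv S ws F G \<Longrightarrow> iter_deriv S ws (\<lambda>x. c * F x) (\<lambda>x. c * G x)"
proof (induction ws arbitrary: F)
  case (Cons w ws)
  then obtain F' where F': "\<forall>x\<in>S. ((\<lambda>t. F (x + t *\<^sub>R w)) has_real_derivative F' x) (at 0)"
      "iter_deriv S ws F' G"
    by auto
  then show ?case using Cons.IH
    by (auto intro!: exI[of _ "\<lambda>x. c * F' x"] DERIV_cmult)
qed simp

lemma iter_deriv_scale:
  assumes S: "open S"
  shows "iter_deriv S (map snd cws) F G \<Longrightarrow>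
    iter_deriv S (map (\<lambda>(c, w). c *\<^sub>R w) cws) F (\<lambda>x. prod_list (map fst cws) * G x)"
proof (induction cws arbitrary: F)
  case (Cons cw cws)
  obtain c w where cw: "cw = (c, w)" by force
  obtain F' where F': "\<forall>x\<in>S. ((\<lambda>t. F (x + t *\<^sub>R w)) has_real_derivative F' x) (at 0)"
      "iter_deriv S (map snd cws) F' G"
    using Cons.prems by (auto simp: cw)
  have "((\<lambda>t. F (x + t *\<^sub>R (c *\<^sub>R w))) has_real_derivative c * F' x) (at 0)" if "x \<in> S" for x
  proof -
    have "((\<lambda>t. F (x + t *\<^sub>R w)) has_real_derivative F' x) (at (0 * c))" using F' that by simp
    then have "((\<lambda>t. F (x + (t * c) *\<^sub>R w)) has_real_derivative F' x * c) (at 0)"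
      by (rule DERIV_chain2) (auto intro!: derivative_eq_intros)
    then show ?thesis by (simp add: mult.commute)
  qed
  moreover have "iter_deriv S (map (\<lambda>(c, w). c *\<^sub>R w) cws) (\<lambda>x. c * F' x) (\<lambda>x. c * (prod_list (map fst cws) * G x))"
    by (rule iter_deriv_cmult[OF Cons.IH[OF F'(2)]])
  ultimately have "iter_deriv S ((c *\<^sub>R w) # map (\<lambda>(c, w). c *\<^sub>R w) cws) F
      (\<lambda>x. c * (prod_list (map fst cws) * G x))"
    unfolding iter_deriv.simps by (intro exI[of _ "\<lambda>x. c * F' x"]) blast
  then show ?case by (simp add: cw mult.assoc)
qed simp

lemma has_derivative_fdiff:
  assumes "\<And>v. v \<in> sbox ws \<Longrightarrow> ((\<lambda>t. F (x + v + t *\<^sub>R w)) has_real_derivative F' (x + v)) (at 0)"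
  shows "((\<lambda>t. fdiff ws F (x + t *\<^sub>R w)) has_real_derivative fdiff ws F' x) (at 0)"
  using assms
proof (induction ws arbitrary: x)
  case (Cons u ws)
  have *: "((\<lambda>t. fdiff ws F (x + s *\<^sub>R u + t *\<^sub>R w)) has_real_derivative fdiff ws F' (x + s *\<^sub>R u)) (at 0)"
    if "s \<in> {0, 1}" for s :: real
  proof (rule Cons.IH)
    fix v assume v: "v \<in> sbox ws"
    have "s *\<^sub>R u + v \<in> sbox (u # ws)" using v that by force
    from Cons.prems[OF this] show "((\<lambda>t. F (x + s *\<^sub>R u + v + t *\<^sub>R w)) has_real_derivative F' (x + s *\<^sub>R u + v)) (at 0)"
      by (simp add: add.assoc)
  qed
  from DERIV_diff[OF *[of 1] *[of 0]] show ?case by (simp add: add.commute add.left_commute add.assoc)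
qed auto

text \<open>Induction on the steps: the one-dimensional mean value theorem is applied in the first
  direction to the difference over the remaining steps, whose derivative is, by
  \<open>has_derivative_fdiff\<close>, the same difference of the derivative.\<close>

lemma fdiff_mvt:
  assumes "iter_deriv S ws F G" "\<And>v. v \<in> sbox ws \<Longrightarrow> x + v \<in> S"
  shows "\<exists>v\<in>sbox ws. fdiff ws F x = G (x + v)"
  using assms
proof (induction ws arbitrary: F x)
  case (Cons w ws)
  obtain F' where F': "\<And>x. x\<in>S \<Longrightarrow> ((\<lambda>t. F (x + t *\<^sub>R w)) has_real_derivative F' x) (at 0)"
      "iter_deriv S ws F' G"
    using Cons.prems by auto
  define g where "g t = fdiff ws F (x + t *\<^sub>R w)" for t
  have inS: "x + t *\<^sub>R w + v \<in> S" if "t \<in> {0..1}" "v \<in> sbox ws" for t v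
    using Cons.prems(2)[of "t *\<^sub>R w + v"] that by (force simp: add.assoc)
  have g: "(g has_real_derivative fdiff ws F' (x + t *\<^sub>R w)) (at t)" if t: "t \<in> {0..1}" for t
  proof -
    have "((\<lambda>s. fdiff ws F (x + t *\<^sub>R w + s *\<^sub>R w)) has_real_derivative fdiff ws F' (x + t *\<^sub>R w)) (at 0)"
      by (rule has_derivative_fdiff) (use F'(1) inS[OF t] in auto)
    then have "((\<lambda>s. g (s + t)) has_real_derivative fdiff ws F' (x + t *\<^sub>R w)) (at 0)"
      by (simp add: g_def algebra_simps)
    then show ?thesis using DERIV_shift[of g _ 0 t] by simp
  qed
  obtain t where t: "0 < t" "t < 1" "g 1 - g 0 = (1 - 0) * fdiff ws F' (x + t *\<^sub>R w)"
    using MVT2[of 0 1 g "\<lambda>t. fdiff ws F' (x + t *\<^sub>R w)"] g by auto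
  obtain v where v: "v \<in> sbox ws" "fdiff ws F' (x + t *\<^sub>R w) = G (x + t *\<^sub>R w + v)"
    using Cons.IH[OF F'(2), of "x + t *\<^sub>R w"] inS[of t] t by auto
  show ?case
  proof
    show "t *\<^sub>R w + v \<in> sbox (w # ws)" using t v by force
    show "fdiff (w # ws) F x = G (x + (t *\<^sub>R w + v))" using t v by (simp add: g_def add.assoc)
  qed
qed auto

section \<open>Power series\<close>

text \<open>An enumeration of the multi-indices turns the unordered sums of
  \<open>real_analytic_on\<close> into ordinary series, to which termwise differentiation
  applies.\<close>

lemma has_sum_countable_sums:
  fixes f :: "'i::countable \<Rightarrow> real"
  assumes inf: "infinite (UNIV :: 'i set)"
  shows "(f has_sum s) UNIV \<Longrightarrow> (\<lambda>n. f (from_nat_into UNIV n)) sums s"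
proof -
  assume h: "(f has_sum s) UNIV"
  have bij: "bij_betw (from_nat_into (UNIV::'i set)) UNIV UNIV"
    using inf by (intro bij_betw_from_nat_into) auto
  have "((f \<circ> from_nat_into UNIV) has_sum s) UNIV"
    using has_sum_reindex[of "from_nat_into (UNIV::'i set)" UNIV f s] bij h
    by (auto simp: bij_betw_def)
  then show ?thesis using has_sum_imp_sums by (auto simp: o_def)
qed

lemma sums_has_sum_from_nat:
  fixes f :: "'i::countable \<Rightarrow> real"
  assumes inf: "infinite (UNIV :: 'i set)" and ab: "(\<lambda>x. norm (f x)) summable_on UNIV"
    and s: "(\<lambda>n. f (from_nat_into UNIV n)) sums s"
  shows "(f has_sum s) UNIV"
proof -
  have "f summable_on UNIV" using ab by (rule abs_summable_summable)
  then obtain s' where s': "(f has_sum s') UNIV" by (auto simp: summable_on_def)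
  then have "s' = s" using has_sum_countable_sums[OF inf s'] s sums_unique2 by blast
  with s' show ?thesis by simp
qed

lemma monomial_plus_unit:
  fixes y :: "real^'q::finite^'p::finite"
  shows "monomial (y + t *\<^sub>R unit_mat i j) \<nu>
    = (y $ i $ j + t) ^ \<nu> i j * (\<Prod>(a, b)\<in>UNIV - {(i, j)}. (y $ a $ b) ^ \<nu> a b)"
proof -
  have "monomial (y + t *\<^sub>R unit_mat i j) \<nu> = (\<Prod>(a, b)\<in>UNIV. ((y + t *\<^sub>R unit_mat i j) $ a $ b) ^ \<nu> a b)"
    unfolding monomial_def by (simp add: prod.cartesian_product UNIV_Times_UNIV[symmetric] del: UNIV_Times_UNIV)
  also have "\<dots> = ((y + t *\<^sub>R unit_mat i j) $ i $ j) ^ \<nu> i j * (\<Prod>(a, b)\<in>UNIV - {(i, j)}. ((y + t *\<^sub>R unit_mat i j) $ a $ b) ^ \<nu> a b)"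
    by (subst prod.remove[of _ "(i, j)"]) auto
  also have "(\<Prod>(a, b)\<in>UNIV - {(i, j)}. ((y + t *\<^sub>R unit_mat i j) $ a $ b) ^ \<nu> a b) = (\<Prod>(a, b)\<in>UNIV - {(i, j)}. (y $ a $ b) ^ \<nu> a b)"
    by (rule prod.cong[OF refl]) (auto simp: unit_mat_def split: if_splits)
  finally show ?thesis by (simp add: unit_mat_def)
qed

definition bump :: "'p \<Rightarrow> 'q \<Rightarrow> ('p \<Rightarrow> 'q \<Rightarrow> nat) \<Rightarrow> 'p \<Rightarrow> 'q \<Rightarrow> nat" where
  "bump i j \<nu> = (\<lambda>a b. if a = i \<and> b = j then Suc (\<nu> a b) else \<nu> a b)"

definition unbump :: "'p \<Rightarrow> 'q \<Rightarrow> ('p \<Rightarrow> 'q \<Rightarrow> nat) \<Rightarrow> 'p \<Rightarrow> 'q \<Rightarrow> nat" where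
  "unbump i j \<nu> = (\<lambda>a b. if a = i \<and> b = j then \<nu> a b - 1 else \<nu> a b)"

lemma monomial_deriv:
  fixes y :: "real^'q::finite^'p::finite"
  shows "((\<lambda>t. monomial (y + t *\<^sub>R unit_mat i j) \<nu>) has_real_derivative
     real (\<nu> i j) * monomial (y + t *\<^sub>R unit_mat i j) (unbump i j \<nu>)) (at t)"
proof -
  have *: "(\<Prod>(a, b)\<in>UNIV - {(i, j)}. (y $ a $ b) ^ unbump i j \<nu> a b) = (\<Prod>(a, b)\<in>UNIV - {(i, j)}. (y $ a $ b) ^ \<nu> a b)"
    by (rule prod.cong[OF refl]) (auto simp: unbump_def split: if_splits)
  show ?thesis
    unfolding monomial_plus_unit * by (auto intro!: derivative_eq_intros simp: unbump_def)
qed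

definition const_mat :: "real \<Rightarrow> real^'q::finite^'p::finite" where
  "const_mat \<rho> = (\<chi> i j. \<rho>)"

lemma norm_const_mat:
  fixes \<rho> :: real
  shows "norm (const_mat \<rho> :: real^'q::finite^'p::finite) \<le> CARD('p) * CARD('q) * \<bar>\<rho>\<bar>"
proof -
  have "norm (const_mat \<rho> :: real^'q^'p) \<le> (\<Sum>i\<in>UNIV. norm ((const_mat \<rho> :: real^'q^'p) $ i))"
    unfolding norm_vec_def by (rule L2_set_le_sum) auto
  also have "\<dots> \<le> (\<Sum>i\<in>(UNIV::'p set). \<Sum>j\<in>(UNIV::'q set). \<bar>\<rho>\<bar>)"
    by (intro sum_mono order_trans[OF norm_le_l1_cart]) (simp add: const_mat_def)
  finally show ?thesis by (simp add: mult.assoc)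
qed

lemma monomial_abs_le:
  assumes "\<And>i j. \<bar>y $ i $ j\<bar> \<le> \<rho>" "0 \<le> \<rho>"
  shows "\<bar>monomial y \<nu>\<bar> \<le> monomial (const_mat \<rho>) \<nu>"
  unfolding monomial_def abs_prod power_abs const_mat_def
  using assms by (auto intro!: prod_mono prod_nonneg power_mono)

text \<open>Since n + 1 <= 2^(n+1), halving the radius absorbs the factor produced by
  differentiating a power.\<close>

lemma monomial_unbump_half:
  fixes i :: "'p::finite" and j :: "'q::finite"
  assumes \<rho>: "0 < \<rho>"
  shows "real (\<nu> i j) * monomial (const_mat (\<rho>/2) :: real^'q^'p) (unbump i j \<nu>) \<le> (2 / \<rho>) * monomial (const_mat \<rho> :: real^'q^'p) \<nu>"
proof (cases "\<nu> i j")
  case 0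
  then show ?thesis using \<rho> by (auto simp: monomial_def const_mat_def intro!: prod_nonneg divide_nonneg_pos)
next
  case (Suc n)
  have e: "monomial (const_mat r :: real^'q^'p) \<mu> = r ^ \<mu> i j * (\<Prod>(a, b)\<in>UNIV - {(i, j)}. r ^ \<mu> a b)" for r \<mu>
    using monomial_plus_unit[of "const_mat r" 0 i j \<mu>] by (simp add: const_mat_def)
  have u: "(\<Prod>(a, b)\<in>UNIV - {(i, j)}. (\<rho>/2) ^ unbump i j \<nu> a b) = (\<Prod>(a, b)\<in>UNIV - {(i, j)}. (\<rho>/2) ^ \<nu> a b)"
    by (rule prod.cong[OF refl]) (auto simp: unbump_def split: if_splits)
  have P: "0 \<le> (\<Prod>(a, b)\<in>UNIV - {(i, j)}. (\<rho>/2) ^ \<nu> a b)" "(\<Prod>(a, b)\<in>UNIV - {(i, j)}. (\<rho>/2) ^ \<nu> a b) \<le> (\<Prod>(a, b)\<in>UNIV - {(i, j)}. \<rho> ^ \<nu> a b)"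
    using \<rho> by (auto intro!: prod_nonneg prod_mono power_mono)
  have n: "real (Suc n) * (\<rho>/2) ^ n \<le> (2 / \<rho>) * \<rho> ^ Suc n"
  proof -
    have "real (Suc n) \<le> 2 ^ Suc n" using of_nat_less_two_power[of "Suc n", where 'a=real] by linarith
    then have "real (Suc n) * (\<rho> ^ n / 2 ^ n) \<le> 2 ^ Suc n * (\<rho> ^ n / 2 ^ n)"
      using \<rho> by (intro mult_right_mono) auto
    then show ?thesis using \<rho> by (simp add: power_divide)
  qed
  have "real (\<nu> i j) * monomial (const_mat (\<rho>/2) :: real^'q^'p) (unbump i j \<nu>) = (real (Suc n) * (\<rho>/2) ^ n) * (\<Prod>(a, b)\<in>UNIV - {(i, j)}. (\<rho>/2) ^ \<nu> a b)"
    unfolding e u using Suc by (simp add: unbump_def)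
  also have "\<dots> \<le> ((2 / \<rho>) * \<rho> ^ Suc n) * (\<Prod>(a, b)\<in>UNIV - {(i, j)}. \<rho> ^ \<nu> a b)"
    by (rule mult_mono[OF n P(2)]) (use P(1) \<rho> in auto)
  also have "\<dots> = (2 / \<rho>) * monomial (const_mat \<rho> :: real^'q^'p) \<nu>" unfolding e using Suc by simp
  finally show ?thesis .
qed

text \<open>Unordered convergence of a real sum is absolute, so convergence at the one matrix with
  all entries \<rho> dominates the series where all entries are at most \<rho>, and the
  differentiated series where they are at most \<rho>/2. Both converge uniformly there.\<close>

lemma power_series_partial:
  fixes c :: "('p::finite \<Rightarrow> 'q::finite \<Rightarrow> nat) \<Rightarrow> real" and g :: "real^'q^'p \<Rightarrow> real"
  assumes e: "0 < e" and g: "\<And>y. norm y < e \<Longrightarrow> ((\<lambda>\<nu>. c \<nu> * monomial y \<nu>) has_sum g y) UNIV"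
  obtains e' where "0 < e'" "e' \<le> e"
    "continuous_on (ball 0 e') g"
    "\<And>y. norm y < e' \<Longrightarrow> ((\<lambda>t. g (y + t *\<^sub>R unit_mat i j)) has_real_derivative partial i j g y) (at 0)"
    "\<And>y. norm y < e' \<Longrightarrow> ((\<lambda>\<nu>. (real (Suc (\<nu> i j)) * c (bump i j \<nu>)) * monomial y \<nu>) has_sum partial i j g y) UNIV"
proof -
  have inf: "infinite (UNIV :: ('p \<Rightarrow> 'q \<Rightarrow> nat) set)"
  proof
    assume "finite (UNIV :: ('p \<Rightarrow> 'q \<Rightarrow> nat) set)"
    then have "finite (range (\<lambda>n::nat. (\<lambda>(_::'p) (_::'q). n)))" by (rule finite_subset[rotated]) auto
    moreover have "inj (\<lambda>n::nat. (\<lambda>(_::'p) (_::'q). n))" by (auto simp: inj_def fun_eq_iff)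
    ultimately show False using finite_imageD infinite_UNIV_nat by blast
  qed
  \<comment> \<open>The matrix with all entries \<rho> has norm at most e/2, hence lies strictly
    inside the ball of convergence.\<close>
  define \<rho> where "\<rho> = e / (2 * CARD('p) * CARD('q))"
  have \<rho>: "0 < \<rho>" using e by (simp add: \<rho>_def)
  have "norm (const_mat \<rho> :: real^'q^'p) \<le> CARD('p) * CARD('q) * \<rho>" using norm_const_mat[of \<rho>] \<rho> by simp
  also have "\<dots> < e" using e by (simp add: \<rho>_def)
  finally have n\<rho>: "norm (const_mat \<rho> :: real^'q^'p) < e" .
  define M where "M \<nu> = \<bar>c \<nu>\<bar> * monomial (const_mat \<rho> :: real^'q^'p) \<nu>" for \<nu>
  have mon0: "0 \<le> monomial (const_mat r :: real^'q^'p) \<nu>" if "0 \<le> r" for r \<nu>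
    using that by (auto simp: monomial_def const_mat_def intro!: prod_nonneg)
  have "(\<lambda>\<nu>. c \<nu> * monomial (const_mat \<rho> :: real^'q^'p) \<nu>) summable_on UNIV"
    using g[OF n\<rho>] by (auto simp: summable_on_def)
  then have "(\<lambda>\<nu>. norm (c \<nu> * monomial (const_mat \<rho> :: real^'q^'p) \<nu>)) summable_on UNIV"
    by (rule summable_on_iff_abs_summable_on_real[THEN iffD1])
  then have Msum: "M summable_on UNIV" unfolding M_def using mon0 \<rho> by (simp add: abs_mult)
  have M0: "0 \<le> M \<nu>" for \<nu> using mon0 \<rho> by (simp add: M_def)
  let ?N = "from_nat_into (UNIV :: ('p \<Rightarrow> 'q \<Rightarrow> nat) set)"
  obtain sM where "(M has_sum sM) UNIV" using Msum by (auto simp: summable_on_def)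
  then have MN: "summable (\<lambda>n. M (?N n))" using has_sum_countable_sums[OF inf] sums_summable by blast
  define e' where "e' = min (e/2) (\<rho>/2)"
  have e': "0 < e'" "e' \<le> e" "e' < e" "e' \<le> \<rho>/2" using e \<rho> by (auto simp: e'_def)
  define d where "d \<nu> y = c \<nu> * (real (\<nu> i j) * monomial y (unbump i j \<nu>))" for \<nu> and y :: "real^'q^'p"
  have comp: "\<bar>y $ a $ b\<bar> \<le> \<rho>/2" if "norm y < e'" for y :: "real^'q^'p" and a b
    using that Finite_Cartesian_Product.norm_nth_le[of y a] component_le_norm_cart[of "y $ a" b] e'(4) by linarith
  have d_le: "norm (d \<nu> y) \<le> (2/\<rho>) * M \<nu>" if y: "norm y < e'" for \<nu> y
  proof -
    have "\<bar>monomial y (unbump i j \<nu>)\<bar> \<le> monomial (const_mat (\<rho>/2) :: real^'q^'p) (unbump i j \<nu>)"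
      using comp[OF y] \<rho> by (intro monomial_abs_le) auto
    then have "norm (d \<nu> y) \<le> \<bar>c \<nu>\<bar> * (real (\<nu> i j) * monomial (const_mat (\<rho>/2) :: real^'q^'p) (unbump i j \<nu>))"
      by (auto simp: d_def abs_mult intro!: mult_left_mono)
    also have "\<dots> \<le> \<bar>c \<nu>\<bar> * ((2 / \<rho>) * monomial (const_mat \<rho> :: real^'q^'p) \<nu>)"
      using monomial_unbump_half[OF \<rho>, of \<nu> i j] by (intro mult_left_mono) auto
    finally show ?thesis by (simp add: M_def mult_ac)
  qed
  have g_le: "norm (c \<nu> * monomial y \<nu>) \<le> M \<nu>" if y: "norm y < e'" for \<nu> y
  proof -
    have "\<bar>y $ a $ b\<bar> \<le> \<rho>" for a b using comp[OF y, of a b] \<rho> by linarith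
    then show ?thesis
      unfolding M_def real_norm_def abs_mult using \<rho> by (intro mult_left_mono monomial_abs_le) auto
  qed
  have gs: "(\<lambda>n. c (?N n) * monomial y (?N n)) sums g y" if "norm y < e'" for y
    by (rule has_sum_countable_sums[OF inf g[OF less_le_trans[OF that e'(2)]]])
  have cont: "continuous_on (ball 0 e') g"
  proof -
    have "uniform_limit (ball 0 e') (\<lambda>n y. \<Sum>k<n. c (?N k) * monomial y (?N k)) (\<lambda>y. \<Sum>k. c (?N k) * monomial y (?N k)) sequentially"
      by (rule Weierstrass_m_test[OF _ MN]) (use g_le in auto)
    then have "continuous_on (ball 0 e') (\<lambda>y. \<Sum>k. c (?N k) * monomial y (?N k))"
      by (rule uniform_limit_theorem[rotated])
         (auto simp: monomial_def intro!: always_eventually continuous_intros)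
    then show ?thesis
      by (rule continuous_on_eq) (use gs in \<open>auto simp: sums_iff\<close>)
  qed
  have der: "((\<lambda>t. g (y + t *\<^sub>R unit_mat i j)) has_real_derivative (\<Sum>n. d (?N n) y)) (at 0)"
    if y: "norm y < e'" for y
  proof -
    have "open ((\<lambda>t. norm (y + t *\<^sub>R unit_mat i j)) -` {..<e'})"
      by (intro open_vimage) (auto intro!: continuous_intros)
    moreover have "(0::real) \<in> ((\<lambda>t. norm (y + t *\<^sub>R unit_mat i j)) -` {..<e'})" using y by simp
    ultimately obtain r where r: "r > 0" "ball 0 r \<subseteq> ((\<lambda>t. norm (y + t *\<^sub>R unit_mat i j)) -` {..<e'})"
      using open_contains_ball by blast
    then have in_e: "norm (y + t *\<^sub>R unit_mat i j) < e'" if "t \<in> ball 0 r" for t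
      using subsetD[OF r(2) that] by simp
    have "((\<lambda>t. \<Sum>n. c (?N n) * monomial (y + t *\<^sub>R unit_mat i j) (?N n)) has_field_derivative (\<Sum>n. d (?N n) (y + 0 *\<^sub>R unit_mat i j))) (at 0)"
    proof (rule has_field_derivative_series'(2))
      show "convex (ball (0::real) r)" by simp
      show "((\<lambda>t. c (?N n) * monomial (y + t *\<^sub>R unit_mat i j) (?N n)) has_field_derivative d (?N n) (y + t *\<^sub>R unit_mat i j)) (at t within ball 0 r)"
        for n t unfolding d_def by (rule DERIV_cmult[OF has_field_derivative_at_within[OF monomial_deriv]])
      have "uniform_limit (ball 0 r) (\<lambda>n t. \<Sum>k<n. d (?N k) (y + t *\<^sub>R unit_mat i j)) (\<lambda>t. \<Sum>k. d (?N k) (y + t *\<^sub>R unit_mat i j)) sequentially"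
        by (rule Weierstrass_m_test[OF _ summable_mult[OF MN, of "2/\<rho>"]]) (use d_le in_e in auto)
      then show "uniformly_convergent_on (ball 0 r) (\<lambda>n t. \<Sum>k<n. d (?N k) (y + t *\<^sub>R unit_mat i j))"
        unfolding uniformly_convergent_on_def by blast
      show "(0::real) \<in> ball 0 r" "(0::real) \<in> interior (ball 0 r)" using r by auto
      show "summable (\<lambda>n. c (?N n) * monomial (y + 0 *\<^sub>R unit_mat i j) (?N n))"
        using gs[OF y] by (simp add: sums_iff)
    qed
    then have "((\<lambda>t. \<Sum>n. c (?N n) * monomial (y + t *\<^sub>R unit_mat i j) (?N n)) has_field_derivative (\<Sum>n. d (?N n) y)) (at 0)" by simp
    then show ?thesis
      by (rule has_field_derivative_transform_within[OF _ r(1)])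
         (use gs in_e r in \<open>auto simp: sums_iff dist_commute\<close>)
  qed
  have part: "partial i j g y = (\<Sum>n. d (?N n) y)" if "norm y < e'" for y
    unfolding partial_def by (rule DERIV_imp_deriv[OF der[OF that]])
  have hs: "((\<lambda>\<nu>. (real (Suc (\<nu> i j)) * c (bump i j \<nu>)) * monomial y \<nu>) has_sum partial i j g y) UNIV"
    if y: "norm y < e'" for y
  proof -
    have "(\<lambda>\<nu>. (2/\<rho>) * M \<nu>) summable_on UNIV" using Msum by (rule summable_on_cmult_right)
    then have ds: "(\<lambda>\<nu>. norm (d \<nu> y)) summable_on UNIV"
      by (rule Infinite_Sum.abs_summable_on_comparison_test') (use d_le[OF y] in auto)
    have "summable (\<lambda>n. d (?N n) y)"
      by (rule summable_comparison_test'[OF summable_mult[OF MN, of "2/\<rho>"]]) (use d_le[OF y] in auto)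
    then have "(\<lambda>n. d (?N n) y) sums partial i j g y" using part[OF y] by (simp add: summable_sums)
    then have "((\<lambda>\<nu>. d \<nu> y) has_sum partial i j g y) UNIV" by (rule sums_has_sum_from_nat[OF inf ds])
    \<comment> \<open>Terms whose exponent at (i, j) is 0 have derivative 0; the other exponents are
      exactly the values of \<open>bump i j\<close>, which allows reindexing.\<close>
    then have "((\<lambda>\<nu>. d \<nu> y) has_sum partial i j g y) (range (bump i j))"
    proof (rule has_sum_cong_neutral[THEN iffD1, rotated -1])
      fix \<nu> assume "\<nu> \<in> UNIV - range (bump i j)"
      then have "\<nu> \<noteq> bump i j (unbump i j \<nu>)" by blast
      then have "\<nu> i j = 0" by (auto simp: bump_def unbump_def fun_eq_iff split: if_splits)
      then show "d \<nu> y = 0" by (simp add: d_def)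
    qed auto
    moreover have "inj (bump i j)" by (auto simp: inj_def bump_def fun_eq_iff split: if_splits)
    ultimately have "((\<lambda>\<nu>. d (bump i j \<nu>) y) has_sum partial i j g y) UNIV"
      by (simp add: has_sum_reindex o_def)
    moreover have "d (bump i j \<nu>) y = (real (Suc (\<nu> i j)) * c (bump i j \<nu>)) * monomial y \<nu>" for \<nu>
    proof -
      have "unbump i j (bump i j \<nu>) = \<nu>" by (auto simp: bump_def unbump_def fun_eq_iff)
      then show ?thesis by (simp add: d_def bump_def)
    qed
    ultimately show ?thesis by simp
  qed
  show thesis
    by (rule that[of e']) (use e' cont der part hs in auto)
qed

lemma real_analytic_partial:
  fixes f :: "real^'q::finite^'p::finite \<Rightarrow> real"
  assumes f: "real_analytic_on f U"
  shows "\<And>x. x \<in> U \<Longrightarrow> isCont f x"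
    and "\<And>x. x \<in> U \<Longrightarrow> ((\<lambda>t. f (x + t *\<^sub>R unit_mat i j)) has_real_derivative partial i j f x) (at 0)"
    and "real_analytic_on (partial i j f) U"
proof -
  have main: "isCont f a \<and> ((\<lambda>t. f (a + t *\<^sub>R unit_mat i j)) has_real_derivative partial i j f a) (at 0)
     \<and> (\<exists>e>0. \<exists>c. \<forall>x\<in>ball a e. ((\<lambda>\<nu>. c \<nu> * monomial (x - a) \<nu>) has_sum partial i j f x) UNIV)"
    if a: "a \<in> U" for a
  proof -
    obtain e c where e: "e > 0" "\<And>x. x \<in> ball a e \<Longrightarrow> ((\<lambda>\<nu>. c \<nu> * monomial (x - a) \<nu>) has_sum f x) UNIV"
      using f a unfolding real_analytic_on_def by metis
    define g where "g y = f (a + y)" for y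
    have g: "((\<lambda>\<nu>. c \<nu> * monomial y \<nu>) has_sum g y) UNIV" if "norm y < e" for y
      using e(2)[of "a + y"] that by (simp add: g_def dist_norm)
    obtain e' where e': "0 < e'" "e' \<le> e" "continuous_on (ball 0 e') g"
      "\<And>y. norm y < e' \<Longrightarrow> ((\<lambda>t. g (y + t *\<^sub>R unit_mat i j)) has_real_derivative partial i j g y) (at 0)"
      "\<And>y. norm y < e' \<Longrightarrow> ((\<lambda>\<nu>. (real (Suc (\<nu> i j)) * c (bump i j \<nu>)) * monomial y \<nu>) has_sum partial i j g y) UNIV"
      by (rule power_series_partial[OF e(1) g, of i j]) auto
    have pg: "partial i j g y = partial i j f (a + y)" for y by (simp add: partial_def g_def add.assoc)
    have "isCont g 0" using e'(1,3) by (simp add: continuous_on_eq_continuous_at)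
    then have "isCont g (a - a)" by simp
    then have "isCont (\<lambda>x. g (x - a)) a"
      by (rule isCont_o2[rotated]) (intro continuous_intros)
    then have "isCont f a" by (simp add: g_def)
    moreover have "((\<lambda>t. f (a + t *\<^sub>R unit_mat i j)) has_real_derivative partial i j f a) (at 0)"
      using e'(4)[of 0] e'(1) pg[of 0] by (simp add: g_def)
    moreover have "((\<lambda>\<nu>. (real (Suc (\<nu> i j)) * c (bump i j \<nu>)) * monomial (x - a) \<nu>) has_sum partial i j f x) UNIV"
      if "x \<in> ball a e'" for x
      using e'(5)[of "x - a"] that pg[of "x - a"] by (simp add: dist_norm norm_minus_commute)
    ultimately show ?thesis using e'(1)
      by (intro conjI exI[of _ e'] exI[of _ "\<lambda>\<nu>. real (Suc (\<nu> i j)) * c (bump i j \<nu>)"]) auto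
  qed
  show "isCont f x" if "x \<in> U" for x using main[OF that] by simp
  show "((\<lambda>t. f (x + t *\<^sub>R unit_mat i j)) has_real_derivative partial i j f x) (at 0)" if "x \<in> U" for x
    using main[OF that] by simp
  show "real_analytic_on (partial i j f) U" unfolding real_analytic_on_def using main by simp
qed

lemma real_analytic_pderivs:
  assumes "real_analytic_on f U" shows "real_analytic_on (pderivs ds f) U"
proof (induction ds)
  case (Cons d ds)
  then show ?case by (cases d) (simp add: real_analytic_partial(3))
qed (use assms in simp)

text \<open>\<open>pderivs\<close> applies the head of its list last, \<open>iter_deriv\<close>
  first; this is the reason for the reversal.\<close>

lemma iter_deriv_pderivs:
  assumes f: "real_analytic_on f U" and S: "S \<subseteq> U"
  shows "iter_deriv S (map (\<lambda>(i, j). unit_mat i j) (rev ds)) f (pderivs ds f)"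
proof (induction ds)
  case (Cons d ds)
  obtain i j where d: "d = (i, j)" by force
  have "iter_deriv S [unit_mat i j] (pderivs ds f) (partial i j (pderivs ds f))"
    using real_analytic_partial(2)[OF real_analytic_pderivs[OF f]] S by auto
  then show ?case using iter_deriv_append[OF Cons] by (simp add: d)
qed simp

section \<open>Transversal directions and averaging of a pivot\<close>

lemma vmult_diff_norm_le: "\<exists>K>0. \<forall>(x :: real^'p::finite) (A :: real^'q::finite^'p). norm (x v* A) \<le> norm x * norm A * K"
  using bounded_bilinear.pos_bounded[OF bounded_bilinear_vector_matrix] by blast

text \<open>On the unit sphere of the complement of \<open>fixspace z0\<close> the form attached to
  z0 is positive by the equality case of contractivity, hence at least 2 \<kappa> by compactness;
  half of this survives a small change of z0. The complement is that of the fixed z0, while z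
  varies.\<close>

lemma fixspace_gap:
  fixes z0 :: "real^'q::finite^'p::finite"
  assumes z0: "z0 \<in> mat_cball"
  obtains \<epsilon> \<kappa> where "0 < \<epsilon>" "0 < \<kappa>" "\<kappa> \<le> 1"
    "\<And>z e. z \<in> mat_cball \<Longrightarrow> norm (z - z0) < \<epsilon> \<Longrightarrow> (\<And>k. k \<in> fixspace z0 \<Longrightarrow> e \<bullet> k = 0) \<Longrightarrow>
        \<kappa> * (e \<bullet> e) \<le> e \<bullet> e - (e v* z) \<bullet> (e v* z)"
proof -
  define E where "E = {e :: real^'p. norm e = 1 \<and> (\<forall>k\<in>fixspace z0. e \<bullet> k = 0)}"
  have "E = sphere 0 1 \<inter> (\<Inter>k\<in>fixspace z0. {e. e \<bullet> k = 0})" by (auto simp: E_def)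
  moreover have "closed (\<Inter>k\<in>fixspace z0. {e :: real^'p. e \<bullet> k = 0})"
    by (intro closed_INT ballI closed_Collect_eq continuous_intros)
  ultimately have cE: "compact E" using compact_sphere compact_Int_closed by metis
  have "\<exists>\<kappa>. 0 < \<kappa> \<and> \<kappa> \<le> 1 \<and> (\<forall>e\<in>E. 2 * \<kappa> \<le> e \<bullet> e - (e v* z0) \<bullet> (e v* z0))"
  proof (cases "E = {}")
    case True
    then show ?thesis by (intro exI[of _ 1]) auto
  next
    case False
    have lin: "linear (\<lambda>e. e v* z0)" by (rule linearI) (simp_all add: vector_matrix_left_distrib vmult_scale)
    have "continuous_on E (\<lambda>e. e \<bullet> e - (e v* z0) \<bullet> (e v* z0))"
      by (intro continuous_intros linear_continuous_on lin[unfolded linear_conv_bounded_linear])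
    then obtain e0 where e0: "e0 \<in> E" "\<And>e. e \<in> E \<Longrightarrow> e0 \<bullet> e0 - (e0 v* z0) \<bullet> (e0 v* z0) \<le> e \<bullet> e - (e v* z0) \<bullet> (e v* z0)"
      using continuous_attains_inf[OF cE False] by blast
    have n0: "e0 \<bullet> e0 = 1" using e0(1) by (simp add: E_def norm_eq_1)
    have "norm (e0 v* z0) \<noteq> norm e0"
    proof
      assume "norm (e0 v* z0) = norm e0"
      then have "e0 \<in> fixspace z0" using fixspace_iff_norm[OF z0] by blast
      then have "e0 \<bullet> e0 = 0" using e0(1) by (simp add: E_def)
      then show False using n0 by simp
    qed
    then have "norm (e0 v* z0) < norm e0" using z0 unfolding mat_cball_iff by (simp add: order_less_le)
    then have pos: "0 < e0 \<bullet> e0 - (e0 v* z0) \<bullet> (e0 v* z0)" by (simp add: norm_lt)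
    show ?thesis
    proof (intro exI conjI ballI)
      let ?l = "(e0 \<bullet> e0 - (e0 v* z0) \<bullet> (e0 v* z0)) / 2"
      show "0 < ?l" using pos by simp
      show "?l \<le> 1" using n0 order_trans[OF _ inner_ge_zero[of "e0 v* z0"], of "-1"] by simp
      show "2 * ?l \<le> e \<bullet> e - (e v* z0) \<bullet> (e v* z0)" if "e \<in> E" for e using e0(2)[OF that] by simp
    qed
  qed
  then obtain \<kappa> where \<kappa>: "0 < \<kappa>" "\<kappa> \<le> 1" "\<And>e. e \<in> E \<Longrightarrow> 2 * \<kappa> \<le> e \<bullet> e - (e v* z0) \<bullet> (e v* z0)" by blast
  obtain K where K: "0 < K" "\<And>(x :: real^'p) (A :: real^'q^'p). norm (x v* A) \<le> norm x * norm A * K"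
    using vmult_diff_norm_le by blast
  show thesis
  proof (rule that[of "\<kappa> / (2 * K)" \<kappa>])
    show "0 < \<kappa> / (2 * K)" using \<kappa> K by simp
    fix z and e :: "real^'p"
    assume z: "z \<in> mat_cball" "norm (z - z0) < \<kappa> / (2 * K)" and e: "\<And>k. k \<in> fixspace z0 \<Longrightarrow> e \<bullet> k = 0"
    show "\<kappa> * (e \<bullet> e) \<le> e \<bullet> e - (e v* z) \<bullet> (e v* z)"
    proof (cases "e = 0")
      case False
      define e1 where "e1 = (1 / norm e) *\<^sub>R e"
      have e1: "e1 \<in> E" using False e by (auto simp: E_def e1_def)
      have ee: "e = norm e *\<^sub>R e1" using False by (simp add: e1_def)
      have n1: "norm e1 = 1" using e1 by (simp add: E_def)
      define a b where "a = e1 v* z" and "b = e1 v* z0"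
      have ab: "norm a \<le> 1" "norm b \<le> 1" using z(1) z0 n1 unfolding a_def b_def mat_cball_iff by metis+
      have "norm (a - b) \<le> norm e1 * norm (z - z0) * K"
        using K(2)[of e1 "z - z0"] by (simp add: a_def b_def vector_matrix_mult_diff_rdistrib)
      also have "\<dots> \<le> \<kappa> / 2" using z(2) K(1) n1 by (simp add: field_simps)
      finally have d: "norm (a - b) \<le> \<kappa> / 2" .
      \<comment> \<open>Both vectors have norm at most 1, so their squared norms differ by at most 2
        |a - b|, which is at most \<kappa>.\<close>
      have "a \<bullet> a - b \<bullet> b = (a - b) \<bullet> (a + b)" by (simp add: inner_diff_left inner_add_right inner_commute[of b a])
      also have "\<dots> \<le> norm (a - b) * norm (a + b)" by (rule norm_cauchy_schwarz)
      also have "\<dots> \<le> (\<kappa> / 2) * 2" using d ab norm_triangle_ineq[of a b] \<kappa>(1) by (intro mult_mono) auto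
      finally have "a \<bullet> a \<le> b \<bullet> b + \<kappa>" by simp
      then have *: "\<kappa> \<le> e1 \<bullet> e1 - a \<bullet> a" using \<kappa>(3)[OF e1] by (simp add: b_def)
      have "e \<bullet> e = (norm e)\<^sup>2 * (e1 \<bullet> e1)" by (subst (1 2) ee) (simp add: power2_eq_square)
      moreover have "(e v* z) \<bullet> (e v* z) = (norm e)\<^sup>2 * (a \<bullet> a)"
        by (subst (1 2) ee) (simp add: power2_eq_square vmult_scale a_def)
      moreover have "e1 \<bullet> e1 = 1" using n1 by (simp add: norm_eq_1)
      ultimately show ?thesis using mult_left_mono[OF *, of "(norm e)\<^sup>2"] by (simp add: algebra_simps)
    qed simp
  qed (use \<kappa> in auto)
qed

lemma dim_fixspace_complement:
  fixes S :: "'a::euclidean_space set"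
  assumes "subspace S"
  shows "dim {e. \<forall>k\<in>S. e \<bullet> k = 0} + dim S = DIM('a)" "subspace {e. \<forall>k\<in>S. e \<bullet> k = 0}"
proof -
  have "{e. \<forall>k\<in>S. e \<bullet> k = 0} = {y \<in> UNIV. \<forall>x\<in>S. orthogonal x y}" by (auto simp: orthogonal_def inner_commute)
  then show "dim {e. \<forall>k\<in>S. e \<bullet> k = 0} + dim S = DIM('a)"
    using dim_subspace_orthogonal_to_vectors[OF assms subspace_UNIV] by simp
  show "subspace {e. \<forall>k\<in>S. e \<bullet> k = 0}" by (auto simp: subspace_def inner_add_left)
qed

text \<open>Here the complement moves with u. Within a stratum the dimension of
  \<open>fixspace u\<close> is constant, so it is complementary to the orthogonal complement G of
  \<open>fixspace u0\<close>. In a decomposition v = g + k the form does not see k, and v is the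
  orthogonal projection of g, hence not longer than g; the gap on G carries over.\<close>

lemma fixspace_gap_uniform:
  fixes u0 :: "real^'q::finite^'p::finite"
  assumes u0: "u0 \<in> stratum r"
  obtains \<epsilon> \<kappa> where "0 < \<epsilon>" "0 < \<kappa>" "\<kappa> \<le> 1"
    "\<And>u v. u \<in> stratum r \<Longrightarrow> norm (u - u0) < \<epsilon> \<Longrightarrow> (\<And>k. k \<in> fixspace u \<Longrightarrow> v \<bullet> k = 0) \<Longrightarrow>
        \<kappa> * (v \<bullet> v) \<le> v \<bullet> v - (v v* u) \<bullet> (v v* u)"
proof -
  have u0c: "u0 \<in> mat_cball" using u0 by (simp add: stratum_iff)
  obtain \<epsilon> \<kappa> where \<epsilon>: "0 < \<epsilon>" and \<kappa>: "0 < \<kappa>" "\<kappa> \<le> 1" and gap: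
    "\<And>z e. z \<in> mat_cball \<Longrightarrow> norm (z - u0) < \<epsilon> \<Longrightarrow> (\<And>k. k \<in> fixspace u0 \<Longrightarrow> e \<bullet> k = 0) \<Longrightarrow>
        \<kappa> * (e \<bullet> e) \<le> e \<bullet> e - (e v* z) \<bullet> (e v* z)"
    using fixspace_gap[OF u0c] by metis
  show thesis
  proof (rule that[OF \<epsilon> \<kappa>])
    fix u and v :: "real^'p"
    assume u: "u \<in> stratum r" "norm (u - u0) < \<epsilon>" and v: "\<And>k. k \<in> fixspace u \<Longrightarrow> v \<bullet> k = 0"
    have uc: "u \<in> mat_cball" using u(1) by (simp add: stratum_iff)
    define G where "G = {e :: real^'p. \<forall>k\<in>fixspace u0. e \<bullet> k = 0}"
    have G: "subspace G" "dim G + dim (fixspace u0) = CARD('p)"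
      using dim_fixspace_complement[OF subspace_fixspace[of u0]] by (simp_all add: G_def)
    have gapG: "\<kappa> * (g \<bullet> g) \<le> g \<bullet> g - (g v* u) \<bullet> (g v* u)" if "g \<in> G" for g
      using gap[OF uc u(2), of g] that by (simp add: G_def)
    have "G \<inter> fixspace u \<subseteq> {0}"
    proof
      fix g assume g: "g \<in> G \<inter> fixspace u"
      then have "norm (g v* u) = norm g" using fixspace_iff_norm[OF uc] by blast
      then have "\<kappa> * (g \<bullet> g) \<le> 0" using gapG[of g] g by (simp add: norm_eq)
      then have "g \<bullet> g \<le> 0" using \<kappa>(1) by (simp add: mult_le_0_iff)
      then have "g \<bullet> g = 0" using inner_ge_zero[of g] by linarith
      then show "g \<in> {0}" by simp
    qed
    then have d0: "dim (G \<inter> fixspace u) = 0" by (simp add: dim_eq_0)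
    define ST where "ST = {x + y |x y. x \<in> G \<and> y \<in> fixspace u}"
    have "dim ST + dim (G \<inter> fixspace u) = dim G + dim (fixspace u)"
      unfolding ST_def by (rule dim_sums_Int[OF G(1) subspace_fixspace])
    moreover have "dim (fixspace u) = dim (fixspace u0)" using u(1) u0 by (simp add: stratum_iff)
    ultimately have "dim ST = DIM(real^'p)" using d0 G(2) by simp
    then have "span ST = UNIV" by (rule dim_eq_full[THEN iffD1])
    moreover have "span ST = ST"
      unfolding span_eq_iff unfolding ST_def by (rule subspace_sums[OF G(1) subspace_fixspace])
    ultimately have "v \<in> ST" by (metis UNIV_I)
    then have "\<exists>g k. g \<in> G \<and> k \<in> fixspace u \<and> v = g + k" unfolding ST_def by (rule CollectD[elim_format]) iprover
    then obtain g k where gk: "g \<in> G" "k \<in> fixspace u" "v = g + k" by blast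
    have vk: "v \<bullet> k = 0" by (rule v[OF gk(2)])
    have "v \<bullet> v = v \<bullet> g" using vk by (simp add: gk(3) inner_add_right)
    then have "norm v * norm v \<le> norm v * norm g" using norm_cauchy_schwarz[of v g]
      by (simp add: power2_norm_eq_inner[symmetric] power2_eq_square)
    then have "norm v \<le> norm g" by (cases "norm v = 0") (auto simp: mult_le_cancel_left)
    then have vg: "v \<bullet> v \<le> g \<bullet> g" by (simp add: norm_le)
    have kk: "u *v (k v* u) = k" using gk(2) by (simp add: fixspace_def)
    have "(k v* u) \<bullet> (x v* u) = k \<bullet> x" for x
      using kk by (metis dot_lmul_matrix inner_commute)
    then have "v \<bullet> v - (v v* u) \<bullet> (v v* u) = g \<bullet> g - (g v* u) \<bullet> (g v* u)"
      unfolding gk(3) vector_matrix_left_distrib inner_add_left inner_add_right by (simp add: inner_commute)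
    then show "\<kappa> * (v \<bullet> v) \<le> v \<bullet> v - (v v* u) \<bullet> (v v* u)"
      using gapG[OF gk(1)] mult_left_mono[OF vg, of \<kappa>] \<kappa>(1) by linarith
  qed
qed

section \<open>Orthonormal frames, transversal directions and averaged pivots\<close>

definition frame_proj :: "('p::finite \<Rightarrow> real^'p) \<Rightarrow> 'p set \<Rightarrow> real^'p^'p" where
  "frame_proj f J = (\<Sum>a\<in>J. outer (f a) (f a))"

lemma outer_vmult: "outer a b *v x = (b \<bullet> x) *\<^sub>R a"
  by (simp add: vec_eq_iff outer_def matrix_vector_mult_def inner_vec_def sum_distrib_left sum_distrib_right mult_ac)

lemma frame_proj_mult: "frame_proj f J *v x = (\<Sum>a\<in>J. (f a \<bullet> x) *\<^sub>R f a)"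
proof -
  have "(\<Sum>a\<in>J. A a) *v x = (\<Sum>a\<in>J. A a *v x)" if "finite J" for J and A :: "'a \<Rightarrow> real^'a^'a"
    using that by (induction J rule: finite_induct) (auto simp: matrix_vector_mult_add_rdistrib)
  then show ?thesis by (simp add: frame_proj_def outer_vmult)
qed

lemma proj_frame_frame_proj:
  assumes f: "\<And>a b. f a \<bullet> f b = (if a = b then 1 else 0)" and j: "j \<in> J"
  shows "proj_frame (f j) (frame_proj f J)"
proof -
  have e: "(\<Sum>a\<in>J. (f a \<bullet> f b) *\<^sub>R f a) = f b" if "b \<in> J" for b
    using that by (simp add: f if_distrib[of "\<lambda>c. c *\<^sub>R _"] cong: if_cong)
  have "frame_proj f J *v (frame_proj f J *v x) = frame_proj f J *v x" for x
  proof -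
    have "f a \<bullet> (\<Sum>b\<in>J. (f b \<bullet> x) *\<^sub>R f b) = f a \<bullet> x" if "a \<in> J" for a
      using that by (simp add: inner_sum_right f if_distrib[of "\<lambda>c. _ * c"] cong: if_cong)
    then show ?thesis unfolding frame_proj_mult by simp
  qed
  moreover have "(frame_proj f J *v x) \<bullet> y = x \<bullet> (frame_proj f J *v y)" for x y
    unfolding frame_proj_mult by (simp add: inner_sum_left inner_sum_right inner_commute mult.commute)
  ultimately show ?thesis using f[of j j] e[OF j] by (simp add: proj_frame_def frame_proj_mult)
qed

text \<open>The span of Bs is taken orthogonal to the vectors (0, k) with k in
  \<open>fixspace z0\<close>, where \<open>sip z0\<close> degenerates, and to the vectors
  representing w -> f a . cov z w for a in J, whose vanishing gives \<open>eta\<close> w = w. These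
  span at most dim (fixspace z0) + card J dimensions.\<close>

lemma transversal_directions:
  fixes z z0 :: "real^'q::finite^'p::finite" and f :: "'p \<Rightarrow> real^'p"
  assumes z: "z \<in> mat_cball"
    and gap: "\<And>e. (\<And>k. k \<in> fixspace z0 \<Longrightarrow> e \<bullet> k = 0) \<Longrightarrow> \<kappa> * (e \<bullet> e) \<le> e \<bullet> e - (e v* z) \<bullet> (e v* z)"
    and \<kappa>: "\<kappa> \<le> 1" and d: "d + card J + dim (fixspace z0) = CARD('p) + CARD('q)"
  obtains Bs :: "('p, 'q) param set" where "pairwise orthogonal Bs" "\<And>b. b \<in> Bs \<Longrightarrow> norm b = 1" "card Bs = d"
    "\<And>w. w \<in> span Bs \<Longrightarrow> eta (frame_proj f J) z w = w"
    "\<And>w. w \<in> span Bs \<Longrightarrow> \<kappa> * (w \<bullet> w) \<le> sip z w w"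
proof -
  define x where "x a = (f a v* z, f a - z *v (f a v* z))" for a
  have x: "x a \<bullet> w = f a \<bullet> cov z w" for a w
    unfolding x_def cov_def
    by (cases w) (simp add: inner_add_right inner_diff_left inner_diff_right dot_lmul_matrix,
       metis dot_lmul_matrix inner_commute)
  obtain Kb where Kb: "Kb \<subseteq> fixspace z0" "card Kb = dim (fixspace z0)" "finite Kb" "fixspace z0 \<subseteq> span Kb"
    using basis_exists[of "fixspace z0"] by (metis finiteI_independent)
  define V where "V = span (((\<lambda>k. (0, k)) ` Kb \<union> x ` J) :: ('p, 'q) param set)"
  have dV: "dim V \<le> dim (fixspace z0) + card J"
  proof -
    have "dim V \<le> card (((\<lambda>k. (0, k)) ` Kb \<union> x ` J) :: ('p, 'q) param set)"
      unfolding V_def using Kb(3) by (simp add: dim_le_card')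
    also have "\<dots> \<le> card (((\<lambda>k. (0, k)) ` Kb) :: ('p, 'q) param set) + card (x ` J)" by (rule card_Un_le)
    also have "\<dots> \<le> card Kb + card J" using Kb(3) by (intro add_mono card_image_le) auto
    finally show ?thesis using Kb(2) by simp
  qed
  define W where "W = {w :: ('p, 'q) param. \<forall>k\<in>V. w \<bullet> k = 0}"
  have W: "subspace W" "dim W + dim V = CARD('p) + CARD('q)"
    using dim_fixspace_complement[of V] by (simp_all add: W_def V_def add.commute)
  obtain B where B: "B \<subseteq> W" "pairwise orthogonal B" "\<And>x. x \<in> B \<Longrightarrow> norm x = 1" "card B = dim W" "independent B"
    using orthonormal_basis_subspace[OF W(1)] by metis
  have "d \<le> card B" using B(4) W(2) dV d by linarith
  then obtain Bs where Bs: "Bs \<subseteq> B" "card Bs = d" by (meson obtain_subset_with_card_n)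
  have sW: "span Bs \<subseteq> W" using Bs(1) B(1) W(1) by (meson order_trans span_minimal)
  have main: "eta (frame_proj f J) z w = w \<and> \<kappa> * (w \<bullet> w) \<le> sip z w w" if "w \<in> span Bs" for w
  proof -
    have w: "w \<bullet> v = 0" if "v \<in> V" for v using sW \<open>w \<in> span Bs\<close> that by (auto simp: W_def)
    have "f a \<bullet> cov z w = 0" if "a \<in> J" for a
      using w[of "x a"] that x[of a w] by (simp add: V_def span_base inner_commute)
    then have "frame_proj f J *v cov z w = 0" unfolding frame_proj_mult by simp
    then have 1: "eta (frame_proj f J) z w = w" by (simp add: eta_def rowv_def zero_prod_def[symmetric])
    have Kw: "snd w \<bullet> k = 0" if "k \<in> Kb" for k
      using w[of "(0, k)"] that by (cases w) (simp add: V_def span_base)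
    have "snd w \<bullet> k = 0" if "k \<in> fixspace z0" for k
    proof -
      have "k \<in> span Kb" using Kb(4) that by blast
      then have "orthogonal (snd w) k" by (rule orthogonal_to_span) (use Kw in \<open>auto simp: orthogonal_def\<close>)
      then show ?thesis by (simp add: orthogonal_def)
    qed
    then have "\<kappa> * (snd w \<bullet> snd w) \<le> snd w \<bullet> snd w - (snd w v* z) \<bullet> (snd w v* z)" by (rule gap)
    moreover have "\<kappa> * (fst w \<bullet> fst w) \<le> fst w \<bullet> fst w" using mult_right_mono[OF \<kappa> inner_ge_zero[of "fst w"]] by simp
    ultimately have "\<kappa> * (w \<bullet> w) \<le> sip z w w" by (cases w) (simp add: sip_def distrib_left)
    with 1 show ?thesis by blast
  qed
  show thesis
  proof (rule that[of Bs])
    show "pairwise orthogonal Bs" using B(2) Bs(1) by (rule pairwise_subset)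
    show "norm b = 1" if "b \<in> Bs" for b using B(3) Bs(1) that by blast
  qed (use Bs(2) main in auto)
qed

text \<open>For orthonormal f and g b = f b v* u this is 1 - z u^t in the basis f, see
  \<open>det_frame_mat\<close>. Keeping g independent of u lets one estimate cover all u.\<close>

definition frame_mat :: "('p::finite \<Rightarrow> real^'p) \<Rightarrow> ('p \<Rightarrow> real^'q::finite) \<Rightarrow> real^'q^'p \<Rightarrow> real^'p^'p" where
  "frame_mat f g z = (\<chi> a b. (if a = b then 1 else 0) - f a \<bullet> (z *v g b))"

lemma frame_mat_mult: "(frame_mat f g z *v v) $ a = v $ a - f a \<bullet> (z *v (\<Sum>b\<in>UNIV. (v $ b) *\<^sub>R g b))"
proof -
  have "linear ((*v) z)" by simp
  then have "z *v (\<Sum>b\<in>UNIV. (v $ b) *\<^sub>R g b) = (\<Sum>b\<in>UNIV. (v $ b) *\<^sub>R (z *v g b))"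
    by (simp add: linear_sum linear_cmul)
  then have "f a \<bullet> (z *v (\<Sum>b\<in>UNIV. (v $ b) *\<^sub>R g b)) = (\<Sum>b\<in>UNIV. (f a \<bullet> (z *v g b)) * v $ b)"
    by (simp add: inner_sum_right mult.commute)
  then show ?thesis
    by (simp add: matrix_vector_mult_def frame_mat_def left_diff_distrib sum_subtractf if_distrib[of "\<lambda>x. x * _"] cong: if_cong)
qed

lemma submat_cong:
  "(\<And>a b. a \<in> I \<Longrightarrow> b \<in> I \<Longrightarrow> A $ a $ b = B $ a $ b) \<Longrightarrow> submat I A = submat I B"
  by (simp add: submat_def vec_eq_iff)

lemma inner_orthonormal_sum:
  fixes h :: "'a \<Rightarrow> 'v::real_inner"
  assumes fin: "finite J" and h: "\<And>a b. a \<in> J \<Longrightarrow> b \<in> J \<Longrightarrow> h a \<bullet> h b = (if a = b then 1 else 0)"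
  shows "(\<Sum>a\<in>J. c a *\<^sub>R h a) \<bullet> (\<Sum>a\<in>J. c a *\<^sub>R h a) = (\<Sum>a\<in>J. c a * c a)"
proof -
  have "(c a *\<^sub>R h a) \<bullet> (\<Sum>b\<in>J. c b *\<^sub>R h b) = c a * c a" if a: "a \<in> J" for a
  proof -
    have "(c a *\<^sub>R h a) \<bullet> (\<Sum>b\<in>J. c b *\<^sub>R h b) = (\<Sum>b\<in>J. if b = a then c a * c a else 0)"
      unfolding inner_sum_right by (rule sum.cong[OF refl]) (simp add: h a)
    then show ?thesis using fin a by simp
  qed
  then show ?thesis unfolding inner_sum_left by (intro sum.cong refl)
qed

text \<open>If two points of the sublevel set differ by a transversal vector, the gap and
  \<open>theta_pivot_ineq\<close> give \<kappa> |x - y|^2 < 8 \<rho>^2. This is the separation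
  required by \<open>packing_bound\<close>, with s = sqrt (8 / \<kappa>) \<rho>.\<close>

lemma pivot_sublevel_measure:
  fixes z z0 :: "real^'q::finite^'p::finite" and f :: "'p \<Rightarrow> real^'p" and g :: "'p \<Rightarrow> real^'q"
  assumes z: "z \<in> mat_cball"
    and gap: "\<And>e. (\<And>k. k \<in> fixspace z0 \<Longrightarrow> e \<bullet> k = 0) \<Longrightarrow> \<kappa> * (e \<bullet> e) \<le> e \<bullet> e - (e v* z) \<bullet> (e v* z)"
    and \<kappa>: "0 < \<kappa>" "\<kappa> \<le> 1" and d: "d + card J + dim (fixspace z0) = CARD('p) + CARD('q)"
    and fr: "proj_frame (f j) (frame_proj f J)"
    and \<delta>: "\<delta> \<le> 1" and small: "\<And>y. norm y \<le> \<delta> \<Longrightarrow> sip z (eta (frame_proj f J) z y) (eta (frame_proj f J) z y) \<le> 1"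
    and cont: "continuous_on (cball 0 \<delta>) (\<lambda>y. theta (f j) (frame_proj f J) z y)"
    and Y: "Y \<bullet> Y = 1 + u \<bullet> u" "u = frame_proj f J *v (z *v Y) - (f j \<bullet> (z *v Y)) *\<^sub>R f j"
    and \<rho>: "0 < \<rho>"
  shows "emeasure lebesgue {y \<in> cball 0 \<delta>. 1 - f j \<bullet> (theta (f j) (frame_proj f J) z y *v Y) < \<rho>\<^sup>2}
    \<le> ennreal (measure lebesgue (cball (0 :: ('p, 'q) param) 2) * (sqrt (8 / \<kappa>) * (d + 1)) ^ d * \<rho> ^ d)"
proof -
  let ?Q = "frame_proj f J"
  define piv where "piv y = 1 - f j \<bullet> (theta (f j) ?Q z y *v Y)" for y
  obtain Bs :: "('p, 'q) param set" where Bs: "pairwise orthogonal Bs" "\<And>b. b \<in> Bs \<Longrightarrow> norm b = 1" "card Bs = d"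
    "\<And>w. w \<in> span Bs \<Longrightarrow> eta ?Q z w = w" "\<And>w. w \<in> span Bs \<Longrightarrow> \<kappa> * (w \<bullet> w) \<le> sip z w w"
    using transversal_directions[OF z gap \<kappa>(2) d] by metis
  define E where "E = {y \<in> cball 0 \<delta>. piv y < \<rho>\<^sup>2}"
  define s where "s = sqrt (8 / \<kappa>) * \<rho>"
  have s: "0 < s" using \<kappa> \<rho> by (simp add: s_def)
  have s2: "\<kappa> * s\<^sup>2 = 8 * \<rho>\<^sup>2" using \<kappa> by (simp add: s_def power_mult_distrib)
  have cpiv: "continuous_on (cball 0 \<delta>) piv"
    unfolding piv_def
    by (intro continuous_intros bounded_bilinear.continuous_on[OF bounded_bilinear_matrix_vector] cont)
  have Em: "E \<in> lmeasurable"
  proof (rule bounded_set_imp_lmeasurable)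
    show "bounded E" by (rule bounded_subset[OF bounded_cball[of 0 \<delta>]]) (auto simp: E_def)
    have "openin (top_of_set (cball 0 \<delta>)) (cball 0 \<delta> \<inter> piv -` {..<\<rho>\<^sup>2})"
      by (rule continuous_openin_preimage_gen[OF cpiv]) simp
    then obtain T where "open T" "cball 0 \<delta> \<inter> piv -` {..<\<rho>\<^sup>2} = cball 0 \<delta> \<inter> T" unfolding openin_open by auto
    moreover have "E = cball 0 \<delta> \<inter> piv -` {..<\<rho>\<^sup>2}" by (auto simp: E_def)
    ultimately show "E \<in> sets lebesgue" by auto
  qed
  have E1: "E \<subseteq> cball 0 1" using \<delta> by (auto simp: E_def)
  have "measure lebesgue E \<le> measure lebesgue (cball (0::('p, 'q) param) 2) * (s * (card Bs + 1)) ^ card Bs"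
  proof (rule packing_bound[OF Em E1 Bs(1,2) s])
    fix x y assume xy: "x \<in> E" "y \<in> E" "x - y \<in> span Bs"
    have t: "sip z (eta ?Q z x) (eta ?Q z x) \<le> 1" "sip z (eta ?Q z y) (eta ?Q z y) \<le> 1"
      using xy by (auto simp: E_def intro!: small)
    have "\<kappa> * ((x - y) \<bullet> (x - y)) \<le> sip z (eta ?Q z (x - y)) (eta ?Q z (x - y))"
      using Bs(4,5)[OF xy(3)] by simp
    also have "\<dots> \<le> 4 * (piv x + piv y)"
      unfolding piv_def using theta_pivot_ineq(1)[OF fr z _ t] Y by simp
    also have "\<dots> < \<kappa> * s\<^sup>2" unfolding s2 using xy by (auto simp: E_def)
    finally have "(x - y) \<bullet> (x - y) < s\<^sup>2" using \<kappa> by simp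
    then show "norm (x - y) < s" using s by (simp add: power2_norm_eq_inner[symmetric] power2_less_imp_less)
  qed
  then have "measure lebesgue E \<le> measure lebesgue (cball (0::('p, 'q) param) 2) * (sqrt (8 / \<kappa>) * (d + 1)) ^ d * \<rho> ^ d"
    by (simp add: Bs(3) s_def power_mult_distrib mult_ac)
  then show ?thesis
    unfolding piv_def[symmetric] E_def[symmetric] using Em by (simp add: emeasure_eq_measure2 ennreal_leI)
qed

text \<open>Moving row j does not change the rows in I, so the larger minor is the pivot times a
  factor independent of y. The pivot has sublevel sets of measure O(\<rho>^d) with d = q + r - i,
  and the constant depends neither on the frames nor on z.\<close>

lemma theta_average:
  fixes z0 :: "real^'q::finite^'p::finite"
  assumes z0: "z0 \<in> stratum r" and \<beta>: "0 < \<beta>" "2 * \<beta> < CARD('q) + r - real i"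
    and \<delta>: "0 < \<delta>" "\<delta> \<le> 1"
    and small: "\<And>(f :: real^'p) Q (z :: real^'q^'p) y. \<lbrakk>proj_frame f Q; z \<in> mat_cball; norm y \<le> \<delta>\<rbrakk>
       \<Longrightarrow> sip z (eta Q z y) (eta Q z y) \<le> 1"
    and cont: "\<And>(f :: real^'p) Q (z :: real^'q^'p). \<lbrakk>proj_frame f Q; z \<in> mat_cball\<rbrakk>
       \<Longrightarrow> continuous_on (cball 0 \<delta>) (\<lambda>y. theta f Q z y)"
    and \<kappa>: "0 < \<kappa>" "\<kappa> \<le> 1"
    and gap: "\<And>z e. z \<in> mat_cball \<Longrightarrow> norm (z - z0) < \<epsilon> \<Longrightarrow> (\<And>k. k \<in> fixspace z0 \<Longrightarrow> e \<bullet> k = 0) \<Longrightarrow>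
        \<kappa> * (e \<bullet> e) \<le> e \<bullet> e - (e v* z) \<bullet> (e v* z)"
  obtains D where "0 < D"
    "\<And>z (f :: 'p \<Rightarrow> real^'p) (g :: 'p \<Rightarrow> real^'q) I j. \<lbrakk>z \<in> mat_cball; norm (z - z0) < \<epsilon>;
        \<And>a b. f a \<bullet> f b = (if a = b then 1 else 0);
        \<And>a b. a \<in> insert j I \<Longrightarrow> b \<in> insert j I \<Longrightarrow> g a \<bullet> g b = (if a = b then 1 else 0);
        j \<notin> I; card (insert j I) = i\<rbrakk> \<Longrightarrow>
      (\<integral>\<^sup>+y\<in>cball 0 \<delta>. negpow \<beta> (det (submat (insert j I) (frame_mat f g (theta (f j) (frame_proj f (insert j I)) z y)))) \<partial>lebesgue)
        \<le> ennreal D * negpow \<beta> (det (submat I (frame_mat f g z)))"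
proof -
  have z0c: "z0 \<in> mat_cball" and dz: "r + dim (fixspace z0) = CARD('p)" using z0 by (simp_all add: stratum_iff)
  \<comment> \<open>Guarantees that the subtraction of natural numbers in \<open>d\<close> is not
    truncated.\<close>
  have iq: "real i < CARD('q) + r" using \<beta> by linarith
  define d where "d = CARD('q) + r - i"
  have d: "real d = CARD('q) + r - real i" "d + i + dim (fixspace z0) = CARD('p) + CARD('q)"
    using iq dz by (simp_all add: d_def of_nat_diff)
  define C where "C = measure lebesgue (cball (0 :: ('p, 'q) param) 2) * (sqrt (8 / \<kappa>) * (d + 1)) ^ d"
  have C: "0 \<le> C" using \<kappa> by (simp add: C_def)
  have \<beta>d: "2 * \<beta> < real d" using \<beta> d by simp
  obtain D where D: "0 < D"
    "\<And>g :: ('p, 'q) param \<Rightarrow> real. \<lbrakk>g \<in> borel_measurable borel;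
       \<And>\<rho>. 0 < \<rho> \<Longrightarrow> emeasure lebesgue {y \<in> cball 0 \<delta>. g y < \<rho>\<^sup>2} \<le> ennreal (C * \<rho> ^ d)\<rbrakk>
      \<Longrightarrow> (\<integral>\<^sup>+y\<in>cball 0 \<delta>. negpow \<beta> (g y) \<partial>lebesgue) \<le> ennreal D"
  proof (rule negpow_integral_bound[OF \<beta>(1) \<beta>d C lmeasurable_cball[of "0 :: ('p, 'q) param" \<delta>]])
    fix D :: real
    assume "0 < D" "\<And>g :: ('p, 'q) param \<Rightarrow> real. \<lbrakk>g \<in> borel_measurable borel;
       \<And>\<rho>. 0 < \<rho> \<Longrightarrow> emeasure lebesgue {y \<in> cball 0 \<delta>. g y < \<rho>\<^sup>2} \<le> ennreal (C * \<rho> ^ d)\<rbrakk>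
      \<Longrightarrow> (\<integral>\<^sup>+y\<in>cball 0 \<delta>. negpow \<beta> (g y) \<partial>lebesgue) \<le> ennreal D"
    then show thesis by (rule that)
  qed
  show thesis
  proof (rule that[OF D(1)])
    fix z and f :: "'p \<Rightarrow> real^'p" and g :: "'p \<Rightarrow> real^'q" and I j
    assume z: "z \<in> mat_cball" "norm (z - z0) < \<epsilon>"
      and f: "\<And>a b. f a \<bullet> f b = (if a = b then 1 else 0)"
      and g: "\<And>a b. a \<in> insert j I \<Longrightarrow> b \<in> insert j I \<Longrightarrow> g a \<bullet> g b = (if a = b then 1 else 0)"
      and j: "j \<notin> I" and ci: "card (insert j I) = i"
    let ?J = "insert j I"
    let ?Q = "frame_proj f ?J"
    let ?\<theta> = "\<lambda>y. theta (f j) ?Q z y"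
    have fr: "proj_frame (f j) ?Q" by (rule proj_frame_frame_proj[OF f]) simp
    show "(\<integral>\<^sup>+y\<in>cball 0 \<delta>. negpow \<beta> (det (submat ?J (frame_mat f g (?\<theta> y)))) \<partial>lebesgue)
        \<le> ennreal D * negpow \<beta> (det (submat I (frame_mat f g z)))"
    proof (cases "det (submat I (frame_mat f g z)) \<le> 0")
      case True
      then show ?thesis using D(1) by (simp add: negpow_def ennreal_mult_top)
    next
      case False
      then have pos: "0 < det (submat I (frame_mat f g z))" and nz: "det (submat I (frame_mat f g z)) \<noteq> 0" by auto
      obtain v where v: "v $ j = 1" "\<And>a. a \<notin> ?J \<Longrightarrow> v $ a = 0" "\<And>a. a \<in> I \<Longrightarrow> (frame_mat f g z *v v) $ a = 0"
        using submat_pivot_exists[OF j nz] by metis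
      \<comment> \<open>The elimination vector v has entry 1 at j and entries
        \<open>f a \<bullet> (z *v Y)\<close> on I. Orthonormality of f and g on these indices then
        yields the normalisation \<open>Y \<bullet> Y = 1 + u \<bullet> u\<close> of
        \<open>theta_pivot_ineq\<close>.\<close>
      define Y where "Y = (\<Sum>b\<in>UNIV. (v $ b) *\<^sub>R g b)"
      have YJ: "Y = (\<Sum>b\<in>?J. (v $ b) *\<^sub>R g b)"
        unfolding Y_def by (rule sum.mono_neutral_right) (use v(2) in auto)
      have va: "v $ a = f a \<bullet> (z *v Y)" if "a \<in> I" for a
        using v(3)[OF that] by (simp add: frame_mat_mult Y_def)
      define u where "u = ?Q *v (z *v Y) - (f j \<bullet> (z *v Y)) *\<^sub>R f j"
      have u: "u = (\<Sum>a\<in>I. (v $ a) *\<^sub>R f a)"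
        using j va by (simp add: u_def frame_proj_mult)
      have "Y \<bullet> Y = (\<Sum>a\<in>?J. (v $ a) * (v $ a))"
        unfolding YJ by (rule inner_orthonormal_sum) (use g in auto)
      moreover have "u \<bullet> u = (\<Sum>a\<in>I. (v $ a) * (v $ a))"
        unfolding u by (rule inner_orthonormal_sum) (use f in auto)
      ultimately have YY: "Y \<bullet> Y = 1 + u \<bullet> u" using j v(1) by simp
      define piv where "piv y = (if y \<in> cball 0 \<delta> then 1 - f j \<bullet> (?\<theta> y *v Y) else 0)" for y
      have det: "det (submat ?J (frame_mat f g (?\<theta> y))) = piv y * det (submat I (frame_mat f g z))"
        if y: "y \<in> cball 0 \<delta>" for y
      proof -
        have same: "f a \<bullet> (?\<theta> y *v x) = f a \<bullet> (z *v x)" if "a \<in> I" for a x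
        proof -
          have "a \<noteq> j" using that j by auto
          have "?Q *v f a = f a"
            using that by (simp add: frame_proj_mult f if_distrib[of "\<lambda>c. c *\<^sub>R _"] cong: if_cong)
          then have "f a v* ?\<theta> y = f a v* z" using f \<open>a \<noteq> j\<close> by (intro theta_fixes_row[OF fr z(1)]) auto
          then show ?thesis by (simp add: dot_lmul_matrix[symmetric])
        qed
        have "det (submat ?J (frame_mat f g (?\<theta> y))) = (frame_mat f g (?\<theta> y) *v v) $ j * det (submat I (frame_mat f g (?\<theta> y)))"
        proof (rule det_submat_insert[OF j v(1,2)])
          fix a assume "a \<in> I"
          then show "(frame_mat f g (?\<theta> y) *v v) $ a = 0"
            using v(3)[of a] same[of a] by (simp add: frame_mat_mult)
        qed
        also have "submat I (frame_mat f g (?\<theta> y)) = submat I (frame_mat f g z)"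
          by (rule submat_cong) (simp add: frame_mat_def same)
        also have "(frame_mat f g (?\<theta> y) *v v) $ j = piv y"
          using y v(1) by (simp add: frame_mat_mult Y_def piv_def)
        finally show ?thesis .
      qed
      have cpiv: "continuous_on (cball 0 \<delta>) (\<lambda>y. 1 - f j \<bullet> (?\<theta> y *v Y))"
        by (intro continuous_intros bounded_bilinear.continuous_on[OF bounded_bilinear_matrix_vector] cont[OF fr z(1)])
      have "(\<integral>\<^sup>+y\<in>cball 0 \<delta>. negpow \<beta> (piv y) \<partial>lebesgue) \<le> ennreal D"
      proof (rule D(2))
        show "piv \<in> borel_measurable borel" unfolding piv_def
          by (intro borel_measurable_continuous_on_if cpiv) auto
        fix \<rho> :: real assume \<rho>: "0 < \<rho>"
        have dd: "d + card ?J + dim (fixspace z0) = CARD('p) + CARD('q)" using d(2) ci by simp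
        have "{y \<in> cball 0 \<delta>. piv y < \<rho>\<^sup>2} = {y \<in> cball 0 \<delta>. 1 - f j \<bullet> (?\<theta> y *v Y) < \<rho>\<^sup>2}"
          by (auto simp: piv_def)
        then show "emeasure lebesgue {y \<in> cball 0 \<delta>. piv y < \<rho>\<^sup>2} \<le> ennreal (C * \<rho> ^ d)"
          using pivot_sublevel_measure[OF z(1) gap[OF z] \<kappa> dd fr \<delta>(2) small[OF fr z(1)] cont[OF fr z(1)] YY u_def \<rho>]
          by (simp only: C_def)
      qed
      then have "(\<integral>\<^sup>+y\<in>cball 0 \<delta>. negpow \<beta> (piv y) \<partial>lebesgue) * negpow \<beta> (det (submat I (frame_mat f g z)))
          \<le> ennreal D * negpow \<beta> (det (submat I (frame_mat f g z)))"
        by (rule mult_right_mono) simp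
      moreover have "(\<integral>\<^sup>+y\<in>cball 0 \<delta>. negpow \<beta> (det (submat ?J (frame_mat f g (?\<theta> y)))) \<partial>lebesgue)
          = (\<integral>\<^sup>+y. negpow \<beta> (piv y) * indicator (cball 0 \<delta>) y * negpow \<beta> (det (submat I (frame_mat f g z))) \<partial>lebesgue)"
        using det negpow_mult[OF pos] by (intro nn_integral_cong) (auto simp: indicator_def)
      moreover have "\<dots> = (\<integral>\<^sup>+y\<in>cball 0 \<delta>. negpow \<beta> (piv y) \<partial>lebesgue) * negpow \<beta> (det (submat I (frame_mat f g z)))"
      proof (rule nn_integral_multc)
        have "piv \<in> borel_measurable borel" unfolding piv_def
          by (intro borel_measurable_continuous_on_if cpiv) auto
        moreover have "cball 0 \<delta> \<in> sets (borel :: ('p, 'q) param measure)" by simp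
        ultimately have "(\<lambda>y. negpow \<beta> (piv y) * indicator (cball 0 \<delta>) y) \<in> borel_measurable lborel" by measurable
        then show "(\<lambda>y. negpow \<beta> (piv y) * indicator (cball 0 \<delta>) y) \<in> borel_measurable lebesgue"
          by (rule measurable_completion)
      qed
      ultimately show ?thesis by simp
    qed
  qed
qed

section \<open>Integrability of negative powers of the kernel determinant\<close>

lemma continuous_on_det [continuous_intros]:
  fixes A :: "'a::topological_space \<Rightarrow> real^'p::finite^'p"
  assumes "\<And>i j. continuous_on S (\<lambda>x. A x $ i $ j)"
  shows "continuous_on S (\<lambda>x. det (A x))"
  unfolding det_def by (intro continuous_intros assms)

lemma continuous_on_minor:
  fixes h :: "'a::topological_space \<Rightarrow> real^'q::finite^'p::finite"
  assumes "continuous_on S h"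
  shows "continuous_on S (\<lambda>x. det (submat I (frame_mat f g (h x))))"
proof (rule continuous_on_det)
  fix i j
  have "continuous_on S (\<lambda>x. (if i = j then 1 else 0) - f i \<bullet> (h x *v g j))"
    by (intro continuous_intros bounded_bilinear.continuous_on[OF bounded_bilinear_matrix_vector] assms)
  then show "continuous_on S (\<lambda>x. submat I (frame_mat f g (h x)) $ i $ j)"
    by (cases "i \<in> I \<and> j \<in> I") (auto simp: submat_def frame_mat_def)
qed

text \<open>For every small y the integral is at most a multiple of the integral of the minor moved
  by \<open>theta\<close>. After averaging over y and exchanging the integrals,
  \<open>theta_average\<close> removes one pivot and leaves a minor of size i over a ball contained
  in that of the induction hypothesis. The moved map is transported through the chart by
  \<open>surface_chart_pullback\<close>.\<close>

lemma minor_integral_step: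
  fixes \<phi> :: "real^'n::finite \<Rightarrow> real^'q::finite^'p::finite"
  assumes ch: "surface_chart (stratum r) V \<phi> \<phi>'" and t0: "t0 \<in> V"
    and \<beta>: "0 < \<beta>" "2 * \<beta> < CARD('q) + r - real (Suc i)"
    and \<rho>0: "0 < \<rho>0" and IH: "\<And>f g (I :: 'p set). \<lbrakk>\<And>a b. f a \<bullet> f b = (if a = b then 1 else 0);
        \<And>a b. a \<in> I \<Longrightarrow> b \<in> I \<Longrightarrow> g a \<bullet> g b = (if a = b then 1 else 0); card I = i\<rbrakk> \<Longrightarrow>
      (\<integral>\<^sup>+t\<in>ball t0 \<rho>0. negpow \<beta> (det (submat I (frame_mat f g (\<phi> t)))) \<partial>lborel) \<le> ennreal B"
    and B: "0 \<le> B"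
  shows "\<exists>\<rho>>0. \<exists>B'\<ge>0. \<forall>f g (J :: 'p set). (\<forall>a b. f a \<bullet> f b = (if a = b then 1 else 0)) \<longrightarrow>
        (\<forall>a\<in>J. \<forall>b\<in>J. g a \<bullet> g b = (if a = b then 1 else 0)) \<longrightarrow> card J = Suc i \<longrightarrow>
      (\<integral>\<^sup>+t\<in>ball t0 \<rho>. negpow \<beta> (det (submat J (frame_mat f g (\<phi> t)))) \<partial>lborel) \<le> ennreal B'"
proof -
  have \<phi>V: "\<phi> ` V \<subseteq> stratum r" and der: "\<And>t. t \<in> V \<Longrightarrow> (\<phi> has_derivative blinfun_apply (\<phi>' t)) (at t)" and oV: "open V"
    using ch unfolding surface_chart_def by auto
  have c\<phi>: "continuous_on V \<phi>"
    using der by (meson continuous_at_imp_continuous_on has_derivative_continuous)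
  have z0: "\<phi> t0 \<in> stratum r" using \<phi>V t0 by blast
  then have z0c: "\<phi> t0 \<in> mat_cball" by (simp add: stratum_iff)
  obtain \<epsilon> \<kappa> where \<epsilon>: "0 < \<epsilon>" and \<kappa>: "0 < \<kappa>" "\<kappa> \<le> 1" and gap:
    "\<And>z e. z \<in> mat_cball \<Longrightarrow> norm (z - \<phi> t0) < \<epsilon> \<Longrightarrow> (\<And>k. k \<in> fixspace (\<phi> t0) \<Longrightarrow> e \<bullet> k = 0) \<Longrightarrow>
        \<kappa> * (e \<bullet> e) \<le> e \<bullet> e - (e v* z) \<bullet> (e v* z)"
    using fixspace_gap[OF z0c] by metis
  obtain L \<delta>0 where L: "0 \<le> L" "0 < \<delta>0" "\<delta>0 \<le> 1" and Lip:
    "\<And>(f :: real^'p) Q (z :: real^'q^'p) y z' y'. \<lbrakk>proj_frame f Q; z \<in> mat_cball; z' \<in> mat_cball; norm y \<le> 1; norm y' \<le> 1\<rbrakk>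
       \<Longrightarrow> norm (theta f Q z y - theta f Q z' y') \<le> L * norm ((z, y) - (z', y'))"
    and small: "\<And>(f :: real^'p) Q (z :: real^'q^'p) y. \<lbrakk>proj_frame f Q; z \<in> mat_cball; norm y \<le> \<delta>0\<rbrakk>
       \<Longrightarrow> sip z (eta Q z y) (eta Q z y) + 2 * \<bar>(f + cov z (eta Q z y)) \<bullet> snd (eta Q z y)\<bar> < 1"
    using theta_uniform[where 'p='p and 'q='q] by metis
  obtain R K where R: "0 < R" "0 < K" "cball t0 (2 * R) \<subseteq> V" and pull:
    "\<And>\<rho>. \<lbrakk>0 < \<rho>; \<rho> \<le> R\<rbrakk> \<Longrightarrow> \<exists>\<delta>>0. \<forall>\<theta> L F. 0 \<le> L \<longrightarrow>
        (\<forall>s\<in>cball t0 (2 * \<rho>). \<theta> (\<phi> s) \<in> stratum r \<and> norm (\<theta> (\<phi> s) - \<phi> s) \<le> \<delta>) \<longrightarrow>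
        (\<forall>s\<in>cball t0 (2 * \<rho>). \<forall>t\<in>cball t0 (2 * \<rho>). norm (\<theta> (\<phi> s) - \<theta> (\<phi> t)) \<le> L * norm (\<phi> s - \<phi> t)) \<longrightarrow>
        F \<in> borel_measurable borel \<longrightarrow>
        (\<integral>\<^sup>+t\<in>ball t0 \<rho>. F (\<phi> t) \<partial>lborel)
          \<le> ennreal ((K * L) ^ CARD('n)) * (\<integral>\<^sup>+s\<in>ball t0 (2 * \<rho>). F (\<theta> (\<phi> s)) \<partial>lborel)"
  proof (rule surface_chart_pullback[OF ch t0])
    fix R K :: real
    assume "0 < R" "0 < K" "cball t0 (2 * R) \<subseteq> V"
    "\<And>\<rho>. \<lbrakk>0 < \<rho>; \<rho> \<le> R\<rbrakk> \<Longrightarrow> \<exists>\<delta>>0. \<forall>\<theta> L F. 0 \<le> L \<longrightarrow>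
        (\<forall>s\<in>cball t0 (2 * \<rho>). \<theta> (\<phi> s) \<in> stratum r \<and> norm (\<theta> (\<phi> s) - \<phi> s) \<le> \<delta>) \<longrightarrow>
        (\<forall>s\<in>cball t0 (2 * \<rho>). \<forall>t\<in>cball t0 (2 * \<rho>). norm (\<theta> (\<phi> s) - \<theta> (\<phi> t)) \<le> L * norm (\<phi> s - \<phi> t)) \<longrightarrow>
        F \<in> borel_measurable borel \<longrightarrow>
        (\<integral>\<^sup>+t\<in>ball t0 \<rho>. F (\<phi> t) \<partial>lborel)
          \<le> ennreal ((K * L) ^ CARD('n)) * (\<integral>\<^sup>+s\<in>ball t0 (2 * \<rho>). F (\<theta> (\<phi> s)) \<partial>lborel)"
    then show thesis by (rule that)
  qed
  obtain d where d: "0 < d" "\<And>t. t \<in> V \<Longrightarrow> dist t t0 < d \<Longrightarrow> dist (\<phi> t) (\<phi> t0) < \<epsilon>"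
    using c\<phi> t0 \<epsilon> unfolding continuous_on_iff by metis
  \<comment> \<open>The doubled ball has to lie in the ball of the induction hypothesis, in the part
    of the chart where transport works, and where the gap at \<open>\<phi> t0\<close> holds.\<close>
  define \<rho> where "\<rho> = min (\<rho>0 / 2) (min R (d / 4))"
  have \<rho>: "0 < \<rho>" "2 * \<rho> \<le> \<rho>0" "\<rho> \<le> R" "2 * \<rho> < d" using \<rho>0 R(1) d(1) by (auto simp: \<rho>_def)
  have cV: "cball t0 (2 * \<rho>) \<subseteq> V" by (rule order_trans[OF subset_cball R(3)]) (use \<rho> in auto)
  have inV: "s \<in> V" if "s \<in> cball t0 (2 * \<rho>)" for s using subsetD[OF cV that] .
  have zs: "\<phi> s \<in> stratum r" "\<phi> s \<in> mat_cball" "norm (\<phi> s - \<phi> t0) < \<epsilon>" if s: "s \<in> cball t0 (2 * \<rho>)" for s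
  proof -
    show 1: "\<phi> s \<in> stratum r" using \<phi>V inV[OF s] by blast
    then show "\<phi> s \<in> mat_cball" by (simp add: stratum_iff)
    have "dist s t0 < d" using s \<rho>(4) by (simp add: dist_commute)
    then show "norm (\<phi> s - \<phi> t0) < \<epsilon>" using d(2)[OF inV[OF s]] by (simp add: dist_norm)
  qed
  obtain \<delta>1 where \<delta>1: "0 < \<delta>1" and pull1: "\<forall>\<theta> L F. 0 \<le> L \<longrightarrow>
        (\<forall>s\<in>cball t0 (2 * \<rho>). \<theta> (\<phi> s) \<in> stratum r \<and> norm (\<theta> (\<phi> s) - \<phi> s) \<le> \<delta>1) \<longrightarrow>
        (\<forall>s\<in>cball t0 (2 * \<rho>). \<forall>t\<in>cball t0 (2 * \<rho>). norm (\<theta> (\<phi> s) - \<theta> (\<phi> t)) \<le> L * norm (\<phi> s - \<phi> t)) \<longrightarrow>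
        F \<in> borel_measurable borel \<longrightarrow>
        (\<integral>\<^sup>+t\<in>ball t0 \<rho>. F (\<phi> t) \<partial>lborel)
          \<le> ennreal ((K * L) ^ CARD('n)) * (\<integral>\<^sup>+s\<in>ball t0 (2 * \<rho>). F (\<theta> (\<phi> s)) \<partial>lborel)"
    using pull[OF \<rho>(1,3)] by (elim exE conjE) (rule that)
  \<comment> \<open>Keeps the displacement, at most L |y|, below the tolerance
    \<open>\<delta>1\<close> of the transport; L + 1 avoids a zero denominator.\<close>
  define \<delta> where "\<delta> = min \<delta>0 (\<delta>1 / (L + 1))"
  have \<delta>: "0 < \<delta>" "\<delta> \<le> \<delta>0" "\<delta> \<le> 1" using L \<delta>1 by (auto simp: \<delta>_def)
  have L\<delta>: "L * \<delta> \<le> \<delta>1"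
  proof -
    have "L * \<delta> \<le> (L + 1) * (\<delta>1 / (L + 1))" using L \<delta>1 \<delta> by (intro mult_mono) (auto simp: \<delta>_def)
    then show ?thesis using L by simp
  qed
  have small1: "sip z (eta Q z y) (eta Q z y) \<le> 1" if "proj_frame f Q" "z \<in> mat_cball" "norm y \<le> \<delta>"
    for f :: "real^'p" and Q and z :: "real^'q^'p" and y
    using small[OF that(1,2), of y] that(3) \<delta>(2) abs_ge_zero[of "(f + cov z (eta Q z y)) \<bullet> snd (eta Q z y)"] by simp
  have contz: "continuous_on ((mat_cball :: (real^'q^'p) set) \<times> cball 0 1) (\<lambda>w. theta f Q (fst w) (snd w))" if "proj_frame f Q"
    for f :: "real^'p" and Q :: "real^'p^'p"
  proof (rule lipschitz_on_continuous_on[of L], rule lipschitz_onI)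
    fix w w' :: "(real^'q^'p) \<times> ('p, 'q) param"
    assume w: "w \<in> mat_cball \<times> cball 0 1" "w' \<in> mat_cball \<times> cball 0 1"
    have "norm (theta f Q (fst w) (snd w) - theta f Q (fst w') (snd w')) \<le> L * norm ((fst w, snd w) - (fst w', snd w'))"
      by (rule Lip[OF that]) (use w in \<open>simp_all add: mem_Times_iff\<close>)
    then show "dist (theta f Q (fst w) (snd w)) (theta f Q (fst w') (snd w')) \<le> L * dist w w'"
      by (simp add: dist_norm)
  qed (rule L(1))
  have conty: "continuous_on (cball 0 \<delta>) (\<lambda>y. theta f Q z y)" if "proj_frame f Q" "z \<in> mat_cball"
    for f :: "real^'p" and Q and z :: "real^'q^'p"
  proof -
    have "continuous_on (cball 0 \<delta>) (\<lambda>y. theta f Q (fst (z, y)) (snd (z, y)))"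
      by (rule continuous_on_compose2[OF contz[OF that(1)]])
         (use that(2) \<delta> in \<open>auto intro!: continuous_intros\<close>)
    then show ?thesis by simp
  qed
  obtain D where D: "0 < D" and avg: 
    "\<And>z (f :: 'p \<Rightarrow> real^'p) (g :: 'p \<Rightarrow> real^'q) I j. \<lbrakk>z \<in> mat_cball; norm (z - \<phi> t0) < \<epsilon>;
        \<And>a b. f a \<bullet> f b = (if a = b then 1 else 0);
        \<And>a b. a \<in> insert j I \<Longrightarrow> b \<in> insert j I \<Longrightarrow> g a \<bullet> g b = (if a = b then 1 else 0);
        j \<notin> I; card (insert j I) = Suc i\<rbrakk> \<Longrightarrow>
      (\<integral>\<^sup>+y\<in>cball 0 \<delta>. negpow \<beta> (det (submat (insert j I) (frame_mat f g (theta (f j) (frame_proj f (insert j I)) z y)))) \<partial>lebesgue)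
        \<le> ennreal D * negpow \<beta> (det (submat I (frame_mat f g z)))"
  proof (rule theta_average[OF z0 \<beta> \<delta>(1,3) small1 conty \<kappa> gap])
    fix D :: real
    assume "0 < D" "\<And>z (f :: 'p \<Rightarrow> real^'p) (g :: 'p \<Rightarrow> real^'q) I j. \<lbrakk>z \<in> mat_cball; norm (z - \<phi> t0) < \<epsilon>;
        \<And>a b. f a \<bullet> f b = (if a = b then 1 else 0);
        \<And>a b. a \<in> insert j I \<Longrightarrow> b \<in> insert j I \<Longrightarrow> g a \<bullet> g b = (if a = b then 1 else 0);
        j \<notin> I; card (insert j I) = Suc i\<rbrakk> \<Longrightarrow>
      (\<integral>\<^sup>+y\<in>cball 0 \<delta>. negpow \<beta> (det (submat (insert j I) (frame_mat f g (theta (f j) (frame_proj f (insert j I)) z y)))) \<partial>lebesgue)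
        \<le> ennreal D * negpow \<beta> (det (submat I (frame_mat f g z)))"
    then show thesis by (rule that)
  qed
  define \<nu> where "\<nu> = measure lborel (cball (0 :: ('p, 'q) param) \<delta>)"
  have \<nu>: "0 < \<nu>" "emeasure lborel (cball (0 :: ('p, 'q) param) \<delta>) = ennreal \<nu>"
  proof -
    have "emeasure lborel (cball (0 :: ('p, 'q) param) \<delta>) < \<infinity>" by (rule emeasure_lborel_cball_finite)
    then show "emeasure lborel (cball (0 :: ('p, 'q) param) \<delta>) = ennreal \<nu>"
      unfolding \<nu>_def by (intro emeasure_eq_ennreal_measure) simp
  qed (simp add: \<nu>_def content_cball_pos \<delta>(1))
  define c where "c = (K * L) ^ CARD('n)"
  have c: "0 \<le> c" using R L by (simp add: c_def)
  define B' where "B' = c * (D * B) / \<nu>"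
  have B'0: "0 \<le> B'" using c D B \<nu> by (simp add: B'_def)
  have final: "(\<integral>\<^sup>+t\<in>ball t0 \<rho>. negpow \<beta> (det (submat J (frame_mat f g (\<phi> t)))) \<partial>lborel) \<le> ennreal B'"
    if f: "\<And>a b. f a \<bullet> f b = (if a = b then 1 else 0)"
      and g: "\<And>a b. a \<in> J \<Longrightarrow> b \<in> J \<Longrightarrow> g a \<bullet> g b = (if a = b then 1 else 0)" and J: "card J = Suc i"
    for f :: "'p \<Rightarrow> real^'p" and g :: "'p \<Rightarrow> real^'q" and J
  proof -
    obtain j I where jI: "J = insert j I" "j \<notin> I" "card I = i"
      using J card_Suc_eq[of J i] by auto
    define Q where "Q = frame_proj f J"
    have fr: "proj_frame (f j) Q" unfolding Q_def by (rule proj_frame_frame_proj[OF f]) (simp add: jI)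
    define F where "F z = negpow \<beta> (det (submat J (frame_mat f g z)))" for z
    have F: "F \<in> borel_measurable borel"
      unfolding F_def by (rule measurable_compose[OF borel_measurable_continuous_onI negpow_measurable])
        (intro continuous_on_minor continuous_on_id)
    define lhs where "lhs = (\<integral>\<^sup>+t\<in>ball t0 \<rho>. F (\<phi> t) \<partial>lborel)"
    have one: "lhs \<le> ennreal c * (\<integral>\<^sup>+s\<in>ball t0 (2 * \<rho>). F (theta (f j) Q (\<phi> s) y) \<partial>lborel)"
      if y: "y \<in> cball 0 \<delta>" for y
    proof -
      have y': "norm y \<le> \<delta>" "norm y \<le> 1" "norm y \<le> \<delta>0" using y \<delta> by auto
      have 1: "theta (f j) Q (\<phi> s) y \<in> stratum r \<and> norm (theta (f j) Q (\<phi> s) y - \<phi> s) \<le> \<delta>1"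
        if s: "s \<in> cball t0 (2 * \<rho>)" for s
      proof -
        have "norm (theta (f j) Q (\<phi> s) y - theta (f j) Q (\<phi> s) 0) \<le> L * norm ((\<phi> s, y) - (\<phi> s, 0))"
          by (rule Lip[OF fr]) (use zs[OF s] y' in auto)
        also have "\<dots> \<le> \<delta>1" using y' L L\<delta> mult_left_mono[OF y'(1) L(1)] by (simp add: norm_Pair)
        finally show ?thesis
          using theta_stratum[OF fr zs(2)[OF s] small[OF fr zs(2)[OF s] y'(3)] zs(1)[OF s]] by (simp add: theta_zero)
      qed
      have 2: "norm (theta (f j) Q (\<phi> s) y - theta (f j) Q (\<phi> t) y) \<le> L * norm (\<phi> s - \<phi> t)"
        if s: "s \<in> cball t0 (2 * \<rho>)" and t: "t \<in> cball t0 (2 * \<rho>)" for s t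
      proof -
        have "norm (theta (f j) Q (\<phi> s) y - theta (f j) Q (\<phi> t) y) \<le> L * norm ((\<phi> s, y) - (\<phi> t, y))"
          by (rule Lip[OF fr]) (use zs[OF s] zs[OF t] y' in auto)
        then show ?thesis by (simp add: norm_Pair)
      qed
      show ?thesis
        unfolding lhs_def c_def
        by (rule pull1[rule_format, where \<theta> = "\<lambda>z. theta (f j) Q z y"]) (intro L(1) F 1 2; assumption)+
    qed
    \<comment> \<open>Cut off in both variables, because continuity of \<open>theta\<close> is known
      only for contractions and bounded y; this gives the joint measurability for Fubini.\<close>
    define H where "H s y = F (theta (f j) Q (\<phi> s) y) * indicator (ball t0 (2 * \<rho>)) s * indicator (cball 0 \<delta>) y"
      for s :: "real^'n" and y :: "('p, 'q) param"
    have Hm: "(\<lambda>(s, y). H s y) \<in> borel_measurable (lborel \<Otimes>\<^sub>M lborel)"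
    proof -
      let ?X = "ball t0 (2 * \<rho>) \<times> cball (0 :: ('p, 'q) param) \<delta>"
      have X: "?X \<in> sets borel" by (intro borel_Times) auto
      have cX: "continuous_on ?X (\<lambda>x. theta (f j) Q (\<phi> (fst x)) (snd x))"
      proof (rule continuous_on_compose2[OF contz[OF fr], of ?X "\<lambda>x. (\<phi> (fst x), snd x)", simplified])
        show "continuous_on ?X (\<lambda>x. (\<phi> (fst x), snd x))"
          by (intro continuous_intros continuous_on_compose2[OF c\<phi>]) (auto intro!: inV)
        show "(\<lambda>x. (\<phi> (fst x), snd x)) ` ?X \<subseteq> mat_cball \<times> cball 0 1"
          using zs(2) \<delta>(3) by auto
      qed
      have "(\<lambda>x. if x \<in> ?X then theta (f j) Q (\<phi> (fst x)) (snd x) else 0) \<in> borel_measurable borel"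
        by (intro borel_measurable_continuous_on_if X cX) auto
      then have "(\<lambda>x. F (if x \<in> ?X then theta (f j) Q (\<phi> (fst x)) (snd x) else 0) * indicator ?X x) \<in> borel_measurable borel"
        using X by (intro borel_measurable_times_ennreal measurable_compose[OF _ F] borel_measurable_indicator)
      moreover have "(\<lambda>(s, y). H s y) = (\<lambda>x. F (if x \<in> ?X then theta (f j) Q (\<phi> (fst x)) (snd x) else 0) * indicator ?X x)"
        by (auto simp: H_def fun_eq_iff indicator_def)
      ultimately show ?thesis by (simp add: borel_prod lborel_prod)
    qed
    \<comment> \<open>The left side does not depend on y, so integrating over y only multiplies it
      by the volume \<nu> of the parameter ball.\<close>
    have "lhs * ennreal \<nu> = (\<integral>\<^sup>+y\<in>cball (0 :: ('p, 'q) param) \<delta>. lhs \<partial>lborel)"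
      by (simp add: nn_integral_cmult_indicator \<nu>(2))
    also have "\<dots> \<le> (\<integral>\<^sup>+y. ennreal c * (\<integral>\<^sup>+s. H s y \<partial>lborel) \<partial>lborel)"
    proof (rule nn_integral_mono)
      fix y :: "('p, 'q) param"
      show "lhs * indicator (cball 0 \<delta>) y \<le> ennreal c * (\<integral>\<^sup>+s. H s y \<partial>lborel)"
      proof (cases "y \<in> cball 0 \<delta>")
        case True
        then have "(\<integral>\<^sup>+s. H s y \<partial>lborel) = (\<integral>\<^sup>+s\<in>ball t0 (2 * \<rho>). F (theta (f j) Q (\<phi> s) y) \<partial>lborel)"
          by (simp add: H_def)
        then show ?thesis using one[OF True] True by simp
      qed simp
    qed
    also have "\<dots> = ennreal c * (\<integral>\<^sup>+y. (\<integral>\<^sup>+s. H s y \<partial>lborel) \<partial>lborel)"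
    proof (rule nn_integral_cmult)
      have "(\<lambda>(y, s). H s y) \<in> borel_measurable (lborel \<Otimes>\<^sub>M lborel)"
        using measurable_pair_swap[OF Hm] by (simp add: case_prod_beta)
      then show "(\<lambda>y. \<integral>\<^sup>+s. H s y \<partial>lborel) \<in> borel_measurable lborel"
        by (rule lborel.borel_measurable_nn_integral)
    qed
    also have "(\<integral>\<^sup>+y. (\<integral>\<^sup>+s. H s y \<partial>lborel) \<partial>lborel) = (\<integral>\<^sup>+s. (\<integral>\<^sup>+y. H s y \<partial>lborel) \<partial>lborel)"
      by (rule lborel_pair.Fubini'[OF Hm])
    also have "\<dots> \<le> (\<integral>\<^sup>+s. ennreal D * (negpow \<beta> (det (submat I (frame_mat f g (\<phi> s)))) * indicator (ball t0 (2 * \<rho>)) s) \<partial>lborel)"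
    proof (rule nn_integral_mono)
      fix s :: "real^'n"
      show "(\<integral>\<^sup>+y. H s y \<partial>lborel) \<le> ennreal D * (negpow \<beta> (det (submat I (frame_mat f g (\<phi> s)))) * indicator (ball t0 (2 * \<rho>)) s)"
      proof (cases "s \<in> ball t0 (2 * \<rho>)")
        case True
        then have s: "s \<in> cball t0 (2 * \<rho>)" "s \<in> ball t0 \<rho>0" using \<rho> by auto
        have "(\<integral>\<^sup>+y. H s y \<partial>lborel) = (\<integral>\<^sup>+y\<in>cball 0 \<delta>. F (theta (f j) Q (\<phi> s) y) \<partial>lebesgue)"
          using True by (simp add: H_def nn_integral_completion)
        also have "\<dots> \<le> ennreal D * negpow \<beta> (det (submat I (frame_mat f g (\<phi> s))))"
          unfolding F_def Q_def jI(1)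
          by (rule avg[OF zs(2,3)[OF s(1)] f]) (use g jI J in auto)
        finally show ?thesis using True by simp
      next
        case False
        then show ?thesis by (simp add: H_def)
      qed
    qed
    also have "\<dots> \<le> ennreal D * ennreal B"
    proof -
      have "(\<lambda>s. if s \<in> ball t0 (2 * \<rho>) then det (submat I (frame_mat f g (\<phi> s))) else 0) \<in> borel_measurable borel"
        by (intro borel_measurable_continuous_on_if continuous_on_minor continuous_on_subset[OF c\<phi>])
           (auto intro!: inV)
      then have "(\<lambda>s. negpow \<beta> (if s \<in> ball t0 (2 * \<rho>) then det (submat I (frame_mat f g (\<phi> s))) else 0) * indicator (ball t0 (2 * \<rho>)) s)
          \<in> borel_measurable borel"
        by (intro borel_measurable_times_ennreal measurable_compose[OF _ negpow_measurable] borel_measurable_indicator) auto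
      also have "(\<lambda>s. negpow \<beta> (if s \<in> ball t0 (2 * \<rho>) then det (submat I (frame_mat f g (\<phi> s))) else 0) * indicator (ball t0 (2 * \<rho>)) s)
          = (\<lambda>s. negpow \<beta> (det (submat I (frame_mat f g (\<phi> s)))) * indicator (ball t0 (2 * \<rho>)) s)"
        by (auto simp: fun_eq_iff indicator_def)
      finally have m: "(\<lambda>s. negpow \<beta> (det (submat I (frame_mat f g (\<phi> s)))) * indicator (ball t0 (2 * \<rho>)) s) \<in> borel_measurable lborel" by simp
      have "(\<integral>\<^sup>+s. ennreal D * (negpow \<beta> (det (submat I (frame_mat f g (\<phi> s)))) * indicator (ball t0 (2 * \<rho>)) s) \<partial>lborel)
          = ennreal D * (\<integral>\<^sup>+s. negpow \<beta> (det (submat I (frame_mat f g (\<phi> s)))) * indicator (ball t0 (2 * \<rho>)) s \<partial>lborel)"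
        by (rule nn_integral_cmult[OF m])
      also have "\<dots> \<le> ennreal D * (\<integral>\<^sup>+s. negpow \<beta> (det (submat I (frame_mat f g (\<phi> s)))) * indicator (ball t0 \<rho>0) s \<partial>lborel)"
        using \<rho>(2) by (intro mult_left_mono nn_integral_mono) (auto simp: indicator_def)
      also have "\<dots> \<le> ennreal D * ennreal B"
        by (intro mult_left_mono IH[OF f _ jI(3)]) (use g jI in auto)
      finally show ?thesis .
    qed
    finally have "lhs * ennreal \<nu> \<le> ennreal c * (ennreal D * ennreal B)" by (simp add: mult_left_mono)
    also have "\<dots> = ennreal B' * ennreal \<nu>"
      using c D B \<nu> B'0 by (simp add: ennreal_mult[symmetric] B'_def)
    finally have "lhs \<le> ennreal B'" using \<nu>(1)
      ennreal_mult_le_mult_iff[of "ennreal \<nu>" lhs "ennreal B'"] by (simp add: mult.commute)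
    then show ?thesis by (simp add: lhs_def F_def)
  qed
  show ?thesis
  proof (rule exI[of _ \<rho>], rule conjI[OF \<rho>(1)], rule exI[of _ B'], rule conjI[OF B'0], intro allI impI)
    fix f :: "'p \<Rightarrow> real^'p" and g :: "'p \<Rightarrow> real^'q" and J :: "'p set"
    assume f: "\<forall>a b. f a \<bullet> f b = (if a = b then 1 else 0)"
      and g: "\<forall>a\<in>J. \<forall>b\<in>J. g a \<bullet> g b = (if a = b then 1 else 0)" and J: "card J = Suc i"
    show "(\<integral>\<^sup>+t\<in>ball t0 \<rho>. negpow \<beta> (det (submat J (frame_mat f g (\<phi> t)))) \<partial>lborel) \<le> ennreal B'"
      by (rule final[OF f[rule_format] g[rule_format] J])
  qed
qed

text \<open>Induction on the size of the minor, starting from the empty one, which is the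
  determinant of the identity. The ball shrinks at each of finitely many steps, and the condition on
  \<beta> for size m implies that for all smaller sizes.\<close>

lemma minor_integral_local:
  fixes \<phi> :: "real^'n::finite \<Rightarrow> real^'q::finite^'p::finite"
  assumes ch: "surface_chart (stratum r) V \<phi> \<phi>'" and t0: "t0 \<in> V"
    and \<beta>: "0 < \<beta>" "2 * \<beta> < CARD('q) + r - real m"
  shows "i \<le> m \<Longrightarrow> \<exists>\<rho>>0. \<exists>B\<ge>0. \<forall>f g (I :: 'p set). (\<forall>a b. f a \<bullet> f b = (if a = b then 1 else 0)) \<longrightarrow>
        (\<forall>a\<in>I. \<forall>b\<in>I. g a \<bullet> g b = (if a = b then 1 else 0)) \<longrightarrow> card I = i \<longrightarrow>
      (\<integral>\<^sup>+t\<in>ball t0 \<rho>. negpow \<beta> (det (submat I (frame_mat f g (\<phi> t)))) \<partial>lborel) \<le> ennreal B"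
proof (induction i)
  case 0
  show ?case
  proof (rule exI[of _ 1], rule conjI, simp, rule exI[of _ "measure lborel (ball t0 1)"], intro conjI allI impI)
    fix f :: "'p \<Rightarrow> real^'p" and g :: "'p \<Rightarrow> real^'q" and I :: "'p set"
    assume "card I = 0"
    then have "I = {}" by simp
    moreover have "emeasure lborel (ball t0 1) < \<infinity>" by (rule emeasure_lborel_ball_finite)
    ultimately show "(\<integral>\<^sup>+t\<in>ball t0 1. negpow \<beta> (det (submat I (frame_mat f g (\<phi> t)))) \<partial>lborel) \<le> ennreal (measure lborel (ball t0 1))"
      by (simp add: negpow_def emeasure_eq_ennreal_measure)
  qed simp
next
  case (Suc i)
  then have "i \<le> m" by simp
  from Suc.IH[OF this] obtain \<rho> B where \<rho>: "0 < \<rho>" and B: "0 \<le> B" and IH: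
    "\<forall>f g (I :: 'p set). (\<forall>a b. f a \<bullet> f b = (if a = b then 1 else 0)) \<longrightarrow>
        (\<forall>a\<in>I. \<forall>b\<in>I. g a \<bullet> g b = (if a = b then 1 else 0)) \<longrightarrow> card I = i \<longrightarrow>
      (\<integral>\<^sup>+t\<in>ball t0 \<rho>. negpow \<beta> (det (submat I (frame_mat f g (\<phi> t)))) \<partial>lborel) \<le> ennreal B"
    by (elim exE conjE) (rule that)
  have "2 * \<beta> < CARD('q) + r - real (Suc i)" using \<beta>(2) Suc.prems by linarith
  then show ?case
    by (rule minor_integral_step[OF ch t0 \<beta>(1) _ \<rho> IH[rule_format] B])
qed

text \<open>Orthonormal bases of S and of its complement are joined and indexed by the type
  \<open>'p\<close> itself, so that the part belonging to S becomes an index set for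
  \<open>submat\<close>.\<close>

lemma adapted_orthonormal_basis:
  fixes S :: "(real^'p::finite) set"
  assumes S: "subspace S"
  obtains f :: "'p \<Rightarrow> real^'p" and I where "\<And>a b. f a \<bullet> f b = (if a = b then 1 else 0)"
    "\<And>a. a \<in> I \<Longrightarrow> f a \<in> S" "\<And>a k. a \<notin> I \<Longrightarrow> k \<in> S \<Longrightarrow> f a \<bullet> k = 0" "card I = dim S"
    "\<And>k. k \<in> S \<Longrightarrow> \<exists>c. k = (\<Sum>a\<in>I. c a *\<^sub>R f a)"
proof -
  define T where "T = {e :: real^'p. \<forall>k\<in>S. e \<bullet> k = 0}"
  have T: "subspace T" "dim T + dim S = CARD('p)"
    using dim_fixspace_complement[OF S] by (simp_all add: T_def)
  obtain A where A: "A \<subseteq> S" "pairwise orthogonal A" "\<And>x. x \<in> A \<Longrightarrow> norm x = 1" "card A = dim S" "independent A" "span A = S"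
    using orthonormal_basis_subspace[OF S] by metis
  obtain B where B: "B \<subseteq> T" "pairwise orthogonal B" "\<And>x. x \<in> B \<Longrightarrow> norm x = 1" "card B = dim T" "independent B"
    using orthonormal_basis_subspace[OF T(1)] by metis
  have AB: "a \<bullet> b = 0" if "a \<in> A" "b \<in> B" for a b
  proof -
    have "b \<bullet> a = 0" using that A(1) B(1) by (auto simp: T_def)
    then show ?thesis by (simp add: inner_commute)
  qed
  have BA: "b \<bullet> a = 0" if "a \<in> A" "b \<in> B" for a b
    using AB[OF that] by (simp add: inner_commute)
  have disj: "A \<inter> B = {}"
  proof (rule ccontr)
    assume "A \<inter> B \<noteq> {}"
    then obtain x where "x \<in> A" "x \<in> B" by auto
    then have "x \<bullet> x = 0" "norm x = 1" using AB A(3) by auto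
    then show False by simp
  qed
  have fin: "finite A" "finite B" using A(5) B(5) finiteI_independent by auto
  have "card (A \<union> B) = CARD('p)" using card_Un_disjoint[OF fin disj] A(4) B(4) T(2) by simp
  then obtain f where f: "bij_betw f (UNIV :: 'p set) (A \<union> B)"
    using fin finite_same_card_bij[of "UNIV :: 'p set" "A \<union> B"] by auto
  have inj: "inj f" and rng: "range f = A \<union> B" using f by (auto simp: bij_betw_def)
  define I where "I = f -` A"
  have fI: "f ` I = A" using rng by (auto simp: I_def)
  show thesis
  proof (rule that[of f I])
    fix a b
    have fab: "f a \<in> A \<union> B" "f b \<in> A \<union> B" using rng by auto
    show "f a \<bullet> f b = (if a = b then 1 else 0)"
    proof (cases "a = b")
      case True
      then show ?thesis using fab A(3) B(3) by (auto simp: norm_eq_1)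
    next
      case False
      then have "f a \<noteq> f b" using inj by (auto dest: injD)
      then show ?thesis using fab A(2) B(2) AB BA False
        by (auto simp: pairwise_def orthogonal_def)
    qed
  next
    show "f a \<in> S" if "a \<in> I" for a using that A(1) by (auto simp: I_def)
    show "f a \<bullet> k = 0" if "a \<notin> I" "k \<in> S" for a k
    proof -
      have "f a \<in> B" using that(1) rng by (auto simp: I_def)
      then show ?thesis using B(1) that(2) by (auto simp: T_def)
    qed
    show "card I = dim S" using fI card_image[of f I] inj A(4) by (metis inj_on_subset subset_UNIV)
    fix k assume "k \<in> S"
    then have "k \<in> span A" using A(6) by simp
    then obtain c where "k = (\<Sum>v\<in>A. c v *\<^sub>R v)" using span_finite[OF fin(1)] by auto
    also have "\<dots> = (\<Sum>a\<in>I. c (f a) *\<^sub>R f a)"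
      unfolding fI[symmetric] by (rule sum.reindex_cong[of f]) (use inj in \<open>auto intro: inj_on_subset\<close>)
    finally show "\<exists>c. k = (\<Sum>a\<in>I. c a *\<^sub>R f a)" by (intro exI[of _ "\<lambda>a. c (f a)"])
  qed
qed

text \<open>Conjugation by the orthogonal matrix with rows f a does not change the
  determinant.\<close>

lemma det_frame_mat:
  fixes z u :: "real^'q::finite^'p::finite"
  assumes f: "\<And>a b. f a \<bullet> f b = (if a = b then 1 else 0)"
  shows "det (mat 1 - z ** transpose u) = det (frame_mat f (\<lambda>b. f b v* u) z)"
proof -
  define H where "H = (\<chi> a. f a)"
  have HHt: "H ** transpose H = mat 1"
    by (simp add: vec_eq_iff matrix_matrix_mult_def transpose_def H_def mat_def inner_vec_def[symmetric] f[unfolded inner_vec_def] f)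
      (simp add: f[unfolded inner_vec_def inner_real_def])
  have entry: "(H ** M ** transpose H) $ a $ b = f a \<bullet> (M *v f b)" for M a b
  proof -
    have "(H ** M ** transpose H) $ a $ b = ((H ** M ** transpose H) *v axis b 1) $ a"
      by (simp only: matrix_vector_mult_basis column_def vec_lambda_beta)
    also have "\<dots> = (H *v (M *v (transpose H *v axis b 1))) $ a"
      by (simp only: matrix_vector_mul_assoc matrix_mul_assoc)
    also have "transpose H *v axis b 1 = f b"
      by (simp add: matrix_vector_mult_basis column_def vec_eq_iff transpose_def H_def del: transpose_matrix_vector)
    also have "(H *v (M *v f b)) $ a = f a \<bullet> (M *v f b)"
      by (simp add: matrix_vector_mult_def H_def inner_vec_def)
    finally show ?thesis .
  qed
  have "frame_mat f (\<lambda>b. f b v* u) z = H ** (mat 1 - z ** transpose u) ** transpose H"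
    unfolding vec_eq_iff entry
    by (simp add: frame_mat_def f matrix_vector_mult_diff_rdistrib inner_diff_right matrix_vector_mul_assoc[symmetric])
  then have "det (frame_mat f (\<lambda>b. f b v* u) z) = det (H ** transpose H) * det (mat 1 - z ** transpose u)"
    by (simp add: det_mul mult_ac)
  then show ?thesis by (simp add: HHt)
qed

text \<open>Adding one index multiplies the minor by a pivot of the form w . w - (w z) . (w u).
  Since z is a contraction this is at least half of w . w - (w u) . (w u). There the component of w
  in \<open>fixspace u\<close> drops out, and the remaining component e satisfies e . f j = 1, so
  the gap bounds the pivot below by \<kappa>/2.\<close>

lemma det_ge_minor:
  fixes z u :: "real^'q::finite^'p::finite"
  assumes z: "z \<in> mat_cball" and u: "u \<in> mat_cball"
    and f: "\<And>a b. f a \<bullet> f b = (if a = b then 1 else 0)"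
    and I0: "\<And>a. a \<in> I0 \<Longrightarrow> f a \<in> fixspace u"
    and span0: "\<And>k. k \<in> fixspace u \<Longrightarrow> \<exists>c. k = (\<Sum>a\<in>I0. c a *\<^sub>R f a)"
    and gap: "\<And>v. (\<And>k. k \<in> fixspace u \<Longrightarrow> v \<bullet> k = 0) \<Longrightarrow> \<kappa> * (v \<bullet> v) \<le> v \<bullet> v - (v v* u) \<bullet> (v v* u)"
    and \<kappa>: "0 < \<kappa>"
    and pos: "0 < det (submat I0 (frame_mat f (\<lambda>b. f b v* u) z))"
  shows "(\<kappa> / 2) ^ (CARD('p) - card I0) * det (submat I0 (frame_mat f (\<lambda>b. f b v* u) z)) \<le> det (mat 1 - z ** transpose u)"
proof -
  let ?A = "frame_mat f (\<lambda>b. f b v* u) z"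
  have step: "\<kappa> / 2 * det (submat I ?A) \<le> det (submat (insert j I) ?A)"
    if j: "j \<notin> I" "I0 \<subseteq> I" and p: "0 < det (submat I ?A)" for I j
  proof -
    obtain v where v: "v $ j = 1" "\<And>a. a \<notin> insert j I \<Longrightarrow> v $ a = 0" "\<And>a. a \<in> I \<Longrightarrow> (?A *v v) $ a = 0"
      using submat_pivot_exists[OF j(1)] p by (metis less_irrefl)
    define w where "w = (\<Sum>b\<in>UNIV. (v $ b) *\<^sub>R f b)"
    have wf: "w \<bullet> f a = v $ a" for a
    proof -
      have "w \<bullet> f a = (\<Sum>b\<in>UNIV. if b = a then v $ a else 0)"
        unfolding w_def inner_sum_left by (rule sum.cong[OF refl]) (simp add: f)
      then show ?thesis by simp
    qed
    have wu: "(\<Sum>b\<in>UNIV. (v $ b) *\<^sub>R (f b v* u)) = w v* u"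
    proof -
      have "linear (\<lambda>x. x v* u)" by (rule linearI) (simp_all add: vector_matrix_left_distrib vmult_scale)
      from linear_sum[OF this, of "\<lambda>b. (v $ b) *\<^sub>R f b" UNIV] show ?thesis
        unfolding w_def by (simp add: vmult_scale)
    qed
    have Av: "(?A *v v) $ a = v $ a - f a \<bullet> (z *v (w v* u))" for a
      by (simp add: frame_mat_mult wu)
    have "(\<Sum>a\<in>UNIV. v $ a * (?A *v v) $ a) = (\<Sum>a\<in>{j}. v $ a * (?A *v v) $ a)"
      by (rule sum.mono_neutral_right) (use v(2,3) in auto)
    then have "(?A *v v) $ j = (\<Sum>a\<in>UNIV. v $ a * (v $ a - f a \<bullet> (z *v (w v* u))))"
      using v(1) by (simp add: Av)
    also have "\<dots> = (\<Sum>a\<in>UNIV. v $ a * v $ a) - w \<bullet> (z *v (w v* u))"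
      by (simp add: right_diff_distrib sum_subtractf w_def inner_sum_left)
    also have "(\<Sum>a\<in>UNIV. v $ a * v $ a) = w \<bullet> w"
      unfolding w_def by (rule inner_orthonormal_sum[symmetric]) (use f in auto)
    also have "w \<bullet> (z *v (w v* u)) = (w v* z) \<bullet> (w v* u)" by (simp add: dot_lmul_matrix)
    finally have piv: "(?A *v v) $ j = w \<bullet> w - (w v* z) \<bullet> (w v* u)" .
    have "0 \<le> (w v* z - w v* u) \<bullet> (w v* z - w v* u)" by simp
    then have "2 * ((w v* z) \<bullet> (w v* u)) \<le> (w v* z) \<bullet> (w v* z) + (w v* u) \<bullet> (w v* u)"
      by (simp add: inner_diff_left inner_diff_right inner_commute)
    moreover have "(w v* z) \<bullet> (w v* z) \<le> w \<bullet> w"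
      using z unfolding mat_cball_iff by (simp add: norm_le)
    ultimately have piv2: "(w \<bullet> w - (w v* u) \<bullet> (w v* u)) / 2 \<le> (?A *v v) $ j" unfolding piv by simp
    define k where "k = (\<Sum>a\<in>I0. (v $ a) *\<^sub>R f a)"
    have kf: "k \<in> fixspace u" unfolding k_def
      by (intro subspace_sum subspace_scale subspace_fixspace I0)
    define e where "e = w - k"
    have ef: "e \<bullet> f a = 0" if "a \<in> I0" for a
    proof -
      have "k \<bullet> f a = (\<Sum>b\<in>I0. if b = a then v $ a else 0)"
        unfolding k_def inner_sum_left by (rule sum.cong[OF refl]) (simp add: f)
      then show ?thesis using that wf by (simp add: e_def inner_diff_left)
    qed
    have ek: "e \<bullet> k' = 0" if k': "k' \<in> fixspace u" for k'
    proof -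
      obtain c where "k' = (\<Sum>a\<in>I0. c a *\<^sub>R f a)" using span0[OF k'] by auto
      then show ?thesis using ef by (simp add: inner_sum_right)
    qed
    have kk: "u *v (k v* u) = k" using kf by (simp add: fixspace_def)
    have ku: "(k v* u) \<bullet> (x v* u) = k \<bullet> x" for x
      using kk by (metis dot_lmul_matrix inner_commute)
    have "w \<bullet> w - (w v* u) \<bullet> (w v* u) = e \<bullet> e - (e v* u) \<bullet> (e v* u)"
    proof -
      have w: "w = e + k" by (simp add: e_def)
      show ?thesis unfolding w vector_matrix_left_distrib inner_add_left inner_add_right
        using ku[of e] ku[of k] ek[OF kf] by (simp add: inner_commute)
    qed
    moreover have "\<kappa> * (e \<bullet> e) \<le> e \<bullet> e - (e v* u) \<bullet> (e v* u)" by (rule gap[OF ek])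
    moreover have "1 \<le> e \<bullet> e"
    proof -
      have "k \<bullet> f j = (\<Sum>b\<in>I0. 0)"
        unfolding k_def inner_sum_left by (rule sum.cong[OF refl]) (use j f in auto)
      then have "e \<bullet> f j = 1" using wf v(1) by (simp add: e_def inner_diff_left)
      then have "1 \<le> norm e * norm (f j)" using norm_cauchy_schwarz[of e "f j"] by simp
      moreover have "norm (f j) = 1" using f[of j j] by (simp add: norm_eq_1)
      ultimately have "1\<^sup>2 \<le> (norm e)\<^sup>2" by (intro power_mono) auto
      then show ?thesis by (simp add: power2_norm_eq_inner)
    qed
    ultimately have "\<kappa> \<le> w \<bullet> w - (w v* u) \<bullet> (w v* u)"
      using mult_left_mono[of 1 "e \<bullet> e" \<kappa>] \<kappa> by linarith
    then have "\<kappa> / 2 \<le> (w \<bullet> w - (w v* u) \<bullet> (w v* u)) / 2" by (rule divide_right_mono) simp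
    also note piv2
    finally have "\<kappa> / 2 \<le> (?A *v v) $ j" .
    then have "\<kappa> / 2 * det (submat I ?A) \<le> (?A *v v) $ j * det (submat I ?A)"
      using p by (intro mult_right_mono) auto
    then show ?thesis using det_submat_insert[OF j(1) v] by simp
  qed
  have "0 < det (submat (I0 \<union> J) ?A) \<and> (\<kappa> / 2) ^ card J * det (submat I0 ?A) \<le> det (submat (I0 \<union> J) ?A)"
    if "finite J" "J \<inter> I0 = {}" for J
    using that
  proof (induction J rule: finite_induct)
    case empty
    then show ?case using pos by simp
  next
    case (insert j J)
    then have IH: "0 < det (submat (I0 \<union> J) ?A)" "(\<kappa> / 2) ^ card J * det (submat I0 ?A) \<le> det (submat (I0 \<union> J) ?A)"
      by auto
    have s: "\<kappa> / 2 * det (submat (I0 \<union> J) ?A) \<le> det (submat (insert j (I0 \<union> J)) ?A)"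
      by (rule step) (use insert IH in auto)
    have "\<kappa> / 2 * ((\<kappa> / 2) ^ card J * det (submat I0 ?A)) \<le> \<kappa> / 2 * det (submat (I0 \<union> J) ?A)"
      using IH(2) \<kappa> by (intro mult_left_mono) auto
    moreover have "0 < \<kappa> / 2 * det (submat (I0 \<union> J) ?A)" using IH(1) \<kappa> by simp
    ultimately show ?case using s insert by (simp add: mult.assoc)
  qed
  from this[of "- I0"] have "(\<kappa> / 2) ^ card (- I0) * det (submat I0 ?A) \<le> det ?A" by (simp add: Compl_partition)
  then show ?thesis unfolding det_frame_mat[OF f] by (simp add: Compl_eq_Diff_UNIV card_Diff_subset)
qed

text \<open>In a frame adapted to \<open>fixspace u\<close> the vectors f a v* u are orthonormal for
  the indices of the kernel part, so the corresponding minor of size p - r falls under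
  \<open>minor_integral_local\<close>; \<open>det_ge_minor\<close> accounts for the other r pivots.
  Compactness is used twice, in t for the local balls and in u for the gap.\<close>

lemma kernel_integral_bound:
  fixes \<phi> :: "real^'n::finite \<Rightarrow> real^'q::finite^'p::finite"
  assumes ch: "surface_chart (stratum r) V \<phi> \<phi>'" and C: "compact C" "C \<subseteq> V"
    and \<beta>: "0 < \<beta>" "2 * \<beta> < real CARD('q) - real CARD('p) + 2 * real r" and r: "r \<le> CARD('p)"
  shows "\<exists>B\<ge>0. \<forall>u\<in>\<phi> ` C. (\<integral>\<^sup>+t\<in>C. negpow \<beta> (det (mat 1 - \<phi> t ** transpose u)) \<partial>lborel) \<le> ennreal B"
proof -
  define m where "m = CARD('p) - r"
  \<comment> \<open>With m = p - r the number q + r - m is q - p + 2 r, the bound in the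
    hypothesis.\<close>
  have \<beta>m: "2 * \<beta> < CARD('q) + r - real m" using \<beta>(2) r by (simp add: m_def of_nat_diff)
  have \<phi>V: "\<phi> ` V \<subseteq> stratum r" and der: "\<And>t. t \<in> V \<Longrightarrow> (\<phi> has_derivative blinfun_apply (\<phi>' t)) (at t)"
    using ch unfolding surface_chart_def by auto
  have c\<phi>: "continuous_on V \<phi>"
    using der by (meson continuous_at_imp_continuous_on has_derivative_continuous)
  define good where "good t0 \<rho> B \<longleftrightarrow> 0 < \<rho> \<and> 0 \<le> B \<and> (\<forall>f g (I :: 'p set). (\<forall>a b. f a \<bullet> f b = (if a = b then 1 else 0)) \<longrightarrow>
        (\<forall>a\<in>I. \<forall>b\<in>I. g a \<bullet> g b = (if a = b then 1 else 0)) \<longrightarrow> card I = m \<longrightarrow>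
      (\<integral>\<^sup>+t\<in>ball t0 \<rho>. negpow \<beta> (det (submat I (frame_mat f g (\<phi> t)))) \<partial>lborel) \<le> ennreal B)" for t0 \<rho> B
  have "\<exists>\<rho> B. good t0 \<rho> B" if "t0 \<in> C" for t0
    using minor_integral_local[OF ch subsetD[OF C(2) that] \<beta>(1) \<beta>m order_refl] unfolding good_def by (elim exE conjE) (intro exI conjI)
  then obtain \<rho> B where good: "\<And>t0. t0 \<in> C \<Longrightarrow> good t0 (\<rho> t0) (B t0)" by metis
  obtain T where T: "T \<subseteq> C" "finite T" "C \<subseteq> (\<Union>t\<in>T. ball t (\<rho> t))"
  proof (rule compactE_image[OF C(1), of C "\<lambda>t. ball t (\<rho> t)"])
    show "C \<subseteq> (\<Union>t\<in>C. ball t (\<rho> t))" using good by (force simp: good_def)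
  qed auto
  define B1 where "B1 = (\<Sum>t\<in>T. B t)"
  have B1: "0 \<le> B1" unfolding B1_def using good T(1) by (intro sum_nonneg) (auto simp: good_def)
  have int1: "(\<integral>\<^sup>+t\<in>C. negpow \<beta> (det (submat I (frame_mat f g (\<phi> t)))) \<partial>lborel) \<le> ennreal B1"
    if f: "\<And>a b. f a \<bullet> f b = (if a = b then 1 else 0)"
      and g: "\<And>a b. a \<in> I \<Longrightarrow> b \<in> I \<Longrightarrow> g a \<bullet> g b = (if a = b then 1 else 0)" and I: "card I = m"
    for f and g and I :: "'p set"
  proof -
    define F where "F t = negpow \<beta> (det (submat I (frame_mat f g (\<phi> t))))" for t
    define G where "G t = F t * indicator C t" for t
    have Gm: "G \<in> borel_measurable borel"
    proof -
      have "(\<lambda>s. if s \<in> C then det (submat I (frame_mat f g (\<phi> s))) else 0) \<in> borel_measurable borel"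
        using compact_imp_closed[OF C(1)]
        by (intro borel_measurable_continuous_on_if continuous_on_minor continuous_on_subset[OF c\<phi> C(2)]) auto
      then have "(\<lambda>s. negpow \<beta> (if s \<in> C then det (submat I (frame_mat f g (\<phi> s))) else 0) * indicator C s) \<in> borel_measurable borel"
        using compact_imp_closed[OF C(1)]
        by (intro borel_measurable_times_ennreal measurable_compose[OF _ negpow_measurable] borel_measurable_indicator) auto
      also have "(\<lambda>s. negpow \<beta> (if s \<in> C then det (submat I (frame_mat f g (\<phi> s))) else 0) * indicator C s) = G"
        by (auto simp: fun_eq_iff indicator_def G_def F_def)
      finally show ?thesis .
    qed
    have "(\<integral>\<^sup>+t. G t \<partial>lborel) \<le> (\<integral>\<^sup>+t. (\<Sum>s\<in>T. G t * indicator (ball s (\<rho> s)) t) \<partial>lborel)"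
    proof (rule nn_integral_mono)
      fix t :: "real^'n"
      show "G t \<le> (\<Sum>s\<in>T. G t * indicator (ball s (\<rho> s)) t)"
      proof (cases "t \<in> C")
        case True
        then obtain s where s: "s \<in> T" "t \<in> ball s (\<rho> s)" using T(3) by auto
        then have "G t = G t * indicator (ball s (\<rho> s)) t" by simp
        also have "\<dots> \<le> (\<Sum>s\<in>T. G t * indicator (ball s (\<rho> s)) t)" by (rule member_le_sum[OF s(1)]) (use T in auto)
        finally show ?thesis .
      qed (simp add: G_def)
    qed
    also have "\<dots> = (\<Sum>s\<in>T. \<integral>\<^sup>+t. G t * indicator (ball s (\<rho> s)) t \<partial>lborel)"
      using Gm by (intro nn_integral_sum borel_measurable_times_ennreal borel_measurable_indicator) auto
    also have "\<dots> \<le> (\<Sum>s\<in>T. ennreal (B s))"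
    proof (rule sum_mono)
      fix s assume s: "s \<in> T"
      have "(\<integral>\<^sup>+t. G t * indicator (ball s (\<rho> s)) t \<partial>lborel) \<le> (\<integral>\<^sup>+t\<in>ball s (\<rho> s). F t \<partial>lborel)"
        by (intro nn_integral_mono) (auto simp: G_def indicator_def)
      also have "\<dots> \<le> ennreal (B s)"
      proof -
        have "good s (\<rho> s) (B s)" using good s T(1) by blast
        then have "\<forall>f g (I :: 'p set). (\<forall>a b. f a \<bullet> f b = (if a = b then 1 else 0)) \<longrightarrow>
          (\<forall>a\<in>I. \<forall>b\<in>I. g a \<bullet> g b = (if a = b then 1 else 0)) \<longrightarrow> card I = m \<longrightarrow>
          (\<integral>\<^sup>+t\<in>ball s (\<rho> s). negpow \<beta> (det (submat I (frame_mat f g (\<phi> t)))) \<partial>lborel) \<le> ennreal (B s)"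
          unfolding good_def by (elim conjE)
        from this[rule_format, of f I g, OF f g I] show ?thesis unfolding F_def .
      qed
      finally show "(\<integral>\<^sup>+t. G t * indicator (ball s (\<rho> s)) t \<partial>lborel) \<le> ennreal (B s)" .
    qed
    also have "\<dots> = ennreal B1" unfolding B1_def using good T(1) by (intro sum_ennreal) (auto simp: good_def)
    finally show ?thesis by (simp add: G_def F_def)
  qed
  have "\<exists>\<epsilon> \<kappa>. 0 < \<epsilon> \<and> 0 < \<kappa> \<and> (\<forall>u\<in>stratum r. norm (u - u0) < \<epsilon> \<longrightarrow> (\<forall>v. (\<forall>k\<in>fixspace u. v \<bullet> k = 0) \<longrightarrow>
      \<kappa> * (v \<bullet> v) \<le> v \<bullet> v - (v v* u) \<bullet> (v v* u)))" if "u0 \<in> \<phi> ` C" for u0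
  proof -
    have "u0 \<in> stratum r" using that \<phi>V C(2) by auto
    then obtain \<epsilon> \<kappa> where "0 < \<epsilon>" "0 < \<kappa>" "\<kappa> \<le> 1"
      "\<And>u v. u \<in> stratum r \<Longrightarrow> norm (u - u0) < \<epsilon> \<Longrightarrow> (\<And>k. k \<in> fixspace u \<Longrightarrow> v \<bullet> k = 0) \<Longrightarrow>
        \<kappa> * (v \<bullet> v) \<le> v \<bullet> v - (v v* u) \<bullet> (v v* u)"
      using fixspace_gap_uniform by metis
    then show ?thesis by (intro exI[of _ \<epsilon>] exI[of _ \<kappa>]) simp
  qed
  then obtain \<epsilon> \<kappa> where \<epsilon>\<kappa>: "\<And>u0. u0 \<in> \<phi> ` C \<Longrightarrow> 0 < \<epsilon> u0 \<and> 0 < \<kappa> u0 \<and> (\<forall>u\<in>stratum r. norm (u - u0) < \<epsilon> u0 \<longrightarrow> (\<forall>v. (\<forall>k\<in>fixspace u. v \<bullet> k = 0) \<longrightarrow>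
      \<kappa> u0 * (v \<bullet> v) \<le> v \<bullet> v - (v v* u) \<bullet> (v v* u)))" by metis
  have cC: "compact (\<phi> ` C)" by (intro compact_continuous_image continuous_on_subset[OF c\<phi> C(2)] C(1))
  obtain U where U: "U \<subseteq> \<phi> ` C" "finite U" "\<phi> ` C \<subseteq> (\<Union>u\<in>U. ball u (\<epsilon> u))"
  proof (rule compactE_image[OF cC, of "\<phi> ` C" "\<lambda>u. ball u (\<epsilon> u)"])
    show "\<phi> ` C \<subseteq> (\<Union>u\<in>\<phi> ` C. ball u (\<epsilon> u))" using \<epsilon>\<kappa> by (force simp del: image_iff)
  qed auto
  \<comment> \<open>The price of the r pivots that are bounded below by \<kappa>/2.\<close>
  define M where "M u = ((\<kappa> u / 2) ^ r) powr (- \<beta>)" for u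
  define B2 where "B2 = (\<Sum>u\<in>U. M u) * B1"
  have B2: "0 \<le> B2" using B1 by (simp add: B2_def M_def sum_nonneg)
  have "(\<integral>\<^sup>+t\<in>C. negpow \<beta> (det (mat 1 - \<phi> t ** transpose u)) \<partial>lborel) \<le> ennreal B2" if u: "u \<in> \<phi> ` C" for u
  proof -
    obtain u0 where u0: "u0 \<in> U" "norm (u - u0) < \<epsilon> u0" using U(3) u by (auto simp: dist_norm norm_minus_commute)
    have u0C: "u0 \<in> \<phi> ` C" using U(1) u0(1) by blast
    have us: "u \<in> stratum r" using u \<phi>V C(2) by auto
    have uc: "u \<in> mat_cball" and du: "r + dim (fixspace u) = CARD('p)" using us by (simp_all add: stratum_iff)
    have \<kappa>: "0 < \<kappa> u0" using \<epsilon>\<kappa>[OF u0C] by simp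
    have gap: "\<kappa> u0 * (v \<bullet> v) \<le> v \<bullet> v - (v v* u) \<bullet> (v v* u)" if "\<And>k. k \<in> fixspace u \<Longrightarrow> v \<bullet> k = 0" for v
      using \<epsilon>\<kappa>[OF u0C] us u0(2) that by simp
    obtain f :: "'p \<Rightarrow> real^'p" and I where f: "\<And>a b. f a \<bullet> f b = (if a = b then 1 else 0)"
      and I: "\<And>a. a \<in> I \<Longrightarrow> f a \<in> fixspace u" "card I = dim (fixspace u)"
        "\<And>k. k \<in> fixspace u \<Longrightarrow> \<exists>c. k = (\<Sum>a\<in>I. c a *\<^sub>R f a)"
    proof (rule adapted_orthonormal_basis[OF subspace_fixspace[of u]])
      fix f :: "'p \<Rightarrow> real^'p" and I
      assume *: "\<And>a b. f a \<bullet> f b = (if a = b then 1 else 0)" "\<And>a. a \<in> I \<Longrightarrow> f a \<in> fixspace u"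
        "card I = dim (fixspace u)" "\<And>k. k \<in> fixspace u \<Longrightarrow> \<exists>c. k = (\<Sum>a\<in>I. c a *\<^sub>R f a)"
      show thesis by (rule that[of f I]; fact *)
    qed
    have cI: "card I = m" "CARD('p) - card I = r" using I(2) du by (simp_all add: m_def)
    \<comment> \<open>Multiplication of rows by u is isometric on \<open>fixspace u\<close>, since
      moving u to the other factor returns f b.\<close>
    have g: "(f a v* u) \<bullet> (f b v* u) = (if a = b then 1 else 0)" if "a \<in> I" "b \<in> I" for a b
      using I(1)[OF that(2)] f[of a b] by (simp add: dot_lmul_matrix fixspace_def)
    have Mpos: "0 < (\<kappa> u0 / 2) ^ r" using \<kappa> by simp
    have pw: "negpow \<beta> (det (mat 1 - z ** transpose u)) \<le> ennreal (M u0) * negpow \<beta> (det (submat I (frame_mat f (\<lambda>b. f b v* u) z)))"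
      if z: "z \<in> mat_cball" for z
    proof (cases "0 < det (submat I (frame_mat f (\<lambda>b. f b v* u) z))")
      case True
      have "(\<kappa> u0 / 2) ^ r * det (submat I (frame_mat f (\<lambda>b. f b v* u) z)) \<le> det (mat 1 - z ** transpose u)"
        using det_ge_minor[OF z uc f I(1) I(3) gap \<kappa> True] cI(2) by simp
      then have "negpow \<beta> (det (mat 1 - z ** transpose u)) \<le> negpow \<beta> ((\<kappa> u0 / 2) ^ r * det (submat I (frame_mat f (\<lambda>b. f b v* u) z)))"
        using \<beta>(1) by (intro negpow_antimono) auto
      also have "\<dots> = negpow \<beta> ((\<kappa> u0 / 2) ^ r) * negpow \<beta> (det (submat I (frame_mat f (\<lambda>b. f b v* u) z)))"
        by (rule negpow_mult[OF True])
      also have "negpow \<beta> ((\<kappa> u0 / 2) ^ r) = ennreal (M u0)" using Mpos by (simp add: negpow_def M_def)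
      finally show ?thesis .
    next
      case False
      moreover have "0 < M u0" using Mpos \<kappa> by (simp add: M_def)
      ultimately show ?thesis by (simp add: negpow_def ennreal_mult_top)
    qed
    have "(\<integral>\<^sup>+t\<in>C. negpow \<beta> (det (mat 1 - \<phi> t ** transpose u)) \<partial>lborel)
       \<le> (\<integral>\<^sup>+t. ennreal (M u0) * (negpow \<beta> (det (submat I (frame_mat f (\<lambda>b. f b v* u) (\<phi> t)))) * indicator C t) \<partial>lborel)"
    proof (rule nn_integral_mono)
      fix t :: "real^'n"
      show "negpow \<beta> (det (mat 1 - \<phi> t ** transpose u)) * indicator C t
        \<le> ennreal (M u0) * (negpow \<beta> (det (submat I (frame_mat f (\<lambda>b. f b v* u) (\<phi> t)))) * indicator C t)"
      proof (cases "t \<in> C")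
        case True
        have "\<phi> t \<in> stratum r" by (rule subsetD[OF \<phi>V imageI[OF subsetD[OF C(2) True]]])
        then have "\<phi> t \<in> mat_cball" by (simp add: stratum_iff)
        then show ?thesis using pw True by simp
      qed simp
    qed
    also have "\<dots> = ennreal (M u0) * (\<integral>\<^sup>+t\<in>C. negpow \<beta> (det (submat I (frame_mat f (\<lambda>b. f b v* u) (\<phi> t)))) \<partial>lborel)"
    proof (rule nn_integral_cmult)
      have "(\<lambda>s. if s \<in> C then det (submat I (frame_mat f (\<lambda>b. f b v* u) (\<phi> s))) else 0) \<in> borel_measurable borel"
        using compact_imp_closed[OF C(1)]
        by (intro borel_measurable_continuous_on_if continuous_on_minor continuous_on_subset[OF c\<phi> C(2)]) auto
      then have "(\<lambda>s. negpow \<beta> (if s \<in> C then det (submat I (frame_mat f (\<lambda>b. f b v* u) (\<phi> s))) else 0) * indicator C s) \<in> borel_measurable borel"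
        using compact_imp_closed[OF C(1)]
        by (intro borel_measurable_times_ennreal measurable_compose[OF _ negpow_measurable] borel_measurable_indicator) auto
      also have "(\<lambda>s. negpow \<beta> (if s \<in> C then det (submat I (frame_mat f (\<lambda>b. f b v* u) (\<phi> s))) else 0) * indicator C s)
         = (\<lambda>s. negpow \<beta> (det (submat I (frame_mat f (\<lambda>b. f b v* u) (\<phi> s)))) * indicator C s)"
        by (auto simp: fun_eq_iff indicator_def)
      finally show "(\<lambda>s. negpow \<beta> (det (submat I (frame_mat f (\<lambda>b. f b v* u) (\<phi> s)))) * indicator C s) \<in> borel_measurable lborel" by simp
    qed
    also have "\<dots> \<le> ennreal (M u0) * ennreal B1"
      by (intro mult_left_mono int1[OF f g cI(1)]) auto
    also have "\<dots> = ennreal (M u0 * B1)" using B1 by (subst ennreal_mult) (simp_all add: M_def)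
    also have "\<dots> \<le> ennreal B2"
    proof -
      have "M u0 \<le> (\<Sum>u\<in>U. M u)" by (rule member_le_sum[OF u0(1) _ U(2)]) (simp add: M_def)
      then show ?thesis unfolding B2_def by (rule ennreal_leI[OF mult_right_mono[OF _ B1]])
    qed
    finally show ?thesis .
  qed
  then show ?thesis by (intro exI[of _ B2] conjI ballI B2)
qed

section \<open>Kernel estimates\<close>

text \<open>Operator norm at most s, in a form without suprema.\<close>

definition opb :: "real \<Rightarrow> real^'q::finite^'p::finite \<Rightarrow> bool" where
  "opb s z \<longleftrightarrow> (\<forall>v. norm (z *v v) \<le> s * norm v)"

lemma opb_mono: "opb s z \<Longrightarrow> s \<le> t \<Longrightarrow> opb t z"
  unfolding opb_def by (meson mult_right_mono norm_ge_zero order_trans)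

lemma opb_add: "opb s z \<Longrightarrow> opb t w \<Longrightarrow> opb (s + t) (z + w)"
  unfolding opb_def
  by (simp add: matrix_vector_mult_add_rdistrib distrib_right norm_triangle_le add_mono)

lemma opb_scale: 
  assumes "opb s z" shows "opb (\<bar>c\<bar> * s) (c *\<^sub>R z)"
proof -
  have "(c *\<^sub>R z) *v v = c *\<^sub>R (z *v v)" for v by (simp add: scaleR_matrix_vector_assoc)
  then show ?thesis using assms unfolding opb_def
    by (simp add: mult.assoc mult_left_mono)
qed

lemma opb_diff: 
  assumes "opb s z" "opb t w" shows "opb (s + t) (z - w)"
  using opb_add[OF assms(1) opb_scale[OF assms(2), of "-1"]] by simp

lemma opb_mult:
  assumes z: "opb s z" and w: "opb t w" and s: "0 \<le> s" shows "opb (s * t) (z ** w)"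
  unfolding opb_def
proof
  fix v
  have "norm (z *v (w *v v)) \<le> s * norm (w *v v)" using z by (simp add: opb_def)
  also have "\<dots> \<le> s * (t * norm v)" using w s by (intro mult_left_mono) (auto simp: opb_def)
  finally show "norm (z ** w *v v) \<le> s * t * norm v"
    by (simp add: matrix_vector_mul_assoc[symmetric] mult.assoc)
qed

lemma opb_transpose:
  fixes z :: "real^'q::finite^'p::finite"
  assumes "opb s z" shows "opb s (transpose z)"
  unfolding opb_def
proof
  fix v
  let ?w = "transpose z *v v"
  have "norm ?w * norm ?w = ?w \<bullet> ?w" by (simp add: power2_norm_eq_inner[symmetric] power2_eq_square)
  also have "\<dots> = v \<bullet> (z *v ?w)" by (simp add: dot_lmul_matrix)
  also have "\<dots> \<le> norm v * norm (z *v ?w)" by (rule norm_cauchy_schwarz)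
  also have "\<dots> \<le> norm v * (s * norm ?w)" using assms by (intro mult_left_mono) (auto simp: opb_def)
  finally have "norm ?w * norm ?w \<le> (s * norm v) * norm ?w" by (simp add: mult_ac)
  moreover have "0 \<le> s * norm v"
  proof (cases "s < 0")
    case True
    have "norm (z *v axis undefined 1) \<le> s * norm (axis undefined (1::real) :: real^'q)"
      using assms unfolding opb_def by blast
    then have "norm (z *v axis undefined 1) \<le> s" by simp
    then have False using True norm_ge_zero[of "z *v axis undefined 1"] by linarith
    then show ?thesis ..
  qed simp
  ultimately show "norm ?w \<le> s * norm v"
    by (cases "norm ?w = 0") (auto simp: mult_le_cancel_right)
qed

lemma opb_entry:
  assumes "opb s z" shows "\<bar>z $ i $ j\<bar> \<le> s"
proof -
  have "norm (z *v axis j 1) \<le> s * norm (axis j (1::real))" using assms unfolding opb_def by blast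
  then have "norm (z *v axis j 1) \<le> s" by simp
  then have "\<bar>(z *v axis j 1) $ i\<bar> \<le> s" using component_le_norm_cart order_trans by blast
  then show ?thesis by (simp add: matrix_vector_mult_basis column_def)
qed

lemma opb_unit_mat: "opb 1 (unit_mat i j)"
  unfolding opb_def
proof
  fix v
  have "unit_mat i j *v v = axis i (v $ j)"
    by (simp add: vec_eq_iff matrix_vector_mult_def unit_mat_def axis_def if_distrib if_distribR cong: if_cong)
  also have "axis i (v $ j) = (v $ j) *\<^sub>R axis i 1" by (simp add: vec_eq_iff axis_def)
  finally show "norm (unit_mat i j *v v) \<le> 1 * norm v" by (simp add: component_le_norm_cart)
qed

lemma opb_1_iff: "opb 1 z \<longleftrightarrow> z \<in> mat_cball"
proof
  assume "opb 1 z"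
  then show "z \<in> mat_cball" unfolding opb_def mat_cball_def by (auto intro: onorm_le)
next
  assume "z \<in> mat_cball"
  then have "onorm (\<lambda>x. z *v x) \<le> 1" by (simp add: mat_cball_def)
  moreover have "norm (z *v v) \<le> onorm (\<lambda>x. z *v x) * norm v" for v by (rule onorm) simp
  ultimately show "opb 1 z" unfolding opb_def
    by (meson mult_right_mono norm_ge_zero order_trans)
qed

lemma opb_onorm: "opb (onorm (\<lambda>x. z *v x)) z"
  unfolding opb_def by (auto intro: onorm)

lemma opb_mat_ball: "opb s z \<Longrightarrow> s < 1 \<Longrightarrow> z \<in> mat_ball"
  unfolding opb_def mat_ball_def by (auto intro: order.strict_trans1[OF onorm_le])

lemma open_mat_ball: "open (mat_ball :: (real^'q::finite^'p::finite) set)"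
  unfolding open_dist
proof
  fix z :: "real^'q^'p" assume "z \<in> mat_ball"
  then have z: "onorm (\<lambda>x. z *v x) < 1" by (simp add: mat_ball_def)
  obtain K where K: "K > 0" "\<And>A (v :: real^'q). norm ((A :: real^'q^'p) *v v) \<le> norm A * norm v * K"
    using bounded_bilinear.pos_bounded[OF bounded_bilinear_matrix_vector] by metis
  define e where "e = (1 - onorm (\<lambda>x. z *v x)) / (2 * K)"
  have e: "e > 0" using z K by (simp add: e_def)
  have "y \<in> mat_ball" if "dist y z < e" for y
  proof -
    have "opb (norm (y - z) * K) (y - z)" unfolding opb_def using K(2) by (simp add: mult_ac)
    moreover have "norm (y - z) * K \<le> e * K" using that K(1) by (intro mult_right_mono) (auto simp: dist_norm)
    moreover have "e * K = (1 - onorm (\<lambda>x. z *v x)) / 2" using K(1) by (simp add: e_def)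
    ultimately have "opb ((1 - onorm (\<lambda>x. z *v x)) / 2) (y - z)" by (metis opb_mono)
    from opb_add[OF opb_onorm[of z] this] have "opb ((1 + onorm (\<lambda>x. z *v x)) / 2) y" by (simp add: field_simps)
    then show ?thesis using z by (auto intro: opb_mat_ball)
  qed
  then show "\<exists>e>0. \<forall>y. dist y z < e \<longrightarrow> y \<in> mat_ball" using e by blast
qed

lemma opb_sub_nonsing:
  fixes X :: "real^'p::finite^'p"
  assumes X: "opb s X" and s: "s < 1"
  shows "norm v * (1 - s) \<le> norm ((mat 1 - X) *v v)" "det (mat 1 - X) \<noteq> 0"
proof -
  show *: "norm v * (1 - s) \<le> norm ((mat 1 - X) *v v)" for v
  proof -
    have "norm v - norm (X *v v) \<le> norm (v - X *v v)" by (rule norm_triangle_ineq2)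
    moreover have "norm (X *v v) \<le> s * norm v" using X by (simp add: opb_def)
    ultimately show ?thesis by (simp add: matrix_vector_mult_diff_rdistrib algebra_simps)
  qed
  have "v = 0" if "(mat 1 - X) *v v = 0" for v using *[of v] that s by (simp add: mult_le_0_iff)
  then have "\<exists>B. B ** (mat 1 - X) = mat 1" by (simp add: matrix_left_invertible_ker)
  then show "det (mat 1 - X) \<noteq> 0" by (metis invertible_det_nz invertible_left_inverse)
qed

lemma continuous_on_det_affine: "continuous_on S (\<lambda>t::real. det (mat 1 - t *\<^sub>R (X :: real^'p::finite^'p)))"
  unfolding det_def by (intro continuous_intros)

text \<open>The determinant of 1 - t X is continuous in t, equals 1 at t = 0 and cannot vanish for t
  in [0, 1], where t X still has norm below 1.\<close>

lemma opb_det_pos: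
  fixes X :: "real^'p::finite^'p"
  assumes X: "opb s X" and s: "0 \<le> s" "s < 1"
  shows "0 < det (mat 1 - X)"
proof (rule ccontr)
  define g where "g t = det (mat 1 - t *\<^sub>R X)" for t
  assume "\<not> 0 < det (mat 1 - X)"
  then have "g 1 \<le> 0" "0 \<le> g 0" by (simp_all add: g_def)
  then obtain t where t: "0 \<le> t" "t \<le> 1" "g t = 0"
    using IVT2'[of g 1 0 0] continuous_on_det_affine unfolding g_def by auto
  have "opb (\<bar>t\<bar> * s) (t *\<^sub>R X)" by (rule opb_scale[OF X])
  moreover have "\<bar>t\<bar> * s < 1" using t s mult_left_le_one_le[of s t] by simp
  ultimately show False using opb_sub_nonsing(2) t(3) unfolding g_def by blast
qed

lemma det_bound:
  fixes A :: "real^'p::finite^'p"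
  assumes "\<And>i j. \<bar>A $ i $ j\<bar> \<le> b"
  shows "\<bar>det A\<bar> \<le> fact CARD('p) * b ^ CARD('p)"
proof -
  have "\<bar>det A\<bar> \<le> (\<Sum>p | p permutes (UNIV :: 'p set). \<bar>of_int (sign p) * (\<Prod>i\<in>UNIV. A $ i $ p i)\<bar>)"
    unfolding det_def by (rule sum_abs)
  also have "\<dots> \<le> (\<Sum>p | p permutes (UNIV :: 'p set). b ^ CARD('p))"
  proof (rule sum_mono)
    fix p :: "'p \<Rightarrow> 'p"
    have "\<bar>of_int (sign p) * (\<Prod>i\<in>UNIV. A $ i $ p i)\<bar> = (\<Prod>i\<in>UNIV. \<bar>A $ i $ p i\<bar>)"
      by (simp add: abs_mult abs_prod sign_def)
    also have "\<dots> \<le> (\<Prod>i\<in>(UNIV :: 'p set). b)" by (intro prod_mono) (use assms in auto)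
    finally show "\<bar>of_int (sign p) * (\<Prod>i\<in>UNIV. A $ i $ p i)\<bar> \<le> b ^ CARD('p)" by simp
  qed
  also have "\<dots> = fact CARD('p) * b ^ CARD('p)" by (simp add: card_permutations)
  finally show ?thesis .
qed

lemma mat_diff_mult: "(A - B) ** C = A ** C - B ** (C :: real^'n^'m::finite)"
  by (simp add: vec_eq_iff matrix_matrix_mult_def left_diff_distrib sum_subtractf)

text \<open>The determinant at boundary points is controlled by its values at points of a nontangential
  approach region: \<open>1 - X = (1 - M) (1 - X')\<close> with \<open>M\<close> bounded.\<close>

lemma det_compare:
  fixes x y \<xi> \<eta> :: "real^'q::finite^'p::finite"
  assumes x: "opb 1 x" and y: "opb 1 y" and \<xi>: "opb (1 - a / 4) \<xi>" and \<eta>: "opb (1 - a / 4) \<eta>"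
    and dx: "opb (3 / 2 * a) (x - \<xi>)" and dy: "opb (3 / 2 * a) (y - \<eta>)" and a: "0 < a" "a \<le> 1"
  shows "0 < det (mat 1 - \<xi> ** transpose \<eta>)"
    "det (mat 1 - x ** transpose y) \<le> fact CARD('p) * 13 ^ CARD('p) * det (mat 1 - \<xi> ** transpose \<eta>)"
proof -
  define X X' where "X = x ** transpose y" and "X' = \<xi> ** transpose \<eta>"
  have "opb ((1 - a / 4) * 1) X'" unfolding X'_def
    by (rule opb_mult[OF \<xi> opb_transpose[OF opb_mono[OF \<eta>]]]) (use a in auto)
  then have X': "opb (1 - a / 4) X'" by simp
  show pos: "0 < det (mat 1 - \<xi> ** transpose \<eta>)"
    using opb_det_pos[OF X'] a unfolding X'_def by simp
  have XX: "X - X' = (x - \<xi>) ** transpose y + \<xi> ** transpose (y - \<eta>)"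
    by (simp add: X_def X'_def vec_eq_iff matrix_matrix_mult_def transpose_def sum.distrib[symmetric] sum_subtractf[symmetric] algebra_simps)
  have "opb (3 / 2 * a * 1) ((x - \<xi>) ** transpose y)"
    by (rule opb_mult[OF dx opb_transpose[OF y]]) (use a in auto)
  moreover have "opb (1 * (3 / 2 * a)) (\<xi> ** transpose (y - \<eta>))"
    by (rule opb_mult[OF opb_mono[OF \<xi>] opb_transpose[OF dy]]) (use a in auto)
  ultimately have d: "opb (3 * a) (X - X')" unfolding XX using opb_add by fastforce
  have nz: "det (mat 1 - X') \<noteq> 0" using pos by (simp add: X'_def)
  then obtain R where R: "(mat 1 - X') ** R = mat 1" "R ** (mat 1 - X') = mat 1"
    unfolding invertible_det_nz[symmetric] invertible_def by blast
  \<comment> \<open>The matrix 1 - X' is bounded below by a/4, so its inverse has norm at most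
    4/a.\<close>
  have Rb: "opb (4 / a) R" unfolding opb_def
  proof
    fix v
    have "norm (R *v v) * (1 - (1 - a / 4)) \<le> norm ((mat 1 - X') *v (R *v v))"
      by (rule opb_sub_nonsing(1)[OF X']) (use a in auto)
    then have "norm (R *v v) * a \<le> 4 * norm v" by (simp add: matrix_vector_mul_assoc R)
    then show "norm (R *v v) \<le> 4 / a * norm v" using a by (simp add: pos_le_divide_eq)
  qed
  define M where "M = (X - X') ** R"
  \<comment> \<open>Nontangential approach pays off here: the difference is of order a and the
    inverse of order 1/a. The product has norm at most 12, so the entries of 1 - M are at most 13 in
    absolute value.\<close>
  have "opb (3 * a * (4 / a)) M" unfolding M_def by (rule opb_mult[OF d Rb]) (use a in auto)
  then have M: "opb 12 M" using a by simp
  have "(mat 1 - M) ** (mat 1 - X') = (mat 1 - X') - (X - X') ** (R ** (mat 1 - X'))"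
    unfolding M_def by (simp add: matrix_mul_assoc mat_diff_mult)
  also have "\<dots> = mat 1 - X" by (simp add: R)
  finally have dd: "det (mat 1 - X) = det (mat 1 - M) * det (mat 1 - X')" by (metis det_mul)
  have "\<bar>(mat 1 - M) $ i $ j\<bar> \<le> 13" for i j
    using opb_entry[OF M, of i j] by (auto simp: mat_def)
  then have "\<bar>det (mat 1 - M)\<bar> \<le> fact CARD('p) * 13 ^ CARD('p)" by (rule det_bound)
  then have "det (mat 1 - M) * det (mat 1 - X') \<le> fact CARD('p) * 13 ^ CARD('p) * det (mat 1 - X')"
    using pos by (intro mult_right_mono) (auto simp: X'_def)
  then show "det (mat 1 - x ** transpose y) \<le> fact CARD('p) * 13 ^ CARD('p) * det (mat 1 - \<xi> ** transpose \<eta>)"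
    using dd by (simp add: X_def X'_def)
qed

section \<open>Polynomial functions and derivatives of powers of the kernel determinant\<close>

lemma real_polynomial_function_direction:
  assumes "real_polynomial_function P"
  shows "\<exists>P'. real_polynomial_function P' \<and> (\<forall>x. ((\<lambda>t. P (x + t *\<^sub>R w)) has_real_derivative P' x) (at 0))"
  using assms
proof (induction P rule: real_polynomial_function.induct)
  case (linear f)
  interpret bounded_linear f by fact
  have "((\<lambda>t. f (x + t *\<^sub>R w)) has_real_derivative f w) (at 0)" for x
    unfolding add scaleR by (auto intro!: derivative_eq_intros)
  then show ?case by (intro exI[of _ "\<lambda>_. f w"]) (auto intro: real_polynomial_function.intros(2))
next
  case (const c)
  show ?case by (rule exI[of _ "\<lambda>_. 0"]) (auto intro: real_polynomial_function.intros(2))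
next
  case (add f g)
  then obtain f' g' where "real_polynomial_function f'" "\<forall>x. ((\<lambda>t. f (x + t *\<^sub>R w)) has_real_derivative f' x) (at 0)"
    "real_polynomial_function g'" "\<forall>x. ((\<lambda>t. g (x + t *\<^sub>R w)) has_real_derivative g' x) (at 0)" by blast
  then show ?case
    by (intro exI[of _ "\<lambda>x. f' x + g' x"]) (auto intro: real_polynomial_function.intros(3) DERIV_add)
next
  case (mult f g)
  then obtain f' g' where *: "real_polynomial_function f'" "\<And>x. ((\<lambda>t. f (x + t *\<^sub>R w)) has_real_derivative f' x) (at 0)"
    "real_polynomial_function g'" "\<And>x. ((\<lambda>t. g (x + t *\<^sub>R w)) has_real_derivative g' x) (at 0)" by metis
  have "((\<lambda>t. f (x + t *\<^sub>R w) * g (x + t *\<^sub>R w)) has_real_derivative f' x * g x + g' x * f x) (at 0)" for x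
    using DERIV_mult[OF *(2)[of x] *(4)[of x]] by simp
  moreover have "real_polynomial_function (\<lambda>x. f' x * g x + g' x * f x)"
    by (intro real_polynomial_function.intros(3,4) * mult)
  ultimately show ?case by (intro exI[of _ "\<lambda>x. f' x * g x + g' x * f x"]) simp
qed

lemma real_polynomial_function_lipschitz:
  fixes P :: "'a::real_normed_vector \<Rightarrow> real"
  assumes "real_polynomial_function P"
  shows "\<exists>L\<ge>0. \<forall>x y. norm x \<le> B \<longrightarrow> norm y \<le> B \<longrightarrow> \<bar>P x\<bar> \<le> L \<and> \<bar>P x - P y\<bar> \<le> L * norm (x - y)"
  using assms
proof (induction P rule: real_polynomial_function.induct)
  case (linear f)
  interpret bounded_linear f by fact
  obtain K where K: "K > 0" "\<And>x. norm (f x) \<le> norm x * K" using pos_bounded by metis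
  show ?case
  proof (rule exI[of _ "K * \<bar>B\<bar> + K"], intro conjI allI impI)
    show "0 \<le> K * \<bar>B\<bar> + K" using K by simp
    fix x y :: 'a assume "norm x \<le> B" "norm y \<le> B"
    then have "norm x * K \<le> \<bar>B\<bar> * K" using K(1) by (intro mult_right_mono) auto
    then have "norm x * K \<le> K * \<bar>B\<bar>" by (simp only: mult.commute)
    then show "\<bar>f x\<bar> \<le> K * \<bar>B\<bar> + K" using K(2)[of x] K(1) unfolding real_norm_def by linarith
    have "norm (x - y) * K \<le> (K * \<bar>B\<bar> + K) * norm (x - y)" using K(1) by (simp add: algebra_simps)
    then show "\<bar>f x - f y\<bar> \<le> (K * \<bar>B\<bar> + K) * norm (x - y)" using K(2)[of "x - y"] by (simp add: diff)
  qed
next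
  case (const c)
  show ?case by (rule exI[of _ "\<bar>c\<bar>"]) auto
next
  case (add f g)
  then obtain L1 L2 where L: "0 \<le> L1" "\<And>x y. norm x \<le> B \<Longrightarrow> norm y \<le> B \<Longrightarrow> \<bar>f x\<bar> \<le> L1 \<and> \<bar>f x - f y\<bar> \<le> L1 * norm (x - y)"
    "0 \<le> L2" "\<And>x y. norm x \<le> B \<Longrightarrow> norm y \<le> B \<Longrightarrow> \<bar>g x\<bar> \<le> L2 \<and> \<bar>g x - g y\<bar> \<le> L2 * norm (x - y)" by metis
  show ?case
  proof (rule exI[of _ "L1 + L2"], intro conjI allI impI)
    fix x y :: 'a assume *: "norm x \<le> B" "norm y \<le> B"
    show "\<bar>f x + g x\<bar> \<le> L1 + L2" using L(2)[OF *] L(4)[OF *] by linarith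
    have "(L1 + L2) * norm (x - y) = L1 * norm (x - y) + L2 * norm (x - y)" by (simp add: algebra_simps)
    then show "\<bar>f x + g x - (f y + g y)\<bar> \<le> (L1 + L2) * norm (x - y)" using L(2)[OF *] L(4)[OF *] by linarith
  qed (use L in auto)
next
  case (mult f g)
  then obtain L1 L2 where L: "0 \<le> L1" "\<And>x y. norm x \<le> B \<Longrightarrow> norm y \<le> B \<Longrightarrow> \<bar>f x\<bar> \<le> L1 \<and> \<bar>f x - f y\<bar> \<le> L1 * norm (x - y)"
    "0 \<le> L2" "\<And>x y. norm x \<le> B \<Longrightarrow> norm y \<le> B \<Longrightarrow> \<bar>g x\<bar> \<le> L2 \<and> \<bar>g x - g y\<bar> \<le> L2 * norm (x - y)" by metis
  show ?case
  proof (rule exI[of _ "2 * (L1 * L2)"], intro conjI allI impI)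
    show "0 \<le> 2 * (L1 * L2)" using L by simp
    fix x y :: 'a assume *: "norm x \<le> B" "norm y \<le> B"
    have a: "\<bar>f x\<bar> * \<bar>g x\<bar> \<le> L1 * L2" using L(1) L(2)[OF *] L(4)[OF *] by (intro mult_mono) auto
    have LL: "0 \<le> L1 * L2" using L by simp
    show "\<bar>f x * g x\<bar> \<le> 2 * (L1 * L2)" using a LL by (simp add: abs_mult)
    have "\<bar>f x\<bar> * \<bar>g x - g y\<bar> \<le> L1 * (L2 * norm (x - y))" using L(1) L(2)[OF *] L(4)[OF *] by (intro mult_mono) auto
    moreover have "\<bar>f x - f y\<bar> * \<bar>g y\<bar> \<le> (L1 * norm (x - y)) * L2"
      using L(1) L(2)[OF *] L(4)[OF *(2,1)] by (intro mult_mono) auto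
    moreover have "f x * g x - f y * g y = f x * (g x - g y) + (f x - f y) * g y" by (simp add: algebra_simps)
    then have "\<bar>f x * g x - f y * g y\<bar> \<le> \<bar>f x\<bar> * \<bar>g x - g y\<bar> + \<bar>f x - f y\<bar> * \<bar>g y\<bar>"
      by (metis abs_mult abs_triangle_ineq)
    ultimately show "\<bar>f x * g x - f y * g y\<bar> \<le> 2 * (L1 * L2) * norm (x - y)" by (simp add: mult_ac)
  qed
qed

definition kdet :: "(real^'q::finite^'p::finite) \<times> (real^'q^'p) \<Rightarrow> real" where
  "kdet \<zeta> = det (mat 1 - fst \<zeta> ** transpose (snd \<zeta>))"

lemma real_polynomial_function_kdet: "real_polynomial_function (kdet :: (real^'q::finite^'p::finite) \<times> _ \<Rightarrow> real)"
proof -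
  have 1: "real_polynomial_function (\<lambda>\<zeta> :: (real^'q^'p) \<times> (real^'q^'p). fst \<zeta> $ i $ j)" for i j
    by (intro real_polynomial_function.intros(1) bounded_linear_compose[OF bounded_linear_vec_nth]
        bounded_linear_fst)
  have 2: "real_polynomial_function (\<lambda>\<zeta> :: (real^'q^'p) \<times> (real^'q^'p). snd \<zeta> $ i $ j)" for i j
    by (intro real_polynomial_function.intros(1) bounded_linear_compose[OF bounded_linear_vec_nth]
        bounded_linear_snd)
  have "real_polynomial_function (\<lambda>\<zeta> :: (real^'q^'p) \<times> (real^'q^'p).
      \<Sum>p | p permutes (UNIV::'p set). of_int (sign p) * (\<Prod>i\<in>UNIV. (mat 1 :: real^'p^'p) $ i $ p i - (\<Sum>j\<in>UNIV. fst \<zeta> $ i $ j * snd \<zeta> $ p i $ j)))"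
    by (intro real_polynomial_function_sum real_polynomial_function.intros(4) real_polynomial_function_prod
        real_polynomial_function_diff real_polynomial_function.intros(2) 1 2) auto
  then show ?thesis by (simp add: kdet_def[abs_def] det_def matrix_matrix_mult_def transpose_def)
qed

lemma kdet_pos: 
  assumes "\<zeta> \<in> mat_ball \<times> mat_ball" shows "0 < kdet \<zeta>"
proof -
  have s: "onorm (\<lambda>x. fst \<zeta> *v x) < 1" "onorm (\<lambda>x. snd \<zeta> *v x) < 1"
    using assms by (auto simp: mat_ball_def)
  have "opb (onorm (\<lambda>x. fst \<zeta> *v x) * 1) (fst \<zeta> ** transpose (snd \<zeta>))"
    by (rule opb_mult[OF opb_onorm opb_transpose[OF opb_mono[OF opb_onorm]]])
      (use s in \<open>auto intro: onorm_pos_le\<close>)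
  then show ?thesis unfolding kdet_def using s by (intro opb_det_pos) (auto intro: onorm_pos_le)
qed

text \<open>One differentiation of P times the power -a of \<open>kdet\<close> raises the exponent
  by one and replaces P by P' kdet - a P D', again a polynomial. Applied to k derivatives in each
  variable this yields the exponent \<alpha> + 2 k.\<close>

lemma kdet_iter_deriv:
  assumes "real_polynomial_function P"
  shows "\<exists>Q. real_polynomial_function Q \<and>
    iter_deriv (mat_ball \<times> mat_ball) ws (\<lambda>\<zeta>. P \<zeta> * kdet \<zeta> powr (- a)) (\<lambda>\<zeta>. Q \<zeta> * kdet \<zeta> powr (- (a + length ws)))"
  using assms
proof (induction ws arbitrary: P a)
  case Nil
  then show ?case by (auto intro!: exI[of _ P])
next
  case (Cons w ws)
  obtain P' where P': "real_polynomial_function P'" "\<And>x. ((\<lambda>t. P (x + t *\<^sub>R w)) has_real_derivative P' x) (at 0)"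
    using real_polynomial_function_direction[OF Cons.prems] by metis
  obtain D' where D': "real_polynomial_function D'" "\<And>x. ((\<lambda>t. kdet (x + t *\<^sub>R w)) has_real_derivative D' x) (at 0)"
    using real_polynomial_function_direction[OF real_polynomial_function_kdet] by metis
  define P1 where "P1 x = P' x * kdet x - a * P x * D' x" for x
  have P1: "real_polynomial_function P1" unfolding P1_def
    by (intro real_polynomial_function_diff real_polynomial_function.intros(4) real_polynomial_function.intros(2)
        real_polynomial_function_kdet Cons.prems P' D')
  obtain Q where Q: "real_polynomial_function Q"
    "iter_deriv (mat_ball \<times> mat_ball) ws (\<lambda>\<zeta>. P1 \<zeta> * kdet \<zeta> powr (- (a + 1))) (\<lambda>\<zeta>. Q \<zeta> * kdet \<zeta> powr (- (a + 1 + length ws)))"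
    using Cons.IH[OF P1, of "a + 1"] by (elim exE conjE) (rule that)
  have der: "((\<lambda>t. P (x + t *\<^sub>R w) * kdet (x + t *\<^sub>R w) powr (- a)) has_real_derivative P1 x * kdet x powr (- (a + 1))) (at 0)"
    if "x \<in> mat_ball \<times> mat_ball" for x
  proof -
    have pos: "0 < kdet x" by (rule kdet_pos[OF that])
    have "((\<lambda>t. kdet (x + t *\<^sub>R w) powr (- a)) has_real_derivative (- a) * kdet (x + 0 *\<^sub>R w) powr (- a - of_nat 1) * D' x) (at 0)"
      by (rule DERIV_fun_powr[OF D'(2)]) (use pos in simp)
    then have k: "((\<lambda>t. kdet (x + t *\<^sub>R w) powr (- a)) has_real_derivative (- a) * kdet x powr (- (a + 1)) * D' x) (at 0)"
      by simp
    have "kdet x powr (- a) = kdet x * kdet x powr (- (a + 1))"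
      using pos by (simp add: powr_mult_base)
    then have e: "P' x * kdet (x + 0 *\<^sub>R w) powr (- a) + (- a * kdet x powr (- (a + 1)) * D' x) * P (x + 0 *\<^sub>R w) = P1 x * kdet x powr (- (a + 1))"
      unfolding P1_def by (simp add: left_diff_distrib)
    show ?thesis using DERIV_mult[OF P'(2)[of x] k] unfolding e .
  qed
  have "iter_deriv (mat_ball \<times> mat_ball) (w # ws) (\<lambda>\<zeta>. P \<zeta> * kdet \<zeta> powr (- a)) (\<lambda>\<zeta>. Q \<zeta> * kdet \<zeta> powr (- (a + 1 + length ws)))"
    unfolding iter_deriv.simps
    by (intro exI[of _ "\<lambda>\<zeta>. P1 \<zeta> * kdet \<zeta> powr (- (a + 1))"] conjI ballI Q(2) der)
  moreover have "a + 1 + real (length ws) = a + real (length (w # ws))" by simp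
  ultimately show ?case using Q(1) by (intro exI[of _ Q] conjI) (simp_all only:)
qed

section \<open>Difference quotients inside the ball and their kernel pairings\<close>

definition unit_dir :: "'p::finite \<times> 'q::finite \<Rightarrow> real^'q^'p" where
  "unit_dir d = unit_mat (fst d) (snd d)"

text \<open>A finite-difference surrogate of \<open>pderivs ds f x\<close> at scale \<open>a\<close> that only uses points of the open
  ball.\<close>

definition dlist :: "('p::finite \<times> 'q::finite) list \<Rightarrow> real \<Rightarrow> real^'q^'p \<Rightarrow> (real \<times> (real^'q^'p)) list" where
  "dlist ds a x = (let h = a / (2 * (length ds + 1)) in
     scale_list (1 / h ^ length ds) (fdlist (map (\<lambda>d. h *\<^sub>R unit_dir d) (rev ds)) ((1 - a) *\<^sub>R x)))"

lemma opb_sbox: "0 \<le> h \<Longrightarrow> v \<in> sbox (map (\<lambda>d. h *\<^sub>R unit_dir d) ds) \<Longrightarrow> opb (h * length ds) v"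
proof (induction ds arbitrary: v)
  case Nil
  then show ?case by (simp add: opb_def)
next
  case (Cons d ds)
  then obtain t w where v: "v = t *\<^sub>R (h *\<^sub>R unit_dir d) + w" "0 \<le> t" "t \<le> 1" "w \<in> sbox (map (\<lambda>d. h *\<^sub>R unit_dir d) ds)"
    by auto
  have "opb (\<bar>t * h\<bar> * 1) ((t * h) *\<^sub>R unit_dir d)" by (intro opb_scale) (simp add: unit_dir_def opb_unit_mat)
  moreover have "\<bar>t * h\<bar> * 1 \<le> h" using v Cons.prems by (simp add: mult_left_le_one_le)
  ultimately have "opb h ((t * h) *\<^sub>R unit_dir d)" by (rule opb_mono)
  from opb_add[OF this Cons.IH[OF Cons.prems(1) v(4)]] show ?case by (simp add: v(1) algebra_simps)
qed

lemma sbox_pair: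
  "v \<in> sbox (map (\<lambda>w. (w, 0)) ws @ map (\<lambda>w. (0, w)) ws') \<Longrightarrow> fst v \<in> sbox ws \<and> snd v \<in> sbox ws'"
proof (induction ws arbitrary: v)
  case Nil
  then show ?case
  proof (induction ws' arbitrary: v)
    case (Cons w ws')
    then obtain t u where "v = t *\<^sub>R (0, w) + u" "t \<in> {0..1}" "u \<in> sbox (map (\<lambda>w. (0, w)) ws')" by auto
    with Cons.IH[of u] show ?case by (auto intro!: sbox_ConsI)
  qed simp
next
  case (Cons w ws)
  then obtain t u where "v = t *\<^sub>R (w, 0) + u" "t \<in> {0..1}" "u \<in> sbox (map (\<lambda>w. (w, 0)) ws @ map (\<lambda>w. (0, w)) ws')" by auto
  with Cons.IH[of u] show ?case by (auto intro!: sbox_ConsI)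
qed

text \<open>The k steps of length a / (2 (k + 1)) move the base point (1 - a) x by at most a/2 in
  operator norm. The 1 added to k keeps the step length meaningful when k = 0.\<close>

lemma dlist_point:
  assumes x: "opb 1 x" and a: "0 < a" "a \<le> 1"
    and v: "v \<in> sbox (map (\<lambda>d. (a / (2 * (length ds + 1))) *\<^sub>R unit_dir d) (rev ds))"
  shows "opb (1 - a / 2) ((1 - a) *\<^sub>R x + v)" "opb (3 / 2 * a) (x - ((1 - a) *\<^sub>R x + v))"
proof -
  have "opb (a / (2 * (length ds + 1)) * length (rev ds)) v" by (rule opb_sbox[OF _ v]) (use a in simp)
  moreover have "a / (2 * (length ds + 1)) * length (rev ds) \<le> a / 2" using a by (simp add: field_simps)
  ultimately have vb: "opb (a / 2) v" by (rule opb_mono)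
  have "opb (\<bar>1 - a\<bar> * 1 + a / 2) ((1 - a) *\<^sub>R x + v)" by (intro opb_add opb_scale x vb)
  then show "opb (1 - a / 2) ((1 - a) *\<^sub>R x + v)" using a by (simp add: algebra_simps)
  have "opb (\<bar>a\<bar> * 1 + a / 2) (a *\<^sub>R x - v)" by (intro opb_diff opb_scale x vb)
  then show "opb (3 / 2 * a) (x - ((1 - a) *\<^sub>R x + v))" using a by (simp add: algebra_simps)
qed

lemma dlist_points:
  fixes x :: "real^'q::finite^'p::finite"
  assumes x: "opb 1 x" and a: "0 < a" "a \<le> 1"
  shows "snd ` set (dlist ds a x) \<subseteq> mat_ball"
proof -
  have "z \<in> mat_ball" if z: "z \<in> snd ` set (dlist ds a x)" for z :: "real^'q^'p"
  proof -
    obtain c where "(c, z) \<in> set (fdlist (map (\<lambda>d. (a / (2 * (length ds + 1))) *\<^sub>R unit_dir d) (rev ds)) ((1 - a) *\<^sub>R x))"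
      using z by (auto simp: dlist_def Let_def scale_list_def)
    from set_fdlist[OF this] obtain v where v: "v \<in> sbox (map (\<lambda>d. (a / (2 * (length ds + 1))) *\<^sub>R unit_dir d) (rev ds))"
      "z = (1 - a) *\<^sub>R x + v" by auto
    show ?thesis unfolding v(2) by (rule opb_mat_ball[OF dlist_point(1)[OF x a v(1)]]) (use a in simp)
  qed
  then show ?thesis by blast
qed

lemma kern_kdet: "(\<lambda>(x, y). kern \<alpha> x y) = (\<lambda>\<zeta>. 1 * kdet \<zeta> powr (- \<alpha>))"
  by (auto simp: kern_def kdet_def fun_eq_iff)

text \<open>The pairing is a difference quotient of total order 2 k of the kernel on the product
  space. By the mean value theorem it equals a mixed derivative at one intermediate point, the step
  lengths cancelling against the normalisation. The polynomial Q is the same for all points and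
  scales.\<close>

lemma ev2_dlist_value:
  fixes ds :: "('p::finite \<times> 'q::finite) list"
  shows "\<exists>Q :: (real^'q^'p) \<times> (real^'q^'p) \<Rightarrow> real. real_polynomial_function Q \<and> (\<forall>x y a b. opb 1 x \<longrightarrow> opb 1 y \<longrightarrow> 0 < a \<longrightarrow> a \<le> 1 \<longrightarrow> 0 < b \<longrightarrow> b \<le> 1 \<longrightarrow>
    (\<exists>\<xi> \<eta>. ev2 (dlist ds a x) (dlist ds b y) (kern \<alpha>) = Q (\<xi>, \<eta>) * kdet (\<xi>, \<eta>) powr (- (\<alpha> + 2 * real (length ds)))
      \<and> opb (1 - a / 2) \<xi> \<and> opb (3 / 2 * a) (x - \<xi>) \<and> opb (1 - b / 2) \<eta> \<and> opb (3 / 2 * b) (y - \<eta>)))"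
proof -
  let ?S = "mat_ball \<times> mat_ball :: ((real^'q^'p) \<times> (real^'q^'p)) set"
  define k where "k = length ds"
  define W :: "((real^'q^'p) \<times> (real^'q^'p)) list" where
    "W = map (\<lambda>d. (unit_dir d, 0)) (rev ds) @ map (\<lambda>d. (0, unit_dir d)) (rev ds)"
  have "real_polynomial_function (\<lambda>\<zeta> :: (real^'q^'p) \<times> (real^'q^'p). 1)" by (rule real_polynomial_function.intros(2))
  from kdet_iter_deriv[OF this, of W \<alpha>] obtain Q where Q: "real_polynomial_function Q"
    "iter_deriv ?S W (\<lambda>\<zeta>. 1 * kdet \<zeta> powr (- \<alpha>)) (\<lambda>\<zeta>. Q \<zeta> * kdet \<zeta> powr (- (\<alpha> + length W)))"
    by (elim exE conjE) (rule that)
  have lW: "real (length W) = 2 * real k" by (simp add: W_def k_def)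
  have main: "\<exists>\<xi> \<eta>. ev2 (dlist ds a x) (dlist ds b y) (kern \<alpha>) = Q (\<xi>, \<eta>) * kdet (\<xi>, \<eta>) powr (- (\<alpha> + 2 * real k))
      \<and> opb (1 - a / 2) \<xi> \<and> opb (3 / 2 * a) (x - \<xi>) \<and> opb (1 - b / 2) \<eta> \<and> opb (3 / 2 * b) (y - \<eta>)"
    if x: "opb 1 x" and y: "opb 1 y" and a: "0 < a" "a \<le> 1" and b: "0 < b" "b \<le> 1" for x y a b
  proof -
    define h where "h = a / (2 * (length ds + 1))"
    define h' where "h' = b / (2 * (length ds + 1))"
    have h: "h \<noteq> 0" "h' \<noteq> 0" using a b by (simp_all add: h_def h'_def)
    define ws :: "(real^'q^'p) list" where "ws = map (\<lambda>d. h *\<^sub>R unit_dir d) (rev ds)"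
    define ws' :: "(real^'q^'p) list" where "ws' = map (\<lambda>d. h' *\<^sub>R unit_dir d) (rev ds)"
    define cws :: "(real \<times> ((real^'q^'p) \<times> (real^'q^'p))) list" where
      "cws = map (\<lambda>d. (h, (unit_dir d, 0))) (rev ds) @ map (\<lambda>d. (h', (0, unit_dir d))) (rev ds)"
    have 1: "map snd cws = W" by (simp add: cws_def W_def)
    have 2: "map (\<lambda>(c, w). c *\<^sub>R w) cws = map (\<lambda>w. (w, 0)) ws @ map (\<lambda>w. (0, w)) ws'"
      by (simp add: cws_def ws_def ws'_def)
    have c: "prod_list (map (\<lambda>d. t) ds') = t ^ length ds'" for t :: real and ds' :: "('p \<times> 'q) list"
      by (induction ds') auto
    have 3: "prod_list (map fst cws) = h ^ k * h' ^ k" by (simp add: cws_def k_def comp_def rev_map[symmetric] c)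
    have it: "iter_deriv ?S (map (\<lambda>w. (w, 0)) ws @ map (\<lambda>w. (0, w)) ws') (\<lambda>\<zeta>. 1 * kdet \<zeta> powr (- \<alpha>))
       (\<lambda>\<zeta>. h ^ k * h' ^ k * (Q \<zeta> * kdet \<zeta> powr (- (\<alpha> + length W))))"
      using iter_deriv_scale[of ?S cws, OF open_Times[OF open_mat_ball open_mat_ball]] Q(2)
      unfolding 1 2 3 by blast
    have pt: "opb (1 - a / 2) ((1 - a) *\<^sub>R x + fst v)" "opb (3 / 2 * a) (x - ((1 - a) *\<^sub>R x + fst v))"
      "opb (1 - b / 2) ((1 - b) *\<^sub>R y + snd v)" "opb (3 / 2 * b) (y - ((1 - b) *\<^sub>R y + snd v))"
      if "v \<in> sbox (map (\<lambda>w. (w, 0)) ws @ map (\<lambda>w. (0, w)) ws')" for v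
      using sbox_pair[OF that] dlist_point[OF x a, where ds = ds] dlist_point[OF y b, where ds = ds]
      unfolding ws_def ws'_def h_def h'_def by blast+
    have "\<exists>v\<in>sbox (map (\<lambda>w. (w, 0)) ws @ map (\<lambda>w. (0, w)) ws').
      fdiff (map (\<lambda>w. (w, 0)) ws @ map (\<lambda>w. (0, w)) ws') (\<lambda>\<zeta>. 1 * kdet \<zeta> powr (- \<alpha>)) ((1 - a) *\<^sub>R x, (1 - b) *\<^sub>R y)
      = h ^ k * h' ^ k * (Q (((1 - a) *\<^sub>R x, (1 - b) *\<^sub>R y) + v) * kdet (((1 - a) *\<^sub>R x, (1 - b) *\<^sub>R y) + v) powr (- (\<alpha> + length W)))"
    proof (rule fdiff_mvt[OF it])
      fix v assume v: "v \<in> sbox (map (\<lambda>w. (w, 0)) ws @ map (\<lambda>w. (0, w)) ws')"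
      have "(1 - a) *\<^sub>R x + fst v \<in> mat_ball" by (rule opb_mat_ball[OF pt(1)[OF v]]) (use a in simp)
      moreover have "(1 - b) *\<^sub>R y + snd v \<in> mat_ball" by (rule opb_mat_ball[OF pt(3)[OF v]]) (use b in simp)
      ultimately show "((1 - a) *\<^sub>R x, (1 - b) *\<^sub>R y) + v \<in> ?S" by (simp add: plus_prod_def)
    qed
    then obtain v where v: "v \<in> sbox (map (\<lambda>w. (w, 0)) ws @ map (\<lambda>w. (0, w)) ws')" and
      fd: "fdiff (map (\<lambda>w. (w, 0)) ws @ map (\<lambda>w. (0, w)) ws') (\<lambda>\<zeta>. 1 * kdet \<zeta> powr (- \<alpha>)) ((1 - a) *\<^sub>R x, (1 - b) *\<^sub>R y)
      = h ^ k * h' ^ k * (Q (((1 - a) *\<^sub>R x, (1 - b) *\<^sub>R y) + v) * kdet (((1 - a) *\<^sub>R x, (1 - b) *\<^sub>R y) + v) powr (- (\<alpha> + length W)))"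
      by (elim bexE) (rule that)
    have "ev2 (dlist ds a x) (dlist ds b y) (kern \<alpha>) = 1 / h ^ k * (1 / h' ^ k) *
       ev2 (fdlist ws ((1 - a) *\<^sub>R x)) (fdlist ws' ((1 - b) *\<^sub>R y)) (kern \<alpha>)"
    proof -
      have 1: "dlist ds a x = scale_list (1 / h ^ k) (fdlist ws ((1 - a) *\<^sub>R x))"
        by (simp only: dlist_def Let_def h_def ws_def k_def)
      have 2: "dlist ds b y = scale_list (1 / h' ^ k) (fdlist ws' ((1 - b) *\<^sub>R y))"
        by (simp only: dlist_def Let_def h'_def ws'_def k_def)
      show ?thesis unfolding 1 2 by (simp only: ev2_def ev_scale ev_cmult mult_ac)
    qed
    also have "ev2 (fdlist ws ((1 - a) *\<^sub>R x)) (fdlist ws' ((1 - b) *\<^sub>R y)) (kern \<alpha>) = 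
       h ^ k * h' ^ k * (Q (((1 - a) *\<^sub>R x, (1 - b) *\<^sub>R y) + v) * kdet (((1 - a) *\<^sub>R x, (1 - b) *\<^sub>R y) + v) powr (- (\<alpha> + length W)))"
      unfolding ev2_fdlist kern_kdet by (rule fd)
    also have "1 / h ^ k * (1 / h' ^ k) * (h ^ k * h' ^ k * (Q (((1 - a) *\<^sub>R x, (1 - b) *\<^sub>R y) + v) * kdet (((1 - a) *\<^sub>R x, (1 - b) *\<^sub>R y) + v) powr (- (\<alpha> + length W))))
       = Q ((1 - a) *\<^sub>R x + fst v, (1 - b) *\<^sub>R y + snd v) * kdet ((1 - a) *\<^sub>R x + fst v, (1 - b) *\<^sub>R y + snd v) powr (- (\<alpha> + 2 * real k))"
      using h by (simp add: lW plus_prod_def)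
    finally show ?thesis using pt[OF v] by blast
  qed
  show ?thesis using Q(1) main unfolding k_def by blast
qed

lemma opb_norm:
  fixes z :: "real^'q::finite^'p::finite" and s :: real
  assumes "opb s z" shows "norm z \<le> CARD('p) * (CARD('q) * s)"
proof -
  have "norm (z $ i) \<le> CARD('q) * s" for i
  proof -
    have "norm (z $ i) \<le> (\<Sum>j\<in>UNIV. \<bar>z $ i $ j\<bar>)" by (rule norm_le_l1_cart)
    also have "\<dots> \<le> (\<Sum>j\<in>(UNIV::'q set). s)" by (intro sum_mono opb_entry assms)
    finally show ?thesis by simp
  qed
  then have "(\<Sum>i\<in>UNIV. norm (z $ i)) \<le> (\<Sum>i\<in>(UNIV::'p set). CARD('q) * s)" by (intro sum_mono)
  then show ?thesis using norm_le_sum_rows[of z] by simp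
qed

lemma powr_neg_diff_bound:
  fixes s t e c :: real
  assumes "e \<le> s" "e \<le> t" "0 < e" "0 \<le> c"
  shows "\<bar>s powr (- c) - t powr (- c)\<bar> \<le> c * e powr (- c - 1) * \<bar>s - t\<bar>"
proof -
  have "norm (s powr (- c) - t powr (- c)) \<le> c * e powr (- c - 1) * norm (s - t)"
  proof (rule field_differentiable_bound[of "{e..}" "\<lambda>z. z powr (- c)" "\<lambda>z. (- c) * z powr (- c - 1)"])
    fix z assume z: "z \<in> {e..}"
    then have "0 < z" using assms by simp
    then show "((\<lambda>z. z powr (- c)) has_field_derivative (- c) * z powr (- c - 1)) (at z within {e..})"
      by (rule has_field_derivative_at_within[OF has_real_derivative_powr])
    have "z powr (- c - 1) \<le> e powr (- c - 1)" using z assms by (intro powr_mono2') auto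
    then show "norm ((- c) * z powr (- c - 1)) \<le> c * e powr (- c - 1)"
      using assms by (simp add: abs_mult mult_left_mono)
  qed (use assms in auto)
  then show ?thesis by simp
qed

text \<open>If a <= d, the factor a of the second bound is at most a^\<gamma> d^(1 - \<gamma>); if a
  > d, the first bound is weakened by replacing d^\<gamma> with a^\<gamma>.\<close>

lemma interpolation_bound:
  fixes a d c \<gamma> C X :: real
  assumes "X \<le> C * d powr (- c)" "X \<le> C * a * d powr (- c - 1)" "0 < a" "0 < d" "0 \<le> C" "0 < \<gamma>" "\<gamma> \<le> 1"
  shows "X \<le> C * a powr \<gamma> * d powr (- (c + \<gamma>))"
proof (cases "a \<le> d")
  case True
  have "a = a powr \<gamma> * a powr (1 - \<gamma>)" using assms(3) by (simp add: powr_add[symmetric])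
  also have "\<dots> \<le> a powr \<gamma> * d powr (1 - \<gamma>)" using True assms by (intro mult_left_mono powr_mono2) auto
  finally have "C * a * d powr (- c - 1) \<le> C * (a powr \<gamma> * d powr (1 - \<gamma>)) * d powr (- c - 1)"
    using assms by (intro mult_right_mono mult_left_mono) auto
  also have "\<dots> = C * a powr \<gamma> * (d powr (1 - \<gamma>) * d powr (- c - 1))" by simp
  also have "d powr (1 - \<gamma>) * d powr (- c - 1) = d powr ((1 - \<gamma>) + (- c - 1))" by (simp only: powr_add)
  also have "(1 - \<gamma>) + (- c - 1) = - (c + \<gamma>)" by simp
  finally show ?thesis using assms(2) by simp
next
  case False
  have "d powr (- c) = d powr \<gamma> * d powr (- (c + \<gamma>))" by (subst powr_add[symmetric]) simp
  also have "\<dots> \<le> a powr \<gamma> * d powr (- (c + \<gamma>))" using False assms by (intro mult_right_mono powr_mono2) auto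
  finally have "C * d powr (- c) \<le> C * (a powr \<gamma> * d powr (- (c + \<gamma>)))" using assms by (intro mult_left_mono) auto
  then show ?thesis using assms(1) by simp
qed

text \<open>The difference has a trivial bound of order d^-c and a Lipschitz bound of order a d^(-c
  - 1), where d = kdet (x, y) enters through \<open>det_compare\<close>. Interpolation gives up
  \<gamma> in the exponent of d and gains the factor a^\<gamma>, which is what makes dyadic scales
  summable.\<close>

lemma kernel_hoelder:
  fixes Q :: "(real^'q::finite^'p::finite) \<times> (real^'q^'p) \<Rightarrow> real"
  assumes Q: "real_polynomial_function Q" and c: "0 \<le> c" and \<gamma>: "0 < \<gamma>" "\<gamma> \<le> 1"
  defines "near \<equiv> \<lambda>(a :: real) x y (\<zeta> :: (real^'q^'p) \<times> (real^'q^'p)). opb (1 - a / 4) (fst \<zeta>) \<and> opb (1 - a / 4) (snd \<zeta>)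
      \<and> opb (3 / 2 * a) (x - fst \<zeta>) \<and> opb (3 / 2 * a) (y - snd \<zeta>)"
  shows "\<exists>C\<ge>0. \<forall>x y a \<zeta> \<zeta>'. opb 1 x \<longrightarrow> opb 1 y \<longrightarrow> 0 < a \<longrightarrow> a \<le> 1 \<longrightarrow> 0 < kdet (x, y) \<longrightarrow> near a x y \<zeta> \<longrightarrow> near a x y \<zeta>' \<longrightarrow>
     \<bar>Q \<zeta> * kdet \<zeta> powr (- c)\<bar> \<le> C * kdet (x, y) powr (- (c + \<gamma>)) \<and>
     \<bar>Q \<zeta> * kdet \<zeta> powr (- c) - Q \<zeta>' * kdet \<zeta>' powr (- c)\<bar> \<le> C * a powr \<gamma> * kdet (x, y) powr (- (c + \<gamma>))"
proof -
  define R where "R = 2 * real CARD('p) * real CARD('q)"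
  have R: "0 \<le> R" by (simp add: R_def)
  obtain L where L: "0 \<le> L" "\<And>\<zeta> \<zeta>'. norm \<zeta> \<le> R \<Longrightarrow> norm \<zeta>' \<le> R \<Longrightarrow> \<bar>Q \<zeta>\<bar> \<le> L \<and> \<bar>Q \<zeta> - Q \<zeta>'\<bar> \<le> L * norm (\<zeta> - \<zeta>')"
    using real_polynomial_function_lipschitz[OF Q, of R] by metis
  obtain M where M: "0 \<le> M" "\<And>\<zeta> \<zeta>' :: (real^'q^'p) \<times> (real^'q^'p). norm \<zeta> \<le> R \<Longrightarrow> norm \<zeta>' \<le> R \<Longrightarrow> \<bar>kdet \<zeta>\<bar> \<le> M \<and> \<bar>kdet \<zeta> - kdet \<zeta>'\<bar> \<le> M * norm (\<zeta> - \<zeta>')"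
    using real_polynomial_function_lipschitz[OF real_polynomial_function_kdet, of R] by metis
  \<comment> \<open>The constant of \<open>det_compare\<close>: at every admissible point
    \<open>kdet\<close> is at least d / D.\<close>
  define D :: real where "D = fact CARD('p) * 13 ^ CARD('p)"
  have D: "0 < D" by (simp add: D_def)
  have pair_norm: "norm \<zeta> \<le> R * s" if "opb s (fst \<zeta>)" "opb s (snd \<zeta>)" for \<zeta> :: "(real^'q^'p) \<times> (real^'q^'p)" and s
  proof -
    have "norm \<zeta> \<le> norm (fst \<zeta>) + norm (snd \<zeta>)" by (metis norm_Pair_le prod.collapse)
    also have "\<dots> \<le> R * s" using opb_norm[OF that(1)] opb_norm[OF that(2)] by (simp add: R_def)
    finally show ?thesis .
  qed
  define C1 where "C1 = 2 * L * D powr c"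
  define C2 where "C2 = 3 * R * L * D powr c * M + L * c * M * 3 * R * D powr (c + 1)"
  \<comment> \<open>The entry with M belongs to the first claim, where d <= M is used to pass from
    the power -c to the power -(c + \<gamma>).\<close>
  define C where "C = max (C1 * M powr \<gamma>) (max C1 C2)"
  have C1: "0 \<le> C1" using L by (simp add: C1_def)
  have C2: "0 \<le> C2" using L M R c by (simp add: C2_def)
  have C: "0 \<le> C" "C1 \<le> C" "C2 \<le> C" "C1 * M powr \<gamma> \<le> C" using C1 by (auto simp: C_def)
  have main: "\<bar>Q \<zeta> * kdet \<zeta> powr (- c)\<bar> \<le> C * kdet (x, y) powr (- (c + \<gamma>)) \<and>
     \<bar>Q \<zeta> * kdet \<zeta> powr (- c) - Q \<zeta>' * kdet \<zeta>' powr (- c)\<bar> \<le> C * a powr \<gamma> * kdet (x, y) powr (- (c + \<gamma>))"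
    if x: "opb 1 x" and y: "opb 1 y" and a: "0 < a" "a \<le> 1" and d0: "0 < kdet (x, y)"
      and n: "near a x y \<zeta>" "near a x y \<zeta>'" for x y a \<zeta> \<zeta>'
  proof -
    define d where "d = kdet (x, y)"
    have d: "0 < d" using d0 by (simp add: d_def)
    have dM: "d \<le> M"
      using M(2)[of "(x, y)" "(x, y)"] pair_norm[of 1 "(x, y)"] x y unfolding d_def by fastforce
    define e where "e = d / D"
    have e: "0 < e" using d D by (simp add: e_def)
    have low: "e \<le> kdet z" "norm z \<le> R" if z: "near a x y z" for z
    proof -
      have "d \<le> D * kdet z"
        using det_compare(2)[OF x y _ _ _ _ a, of "fst z" "snd z"] z unfolding near_def d_def D_def kdet_def by simp
      then show "e \<le> kdet z" using D by (simp add: e_def pos_divide_le_eq mult.commute)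
      have "opb 1 (fst z)" "opb 1 (snd z)"
        using z a unfolding near_def by (auto elim: opb_mono)
      then show "norm z \<le> R" using pair_norm[of 1 z] by simp
    qed
    have dist: "norm (\<zeta> - \<zeta>') \<le> R * (3 * a)"
    proof (rule pair_norm)
      have "opb (3 / 2 * a + 3 / 2 * a) ((x - fst \<zeta>') - (x - fst \<zeta>))"
        by (rule opb_diff) (use n in \<open>simp_all add: near_def\<close>)
      then show "opb (3 * a) (fst (\<zeta> - \<zeta>'))" by simp
      have "opb (3 / 2 * a + 3 / 2 * a) ((y - snd \<zeta>') - (y - snd \<zeta>))"
        by (rule opb_diff) (use n in \<open>simp_all add: near_def\<close>)
      then show "opb (3 * a) (snd (\<zeta> - \<zeta>'))" by simp
    qed
    have ec: "e powr (- c) = D powr c * d powr (- c)" "e powr (- c - 1) = D powr (c + 1) * d powr (- c - 1)"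
      using d D by (simp_all add: e_def powr_divide powr_minus_divide[of _ "c"] powr_minus_divide[of _ "c + 1"] powr_diff powr_add)
    have gb: "\<bar>Q z * kdet z powr (- c)\<bar> \<le> L * D powr c * d powr (- c)" if z: "near a x y z" for z
    proof -
      have "kdet z powr (- c) \<le> e powr (- c)" using low(1)[OF z] e c by (intro powr_mono2') auto
      moreover have "\<bar>Q z\<bar> \<le> L" using L(2)[OF low(2)[OF z] low(2)[OF z]] by simp
      ultimately have "\<bar>Q z\<bar> * kdet z powr (- c) \<le> L * e powr (- c)" using L(1) by (intro mult_mono) auto
      then show ?thesis by (simp add: abs_mult ec mult.assoc)
    qed
    have A: "\<bar>Q \<zeta> * kdet \<zeta> powr (- c) - Q \<zeta>' * kdet \<zeta>' powr (- c)\<bar> \<le> C1 * d powr (- c)"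
      using gb[OF n(1)] gb[OF n(2)] unfolding C1_def by linarith
    have q: "\<bar>Q \<zeta>\<bar> \<le> L" "\<bar>Q \<zeta>'\<bar> \<le> L" "\<bar>Q \<zeta> - Q \<zeta>'\<bar> \<le> L * (R * (3 * a))"
      using L(2)[OF low(2)[OF n(1)] low(2)[OF n(2)]] L(2)[OF low(2)[OF n(2)] low(2)[OF n(2)]] mult_left_mono[OF dist L(1)] by auto
    have k1: "\<bar>kdet \<zeta> - kdet \<zeta>'\<bar> \<le> M * (R * (3 * a))"
      using M(2)[OF low(2)[OF n(1)] low(2)[OF n(2)]] mult_left_mono[OF dist M(1)] by auto
    have "\<bar>kdet \<zeta> powr (- c) - kdet \<zeta>' powr (- c)\<bar> \<le> c * e powr (- c - 1) * \<bar>kdet \<zeta> - kdet \<zeta>'\<bar>"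
      by (rule powr_neg_diff_bound[OF low(1)[OF n(1)] low(1)[OF n(2)] e c])
    also have "\<dots> \<le> c * e powr (- c - 1) * (M * (R * (3 * a)))" using k1 c by (intro mult_left_mono) auto
    finally have k2: "\<bar>kdet \<zeta> powr (- c) - kdet \<zeta>' powr (- c)\<bar> \<le> c * e powr (- c - 1) * (M * (R * (3 * a)))" .
    have k3: "kdet \<zeta> powr (- c) \<le> e powr (- c)" using low(1)[OF n(1)] e c by (intro powr_mono2') auto
    have "Q \<zeta> * kdet \<zeta> powr (- c) - Q \<zeta>' * kdet \<zeta>' powr (- c)
        = (Q \<zeta> - Q \<zeta>') * kdet \<zeta> powr (- c) + Q \<zeta>' * (kdet \<zeta> powr (- c) - kdet \<zeta>' powr (- c))" by (simp add: algebra_simps)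
    then have "\<bar>Q \<zeta> * kdet \<zeta> powr (- c) - Q \<zeta>' * kdet \<zeta>' powr (- c)\<bar>
        \<le> \<bar>Q \<zeta> - Q \<zeta>'\<bar> * \<bar>kdet \<zeta> powr (- c)\<bar> + \<bar>Q \<zeta>'\<bar> * \<bar>kdet \<zeta> powr (- c) - kdet \<zeta>' powr (- c)\<bar>"
      by (metis abs_mult abs_triangle_ineq)
    also have "\<dots> \<le> (L * (R * (3 * a))) * e powr (- c) + L * (c * e powr (- c - 1) * (M * (R * (3 * a))))"
      by (intro add_mono mult_mono) (use q k2 k3 L(1) R a in auto)
    also have "\<dots> = 3 * R * L * D powr c * d powr (- c) * a + L * c * M * 3 * R * D powr (c + 1) * d powr (- c - 1) * a"
      unfolding ec by simp
    also have "d powr (- c) = d * d powr (- c - 1)" using d by (simp add: powr_mult_base)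
    also have "3 * R * L * D powr c * (d * d powr (- c - 1)) * a \<le> 3 * R * L * D powr c * (M * d powr (- c - 1)) * a"
      using dM R L(1) a by (intro mult_right_mono mult_left_mono) auto
    finally have B: "\<bar>Q \<zeta> * kdet \<zeta> powr (- c) - Q \<zeta>' * kdet \<zeta>' powr (- c)\<bar> \<le> C2 * a * d powr (- c - 1)"
      unfolding C2_def by (simp add: algebra_simps)
    have "C1 * d powr (- c) \<le> C * d powr (- c)" "C2 * a * d powr (- c - 1) \<le> C * a * d powr (- c - 1)"
      using C a by (simp_all add: mult_right_mono)
    then have two: "\<bar>Q \<zeta> * kdet \<zeta> powr (- c) - Q \<zeta>' * kdet \<zeta>' powr (- c)\<bar> \<le> C * a powr \<gamma> * d powr (- (c + \<gamma>))"
      using A B by (intro interpolation_bound[OF _ _ a(1) d C(1) \<gamma>]) auto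
    have "L * D powr c * d powr (- c) \<le> C1 * d powr (- c)" using L(1) by (simp add: C1_def)
    also have "C1 * d powr (- c) = C1 * (d powr \<gamma> * d powr (- (c + \<gamma>)))" by (subst powr_add[symmetric]) simp
    also have "C1 * (d powr \<gamma> * d powr (- (c + \<gamma>))) \<le> C1 * (M powr \<gamma> * d powr (- (c + \<gamma>)))"
      using C1 d dM \<gamma> by (intro mult_left_mono mult_right_mono powr_mono2) auto
    also have "\<dots> = (C1 * M powr \<gamma>) * d powr (- (c + \<gamma>))" by simp
    also have "\<dots> \<le> C * d powr (- (c + \<gamma>))" using C(4) by (intro mult_right_mono) auto
    finally have "L * D powr c * d powr (- c) \<le> C * d powr (- (c + \<gamma>))" .
    then show ?thesis unfolding d_def[symmetric] by (intro conjI two) (rule order_trans[OF gb[OF n(1)]])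
  qed
  show ?thesis by (rule exI[of _ C], rule conjI[OF C(1)], intro allI impI, rule main; assumption)
qed

text \<open>All scales between a/2 and a have their intermediate points in one approach region,
  described by 1 - a/4 and 3 a / 2. Hence two consecutive dyadic scales and their mixed pairings are
  compared at once by \<open>kernel_hoelder\<close>.\<close>

lemma dlist_kernel_bounds:
  fixes ds :: "('p::finite \<times> 'q::finite) list"
  assumes \<alpha>: "0 \<le> \<alpha>" and \<gamma>: "0 < \<gamma>" "\<gamma> \<le> 1"
  defines "\<beta> \<equiv> \<alpha> + 2 * real (length ds) + \<gamma>"
  shows "\<exists>C\<ge>0. \<forall>x y :: real^'q^'p. \<forall>a b b' c c'. opb 1 x \<longrightarrow> opb 1 y \<longrightarrow> 0 < a \<longrightarrow> a \<le> 1 \<longrightarrow> 0 < kdet (x, y) \<longrightarrow>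
     {b, b', c, c'} \<subseteq> {a / 2..a} \<longrightarrow>
     \<bar>ev2 (dlist ds b x) (dlist ds c y) (kern \<alpha>)\<bar> \<le> C * kdet (x, y) powr (- \<beta>) \<and>
     \<bar>ev2 (dlist ds b x) (dlist ds c y) (kern \<alpha>) - ev2 (dlist ds b' x) (dlist ds c' y) (kern \<alpha>)\<bar> \<le> C * a powr \<gamma> * kdet (x, y) powr (- \<beta>)"
proof -
  obtain Q :: "(real^'q^'p) \<times> (real^'q^'p) \<Rightarrow> real" where Q: "real_polynomial_function Q" and
    val: "\<And>x y a b. opb 1 x \<Longrightarrow> opb 1 y \<Longrightarrow> 0 < a \<Longrightarrow> a \<le> 1 \<Longrightarrow> 0 < b \<Longrightarrow> b \<le> 1 \<Longrightarrow>
    (\<exists>\<xi> \<eta>. ev2 (dlist ds a x) (dlist ds b y) (kern \<alpha>) = Q (\<xi>, \<eta>) * kdet (\<xi>, \<eta>) powr (- (\<alpha> + 2 * real (length ds)))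
      \<and> opb (1 - a / 2) \<xi> \<and> opb (3 / 2 * a) (x - \<xi>) \<and> opb (1 - b / 2) \<eta> \<and> opb (3 / 2 * b) (y - \<eta>))"
    using ev2_dlist_value[of ds \<alpha>] by (elim exE conjE) (rule that, assumption, blast)
  define c0 where "c0 = \<alpha> + 2 * real (length ds)"
  have c0: "0 \<le> c0" using \<alpha> by (simp add: c0_def)
  define near where "near a x y \<zeta> \<longleftrightarrow> opb (1 - a / 4) (fst \<zeta>) \<and> opb (1 - a / 4) (snd \<zeta>)
      \<and> opb (3 / 2 * a) (x - fst \<zeta>) \<and> opb (3 / 2 * a) (y - snd \<zeta>)" for a x y and \<zeta> :: "(real^'q^'p) \<times> (real^'q^'p)"
  obtain C where C: "0 \<le> C" and hoe: "\<And>x y a \<zeta> \<zeta>'. opb 1 x \<Longrightarrow> opb 1 y \<Longrightarrow> 0 < a \<Longrightarrow> a \<le> 1 \<Longrightarrow> 0 < kdet (x, y) \<Longrightarrow> near a x y \<zeta> \<Longrightarrow> near a x y \<zeta>' \<Longrightarrow>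
     \<bar>Q \<zeta> * kdet \<zeta> powr (- c0)\<bar> \<le> C * kdet (x, y) powr (- (c0 + \<gamma>)) \<and>
     \<bar>Q \<zeta> * kdet \<zeta> powr (- c0) - Q \<zeta>' * kdet \<zeta>' powr (- c0)\<bar> \<le> C * a powr \<gamma> * kdet (x, y) powr (- (c0 + \<gamma>))"
    using kernel_hoelder[OF Q c0 \<gamma>] unfolding near_def by metis
  have pt: "\<exists>\<zeta>. ev2 (dlist ds b x) (dlist ds c y) (kern \<alpha>) = Q \<zeta> * kdet \<zeta> powr (- c0) \<and> near a x y \<zeta>"
    if xy: "opb 1 x" "opb 1 y" and ab: "0 < a" "a \<le> 1" "b \<in> {a / 2..a}" "c \<in> {a / 2..a}" for x y a b c
  proof -
    have bc: "0 < b" "b \<le> 1" "0 < c" "c \<le> 1" using ab by auto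
    obtain \<xi> \<eta> where v: "ev2 (dlist ds b x) (dlist ds c y) (kern \<alpha>) = Q (\<xi>, \<eta>) * kdet (\<xi>, \<eta>) powr (- c0)"
      "opb (1 - b / 2) \<xi>" "opb (3 / 2 * b) (x - \<xi>)" "opb (1 - c / 2) \<eta>" "opb (3 / 2 * c) (y - \<eta>)"
      using val[OF xy bc, folded c0_def] by (elim exE conjE) (rule that)
    have "near a x y (\<xi>, \<eta>)"
      unfolding near_def fst_conv snd_conv
      by (intro conjI opb_mono[OF v(2)] opb_mono[OF v(3)] opb_mono[OF v(4)] opb_mono[OF v(5)]) (use ab in auto)
    then show ?thesis using v(1) by blast
  qed
  have \<beta>: "\<beta> = c0 + \<gamma>" by (simp add: \<beta>_def c0_def)
  show ?thesis
  proof (intro exI[of _ C] conjI[OF C] allI impI)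
    fix x y :: "real^'q^'p" and a b b' c c' :: real
    assume xy: "opb 1 x" "opb 1 y" and a: "0 < a" "a \<le> 1" and d: "0 < kdet (x, y)" and sub: "{b, b', c, c'} \<subseteq> {a / 2..a}"
    obtain \<zeta> where 1: "ev2 (dlist ds b x) (dlist ds c y) (kern \<alpha>) = Q \<zeta> * kdet \<zeta> powr (- c0)" "near a x y \<zeta>"
      using pt[OF xy a, of b c] sub by auto
    obtain \<zeta>' where 2: "ev2 (dlist ds b' x) (dlist ds c' y) (kern \<alpha>) = Q \<zeta>' * kdet \<zeta>' powr (- c0)" "near a x y \<zeta>'"
      using pt[OF xy a, of b' c'] sub by auto
    show "\<bar>ev2 (dlist ds b x) (dlist ds c y) (kern \<alpha>)\<bar> \<le> C * kdet (x, y) powr (- \<beta>) \<and>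
     \<bar>ev2 (dlist ds b x) (dlist ds c y) (kern \<alpha>) - ev2 (dlist ds b' x) (dlist ds c' y) (kern \<alpha>)\<bar> \<le> C * a powr \<gamma> * kdet (x, y) powr (- \<beta>)"
      unfolding 1(1) 2(1) \<beta> by (rule hoe[OF xy a d 1(2) 2(2)])
  qed
qed

section \<open>From finite quadratic forms to integrals\<close>

text \<open>Formal power series serve as the vector space of all real sequences.\<close>

lemma linear_limit_extension:
  "\<exists>\<Lambda> :: (nat \<Rightarrow> real) \<Rightarrow> real. (\<forall>a b x y. \<Lambda> (\<lambda>m. a * x m + b * y m) = a * \<Lambda> x + b * \<Lambda> y)
     \<and> (\<forall>x l. x \<longlonglongrightarrow> l \<longrightarrow> \<Lambda> x = l)"
proof -
  interpret vector_space_pair "\<lambda>c (f :: real fps). fps_const c * f" "(*) :: real \<Rightarrow> real \<Rightarrow> real"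
    by unfold_locales (auto simp: algebra_simps fps_const_add[symmetric] fps_const_mult[symmetric] simp del: fps_const_add fps_const_mult)
  define S where "S = {f :: real fps. convergent (fps_nth f)}"
  obtain B where B: "B \<subseteq> S" "vs1.independent B" "S \<subseteq> vs1.span B"
    using vs1.maximal_independent_subset[of S] by metis
  obtain g where g: "Vector_Spaces.linear (\<lambda>c (f :: real fps). fps_const c * f) (*) g" "\<forall>f\<in>B. g f = lim (fps_nth f)"
    using linear_independent_extend[OF B(2), of "\<lambda>f. lim (fps_nth f)"] by blast
  interpret g: Vector_Spaces.linear "\<lambda>c (f :: real fps). fps_const c * f" "(*)" g by (rule g(1))
  \<comment> \<open>The functional g agrees with the limit on a basis of the convergent sequences.
    The sequences converging to their own value under g form a subspace, so it contains everything
    spanned by that basis.\<close>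
  have "vs1.subspace {f. fps_nth f \<longlonglongrightarrow> g f}"
  proof (rule vs1.subspaceI)
    have "fps_nth (0 :: real fps) = (\<lambda>_. 0)" by (simp add: fun_eq_iff)
    then show "0 \<in> {f. fps_nth f \<longlonglongrightarrow> g f}" by (simp add: g.zero)
    show "x + y \<in> {f. fps_nth f \<longlonglongrightarrow> g f}"
      if "x \<in> {f. fps_nth f \<longlonglongrightarrow> g f}" "y \<in> {f. fps_nth f \<longlonglongrightarrow> g f}" for x y
    proof -
      have "fps_nth (x + y) = (\<lambda>n. fps_nth x n + fps_nth y n)" by (simp add: fun_eq_iff)
      then show ?thesis using tendsto_add[of "fps_nth x" "g x" sequentially "fps_nth y" "g y"] that by (simp add: g.add)
    qed
    show "fps_const c * x \<in> {f. fps_nth f \<longlonglongrightarrow> g f}" if "x \<in> {f. fps_nth f \<longlonglongrightarrow> g f}" for c x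
    proof -
      have "fps_nth (fps_const c * x) = (\<lambda>n. c * fps_nth x n)" by (simp add: fun_eq_iff)
      then show ?thesis using tendsto_mult_left[of "fps_nth x" "g x" sequentially c] that by (simp add: g.scale)
    qed
  qed
  moreover have "B \<subseteq> {f. fps_nth f \<longlonglongrightarrow> g f}"
    using B(1) g(2) by (auto simp: S_def convergent_LIMSEQ_iff)
  ultimately have "vs1.span B \<subseteq> {f. fps_nth f \<longlonglongrightarrow> g f}" by (rule vs1.span_minimal[rotated])
  then have lim: "fps_nth f \<longlonglongrightarrow> g f" if "convergent (fps_nth f)" for f
    using that B(3) by (auto simp: S_def)
  show ?thesis
  proof (rule exI[of _ "\<lambda>x. g (Abs_fps x)"], intro conjI allI impI)
    fix a b :: real and x y :: "nat \<Rightarrow> real"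
    have "Abs_fps (\<lambda>m. a * x m + b * y m) = fps_const a * Abs_fps x + fps_const b * Abs_fps y"
      by (simp add: fps_eq_iff)
    then show "g (Abs_fps (\<lambda>m. a * x m + b * y m)) = a * g (Abs_fps x) + b * g (Abs_fps y)"
      by (simp only: g.add g.scale)
  next
    fix x :: "nat \<Rightarrow> real" and l assume x: "x \<longlonglongrightarrow> l"
    have e: "fps_nth (Abs_fps x) = x" by (simp add: fun_eq_iff)
    have "convergent x" using x by (auto simp: convergent_def)
    then have "x \<longlonglongrightarrow> g (Abs_fps x)" using lim[of "Abs_fps x"] unfolding e by blast
    then show "g (Abs_fps x) = l" using x LIMSEQ_unique by blast
  qed
qed

lemma borel_measurable_continuous_on_compact:
  fixes F :: "real^'n::finite \<Rightarrow> real"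
  assumes "compact C" "continuous_on C F"
  shows "(\<lambda>t. F t * indicator C t) \<in> borel_measurable borel"
proof -
  have "(\<lambda>t. if t \<in> C then F t else 0) \<in> borel_measurable borel"
    using assms by (intro borel_measurable_continuous_on_if compact_imp_closed borel_closed) auto
  also have "(\<lambda>t. if t \<in> C then F t else 0) = (\<lambda>t. F t * indicator C t)" by (auto simp: indicator_def)
  finally show ?thesis .
qed

text \<open>Finitely many balls around points of C cover it; removing from each ball the earlier
  ones in an enumeration makes the pieces disjoint.\<close>

lemma finite_measurable_partition:
  fixes C :: "(real^'n::finite) set"
  assumes C: "compact C" and \<delta>: "0 < \<delta>"
  obtains T A where "finite T" "T \<subseteq> C" "\<And>s. s \<in> T \<Longrightarrow> A s \<in> sets borel" "\<And>s. s \<in> T \<Longrightarrow> A s \<subseteq> C \<inter> ball s \<delta>"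
    "\<And>t. t \<in> C \<Longrightarrow> (\<Sum>s\<in>T. indicator (A s) t) = (1 :: real)"
proof -
  obtain T where T: "T \<subseteq> C" "finite T" "C \<subseteq> (\<Union>s\<in>T. ball s \<delta>)"
    by (rule compactE_image[OF C, of C "\<lambda>s. ball s \<delta>"]) (use \<delta> in auto)
  obtain xs where xs: "set xs = T" "distinct xs" using finite_distinct_list[OF T(2)] by auto
  define ix where "ix s = (THE i. i < length xs \<and> xs ! i = s)" for s
  have ix: "ix (xs ! i) = i" if "i < length xs" for i
    unfolding ix_def using that xs(2) by (auto simp: nth_eq_iff_index_eq)
  define A where "A s = C \<inter> ball s \<delta> - (\<Union>i<ix s. ball (xs ! i) \<delta>)" for s
  show thesis
  proof (rule that[of T A])
    show "A s \<in> sets borel" for s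
      unfolding A_def using borel_compact[OF C] by (intro sets.Diff sets.Int sets.finite_UN) auto
    show "A s \<subseteq> C \<inter> ball s \<delta>" for s by (auto simp: A_def)
    fix t assume t: "t \<in> C"
    define n where "n = (LEAST i. i < length xs \<and> t \<in> ball (xs ! i) \<delta>)"
    have "\<exists>i. i < length xs \<and> t \<in> ball (xs ! i) \<delta>" 
    proof -
      obtain s where "s \<in> set xs" "t \<in> ball s \<delta>" using subsetD[OF T(3) t] xs(1) by auto
      then show ?thesis by (metis in_set_conv_nth)
    qed
    from LeastI_ex[OF this] have n: "n < length xs" "t \<in> ball (xs ! n) \<delta>" by (simp_all add: n_def)
    have nl: "t \<notin> ball (xs ! i) \<delta>" if "i < n" for i
      using not_less_Least[OF that[unfolded n_def]] n(1) that by auto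
    have mem: "t \<in> A s \<longleftrightarrow> s = xs ! n" if s: "s \<in> T" for s
    proof -
      obtain i where i: "i < length xs" "s = xs ! i" using s xs(1) by (metis in_set_conv_nth)
      show ?thesis
      proof
        assume "t \<in> A s"
        then have "t \<in> ball (xs ! i) \<delta>" "\<not> n < i" using n(2) unfolding A_def i(2) ix[OF i(1)] by auto
        then show "s = xs ! n" using nl[of i] i by (cases "i < n") auto
      next
        assume "s = xs ! n"
        then show "t \<in> A s" using t n nl by (auto simp: A_def ix)
      qed
    qed
    have "xs ! n \<in> T" using n(1) xs(1) by auto
    have "(\<Sum>s\<in>T. indicator (A s) t) = (\<Sum>s\<in>T. if s = xs ! n then 1 else (0::real))"
      by (rule sum.cong) (auto simp: mem indicator_def)
    also have "\<dots> = 1" using \<open>xs ! n \<in> T\<close> T(2) by simp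
    finally show "(\<Sum>s\<in>T. indicator (A s) t) = (1::real)" .
  qed (use T in auto)
qed

text \<open>Riemann sums with the measures of small pieces as weights. The hypothesis bounds the sum
  for F by the root of a double sum for G, and summing over one index first bounds the latter by the
  measure of C times M1. Uniform continuity of F and G makes all errors vanish with
  \<epsilon>.\<close>

lemma integral_le_of_quadratic:
  fixes C :: "(real^'n::finite) set" and F :: "real^'n \<Rightarrow> real" and G :: "real^'n \<Rightarrow> real^'n \<Rightarrow> real"
  assumes C: "compact C" and F: "continuous_on C F" and G: "continuous_on (C \<times> C) (\<lambda>(s, t). G s t)"
    and quad: "\<And>T a M. finite T \<Longrightarrow> T \<subseteq> C \<Longrightarrow> (\<And>s. 0 \<le> a s) \<Longrightarrow> 0 < M \<Longrightarrow>
        (\<Sum>s\<in>T. \<Sum>t\<in>T. a s * a t * \<bar>G s t\<bar>) \<le> M \<Longrightarrow> (\<Sum>s\<in>T. a s * \<bar>F s\<bar>) \<le> N * sqrt M"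
    and int: "\<And>s. s \<in> C \<Longrightarrow> (\<integral>\<^sup>+t\<in>C. ennreal \<bar>G t s\<bar> \<partial>lborel) \<le> ennreal M1"
    and N: "0 \<le> N" and M1: "0 \<le> M1"
  shows "(\<integral>\<^sup>+t\<in>C. ennreal \<bar>F t\<bar> \<partial>lborel) \<le> ennreal (N * sqrt (measure lborel C * M1))"
proof -
  define v where "v = measure lborel C"
  have v: "0 \<le> v" "emeasure lborel C = ennreal v"
    unfolding v_def using emeasure_compact_finite[OF C] by (auto intro: emeasure_eq_ennreal_measure)
  have Cs: "C \<in> sets borel" using C by (rule borel_compact)
  have step: "(\<integral>\<^sup>+t\<in>C. ennreal \<bar>F t\<bar> \<partial>lborel) \<le> ennreal (N * sqrt (v * (M1 + \<epsilon> * v) + \<epsilon>) + \<epsilon> * v)" if \<epsilon>: "0 < \<epsilon>" for \<epsilon>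
  proof -
    have "uniformly_continuous_on C F" using compact_uniformly_continuous[OF F C] .
    then obtain \<delta>1 where \<delta>1: "0 < \<delta>1" "\<And>s t. s \<in> C \<Longrightarrow> t \<in> C \<Longrightarrow> dist t s < \<delta>1 \<Longrightarrow> dist (F t) (F s) < \<epsilon>"
      using \<epsilon> unfolding uniformly_continuous_on_def by metis
    have "uniformly_continuous_on (C \<times> C) (\<lambda>(s, t). G s t)" using compact_uniformly_continuous[OF G compact_Times[OF C C]] .
    then obtain \<delta>2 where \<delta>2: "0 < \<delta>2" "\<And>p p'. p \<in> C \<times> C \<Longrightarrow> p' \<in> C \<times> C \<Longrightarrow> dist p' p < \<delta>2 \<Longrightarrow> dist ((\<lambda>(s, t). G s t) p') ((\<lambda>(s, t). G s t) p) < \<epsilon>"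
      using \<epsilon> unfolding uniformly_continuous_on_def by metis
    obtain T A where T: "finite T" "T \<subseteq> C" "\<And>s. s \<in> T \<Longrightarrow> A s \<in> sets borel" "\<And>s. s \<in> T \<Longrightarrow> A s \<subseteq> C \<inter> ball s (min \<delta>1 \<delta>2)"
      "\<And>t. t \<in> C \<Longrightarrow> (\<Sum>s\<in>T. indicator (A s) t) = (1 :: real)"
      using finite_measurable_partition[OF C, of "min \<delta>1 \<delta>2"] \<delta>1(1) \<delta>2(1) by (metis min_less_iff_conj)
    have AC: "t \<in> C" "dist t s < \<delta>1" "dist t s < \<delta>2" if "s \<in> T" "t \<in> A s" for s t
      using subsetD[OF T(4)[OF that(1)] that(2)] by (auto simp: dist_commute)
    define a where "a s = measure lborel (A s)" for s
    have a0: "0 \<le> a s" for s by (simp add: a_def)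
    have ae: "emeasure lborel (A s) = ennreal (a s)" if "s \<in> T" for s
    proof -
      have "emeasure lborel (A s) \<le> emeasure lborel C" using T(4)[OF that] Cs by (intro emeasure_mono) auto
      then have "emeasure lborel (A s) < \<infinity>" using v(2) by (simp add: order.strict_trans1)
      then show ?thesis unfolding a_def by (intro emeasure_eq_ennreal_measure) simp
    qed
    have sumint: "(\<integral>\<^sup>+t. (\<Sum>s\<in>T. ennreal (H s) * indicator (A s) t) \<partial>lborel) = ennreal (\<Sum>s\<in>T. a s * H s)"
      if H: "\<And>s. 0 \<le> H s" for H
    proof -
      have "(\<integral>\<^sup>+t. (\<Sum>s\<in>T. ennreal (H s) * indicator (A s) t) \<partial>lborel) = (\<Sum>s\<in>T. ennreal (H s) * emeasure lborel (A s))"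
        using T(3) by (subst nn_integral_sum) (auto simp: nn_integral_cmult_indicator)
      also have "\<dots> = (\<Sum>s\<in>T. ennreal (a s * H s))"
        by (rule sum.cong) (simp_all add: ae a0 H ennreal_mult mult.commute)
      also have "\<dots> = ennreal (\<Sum>s\<in>T. a s * H s)" by (rule sum_ennreal) (simp add: a0 H)
      finally show ?thesis .
    qed
    have asum: "(\<Sum>s\<in>T. a s) = v"
    proof -
      have ind: "(\<Sum>s\<in>T. ennreal 1 * indicator (A s) t) = indicator C t" for t
      proof (cases "t \<in> C")
        case True
        have "(\<Sum>s\<in>T. ennreal 1 * indicator (A s) t) = (\<Sum>s\<in>T. ennreal (indicator (A s) t))"
          by (rule sum.cong) (auto simp: indicator_def)
        also have "\<dots> = ennreal 1" unfolding T(5)[OF True, symmetric] by (rule sum_ennreal) simp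
        finally show ?thesis using True by simp
      next
        case False
        then show ?thesis using AC(1) by (auto intro!: sum.neutral simp: indicator_def)
      qed
      have "ennreal (\<Sum>s\<in>T. a s * 1) = ennreal v"
        using sumint[of "\<lambda>_. 1"] unfolding ind using Cs v(2) by simp
      then show ?thesis using v(1) a0 by (simp add: sum_nonneg)
    qed
    have Fle: "(\<integral>\<^sup>+t\<in>C. ennreal \<bar>F t\<bar> \<partial>lborel) \<le> ennreal ((\<Sum>s\<in>T. a s * \<bar>F s\<bar>) + \<epsilon> * v)"
    proof -
      have "(\<integral>\<^sup>+t\<in>C. ennreal \<bar>F t\<bar> \<partial>lborel) \<le> (\<integral>\<^sup>+t. (\<Sum>s\<in>T. ennreal (\<bar>F s\<bar> + \<epsilon>) * indicator (A s) t) \<partial>lborel)"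
      proof (rule nn_integral_mono)
        fix t :: "real^'n"
        show "ennreal \<bar>F t\<bar> * indicator C t \<le> (\<Sum>s\<in>T. ennreal (\<bar>F s\<bar> + \<epsilon>) * indicator (A s) t)"
        proof (cases "t \<in> C")
          case True
          have "\<bar>F t\<bar> = (\<Sum>s\<in>T. \<bar>F t\<bar> * indicator (A s) t)" using T(5)[OF True] by (simp add: sum_distrib_left[symmetric])
          also have "\<dots> \<le> (\<Sum>s\<in>T. (\<bar>F s\<bar> + \<epsilon>) * indicator (A s) t)"
          proof (rule sum_mono)
            fix s assume s: "s \<in> T"
            show "\<bar>F t\<bar> * indicator (A s) t \<le> (\<bar>F s\<bar> + \<epsilon>) * indicator (A s) t"
            proof (cases "t \<in> A s")
              case True
              then have "dist t s < \<delta>1" by (rule AC(2)[OF s])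
              then have "dist (F t) (F s) < \<epsilon>" using \<delta>1(2) s T(2) \<open>t \<in> C\<close> by blast
              then show ?thesis using True by (simp add: dist_real_def)
            qed simp
          qed
          finally have "ennreal \<bar>F t\<bar> \<le> ennreal (\<Sum>s\<in>T. (\<bar>F s\<bar> + \<epsilon>) * indicator (A s) t)" by (rule ennreal_leI)
          also have "\<dots> = (\<Sum>s\<in>T. ennreal ((\<bar>F s\<bar> + \<epsilon>) * indicator (A s) t))"
            using \<epsilon> by (intro sum_ennreal[symmetric]) (auto simp: indicator_def)
          also have "\<dots> = (\<Sum>s\<in>T. ennreal (\<bar>F s\<bar> + \<epsilon>) * indicator (A s) t)" by (rule sum.cong) (auto simp: indicator_def)
          finally show ?thesis using True by simp
        qed simp
      qed
      also have "\<dots> = ennreal (\<Sum>s\<in>T. a s * (\<bar>F s\<bar> + \<epsilon>))" by (rule sumint) (use \<epsilon> in simp)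
      also have "(\<Sum>s\<in>T. a s * (\<bar>F s\<bar> + \<epsilon>)) = (\<Sum>s\<in>T. a s * \<bar>F s\<bar>) + \<epsilon> * v"
        by (simp add: distrib_left sum.distrib asum[symmetric] sum_distrib_left mult.commute)
      finally show ?thesis .
    qed
    have Gle: "(\<Sum>s\<in>T. a s * \<bar>G s u\<bar>) \<le> M1 + \<epsilon> * v" if u: "u \<in> C" for u
    proof -
      have "ennreal (\<Sum>s\<in>T. a s * \<bar>G s u\<bar>) = (\<integral>\<^sup>+t. (\<Sum>s\<in>T. ennreal \<bar>G s u\<bar> * indicator (A s) t) \<partial>lborel)"
        by (rule sumint[symmetric]) simp
      also have "\<dots> \<le> (\<integral>\<^sup>+t. ennreal \<bar>G t u\<bar> * indicator C t + ennreal \<epsilon> * indicator C t \<partial>lborel)"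
      proof (rule nn_integral_mono)
        fix t :: "real^'n"
        show "(\<Sum>s\<in>T. ennreal \<bar>G s u\<bar> * indicator (A s) t) \<le> ennreal \<bar>G t u\<bar> * indicator C t + ennreal \<epsilon> * indicator C t"
        proof (cases "t \<in> C")
          case True
          have "(\<Sum>s\<in>T. ennreal \<bar>G s u\<bar> * indicator (A s) t) = (\<Sum>s\<in>T. ennreal (\<bar>G s u\<bar> * indicator (A s) t))"
            by (rule sum.cong) (auto simp: indicator_def)
          also have "\<dots> = ennreal (\<Sum>s\<in>T. \<bar>G s u\<bar> * indicator (A s) t)" by (rule sum_ennreal) (simp add: indicator_def)
          also have "(\<Sum>s\<in>T. \<bar>G s u\<bar> * indicator (A s) t) \<le> (\<Sum>s\<in>T. (\<bar>G t u\<bar> + \<epsilon>) * indicator (A s) t)"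
          proof (rule sum_mono)
            fix s assume s: "s \<in> T"
            show "\<bar>G s u\<bar> * indicator (A s) t \<le> (\<bar>G t u\<bar> + \<epsilon>) * indicator (A s) t"
            proof (cases "t \<in> A s")
              case True
              then have "dist t s < \<delta>2" by (rule AC(3)[OF s])
              then have "dist (s, u) (t, u) < \<delta>2" by (simp add: dist_Pair_Pair dist_commute)
              then have "dist (G s u) (G t u) < \<epsilon>" using \<delta>2(2)[of "(t, u)" "(s, u)"] s T(2) \<open>t \<in> C\<close> u by auto
              then show ?thesis using True by (simp add: dist_real_def)
            qed simp
          qed
          also have "\<dots> = \<bar>G t u\<bar> + \<epsilon>" using T(5)[OF True] by (simp add: sum_distrib_left[symmetric])
          finally show ?thesis using True \<epsilon> by (simp add: ennreal_leI)
        next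
          case False
          then have "(\<Sum>s\<in>T. ennreal \<bar>G s u\<bar> * indicator (A s) t) = 0"
            using AC(1) by (intro sum.neutral) (auto simp: indicator_def)
          then show ?thesis by simp
        qed
      qed
      also have "\<dots> = (\<integral>\<^sup>+t\<in>C. ennreal \<bar>G t u\<bar> \<partial>lborel) + (\<integral>\<^sup>+t. ennreal \<epsilon> * indicator C t \<partial>lborel)"
      proof (rule nn_integral_add)
        have "continuous_on C (\<lambda>t. \<bar>G t u\<bar>)"
        proof -
          have "continuous_on C (\<lambda>t. (t, u))" by (intro continuous_intros)
          moreover have "(\<lambda>t. (t, u)) ` C \<subseteq> C \<times> C" using u by auto
          ultimately show ?thesis using continuous_on_compose2[OF G, of C "\<lambda>t. (t, u)"] by (intro continuous_on_rabs) simp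
        qed
        from borel_measurable_continuous_on_compact[OF C this]
        have "(\<lambda>t. ennreal (\<bar>G t u\<bar> * indicator C t)) \<in> borel_measurable borel" by simp
        also have "(\<lambda>t. ennreal (\<bar>G t u\<bar> * indicator C t)) = (\<lambda>t. ennreal \<bar>G t u\<bar> * indicator C t)" by (auto simp: indicator_def)
        finally show "(\<lambda>t. ennreal \<bar>G t u\<bar> * indicator C t) \<in> borel_measurable lborel" by simp
      qed (use Cs in auto)
      also have "\<dots> \<le> ennreal M1 + ennreal \<epsilon> * ennreal v"
        using int[OF u] Cs v(2) by (intro add_mono) (simp_all add: nn_integral_cmult_indicator)
      also have "\<dots> = ennreal (M1 + \<epsilon> * v)" using M1 \<epsilon> v(1) by (simp add: ennreal_mult ennreal_plus)
      finally have le: "ennreal (\<Sum>s\<in>T. a s * \<bar>G s u\<bar>) \<le> ennreal (M1 + \<epsilon> * v)" .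
      have "0 \<le> M1 + \<epsilon> * v" using M1 \<epsilon> v(1) by simp
      from ennreal_le_iff[OF this] le show ?thesis by blast
    qed
    have "(\<Sum>s\<in>T. \<Sum>t\<in>T. a s * a t * \<bar>G s t\<bar>) = (\<Sum>t\<in>T. a t * (\<Sum>s\<in>T. a s * \<bar>G s t\<bar>))"
      by (subst sum.swap) (simp add: sum_distrib_left mult_ac)
    also have "\<dots> \<le> (\<Sum>t\<in>T. a t * (M1 + \<epsilon> * v))"
      using T(2) a0 Gle by (intro sum_mono mult_left_mono) auto
    also have "\<dots> = v * (M1 + \<epsilon> * v)" by (simp add: sum_distrib_right[symmetric] asum)
    \<comment> \<open>The added \<epsilon> makes the bound strictly positive, as \<open>quad\<close>
      demands, even when C is a null set.\<close>
    also have "\<dots> \<le> v * (M1 + \<epsilon> * v) + \<epsilon>" using \<epsilon> by simp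
    finally have q: "(\<Sum>s\<in>T. \<Sum>t\<in>T. a s * a t * \<bar>G s t\<bar>) \<le> v * (M1 + \<epsilon> * v) + \<epsilon>" .
    have "0 < v * (M1 + \<epsilon> * v) + \<epsilon>" using v(1) M1 \<epsilon> by (intro add_nonneg_pos mult_nonneg_nonneg add_nonneg_nonneg) auto
    then have "(\<Sum>s\<in>T. a s * \<bar>F s\<bar>) \<le> N * sqrt (v * (M1 + \<epsilon> * v) + \<epsilon>)"
      by (rule quad[OF T(1,2) a0 _ q])
    then have "ennreal ((\<Sum>s\<in>T. a s * \<bar>F s\<bar>) + \<epsilon> * v) \<le> ennreal (N * sqrt (v * (M1 + \<epsilon> * v) + \<epsilon>) + \<epsilon> * v)"
      by (intro ennreal_leI add_right_mono)
    with Fle show ?thesis by (rule order_trans)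
  qed
  have "((\<lambda>\<epsilon>. ennreal (N * sqrt (v * (M1 + \<epsilon> * v) + \<epsilon>) + \<epsilon> * v)) \<longlongrightarrow> ennreal (N * sqrt (v * (M1 + 0 * v) + 0) + 0 * v)) (at_right 0)"
    by (intro tendsto_intros)
  moreover have "\<forall>\<^sub>F \<epsilon> in at_right 0. (\<integral>\<^sup>+t\<in>C. ennreal \<bar>F t\<bar> \<partial>lborel) \<le> ennreal (N * sqrt (v * (M1 + \<epsilon> * v) + \<epsilon>) + \<epsilon> * v)"
    using step by (auto simp: eventually_at_right_field intro!: exI[of _ 1])
  ultimately have "(\<integral>\<^sup>+t\<in>C. ennreal \<bar>F t\<bar> \<partial>lborel) \<le> ennreal (N * sqrt (v * (M1 + 0 * v) + 0) + 0 * v)"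
    by (intro tendsto_lowerbound) auto
  then show ?thesis by (simp add: v_def)
qed

lemma continuous_on_fdiff:
  fixes F :: "'a::real_normed_vector \<Rightarrow> real" and g :: "'b::topological_space \<Rightarrow> 'a"
  assumes "continuous_on B F" "continuous_on S g" "\<And>s v. s \<in> S \<Longrightarrow> v \<in> sbox ws \<Longrightarrow> g s + v \<in> B"
  shows "continuous_on S (\<lambda>s. fdiff ws F (g s))"
  using assms(2,3)
proof (induction ws arbitrary: g)
  case Nil
  have "g ` S \<subseteq> B" using Nil(2)[of _ 0] by auto
  then show ?case using continuous_on_compose2[OF assms(1) Nil(1)] by simp
next
  case (Cons w ws)
  have "continuous_on S (\<lambda>s. fdiff ws F (g s + w))"
  proof (rule Cons.IH)
    show "continuous_on S (\<lambda>s. g s + w)" by (intro continuous_intros Cons.prems(1))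
    show "g s + w + v \<in> B" if "s \<in> S" "v \<in> sbox ws" for s v
      using Cons.prems(2)[OF that(1) sbox_ConsI[of 1 v ws w]] that(2) by (simp add: add.assoc)
  qed
  moreover have "continuous_on S (\<lambda>s. fdiff ws F (g s))"
  proof (rule Cons.IH[OF Cons.prems(1)])
    show "g s + v \<in> B" if "s \<in> S" "v \<in> sbox ws" for s v
      using Cons.prems(2)[OF that(1) sbox_ConsI[of 0 v ws w]] that(2) by simp
  qed
  ultimately show ?case by (simp add: continuous_on_diff)
qed

lemma dlist_sbox_ball:
  fixes x :: "real^'q::finite^'p::finite"
  assumes "opb 1 x" "0 < a" "a \<le> 1"
    "v \<in> sbox (map (\<lambda>d. (a / (2 * (length ds + 1))) *\<^sub>R unit_dir d) (rev ds))"
  shows "(1 - a) *\<^sub>R x + v \<in> mat_ball"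
  using opb_mat_ball[OF dlist_point(1)[OF assms]] assms(2) by simp

lemma ev_dlist:
  "ev (dlist ds a x) f = fdiff (map (\<lambda>d. (a / (2 * (length ds + 1))) *\<^sub>R unit_dir d) (rev ds)) f ((1 - a) *\<^sub>R x)
     / (a / (2 * (length ds + 1))) ^ length ds"
  by (simp add: dlist_def Let_def ev_fdlist)

lemma continuous_on_ev_dlist:
  fixes g :: "'b::topological_space \<Rightarrow> real^'q::finite^'p::finite"
  assumes f: "continuous_on mat_ball f" and g: "continuous_on S g" and gS: "\<And>s. s \<in> S \<Longrightarrow> opb 1 (g s)" and a: "0 < a" "a \<le> 1"
  shows "continuous_on S (\<lambda>s. ev (dlist ds a (g s)) f)"
proof -
  have "continuous_on S (\<lambda>s. (1 / (a / (2 * (length ds + 1))) ^ length ds) *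
      fdiff (map (\<lambda>d. (a / (2 * (length ds + 1))) *\<^sub>R unit_dir d) (rev ds)) f ((1 - a) *\<^sub>R g s))"
    by (intro continuous_on_mult_left continuous_on_fdiff[OF f] continuous_intros g)
      (rule dlist_sbox_ball[OF gS a])
  then show ?thesis unfolding ev_dlist by simp
qed

lemma continuous_on_kern: "continuous_on (mat_ball \<times> mat_ball) (\<lambda>(x, y). kern \<alpha> x y)"
proof -
  have "continuous_on (mat_ball \<times> mat_ball) kdet"
    by (intro continuous_at_imp_continuous_on ballI continuous_real_polymonial_function real_polynomial_function_kdet)
  moreover have "\<forall>\<zeta>\<in>mat_ball \<times> mat_ball. kdet \<zeta> \<noteq> 0" using kdet_pos less_irrefl by metis
  ultimately have "continuous_on (mat_ball \<times> mat_ball) (\<lambda>\<zeta>. kdet \<zeta> powr (- \<alpha>))"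
    by (rule continuous_on_powr[OF _ continuous_on_const])
  then show ?thesis unfolding kern_kdet by simp
qed

lemma continuous_on_ev2_dlist:
  fixes g :: "'b::topological_space \<Rightarrow> real^'q::finite^'p::finite"
  assumes g: "continuous_on S g" and gS: "\<And>s. s \<in> S \<Longrightarrow> opb 1 (g s)" and a: "0 < a" "a \<le> 1" and b: "0 < b" "b \<le> 1"
  shows "continuous_on (S \<times> S) (\<lambda>(s, t). ev2 (dlist ds a (g s)) (dlist ds b (g t)) (kern \<alpha>))"
proof -
  define h where "h = a / (2 * (length ds + 1))"
  define h' where "h' = b / (2 * (length ds + 1))"
  let ?ws = "map (\<lambda>d. h *\<^sub>R unit_dir d) (rev ds) :: (real^'q^'p) list"
  let ?ws' = "map (\<lambda>d. h' *\<^sub>R unit_dir d) (rev ds) :: (real^'q^'p) list"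
  let ?W = "map (\<lambda>w. (w, 0)) ?ws @ map (\<lambda>w. (0, w)) ?ws'"
  have e: "ev2 (dlist ds a (g s)) (dlist ds b (g t)) (kern \<alpha>) =
      (1 / h ^ length ds * (1 / h' ^ length ds)) * fdiff ?W (\<lambda>(x, y). kern \<alpha> x y) ((1 - a) *\<^sub>R g s, (1 - b) *\<^sub>R g t)" for s t
    unfolding ev2_fdlist[symmetric] dlist_def Let_def h_def[symmetric] h'_def[symmetric]
    by (simp only: ev2_def ev_scale ev_cmult mult_ac)
  have g1: "continuous_on (S \<times> S) (\<lambda>p. g (fst p))" "continuous_on (S \<times> S) (\<lambda>p. g (snd p))"
    by (rule continuous_on_compose2[OF g]; force intro: continuous_intros)+
  have "continuous_on (S \<times> S) (\<lambda>p. fdiff ?W (\<lambda>(x, y). kern \<alpha> x y) ((1 - a) *\<^sub>R g (fst p), (1 - b) *\<^sub>R g (snd p)))"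
  proof (rule continuous_on_fdiff[OF continuous_on_kern])
    show "continuous_on (S \<times> S) (\<lambda>p. ((1 - a) *\<^sub>R g (fst p), (1 - b) *\<^sub>R g (snd p)))"
      by (intro continuous_intros g1)
    fix p v assume p: "p \<in> S \<times> S" and v: "v \<in> sbox ?W"
    have "(1 - a) *\<^sub>R g (fst p) + fst v \<in> mat_ball"
      by (rule dlist_sbox_ball[OF gS a]) (use p sbox_pair[OF v] in \<open>auto simp: h_def\<close>)
    moreover have "(1 - b) *\<^sub>R g (snd p) + snd v \<in> mat_ball"
      by (rule dlist_sbox_ball[OF gS b]) (use p sbox_pair[OF v] in \<open>auto simp: h'_def\<close>)
    ultimately show "((1 - a) *\<^sub>R g (fst p), (1 - b) *\<^sub>R g (snd p)) + v \<in> mat_ball \<times> mat_ball" by (simp add: plus_prod_def)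
  qed
  then have "continuous_on (S \<times> S) (\<lambda>p. (1 / h ^ length ds * (1 / h' ^ length ds)) *
      fdiff ?W (\<lambda>(x, y). kern \<alpha> x y) ((1 - a) *\<^sub>R g (fst p), (1 - b) *\<^sub>R g (snd p)))"
    by (rule continuous_on_mult_left)
  then show ?thesis unfolding e by (simp add: case_prod_beta)
qed

text \<open>Multiplying each weight by the sign of \<open>ev (L s) f\<close> produces the absolute
  values on the left, while the quadratic form of the signed combination is at most the sum of
  absolute values.\<close>

lemma rkhs_sum_le:
  assumes f: "in_rkhs K X f" and T: "finite T" and a: "\<And>s. 0 \<le> a s" and L: "\<And>s. s \<in> T \<Longrightarrow> snd ` set (L s) \<subseteq> X"
    and M: "0 < M" "(\<Sum>s\<in>T. \<Sum>t\<in>T. a s * a t * \<bar>ev2 (L s) (L t) K\<bar>) \<le> M"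
  shows "(\<Sum>s\<in>T. a s * \<bar>ev (L s) f\<bar>) \<le> rkhs_norm K X f * sqrt M"
proof -
  obtain xs where xs: "set xs = T" "distinct xs" using finite_distinct_list[OF T] by auto
  define b where "b s = a s * sgn (ev (L s) f)" for s
  define L' where "L' = concat (map (\<lambda>s. scale_list (b s) (L s)) xs)"
  have "ev L' f = (\<Sum>s\<in>T. b s * ev (L s) f)"
    unfolding L'_def ev_concat ev_scale using xs by (simp add: sum_list_distinct_conv_sum_set)
  also have "\<dots> = (\<Sum>s\<in>T. a s * \<bar>ev (L s) f\<bar>)"
    by (rule sum.cong) (simp_all add: b_def mult.assoc linordered_idom_class.abs_sgn mult.commute[of "sgn _"])
  finally have 1: "ev L' f = (\<Sum>s\<in>T. a s * \<bar>ev (L s) f\<bar>)" .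
  have b: "\<bar>b s\<bar> \<le> a s" for s using a[of s] by (auto simp: b_def abs_mult sgn_if)
  have "ev2 L' L' K = (\<Sum>s\<in>T. \<Sum>t\<in>T. b s * b t * ev2 (L t) (L s) K)"
    unfolding L'_def ev2_scale_concat using xs by (simp add: sum_list_distinct_conv_sum_set)
  also have "\<dots> \<le> (\<Sum>s\<in>T. \<Sum>t\<in>T. a s * a t * \<bar>ev2 (L t) (L s) K\<bar>)"
  proof (intro sum_mono)
    fix s t
    have "b s * b t * ev2 (L t) (L s) K \<le> \<bar>b s\<bar> * \<bar>b t\<bar> * \<bar>ev2 (L t) (L s) K\<bar>"
      by (metis abs_ge_self abs_mult)
    also have "\<dots> \<le> a s * a t * \<bar>ev2 (L t) (L s) K\<bar>"
      using b a by (intro mult_right_mono mult_mono) auto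
    finally show "b s * b t * ev2 (L t) (L s) K \<le> a s * a t * \<bar>ev2 (L t) (L s) K\<bar>" .
  qed
  also have "\<dots> = (\<Sum>s\<in>T. \<Sum>t\<in>T. a s * a t * \<bar>ev2 (L s) (L t) K\<bar>)"
    by (subst sum.swap) (simp add: mult.commute)
  finally have 2: "ev2 L' L' K \<le> M" using M(2) by simp
  have 3: "snd ` set L' \<subseteq> X" using L xs(1) by (force simp: L'_def scale_list_def)
  have "\<bar>ev L' f\<bar> \<le> rkhs_norm K X f * sqrt M" by (rule rkhs_ev_le[OF f 3 2 M(1)])
  then show ?thesis unfolding 1 by linarith
qed

text \<open>The telescoping series of differences converges absolutely almost everywhere, and
  wherever it does, F m t converges and h t is forced to be the limit. On the remaining null set h
  is arbitrary, so completeness of Lebesgue measure gives its measurability.\<close>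

lemma limit_set_integrable:
  fixes F :: "nat \<Rightarrow> real^'n::finite \<Rightarrow> real" and h J :: "real^'n \<Rightarrow> real"
  assumes C: "compact C" and F: "\<And>m. continuous_on C (F m)"
    and I0: "(\<integral>\<^sup>+t\<in>C. ennreal \<bar>F 0 t\<bar> \<partial>lborel) \<le> ennreal A"
    and I1: "\<And>m. (\<integral>\<^sup>+t\<in>C. ennreal \<bar>F (Suc m) t - F m t\<bar> \<partial>lborel) \<le> ennreal (A * q ^ m)"
    and A: "0 \<le> A" and q: "0 \<le> q" "q < 1"
    and h: "\<And>t l. t \<in> C \<Longrightarrow> (\<lambda>m. F m t) \<longlonglongrightarrow> l \<Longrightarrow> h t = l"
    and J: "continuous_on C J" "\<And>t. t \<in> C \<Longrightarrow> \<bar>J t\<bar> \<le> Jm" and Jm: "0 \<le> Jm"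
  shows "set_integrable lebesgue C (\<lambda>t. \<bar>h t\<bar> * J t)"
    "set_lebesgue_integral lebesgue C (\<lambda>t. \<bar>h t\<bar> * J t) \<le> Jm * (A + A / (1 - q))"
proof -
  \<comment> \<open>Index 0 carries F 0 itself and index m the m-th difference, so that the sum up
    to m dominates F m.\<close>
  define f where "f m t = (if m = 0 then \<bar>F 0 t\<bar> else \<bar>F m t - F (m - 1) t\<bar>) * indicator C t" for m t
  define S where "S t = (\<Sum>m. ennreal (f m t))" for t
  define e where "e m = (if m = 0 then A else A * q ^ (m - 1))" for m
  have e0: "0 \<le> e m" for m using A q by (simp add: e_def)
  have es: "(\<lambda>m. e (Suc m)) sums (A * (1 / (1 - q)))"
  proof -
    have "(\<lambda>m. A * q ^ m) sums (A * (1 / (1 - q)))" using q by (intro sums_mult geometric_sums) simp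
    then show ?thesis by (simp add: e_def)
  qed
  have "e 0 = A" by (simp add: e_def)
  then have es': "e sums (A + A / (1 - q))"
    using sums_Suc[OF es] by (simp add: add.commute)
  have fm: "f m \<in> borel_measurable borel" for m
  proof -
    have "continuous_on C (\<lambda>t. if m = 0 then \<bar>F 0 t\<bar> else \<bar>F m t - F (m - 1) t\<bar>)"
      by (cases "m = 0") (simp_all add: F continuous_on_rabs continuous_on_diff)
    from borel_measurable_continuous_on_compact[OF C this] show ?thesis by (simp only: f_def[abs_def])
  qed
  have f0: "0 \<le> f m t" for m t by (simp add: f_def)
  have fi: "(\<integral>\<^sup>+t. ennreal (f m t) \<partial>lborel) \<le> ennreal (e m)" for m
  proof -
    have "(\<integral>\<^sup>+t. ennreal (f m t) \<partial>lborel) = (\<integral>\<^sup>+t\<in>C. ennreal (if m = 0 then \<bar>F 0 t\<bar> else \<bar>F m t - F (m - 1) t\<bar>) \<partial>lborel)"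
      by (rule nn_integral_cong) (simp add: f_def indicator_def split: if_split)
    then show ?thesis using I0 I1[of "m - 1"] by (cases "m = 0") (simp_all add: e_def)
  qed
  have Sm: "S \<in> borel_measurable lborel" unfolding S_def using fm by measurable
  have "(\<integral>\<^sup>+t. S t \<partial>lborel) = (\<Sum>m. \<integral>\<^sup>+t. ennreal (f m t) \<partial>lborel)"
    unfolding S_def using fm by (intro nn_integral_suminf) measurable
  also have "\<dots> \<le> (\<Sum>m. ennreal (e m))" by (intro suminf_le fi) auto
  also have "\<dots> = ennreal (A + A / (1 - q))" using es' e0 by (simp add: suminf_ennreal2 sums_iff)
  finally have SI: "(\<integral>\<^sup>+t. S t \<partial>lborel) \<le> ennreal (A + A / (1 - q))" .
  have "(\<integral>\<^sup>+t. S t \<partial>lborel) \<noteq> \<infinity>" using SI by (auto simp: top_unique)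
  then have AEf: "AE t in lborel. S t \<noteq> \<infinity>" by (rule nn_integral_PInf_AE[OF Sm])
  have conv: "(\<lambda>m. F m t) \<longlonglongrightarrow> h t \<and> ennreal \<bar>h t\<bar> \<le> S t" if t: "t \<in> C" and S: "S t \<noteq> \<infinity>" for t
  proof -
    have sm: "summable (\<lambda>m. f m t)" using S f0 unfolding S_def by (intro summable_suminf_not_top) auto
    then have "summable (\<lambda>m. \<bar>F (Suc m) t - F m t\<bar>)"
      using summable_Suc_iff[of "\<lambda>m. f m t"] t by (simp add: f_def)
    then have "summable (\<lambda>m. F (Suc m) t - F m t)" by (rule summable_rabs_cancel)
    then have "convergent (\<lambda>n. \<Sum>m<n. F (Suc m) t - F m t)" by (simp add: summable_iff_convergent)
    then have "convergent (\<lambda>n. F n t - F 0 t)" by (simp only: sum_lessThan_telescope[of "\<lambda>m. F m t"])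
    then obtain l where "(\<lambda>n. F n t - F 0 t) \<longlonglongrightarrow> l" by (auto simp: convergent_def)
    from tendsto_add[OF this tendsto_const[of "F 0 t"]] have l: "(\<lambda>n. F n t) \<longlonglongrightarrow> l + F 0 t" by simp
    then have hl: "(\<lambda>m. F m t) \<longlonglongrightarrow> h t" using h[OF t l] by simp
    have bd: "\<bar>F n t\<bar> \<le> (\<Sum>m. f m t)" for n
    proof -
      have "\<bar>F n t\<bar> \<le> (\<Sum>m<Suc n. f m t)"
      proof (induction n)
        case (Suc n)
        have "\<bar>F (Suc n) t\<bar> \<le> \<bar>F n t\<bar> + f (Suc n) t" using t by (simp add: f_def)
        then show ?case using Suc by simp
      qed (use t in \<open>simp add: f_def\<close>)
      also have "\<dots> \<le> (\<Sum>m. f m t)" by (rule sum_le_suminf[OF sm]) (auto simp: f0)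
      finally show ?thesis .
    qed
    have "\<bar>h t\<bar> \<le> (\<Sum>m. f m t)"
      by (rule tendsto_upperbound[OF tendsto_rabs[OF hl]]) (auto simp: bd)
    then have "ennreal \<bar>h t\<bar> \<le> ennreal (\<Sum>m. f m t)" by (rule ennreal_leI)
    also have "\<dots> = S t" unfolding S_def using sm f0 by (intro suminf_ennreal2[symmetric]) auto
    finally show ?thesis using hl by simp
  qed
  \<comment> \<open>A Borel function that agrees with the integrand wherever S is finite; elsewhere
    \<open>lim\<close> has some unspecified but measurable value.\<close>
  define g where "g t = \<bar>lim (\<lambda>m. F m t * indicator C t)\<bar> * (J t * indicator C t)" for t
  have gm: "g \<in> borel_measurable borel"
    unfolding g_def[abs_def]
    by (rule borel_measurable_times[OF borel_measurable_abs[OF borel_measurable_lim_metric]])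
      (rule borel_measurable_continuous_on_compact[OF C] F J(1))+
  have geq: "g t = indicator C t *\<^sub>R (\<bar>h t\<bar> * J t)" if "S t \<noteq> \<infinity>" for t
  proof (cases "t \<in> C")
    case True
    then show ?thesis using limI[of "\<lambda>m. F m t" "h t"] conv[OF True that] by (simp add: g_def)
  qed (simp add: g_def)
  have gb: "ennreal (norm (g t)) \<le> ennreal Jm * S t" if "S t \<noteq> \<infinity>" for t
  proof (cases "t \<in> C")
    case True
    have "ennreal (norm (g t)) = ennreal (\<bar>J t\<bar> * \<bar>h t\<bar>)" unfolding geq[OF that] using True by (simp add: abs_mult mult.commute)
    also have "\<dots> \<le> ennreal (Jm * \<bar>h t\<bar>)" using J(2)[OF True] by (intro ennreal_leI mult_right_mono) auto
    also have "\<dots> = ennreal Jm * ennreal \<bar>h t\<bar>" using Jm by (simp add: ennreal_mult)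
    also have "\<dots> \<le> ennreal Jm * S t" using conv[OF True that] by (intro mult_left_mono) auto
    finally show ?thesis .
  qed (simp add: g_def)
  have "(\<integral>\<^sup>+t. ennreal (norm (g t)) \<partial>lborel) \<le> (\<integral>\<^sup>+t. ennreal Jm * S t \<partial>lborel)"
    using AEf gb by (intro nn_integral_mono_AE) auto
  also have "\<dots> = ennreal Jm * (\<integral>\<^sup>+t. S t \<partial>lborel)" by (rule nn_integral_cmult[OF Sm])
  also have "\<dots> \<le> ennreal Jm * ennreal (A + A / (1 - q))" by (intro mult_left_mono SI) auto
  also have "\<dots> = ennreal (Jm * (A + A / (1 - q)))" using Jm A q by (simp add: ennreal_mult)
  finally have gI: "(\<integral>\<^sup>+t. ennreal (norm (g t)) \<partial>lborel) \<le> ennreal (Jm * (A + A / (1 - q)))" .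
  have gint: "integrable lborel g"
    using gm gI by (intro integrableI_bounded) (auto simp: order.strict_trans1)
  have "integral\<^sup>L lborel g \<le> integral\<^sup>L lborel (\<lambda>t. norm (g t))"
    by (rule integral_mono[OF gint integrable_norm[OF gint]]) auto
  also have "\<dots> = enn2real (\<integral>\<^sup>+t. ennreal (norm (g t)) \<partial>lborel)"
    using gm by (intro integral_eq_nn_integral) auto
  also have "\<dots> \<le> Jm * (A + A / (1 - q))"
    using gI Jm A q by (intro enn2real_leI) auto
  finally have gle: "integral\<^sup>L lborel g \<le> Jm * (A + A / (1 - q))" .
  have gint': "integrable lebesgue g" using gint gm by (simp add: integrable_completion)
  have AEl: "AE t in lebesgue. g t = indicator C t *\<^sub>R (\<bar>h t\<bar> * J t)"
    using AEf by (intro AE_completion) (auto elim!: eventually_mono simp: geq)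
  have hm: "(\<lambda>t. indicator C t *\<^sub>R (\<bar>h t\<bar> * J t)) \<in> borel_measurable lebesgue"
    using borel_measurable_AE[OF borel_measurable_integrable[OF gint'] AEl] .
  show "set_integrable lebesgue C (\<lambda>t. \<bar>h t\<bar> * J t)"
    unfolding set_integrable_def by (rule integrable_cong_AE_imp[OF gint' hm AEl])
  have "set_lebesgue_integral lebesgue C (\<lambda>t. \<bar>h t\<bar> * J t) = integral\<^sup>L lebesgue g"
    unfolding set_lebesgue_integral_def using gint' by (intro integral_cong_AE hm) (use AEl in auto)
  also have "\<dots> = integral\<^sup>L lborel g" using gm by (simp add: integral_completion)
  finally show "set_lebesgue_integral lebesgue C (\<lambda>t. \<bar>h t\<bar> * J t) \<le> Jm * (A + A / (1 - q))" using gle by simp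
qed

section \<open>The boundary operator\<close>

text \<open>By the mean value theorem the quotient at scale a is the derivative at a point within 3
  a / 2 of x in operator norm. As a tends to 0 the point tends to x, where the derivative is
  continuous because f is analytic near the closed ball.\<close>

lemma dlist_tendsto_pderivs:
  fixes f :: "real^'q::finite^'p::finite \<Rightarrow> real"
  assumes f: "f \<in> H_hol \<alpha>" and x: "opb 1 x"
  shows "(\<lambda>m. ev (dlist ds ((1 / 2) ^ m) x) f) \<longlonglongrightarrow> pderivs ds f x"
proof -
  obtain U where U: "open U" "mat_cball \<subseteq> U" "real_analytic_on f U" using f by (auto simp: H_hol_def)
  have "(mat_ball :: (real^'q^'p) set) \<subseteq> mat_cball" by (auto simp: mat_ball_def mat_cball_def)
  then have "mat_ball \<subseteq> U" using U(2) by blast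
  from iter_deriv_pderivs[OF U(3) this, of ds]
  have it: "iter_deriv mat_ball (map unit_dir (rev ds)) f (pderivs ds f)"
    by (simp add: unit_dir_def[abs_def] case_prod_beta')
  define a :: "nat \<Rightarrow> real" where "a m = (1 / 2) ^ m" for m
  have a: "0 < a m" "a m \<le> 1" for m by (simp_all add: a_def power_le_one)
  define ws where "ws m = map (\<lambda>d. (a m / (2 * (length ds + 1))) *\<^sub>R unit_dir d) (rev ds)" for m
  have "\<exists>v\<in>sbox (ws m). ev (dlist ds (a m) x) f = pderivs ds f ((1 - a m) *\<^sub>R x + v)" for m
  proof -
    define h where "h = a m / (2 * (length ds + 1))"
    have h: "h \<noteq> 0" using a[of m] by (simp add: h_def)
    define cws where "cws = map (\<lambda>d. (h, unit_dir d :: real^'q^'p)) (rev ds)"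
    have 1: "map snd cws = map unit_dir (rev ds)" "map (\<lambda>(c, w). c *\<^sub>R w) cws = ws m"
      by (simp_all add: cws_def ws_def h_def)
    have c: "prod_list (map (\<lambda>d. t) ds') = t ^ length ds'" for t :: real and ds' :: "('p \<times> 'q) list"
      by (induction ds') auto
    have 2: "prod_list (map fst cws) = h ^ length ds" by (simp add: cws_def comp_def c)
    have "iter_deriv mat_ball (ws m) f (\<lambda>x. h ^ length ds * pderivs ds f x)"
      using iter_deriv_scale[of mat_ball cws, OF open_mat_ball] it unfolding 1 2 by blast
    moreover have "(1 - a m) *\<^sub>R x + v \<in> mat_ball" if "v \<in> sbox (ws m)" for v
      using dlist_sbox_ball[OF x a] that unfolding ws_def .
    ultimately obtain v where v: "v \<in> sbox (ws m)" "fdiff (ws m) f ((1 - a m) *\<^sub>R x) = h ^ length ds * pderivs ds f ((1 - a m) *\<^sub>R x + v)"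
      using fdiff_mvt[of mat_ball "ws m" f "\<lambda>x. h ^ length ds * pderivs ds f x" "(1 - a m) *\<^sub>R x"] by blast
    have "ev (dlist ds (a m) x) f = fdiff (ws m) f ((1 - a m) *\<^sub>R x) / h ^ length ds"
      unfolding ev_dlist ws_def h_def by (rule refl)
    then show ?thesis using h v by (intro bexI[of _ v]) simp_all
  qed
  then obtain v where v: "\<And>m. v m \<in> sbox (ws m)" "\<And>m. ev (dlist ds (a m) x) f = pderivs ds f ((1 - a m) *\<^sub>R x + v m)" by metis
  have "(\<lambda>m. (1 - a m) *\<^sub>R x + v m) \<longlonglongrightarrow> x"
  proof (rule LIM_zero_cancel, rule Lim_null_comparison)
    show "\<forall>\<^sub>F m in sequentially. norm ((1 - a m) *\<^sub>R x + v m - x) \<le> CARD('p) * (CARD('q) * (3 / 2 * a m))"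
      using opb_norm[OF dlist_point(2)[OF x a, OF v(1)[unfolded ws_def]]] by (simp add: norm_minus_commute)
    have "(\<lambda>m. CARD('p) * (CARD('q) * (3 / 2 * a m))) \<longlonglongrightarrow> CARD('p) * (CARD('q) * (3 / 2 * 0))"
      unfolding a_def by (intro tendsto_intros LIMSEQ_realpow_zero) auto
    then show "(\<lambda>m. CARD('p) * (CARD('q) * (3 / 2 * a m))) \<longlonglongrightarrow> 0" by simp
  qed
  moreover have "isCont (pderivs ds f) x"
    using real_analytic_partial(1)[OF real_analytic_pderivs[OF U(3)]] U(2) x by (auto simp: opb_1_iff)
  ultimately have "(\<lambda>m. pderivs ds f ((1 - a m) *\<^sub>R x + v m)) \<longlonglongrightarrow> pderivs ds f x" by (rule isCont_tendsto_compose[rotated])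
  then have "(\<lambda>m. ev (dlist ds (a m) x) f) \<longlonglongrightarrow> pderivs ds f x" by (simp only: v(2))
  then show ?thesis by (simp only: a_def)
qed

lemma ev_diff: "ev L (\<lambda>z. f z - g z) = ev L f - ev L g"
  by (induction L) (auto simp: algebra_simps)

lemma ev2_diff:
  "ev2 (A @ scale_list (-1) B) (A' @ scale_list (-1) B') K = (ev2 A A' K - ev2 A B' K) - (ev2 B A' K - ev2 B B' K)"
  by (simp add: ev2_def ev_diff)

text \<open>\<open>integral_le_of_quadratic\<close> is applied to the quotient at scale 1 and to
  differences of consecutive quotients. \<open>dlist_kernel_bounds\<close> reduces the pairings to a
  power of the determinant, integrable by \<open>kernel_integral_bound\<close>. The norm is the root
  of a pairing, so the rate of decay is q = sqrt ((1/2)^\<gamma>).\<close>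

lemma chart_estimate:
  fixes \<phi> :: "real^'n::finite \<Rightarrow> real^'q::finite^'p::finite" and ds :: "('p \<times> 'q) list"
  assumes ch: "surface_chart (stratum r) V \<phi> \<phi>'" and C: "compact C" "C \<subseteq> V"
    and \<alpha>: "0 \<le> \<alpha>" and r: "r \<le> CARD('p)"
    and lt: "\<alpha> + 2 * real (length ds) < (real CARD('q) - real CARD('p) + 2 * real r) / 2"
  defines "F \<equiv> \<lambda>f m t. ev (dlist ds ((1 / 2) ^ m) (\<phi> t)) f"
  shows "\<exists>A\<ge>0. \<exists>q\<ge>0. q < 1 \<and> (\<forall>f\<in>H_space \<alpha>. (\<forall>m. continuous_on C (F f m)) \<and>
     (\<integral>\<^sup>+t\<in>C. ennreal \<bar>F f 0 t\<bar> \<partial>lborel) \<le> ennreal (A * H_norm \<alpha> f) \<and>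
     (\<forall>m. (\<integral>\<^sup>+t\<in>C. ennreal \<bar>F f (Suc m) t - F f m t\<bar> \<partial>lborel) \<le> ennreal (A * H_norm \<alpha> f * q ^ m)))"
proof -
  \<comment> \<open>Half of the room in the strict inequality, so that \<alpha> + 2 k + \<gamma>
    still satisfies the integrability condition; at most 1 as the interpolation requires.\<close>
  define \<gamma> where "\<gamma> = min 1 (((real CARD('q) - real CARD('p) + 2 * real r) / 2 - (\<alpha> + 2 * real (length ds))) / 2)"
  have \<gamma>: "0 < \<gamma>" "\<gamma> \<le> 1" using lt by (simp_all add: \<gamma>_def)
  define \<beta> where "\<beta> = \<alpha> + 2 * real (length ds) + \<gamma>"
  have "\<gamma> \<le> ((real CARD('q) - real CARD('p) + 2 * real r) / 2 - (\<alpha> + 2 * real (length ds))) / 2" unfolding \<gamma>_def by (rule min.cobounded2)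
  then have \<beta>: "0 < \<beta>" "2 * \<beta> < real CARD('q) - real CARD('p) + 2 * real r"
    using \<gamma> \<alpha> lt by (simp_all add: \<beta>_def field_simps)
  have \<phi>V: "\<phi> ` V \<subseteq> stratum r" and der: "\<And>t. t \<in> V \<Longrightarrow> (\<phi> has_derivative blinfun_apply (\<phi>' t)) (at t)"
    using ch unfolding surface_chart_def by auto
  have "continuous_on V \<phi>"
    using der by (meson continuous_at_imp_continuous_on has_derivative_continuous)
  then have c\<phi>: "continuous_on C \<phi>" using C(2) continuous_on_subset by blast
  have \<phi>1: "opb 1 (\<phi> t)" if "t \<in> C" for t
  proof -
    have "\<phi> t \<in> stratum r" by (rule subsetD[OF \<phi>V imageI[OF subsetD[OF C(2) that]]])
    then show ?thesis by (simp add: stratum_iff opb_1_iff)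
  qed
  obtain C0 where C0: "0 \<le> C0" and kb: "\<forall>x y :: real^'q^'p. \<forall>a b b' c c'. opb 1 x \<longrightarrow> opb 1 y \<longrightarrow> 0 < a \<longrightarrow> a \<le> 1 \<longrightarrow> 0 < kdet (x, y) \<longrightarrow>
     {b, b', c, c'} \<subseteq> {a / 2..a} \<longrightarrow>
     \<bar>ev2 (dlist ds b x) (dlist ds c y) (kern \<alpha>)\<bar> \<le> C0 * kdet (x, y) powr (- \<beta>) \<and>
     \<bar>ev2 (dlist ds b x) (dlist ds c y) (kern \<alpha>) - ev2 (dlist ds b' x) (dlist ds c' y) (kern \<alpha>)\<bar> \<le> C0 * a powr \<gamma> * kdet (x, y) powr (- \<beta>)"
    using dlist_kernel_bounds[OF \<alpha> \<gamma>, of ds, folded \<beta>_def] by (elim exE conjE) (rule that)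
  obtain B where B: "0 \<le> B" "\<forall>u\<in>\<phi> ` C. (\<integral>\<^sup>+t\<in>C. negpow \<beta> (det (mat 1 - \<phi> t ** transpose u)) \<partial>lborel) \<le> ennreal B"
    using kernel_integral_bound[OF ch C \<beta> r] by (elim exE conjE) (rule that)
  define v where "v = measure lborel C"
  have key: "(\<integral>\<^sup>+t\<in>C. ennreal \<bar>ev (L t) f\<bar> \<partial>lborel) \<le> ennreal (H_norm \<alpha> f * sqrt (v * (c * B)))"
    if f: "f \<in> H_space \<alpha>" and L: "\<And>t. t \<in> C \<Longrightarrow> snd ` set (L t) \<subseteq> mat_ball"
      and Fc: "continuous_on C (\<lambda>t. ev (L t) f)" and Gc: "continuous_on (C \<times> C) (\<lambda>(s, t). ev2 (L s) (L t) (kern \<alpha>))"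
      and c: "0 < c" and bd: "\<And>s t. s \<in> C \<Longrightarrow> t \<in> C \<Longrightarrow> 0 < kdet (\<phi> s, \<phi> t) \<Longrightarrow>
         \<bar>ev2 (L s) (L t) (kern \<alpha>)\<bar> \<le> c * kdet (\<phi> s, \<phi> t) powr (- \<beta>)"
    for f L c
    unfolding v_def
  proof (rule integral_le_of_quadratic[OF C(1) Fc Gc])
    have f': "in_rkhs (kern \<alpha>) mat_ball f" using f by (simp add: H_space_def)
    show "0 \<le> H_norm \<alpha> f" unfolding H_norm_def by (rule rkhs_norm_nonneg[OF f'])
    show "0 \<le> c * B" using c B(1) by simp
    show "(\<Sum>s\<in>T. a s * \<bar>ev (L s) f\<bar>) \<le> H_norm \<alpha> f * sqrt M"
      if "finite T" "T \<subseteq> C" "\<And>s. 0 \<le> a s" "0 < M" "(\<Sum>s\<in>T. \<Sum>t\<in>T. a s * a t * \<bar>ev2 (L s) (L t) (kern \<alpha>)\<bar>) \<le> M" for T a M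
      unfolding H_norm_def by (rule rkhs_sum_le[OF f' that(1,3) _ that(4,5)]) (use L that(2) in blast)
    fix s assume s: "s \<in> C"
    have "(\<integral>\<^sup>+t\<in>C. ennreal \<bar>ev2 (L t) (L s) (kern \<alpha>)\<bar> \<partial>lborel)
       \<le> (\<integral>\<^sup>+t. ennreal c * (negpow \<beta> (det (mat 1 - \<phi> t ** transpose (\<phi> s))) * indicator C t) \<partial>lborel)"
    proof (rule nn_integral_mono)
      fix t :: "real^'n"
      show "ennreal \<bar>ev2 (L t) (L s) (kern \<alpha>)\<bar> * indicator C t \<le> ennreal c * (negpow \<beta> (det (mat 1 - \<phi> t ** transpose (\<phi> s))) * indicator C t)"
      proof (cases "t \<in> C \<and> 0 < kdet (\<phi> t, \<phi> s)")
        case True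
        then have "ennreal \<bar>ev2 (L t) (L s) (kern \<alpha>)\<bar> \<le> ennreal (c * kdet (\<phi> t, \<phi> s) powr (- \<beta>))"
          using bd s by (intro ennreal_leI) blast
        also have "\<dots> = ennreal c * negpow \<beta> (det (mat 1 - \<phi> t ** transpose (\<phi> s)))"
          using True c by (simp add: negpow_def kdet_def ennreal_mult)
        finally show ?thesis using True by simp
      next
        \<comment> \<open>For t in C with nonpositive determinant the right side is infinite because
          c > 0; outside C both sides are 0.\<close>
        case False
        then show ?thesis using c by (auto simp: negpow_def kdet_def ennreal_mult_top indicator_def)
      qed
    qed
    also have "\<dots> = ennreal c * (\<integral>\<^sup>+t\<in>C. negpow \<beta> (det (mat 1 - \<phi> t ** transpose (\<phi> s))) \<partial>lborel)"
    proof (rule nn_integral_cmult)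
      have "continuous_on C (\<lambda>t. det (mat 1 - \<phi> t ** transpose (\<phi> s)))"
        by (intro continuous_on_det) (auto simp: matrix_matrix_mult_def intro!: continuous_intros c\<phi>)
      then have "(\<lambda>t. if t \<in> C then det (mat 1 - \<phi> t ** transpose (\<phi> s)) else 0) \<in> borel_measurable borel"
        using compact_imp_closed[OF C(1)] by (intro borel_measurable_continuous_on_if) auto
      then have "(\<lambda>t. negpow \<beta> (if t \<in> C then det (mat 1 - \<phi> t ** transpose (\<phi> s)) else 0) * indicator C t) \<in> borel_measurable borel"
        using compact_imp_closed[OF C(1)]
        by (intro borel_measurable_times_ennreal measurable_compose[OF _ negpow_measurable] borel_measurable_indicator) auto
      also have "(\<lambda>t. negpow \<beta> (if t \<in> C then det (mat 1 - \<phi> t ** transpose (\<phi> s)) else 0) * indicator C t)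
         = (\<lambda>t. negpow \<beta> (det (mat 1 - \<phi> t ** transpose (\<phi> s))) * indicator C t)"
        by (auto simp: fun_eq_iff indicator_def)
      finally show "(\<lambda>t. negpow \<beta> (det (mat 1 - \<phi> t ** transpose (\<phi> s))) * indicator C t) \<in> borel_measurable lborel" by simp
    qed
    also have "\<dots> \<le> ennreal c * ennreal B" by (intro mult_left_mono B(2)[rule_format] imageI s) auto
    also have "\<dots> = ennreal (c * B)" using c B(1) by (simp add: ennreal_mult)
    finally show "(\<integral>\<^sup>+t\<in>C. ennreal \<bar>ev2 (L t) (L s) (kern \<alpha>)\<bar> \<partial>lborel) \<le> ennreal (c * B)" .
  qed
  \<comment> \<open>Raised by 1 to be strictly positive, as \<open>key\<close> requires of its
    constant.\<close>
  define C1 where "C1 = C0 + 1"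
  have C1: "0 < C1" "C0 \<le> C1" using C0 by (simp_all add: C1_def)
  define A where "A = sqrt (v * (2 * C1 * B))"
  define q where "q = sqrt ((1 / 2) powr \<gamma>)"
  have v: "0 \<le> v" by (simp add: v_def)
  have A: "0 \<le> A" using v C1 B by (simp add: A_def)
  have "(1 / 2) powr \<gamma> < (1 / 2 :: real) powr 0" by (rule powr_less_mono') (use \<gamma> in auto)
  then have q: "0 \<le> q" "q < 1" by (simp_all add: q_def)
  have fc: "continuous_on mat_ball f" if "f \<in> H_space \<alpha>" for f :: "real^'q^'p \<Rightarrow> real"
    using that by (intro rkhs_continuous_on[OF _ continuous_on_kern]) (simp add: H_space_def)
  have am: "0 < (1 / 2 :: real) ^ m" "(1 / 2 :: real) ^ m \<le> 1" for m by (simp_all add: power_le_one)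
  have Fcont: "continuous_on C (F f m)" if "f \<in> H_space \<alpha>" for f m
    unfolding F_def by (rule continuous_on_ev_dlist[OF fc[OF that] c\<phi> \<phi>1 am])
  have N: "0 \<le> H_norm \<alpha> f" if "f \<in> H_space \<alpha>" for f :: "real^'q^'p \<Rightarrow> real"
    using that rkhs_norm_nonneg by (auto simp: H_norm_def H_space_def)
  have first: "(\<integral>\<^sup>+t\<in>C. ennreal \<bar>F f 0 t\<bar> \<partial>lborel) \<le> ennreal (A * H_norm \<alpha> f)" if f: "f \<in> H_space \<alpha>" for f
  proof -
    have "(\<integral>\<^sup>+t\<in>C. ennreal \<bar>ev (dlist ds 1 (\<phi> t)) f\<bar> \<partial>lborel) \<le> ennreal (H_norm \<alpha> f * sqrt (v * (2 * C1 * B)))"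
    proof (rule key[OF f])
      show "snd ` set (dlist ds 1 (\<phi> t)) \<subseteq> mat_ball" if "t \<in> C" for t by (rule dlist_points[OF \<phi>1[OF that]]) auto
      show "continuous_on C (\<lambda>t. ev (dlist ds 1 (\<phi> t)) f)" by (rule continuous_on_ev_dlist[OF fc[OF f] c\<phi> \<phi>1]) auto
      show "continuous_on (C \<times> C) (\<lambda>(s, t). ev2 (dlist ds 1 (\<phi> s)) (dlist ds 1 (\<phi> t)) (kern \<alpha>))"
        by (rule continuous_on_ev2_dlist[OF c\<phi> \<phi>1]) auto
      show "0 < 2 * C1" using C1 by simp
      fix s t assume st: "s \<in> C" "t \<in> C" "0 < kdet (\<phi> s, \<phi> t)"
      have "\<bar>ev2 (dlist ds 1 (\<phi> s)) (dlist ds 1 (\<phi> t)) (kern \<alpha>)\<bar> \<le> C0 * kdet (\<phi> s, \<phi> t) powr (- \<beta>)"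
        by (rule kb[rule_format, THEN conjunct1, OF \<phi>1[OF st(1)] \<phi>1[OF st(2)] zero_less_one order_refl st(3), of 1 1 1 1]) auto
      also have "\<dots> \<le> 2 * C1 * kdet (\<phi> s, \<phi> t) powr (- \<beta>)" using C1 by (intro mult_right_mono) auto
      finally show "\<bar>ev2 (dlist ds 1 (\<phi> s)) (dlist ds 1 (\<phi> t)) (kern \<alpha>)\<bar> \<le> 2 * C1 * kdet (\<phi> s, \<phi> t) powr (- \<beta>)" .
    qed
    then show ?thesis by (simp add: F_def A_def mult.commute)
  qed
  have next_le: "(\<integral>\<^sup>+t\<in>C. ennreal \<bar>F f (Suc m) t - F f m t\<bar> \<partial>lborel) \<le> ennreal (A * H_norm \<alpha> f * q ^ m)"
    if f: "f \<in> H_space \<alpha>" for f m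
  proof -
    define a :: real where "a = (1 / 2) ^ m"
    have a: "0 < a" "a \<le> 1" "0 < a / 2" "a / 2 \<le> 1" using am[of m] by (simp_all add: a_def)
    \<comment> \<open>The pairing of this difference with itself is a difference of two differences,
      each controlled by \<open>kb\<close>; this explains the factor 2 in A.\<close>
    define L where "L t = dlist ds (a / 2) (\<phi> t) @ scale_list (-1) (dlist ds a (\<phi> t))" for t
    have evL: "ev (L t) f = F f (Suc m) t - F f m t" for t by (simp add: L_def F_def a_def)
    have ev2L: "ev2 (L s) (L t) (kern \<alpha>) =
       (ev2 (dlist ds (a / 2) (\<phi> s)) (dlist ds (a / 2) (\<phi> t)) (kern \<alpha>) - ev2 (dlist ds (a / 2) (\<phi> s)) (dlist ds a (\<phi> t)) (kern \<alpha>))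
       - (ev2 (dlist ds a (\<phi> s)) (dlist ds (a / 2) (\<phi> t)) (kern \<alpha>) - ev2 (dlist ds a (\<phi> s)) (dlist ds a (\<phi> t)) (kern \<alpha>))" for s t
      unfolding L_def by (rule ev2_diff)
    have "(\<integral>\<^sup>+t\<in>C. ennreal \<bar>ev (L t) f\<bar> \<partial>lborel) \<le> ennreal (H_norm \<alpha> f * sqrt (v * (2 * C1 * a powr \<gamma> * B)))"
    proof (rule key[OF f])
      show "snd ` set (L t) \<subseteq> mat_ball" if "t \<in> C" for t
        using dlist_points[OF \<phi>1[OF that] a(1,2), of ds] dlist_points[OF \<phi>1[OF that] a(3,4), of ds]
        unfolding L_def by (simp add: image_Un)
      show "continuous_on C (\<lambda>t. ev (L t) f)" unfolding evL by (intro continuous_on_diff Fcont[OF f])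
      have "continuous_on (C \<times> C) (\<lambda>p.
       (ev2 (dlist ds (a / 2) (\<phi> (fst p))) (dlist ds (a / 2) (\<phi> (snd p))) (kern \<alpha>) - ev2 (dlist ds (a / 2) (\<phi> (fst p))) (dlist ds a (\<phi> (snd p))) (kern \<alpha>))
       - (ev2 (dlist ds a (\<phi> (fst p))) (dlist ds (a / 2) (\<phi> (snd p))) (kern \<alpha>) - ev2 (dlist ds a (\<phi> (fst p))) (dlist ds a (\<phi> (snd p))) (kern \<alpha>)))"
        by (intro continuous_on_diff continuous_on_ev2_dlist[OF c\<phi> \<phi>1, unfolded case_prod_beta] a)
      then show "continuous_on (C \<times> C) (\<lambda>(s, t). ev2 (L s) (L t) (kern \<alpha>))" unfolding ev2L case_prod_beta .
      show "0 < 2 * C1 * a powr \<gamma>" using C1 a by simp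
      fix s t assume st: "s \<in> C" "t \<in> C" "0 < kdet (\<phi> s, \<phi> t)"
      have 1: "\<bar>ev2 (dlist ds (a / 2) (\<phi> s)) (dlist ds (a / 2) (\<phi> t)) (kern \<alpha>) - ev2 (dlist ds (a / 2) (\<phi> s)) (dlist ds a (\<phi> t)) (kern \<alpha>)\<bar>
         \<le> C0 * a powr \<gamma> * kdet (\<phi> s, \<phi> t) powr (- \<beta>)"
        by (rule kb[rule_format, THEN conjunct2, OF \<phi>1[OF st(1)] \<phi>1[OF st(2)] a(1,2) st(3)]) (use a in auto)
      have 2: "\<bar>ev2 (dlist ds a (\<phi> s)) (dlist ds (a / 2) (\<phi> t)) (kern \<alpha>) - ev2 (dlist ds a (\<phi> s)) (dlist ds a (\<phi> t)) (kern \<alpha>)\<bar>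
         \<le> C0 * a powr \<gamma> * kdet (\<phi> s, \<phi> t) powr (- \<beta>)"
        by (rule kb[rule_format, THEN conjunct2, OF \<phi>1[OF st(1)] \<phi>1[OF st(2)] a(1,2) st(3)]) (use a in auto)
      have "\<bar>ev2 (L s) (L t) (kern \<alpha>)\<bar> \<le> 2 * (C0 * a powr \<gamma> * kdet (\<phi> s, \<phi> t) powr (- \<beta>))"
        unfolding ev2L using order_trans[OF abs_triangle_ineq4 add_mono[OF 1 2]] by simp
      also have "\<dots> = 2 * C0 * a powr \<gamma> * kdet (\<phi> s, \<phi> t) powr (- \<beta>)" by simp
      also have "\<dots> \<le> 2 * C1 * a powr \<gamma> * kdet (\<phi> s, \<phi> t) powr (- \<beta>)" using C1 by (intro mult_right_mono) auto
      finally show "\<bar>ev2 (L s) (L t) (kern \<alpha>)\<bar> \<le> 2 * C1 * a powr \<gamma> * kdet (\<phi> s, \<phi> t) powr (- \<beta>)" .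
    qed
    also have "a powr \<gamma> = ((1 / 2) powr \<gamma>) ^ m"
    proof -
      have "a powr \<gamma> = ((1 / 2) powr real m) powr \<gamma>" by (simp add: a_def powr_realpow)
      also have "\<dots> = ((1 / 2) powr \<gamma>) powr real m" by (simp add: powr_powr mult.commute)
      also have "\<dots> = ((1 / 2) powr \<gamma>) ^ m" by (rule powr_realpow) simp
      finally show ?thesis .
    qed
    also have "sqrt (v * (2 * C1 * ((1 / 2) powr \<gamma>) ^ m * B)) = A * q ^ m"
    proof -
      have "v * (2 * C1 * ((1 / 2) powr \<gamma>) ^ m * B) = (v * (2 * C1 * B)) * ((1 / 2) powr \<gamma>) ^ m" by simp
      then show ?thesis by (simp only: A_def q_def real_sqrt_mult real_sqrt_power)
    qed
    finally show ?thesis unfolding evL by (simp only: mult_ac)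
  qed
  show ?thesis
    by (rule exI[of _ A], rule conjI[OF A], rule exI[of _ q], rule conjI[OF q(1)], rule conjI[OF q(2)], intro ballI conjI allI)
      (erule Fcont first next_le)+
qed

lemma continuous_on_chart_jac:
  assumes "continuous_on V \<phi>'" shows "continuous_on V (chart_jac \<phi>')"
proof -
  have "continuous_on V (\<lambda>t. det (\<chi> a b. (\<phi>' t) (axis a 1) \<bullet> (\<phi>' t) (axis b 1)))"
    by (intro continuous_on_det) (auto intro!: continuous_intros assms)
  then show ?thesis unfolding chart_jac_def[abs_def] by (rule continuous_on_real_sqrt)
qed

text \<open>Continuity into L^1_loc is expressed chart by chart: a compact part of the stratum is a
  finite union of chart images of compact sets, and on each of these surface measure is
  \<open>chart_jac\<close> times Lebesgue measure. The chart domain has dimension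
  \<open>CARD('n)\<close>.\<close>

theorem theorem3p7:
  fixes \<alpha> :: real and r k :: nat and ds :: "('p::finite \<times> 'q::finite) list"
  assumes "CARD('p) < CARD('q)"
    and "(\<exists>n::nat. n < CARD('p) \<and> \<alpha> = real n) \<or> \<alpha> > real CARD('p) - 1"
    and "r \<le> CARD('p)"
    and "length ds = k"
    and "\<alpha> + 2 * real k < (real CARD('q) - real CARD('p) + 2 * real r) / 2"
  shows "\<exists>T :: (real^'q^'p \<Rightarrow> real) \<Rightarrow> (real^'q^'p \<Rightarrow> real).
    (\<forall>f\<in>H_space \<alpha>. \<forall>g\<in>H_space \<alpha>. \<forall>a b.
        T (\<lambda>z. a * f z + b * g z) = (\<lambda>x. a * T f x + b * T g x))
  \<and> (\<forall>f\<in>H_hol \<alpha>. \<forall>x\<in>stratum r. T f x = pderivs ds f x)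
  \<and> (\<forall>V (\<phi> :: real^'n::finite \<Rightarrow> real^'q^'p) \<phi>'. surface_chart (stratum r) V \<phi> \<phi>' \<longrightarrow>
       (\<forall>C. compact C \<and> C \<subseteq> V \<longrightarrow>
          (\<exists>c. \<forall>f\<in>H_space \<alpha>.
              set_integrable lebesgue C (\<lambda>t. \<bar>T f (\<phi> t)\<bar> * chart_jac \<phi>' t)
            \<and> set_lebesgue_integral lebesgue C (\<lambda>t. \<bar>T f (\<phi> t)\<bar> * chart_jac \<phi>' t)
                \<le> c * H_norm \<alpha> f)))"
proof -
  \<comment> \<open>Makes the alternative \<alpha> > p - 1 imply that \<alpha> is
    nonnegative.\<close>
  have "1 \<le> real CARD('p)" by (simp add: Suc_le_eq)
  then have \<alpha>: "0 \<le> \<alpha>" using assms(2) by (elim disjE exE conjE) (simp, linarith)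
  obtain \<Lambda> :: "(nat \<Rightarrow> real) \<Rightarrow> real" where lin: "\<And>a b x y. \<Lambda> (\<lambda>m. a * x m + b * y m) = a * \<Lambda> x + b * \<Lambda> y"
    and lim: "\<And>x l. x \<longlonglongrightarrow> l \<Longrightarrow> \<Lambda> x = l"
    using linear_limit_extension by blast
  \<comment> \<open>Since \<open>\<Lambda>\<close> is linear on all sequences, T f x is defined and
    linear in f even at points where the quotients diverge; where they converge, T f x is their
    limit.\<close>
  define T where "T f x = \<Lambda> (\<lambda>m. ev (dlist ds ((1 / 2) ^ m) x) f)" for f and x :: "real^'q^'p"
  have 1: "T (\<lambda>z. a * f z + b * g z) = (\<lambda>x. a * T f x + b * T g x)" for a b f g
    by (simp add: T_def fun_eq_iff ev_linear lin)
  have 2: "T f x = pderivs ds f x" if "f \<in> H_hol \<alpha>" "x \<in> stratum r" for f x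
    unfolding T_def
    by (rule lim[OF dlist_tendsto_pderivs[OF that(1)]]) (use that(2) in \<open>simp add: stratum_iff opb_1_iff\<close>)
  have 3: "\<exists>c. \<forall>f\<in>H_space \<alpha>.
              set_integrable lebesgue C (\<lambda>t. \<bar>T f (\<phi> t)\<bar> * chart_jac \<phi>' t)
            \<and> set_lebesgue_integral lebesgue C (\<lambda>t. \<bar>T f (\<phi> t)\<bar> * chart_jac \<phi>' t) \<le> c * H_norm \<alpha> f"
    if ch: "surface_chart (stratum r) V \<phi> \<phi>'" and C: "compact C" "C \<subseteq> V" for V and \<phi> :: "real^'n \<Rightarrow> real^'q^'p" and \<phi>' C
  proof -
    obtain A q where A: "0 \<le> A" and q: "0 \<le> q" "q < 1" and est: "\<forall>f\<in>H_space \<alpha>. (\<forall>m. continuous_on C (\<lambda>t. ev (dlist ds ((1 / 2) ^ m) (\<phi> t)) f)) \<and>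
     (\<integral>\<^sup>+t\<in>C. ennreal \<bar>ev (dlist ds ((1 / 2) ^ 0) (\<phi> t)) f\<bar> \<partial>lborel) \<le> ennreal (A * H_norm \<alpha> f) \<and>
     (\<forall>m. (\<integral>\<^sup>+t\<in>C. ennreal \<bar>ev (dlist ds ((1 / 2) ^ Suc m) (\<phi> t)) f - ev (dlist ds ((1 / 2) ^ m) (\<phi> t)) f\<bar> \<partial>lborel) \<le> ennreal (A * H_norm \<alpha> f * q ^ m))"
      using chart_estimate[OF ch C \<alpha> assms(3) assms(5)[folded assms(4)]] by (elim exE conjE) (rule that)
    have "continuous_on V \<phi>'" using ch by (simp add: surface_chart_def)
    then have J: "continuous_on C (chart_jac \<phi>')" by (intro continuous_on_subset[OF continuous_on_chart_jac C(2)])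
    have "bounded (chart_jac \<phi>' ` C)" by (intro compact_imp_bounded compact_continuous_image J C(1))
    then obtain Jm where Jm: "0 < Jm" "\<forall>y\<in>chart_jac \<phi>' ` C. norm y \<le> Jm" unfolding bounded_pos by blast
    show ?thesis
    proof (rule exI[of _ "Jm * (A + A / (1 - q))"], rule ballI)
      fix f :: "real^'q^'p \<Rightarrow> real" assume f: "f \<in> H_space \<alpha>"
      define N where "N = H_norm \<alpha> f"
      have N: "0 \<le> N" using f rkhs_norm_nonneg by (auto simp: N_def H_norm_def H_space_def)
      define F where "F m t = ev (dlist ds ((1 / 2) ^ m) (\<phi> t)) f" for m t
      note e = est[rule_format, OF f, folded F_def N_def]
      note I = limit_set_integrable[of C F "A * N" q "\<lambda>t. T f (\<phi> t)" "chart_jac \<phi>'" Jm]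
      have AN: "0 \<le> A * N" using A N by simp
      have h: "T f (\<phi> t) = l" if "(\<lambda>m. F m t) \<longlonglongrightarrow> l" for t l
        using lim[OF that] by (simp add: T_def F_def)
      have Fc: "\<And>m. continuous_on C (F m)" and I0: "(\<integral>\<^sup>+t\<in>C. ennreal \<bar>F 0 t\<bar> \<partial>lborel) \<le> ennreal (A * N)"
        and I1: "\<And>m. (\<integral>\<^sup>+t\<in>C. ennreal \<bar>F (Suc m) t - F m t\<bar> \<partial>lborel) \<le> ennreal (A * N * q ^ m)"
        using e by (simp_all add: F_def[abs_def])
      have Jb: "\<And>t. t \<in> C \<Longrightarrow> \<bar>chart_jac \<phi>' t\<bar> \<le> Jm" using Jm(2) by simp
      have "Jm * (A * N + A * N / (1 - q)) = Jm * (A + A / (1 - q)) * N"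
        by (simp add: algebra_simps)
      then show "set_integrable lebesgue C (\<lambda>t. \<bar>T f (\<phi> t)\<bar> * chart_jac \<phi>' t)
            \<and> set_lebesgue_integral lebesgue C (\<lambda>t. \<bar>T f (\<phi> t)\<bar> * chart_jac \<phi>' t) \<le> Jm * (A + A / (1 - q)) * H_norm \<alpha> f"
        using I(1)[OF C(1) Fc I0 I1 AN q h J Jb less_imp_le[OF Jm(1)]] I(2)[OF C(1) Fc I0 I1 AN q h J Jb less_imp_le[OF Jm(1)]]
        unfolding N_def[symmetric] by (simp only: simp_thms)
    qed
  qed
  show ?thesis by (rule exI[of _ T], intro conjI ballI allI impI; (elim conjE)?; rule 1 2 3; assumption)
qed

end
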